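(* Let $(M,\mathcal{T},\varepsilon,\eta)$ be a weighted triangulated connected closed surface with weights $\varepsilon: V\to\{0,1\}$ and $\eta: E\to\mathbb{R}$ satisfying $\varepsilon_s\varepsilon_t+\eta_{st}>0$ for all $\{st\}\in E$, and $\varepsilon_q\eta_{st}+\eta_{qs}\eta_{qt}\ge 0$ for $\{q,s,t\}=\{i,j,k\}$ for every triangle $\{ijk\}\in F$. Let $\alpha\in\mathbb{R}$ be a constant and $\overline{R}:V\to\mathbb{R}$ a given function. Consider the normalized combinatorial $\alpha$-Ricci flow in the Euclidean background geometry $$\frac{du_i}{dt}=R_{\alpha,av}-R_{\alpha,i},\qquad R_{\alpha,av}=\frac{2\pi\chi(M)}{\sum_{i=1}^Ne^{\alpha u_i}},\tag{N}$$ and the modified combinatorial $\alpha$-Ricci flow in the Euclidean or hyperbolic background geometry $$\frac{du_i}{dt}=\overline{R}_i-R_{\alpha,i}.\tag{M}$$ (a) The solutions of (N) and (M) can be extended by extending the inner angles in triangles by constants, i.e. they extend to solutions of the extended flows obtained from (N) and (M) by replacing $R_{\alpha,i}$ by the extended combinatorial $\alpha$-curvature $\widetilde{R}_{\alpha,i}$. Furthermore, if $\alpha\chi(M)\le 0$, the extended solution of (N) is unique for any initial Euclidean discrete conformal structure; if $\alpha\overline{R}\le 0$, the extended solution of (M) is unique for any initial Euclidean or hyperbolic discrete conformal structure. (b) Suppose there exists a Euclidean discrete conformal structure with constant combinatorial $\alpha$-curvature and $\alpha\chi(M)\le 0$. Then the flow (N) develops no essential singularities. If the solution of (N) develops no removable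 singularities in finite time, then the solution of (N) exists for all time, converges exponentially fast for any initial Euclidean discrete conformal structure, and does not develop removable singularities at time infinity. Furthermore, the extended solution of (N) exists for all time and converges exponentially fast for any initial Euclidean discrete conformal structure. (c) Suppose there exists a hyperbolic discrete conformal structure with combinatorial $\alpha$-curvature $\overline{R}$ and one of the following three conditions holds: (1) $\alpha>0$ and $\overline{R}_i\le 0$ for all $i\in V$; (2) $\alpha<0$ and $\overline{R}_i\in[0,2\pi)$ for all $i\in V$; (3) $\alpha=0$, $\overline{R}_i\in(-\infty,2\pi)$ for all $i\in V$ and $\sum_{i=1}^N\overline{R}_i>2\pi\chi(M)$. Then the flow (M) in the hyperbolic background geometry develops no essential singularities. If the solution of (M) develops no removable singularities in finite time, then the solution of (M) exists for all time, converges exponentially fast for any initial hyperbolic discrete conformal structure, and does not develop removable singularities at time infinity. Furthermore, the extended solution of (M) in the hyperbolic background geometry exists for all time and converges exponentially fast for any initial hyperbolic discrete conformal structure.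
   Context: $M$ is a connected closed surface with a triangulation $\mathcal{T}=(V,E,F)$ ($V$ finite, $|V|=N$); vertices, edges and faces are written $i$, $\{ij\}$, $\{ijk\}$; $\eta_{ij}=\eta_{ji}$; $\chi(M)$ is the Euler characteristic. Functions on $V$ are identified with vectors in $\mathbb{R}^N$; inequalities between functions are meant at every vertex. Discrete conformal structure: a function $f:V\to\mathbb{R}$ assigning to each edge $\{ij\}$ the length $$l_{ij}=\sqrt{\varepsilon_ie^{2f_i}+\varepsilon_je^{2f_j}+2\eta_{ij}e^{f_i+f_j}}\quad\text{(Euclidean background geometry)},$$ $$l_{ij}=\cosh^{-1}\left(\sqrt{(1+\varepsilon_ie^{2f_i})(1+\varepsilon_je^{2f_j})}+\eta_{ij}e^{f_i+f_j}\right)\quad\text{(hyperbolic background geometry)},$$ such that for every face $\{ijk\}$ the lengths $l_{ij},l_{ik},l_{jk}$ satisfy the three strict triangle inequalities. Let $\theta_i^{jk}$ be the inner angle at $i$ of the corresponding triangle in $\mathbb{E}^2$ (resp. $\mathbb{H}^2$), and $K_i=2\pi-\sum_{\{ijk\}\in F}\theta_i^{jk}$ (sum over triangles with vertex $i$). Set $u_i=f_i$ in the Euclidean background geometry; in the hyperbolic background geometry $u_i=f_i$ if $\varepsilon_i=0$ and $u_i=\frac12\ln\left|\frac{\sqrt{1+e^{2f_i}}-1}{\sqrt{1+e^{2f_i}}+1}\right|$ (which ranges over $\mathbb{R}_{<0}$) if $\varepsilon_i=1$. The function $u$ is also called a discrete conformal structure. The combinatorial $\alpha$-curvature is $R_{\alpha,i}=K_i/e^{\alpha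 u_i}$. Extension by constants: under the two conditions on $\varepsilon,\eta$ in the claim, $l_{ij}$ is well defined and positive for all $f\in\mathbb{R}^N$, and it is known that for each face the inner angles, defined where the strict triangle inequalities hold, extend by constants to continuous functions $\widetilde\theta_i^{jk},\widetilde\theta_j^{ik},\widetilde\theta_k^{ij}$ of $(f_i,f_j,f_k)\in\mathbb{R}^3$ (explicitly, $\widetilde\theta_i^{jk}=\pi$, $\widetilde\theta_j^{ik}=\widetilde\theta_k^{ij}=0$ where $l_{jk}\ge l_{ij}+l_{ik}$). Set $\widetilde K_i=2\pi-\sum_{\{ijk\}\in F}\widetilde\theta_i^{jk}$ and $\widetilde R_{\alpha,i}=\widetilde K_i/e^{\alpha u_i}$. A solution of an extended flow is called an extended solution. Singularities: a flow ((N) or (M)) with solution on $[0,T)$, $T\le+\infty$, develops a removable singularity (at time $T$) if some triangle degenerates, i.e. along some sequence $t_n\to T$ the discrete conformal structure $f(t_n)$ converges to a point of $\mathbb{R}^N$ that lies on the boundary of the set of (nondegenerate) discrete conformal structures; it develops an essential singularity if the discrete conformal structure tends to infinity, i.e. for some $i\in V$ and some sequence $t_n\to T$, $f_i(t_n)\to\pm\infty$. The singularity is "in finite time" if $T<+\infty$ and "at time infinity" if $T=+\infty$. Exponential convergence of $u(t)$ to a limit $u_\infty$ means $\|u(t)-u_\infty\|\le Ce^{-ct}$ for some constants $C,c>0$ and all $t\geq 0$. *)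

theory Defs
  imports "HOL-Analysis.Analysis"
begin

text \<open>
  The vertex set is a finite type \<open>'v\<close>, and a triangulation is given by its set \<open>F\<close> of
  triangles, each of them a set of three vertices.
\<close>

definition edges :: "'v set set \<Rightarrow> 'v set set" where
  "edges F = {e. card e = 2 \<and> (\<exists>\<sigma>\<in>F. e \<subseteq> \<sigma>)}"

text \<open>
  The complex is a closed surface iff every vertex link is a circle. An edge \<open>{i, j}\<close>
  lying in exactly two triangles says that \<open>j\<close> has degree 2 in the link of \<open>i\<close>; the fourth
  condition says that the link of \<open>i\<close> is connected, and the last one that the surface is.
\<close>

definition connected_closed_surface :: "'v::finite set set \<Rightarrow> bool" where
  "connected_closed_surface F \<longleftrightarrow>
     (\<forall>\<sigma>\<in>F. card \<sigma> = 3) \<and>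
     \<Union>F = UNIV \<and>
     (\<forall>e\<in>edges F. card {\<sigma>\<in>F. e \<subseteq> \<sigma>} = 2) \<and>
     (\<forall>i j k. {i, j} \<in> edges F \<and> {i, k} \<in> edges F \<longrightarrow> (j, k) \<in> {(a, b). {i, a, b} \<in> F}\<^sup>*) \<and>
     (\<forall>i j. (i, j) \<in> {(a, b). {a, b} \<in> edges F}\<^sup>*)"

definition euler_char :: "'v::finite set set \<Rightarrow> real" where
  "euler_char F = real CARD('v) - real (card (edges F)) + real (card F)"

text \<open>The weight \<open>eta\<close> is a function on unordered pairs, hence symmetric.\<close>

definition admissible_weights ::
  "'v::finite set set \<Rightarrow> ('v \<Rightarrow> real) \<Rightarrow> ('v set \<Rightarrow> real) \<Rightarrow> bool" where
  "admissible_weights F eps eta \<longleftrightarrow>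
     (\<forall>i. eps i \<in> {0, 1}) \<and>
     (\<forall>s t. {s, t} \<in> edges F \<longrightarrow> eps s * eps t + eta {s, t} > 0) \<and>
     (\<forall>q s t. {q, s, t} \<in> F \<longrightarrow> eps q * eta {s, t} + eta {q, s} * eta {q, t} \<ge> 0)"

datatype geometry = Euclidean | Hyperbolic

fun edge_len :: "geometry \<Rightarrow> ('v::finite \<Rightarrow> real) \<Rightarrow> ('v set \<Rightarrow> real) \<Rightarrow> real^'v \<Rightarrow> 'v \<Rightarrow> 'v \<Rightarrow> real" where
  "edge_len Euclidean eps eta f i j =
     sqrt (eps i * exp (2 * f$i) + eps j * exp (2 * f$j) + 2 * eta {i, j} * exp (f$i + f$j))"
| "edge_len Hyperbolic eps eta f i j =
     arcosh (sqrt ((1 + eps i * exp (2 * f$i)) * (1 + eps j * exp (2 * f$j)))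
             + eta {i, j} * exp (f$i + f$j))"

text \<open>Since \<open>i, j, k\<close> range over all orderings, these are all three triangle inequalities.\<close>

definition dcs ::
  "geometry \<Rightarrow> 'v::finite set set \<Rightarrow> ('v \<Rightarrow> real) \<Rightarrow> ('v set \<Rightarrow> real) \<Rightarrow> (real^'v) set" where
  "dcs g F eps eta =
     {f. \<forall>i j k. {i, j, k} \<in> F \<longrightarrow>
           edge_len g eps eta f j k < edge_len g eps eta f i j + edge_len g eps eta f i k}"

text \<open>
  The angle opposite to the side \<open>a\<close> in a triangle with sides \<open>a, b, c\<close>, by the Euclidean,
  respectively hyperbolic, law of cosines.
\<close>

fun tri_angle :: "geometry \<Rightarrow> real \<Rightarrow> real \<Rightarrow> real \<Rightarrow> real" where
  "tri_angle Euclidean a b c = arccos ((b\<^sup>2 + c\<^sup>2 - a\<^sup>2) / (2 * b * c))"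
| "tri_angle Hyperbolic a b c = arccos ((cosh b * cosh c - cosh a) / (sinh b * sinh c))"

text \<open>The extension by constants to positive side lengths violating a triangle inequality.\<close>

definition ext_tri_angle :: "geometry \<Rightarrow> real \<Rightarrow> real \<Rightarrow> real \<Rightarrow> real" where
  "ext_tri_angle g a b c =
     (if a \<ge> b + c then pi
      else if b \<ge> a + c \<or> c \<ge> a + b then 0
      else tri_angle g a b c)"

text \<open>
  The sum ranges over the ordered pairs \<open>(j, k)\<close> completing \<open>i\<close> to a triangle, so every
  triangle at \<open>i\<close> occurs twice, with the same angle; whence the factor 1/2. The parameter
  \<open>ang\<close> is \<open>tri_angle g\<close> or \<open>ext_tri_angle g\<close>.
\<close>

definition angle_defect ::
  "(real \<Rightarrow> real \<Rightarrow> real \<Rightarrow> real) \<Rightarrow> geometry \<Rightarrow> 'v::finite set set \<Rightarrow> ('v \<Rightarrow> real) \<Rightarrow> ('v set \<Rightarrow> real)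
   \<Rightarrow> real^'v \<Rightarrow> 'v \<Rightarrow> real" where
  "angle_defect ang g F eps eta f i =
     2 * pi - (\<Sum>(j, k) \<in> {(j, k). {i, j, k} \<in> F}.
       ang (edge_len g eps eta f j k) (edge_len g eps eta f i j) (edge_len g eps eta f i k)) / 2"

fun conf_coord :: "geometry \<Rightarrow> ('v::finite \<Rightarrow> real) \<Rightarrow> real^'v \<Rightarrow> real^'v" where
  "conf_coord Euclidean eps f = f"
| "conf_coord Hyperbolic eps f =
     (\<chi> i. if eps i = 0 then f$i
           else 1/2 * ln \<bar>(sqrt (1 + exp (2 * f$i)) - 1) / (sqrt (1 + exp (2 * f$i)) + 1)\<bar>)"

definition alpha_curv ::
  "(real \<Rightarrow> real \<Rightarrow> real \<Rightarrow> real) \<Rightarrow> geometry \<Rightarrow> 'v::finite set set \<Rightarrow> ('v \<Rightarrow> real) \<Rightarrow> ('v set \<Rightarrow> real)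
   \<Rightarrow> real \<Rightarrow> real^'v \<Rightarrow> 'v \<Rightarrow> real" where
  "alpha_curv ang g F eps eta \<alpha> f i =
     angle_defect ang g F eps eta f i / exp (\<alpha> * conf_coord g eps f $ i)"

definition curv ::
  "geometry \<Rightarrow> 'v::finite set set \<Rightarrow> ('v \<Rightarrow> real) \<Rightarrow> ('v set \<Rightarrow> real) \<Rightarrow> real \<Rightarrow> real^'v \<Rightarrow> 'v \<Rightarrow> real" where
  "curv g = alpha_curv (tri_angle g) g"

definition ext_curv ::
  "geometry \<Rightarrow> 'v::finite set set \<Rightarrow> ('v \<Rightarrow> real) \<Rightarrow> ('v set \<Rightarrow> real) \<Rightarrow> real \<Rightarrow> real^'v \<Rightarrow> 'v \<Rightarrow> real" where
  "ext_curv g = alpha_curv (ext_tri_angle g) g"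

definition curv_av :: "'v::finite set set \<Rightarrow> real \<Rightarrow> real^'v \<Rightarrow> real" where
  "curv_av F \<alpha> u = 2 * pi * euler_char F / (\<Sum>i\<in>UNIV. exp (\<alpha> * u$i))"

definition time_dom :: "ereal \<Rightarrow> real set" where
  "time_dom T = {t. 0 \<le> t \<and> ereal t < T}"

text \<open>
  A solution on \<open>[0, T)\<close>, with \<open>0 < T \<le> \<infinity>\<close>, of an equation \<open>du/dt = rhs\<close> is recorded by the
  curve \<open>f\<close>; the differentiated quantity is \<open>u = conf_coord g eps f\<close>. In the hyperbolic
  case \<open>f \<mapsto> u\<close> is a bijection onto the set of admissible \<open>u\<close>, so this is an equation for
  \<open>u\<close>. Solutions stay in \<open>D\<close>, which is the set of discrete conformal structures for
  the original flows and the whole space for the extended ones.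
\<close>

definition flow_solution ::
  "geometry \<Rightarrow> ('v::finite \<Rightarrow> real) \<Rightarrow> (real^'v) set \<Rightarrow> (real^'v \<Rightarrow> 'v \<Rightarrow> real)
   \<Rightarrow> ereal \<Rightarrow> (real \<Rightarrow> real^'v) \<Rightarrow> bool" where
  "flow_solution g eps D rhs T f \<longleftrightarrow>
     0 < T \<and>
     (\<forall>t\<in>time_dom T. f t \<in> D \<and>
        (\<forall>i. ((\<lambda>s. conf_coord g eps (f s) $ i) has_real_derivative rhs (f t) i)
                (at t within time_dom T)))"

definition sol_N ::
  "'v::finite set set \<Rightarrow> ('v \<Rightarrow> real) \<Rightarrow> ('v set \<Rightarrow> real) \<Rightarrow> real
   \<Rightarrow> ereal \<Rightarrow> (real \<Rightarrow> real^'v) \<Rightarrow> bool" where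
  "sol_N F eps eta \<alpha> =
     flow_solution Euclidean eps (dcs Euclidean F eps eta)
       (\<lambda>f i. curv_av F \<alpha> (conf_coord Euclidean eps f) - curv Euclidean F eps eta \<alpha> f i)"

definition ext_sol_N ::
  "'v::finite set set \<Rightarrow> ('v \<Rightarrow> real) \<Rightarrow> ('v set \<Rightarrow> real) \<Rightarrow> real
   \<Rightarrow> ereal \<Rightarrow> (real \<Rightarrow> real^'v) \<Rightarrow> bool" where
  "ext_sol_N F eps eta \<alpha> =
     flow_solution Euclidean eps UNIV
       (\<lambda>f i. curv_av F \<alpha> (conf_coord Euclidean eps f) - ext_curv Euclidean F eps eta \<alpha> f i)"

definition sol_M ::
  "geometry \<Rightarrow> 'v::finite set set \<Rightarrow> ('v \<Rightarrow> real) \<Rightarrow> ('v set \<Rightarrow> real) \<Rightarrow> real \<Rightarrow> ('v \<Rightarrow> real)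
   \<Rightarrow> ereal \<Rightarrow> (real \<Rightarrow> real^'v) \<Rightarrow> bool" where
  "sol_M g F eps eta \<alpha> Rbar =
     flow_solution g eps (dcs g F eps eta) (\<lambda>f i. Rbar i - curv g F eps eta \<alpha> f i)"

definition ext_sol_M ::
  "geometry \<Rightarrow> 'v::finite set set \<Rightarrow> ('v \<Rightarrow> real) \<Rightarrow> ('v set \<Rightarrow> real) \<Rightarrow> real \<Rightarrow> ('v \<Rightarrow> real)
   \<Rightarrow> ereal \<Rightarrow> (real \<Rightarrow> real^'v) \<Rightarrow> bool" where
  "ext_sol_M g F eps eta \<alpha> Rbar =
     flow_solution g eps UNIV (\<lambda>f i. Rbar i - ext_curv g F eps eta \<alpha> f i)"

text \<open>Below \<open>D\<close> is the set of discrete conformal structures.\<close>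

definition removable_sing :: "('a::topological_space) set \<Rightarrow> ereal \<Rightarrow> (real \<Rightarrow> 'a) \<Rightarrow> bool" where
  "removable_sing D T f \<longleftrightarrow>
     (\<exists>t p. (\<forall>n. t n \<in> time_dom T) \<and> (\<lambda>n. ereal (t n)) \<longlonglongrightarrow> T \<and>
            (\<lambda>n. f (t n)) \<longlonglongrightarrow> p \<and> p \<in> frontier D)"

definition essential_sing :: "ereal \<Rightarrow> (real \<Rightarrow> real^'v::finite) \<Rightarrow> bool" where
  "essential_sing T f \<longleftrightarrow>
     (\<exists>i t. (\<forall>n. t n \<in> time_dom T) \<and> (\<lambda>n. ereal (t n)) \<longlonglongrightarrow> T \<and>
            (filterlim (\<lambda>n. f (t n) $ i) at_top sequentially \<or>
             filterlim (\<lambda>n. f (t n) $ i) at_bot sequentially))"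

text \<open>
  Every solution of the original flow is part of a solution of the extended flow, and the
  latter continues past a removable singularity in finite time. (Without the second clause the
  property would be trivial, as both flows agree on \<open>D\<close>.)
\<close>

definition solutions_extend ::
  "('a::topological_space) set \<Rightarrow> (ereal \<Rightarrow> (real \<Rightarrow> 'a) \<Rightarrow> bool) \<Rightarrow> (ereal \<Rightarrow> (real \<Rightarrow> 'a) \<Rightarrow> bool) \<Rightarrow> bool" where
  "solutions_extend D sol ext_sol \<longleftrightarrow>
     (\<forall>T f. sol T f \<longrightarrow>
        (\<exists>T' h. T \<le> T' \<and> ext_sol T' h \<and> (\<forall>t\<in>time_dom T. h t = f t) \<and>
                (T < \<infinity> \<and> removable_sing D T f \<longrightarrow> T < T')))"

definition unique_solution :: "(ereal \<Rightarrow> (real \<Rightarrow> 'a) \<Rightarrow> bool) \<Rightarrow> 'a \<Rightarrow> bool" where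
  "unique_solution sol f0 \<longleftrightarrow>
     (\<exists>T f. sol T f \<and> f 0 = f0) \<and>
     (\<forall>T1 T2 f1 f2. sol T1 f1 \<and> sol T2 f2 \<and> f1 0 = f0 \<and> f2 0 = f0 \<longrightarrow>
        (\<forall>t\<in>time_dom T1 \<inter> time_dom T2. f1 t = f2 t))"

definition exp_convergent ::
  "geometry \<Rightarrow> ('v::finite \<Rightarrow> real) \<Rightarrow> (real \<Rightarrow> real^'v) \<Rightarrow> bool" where
  "exp_convergent g eps f \<longleftrightarrow>
     (\<exists>f_lim C c. C > 0 \<and> c > 0 \<and>
        (\<forall>t\<ge>0. norm (conf_coord g eps (f t) - conf_coord g eps f_lim) \<le> C * exp (- c * t)))"

definition exists_and_converges ::
  "geometry \<Rightarrow> ('v::finite \<Rightarrow> real) \<Rightarrow> (ereal \<Rightarrow> (real \<Rightarrow> real^'v) \<Rightarrow> bool) \<Rightarrow> real^'v \<Rightarrow> bool" where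
  "exists_and_converges g eps sol f0 \<longleftrightarrow>
     (\<exists>f. sol \<infinity> f \<and> f 0 = f0) \<and>
     (\<forall>f. sol \<infinity> f \<and> f 0 = f0 \<longrightarrow> exp_convergent g eps f)"

end

theory Submission
  imports Defs "HOL-Complex_Analysis.Great_Picard"
begin

text \<open>
  In the coordinates \<open>u\<close> the angles of a triangle satisfy \<open>- \<Sum> (d\<theta>\<^sub>i/dt) w\<^sub>i \<ge> 0\<close> along \<open>u + t w\<close>, so
  the extended angle defect \<open>k\<close> is a monotone vector field: writing the extended angle as the arc
  cosine of a clamped quotient, it is differentiable at nondegenerate triangles, where the
  quadratic form is definite (Euclidean case: up to constants), and takes only the values
  \<open>0, \<pi>\<close> at the others. At a nondegenerate \<open>p\<close> this makes \<open>k\<close> coercive,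
  \<open>(u - p) \<bullet> (k u - k p) \<ge> m min(|u - p|, |u - p|\<^sup>2)\<close>.

  Multiplying the flow \<open>u\<^sub>i' = R\<^sub>i - k\<^sub>i(u) exp(-\<alpha> u\<^sub>i)\<close> by \<open>exp(\<alpha> u\<^sub>i)\<close> exposes the monotone part:
  a Gronwall estimate for \<open>\<Sum> exp(\<alpha> u\<^sub>i) (u\<^sub>i - v\<^sub>i)\<^sup>2\<close> gives uniqueness for every \<open>\<alpha>\<close>, and with \<open>p\<close> of
  the prescribed curvature and \<open>\<alpha> R \<le> 0\<close> the sum of the antiderivatives of \<open>exp(\<alpha> x) (x - p\<^sub>i)\<close>
  decreases at the rate of coercivity. It confines solutions to a compact set, with a separate
  argument where \<open>exp(\<alpha> u\<^sub>i)\<close> could tend to \<open>0\<close> and, in the hyperbolic case, with the angles at \<open>i\<close>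
  tending to \<open>0\<close> as \<open>u\<^sub>i\<close> tends to \<open>0\<close>; exponential convergence follows. The flow (N) conserves
  \<open>\<Sum> exp(\<alpha> u\<^sub>i)\<close>, hence is an instance of (M) with constant \<open>R\<close>.
\<close>

section \<open>Definiteness of quadratic forms of triangles\<close>

text \<open>The arc cosine has infinite slope at -1 and 1, so no Lipschitz bound for the extended
  field is at hand. Existence therefore rests on compactness, and monotonicity of the defect takes
  over the role of a Lipschitz bound. Nothing controls the set of parameters at which a segment
  meets degenerate triangles; the comparison along it is made on the values of the weighted angle
  sum, of which degeneracy leaves only finitely many, and not on the parameters.

  Definiteness on a single triangle is not a matter of signs: the coefficient of an edge can be
  negative. The determinant of the form is a positive multiple of a cyclic expression in the vertex
  data, and the two weight conditions are what makes this expression positive.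

  For \<alpha> other than 0 the Lyapunov function is not proper: its i-th summand has the finite
  limit \<open>exp(\<alpha> p i) / \<alpha>^2\<close> as \<open>exp(\<alpha> u i)\<close> tends to
  0. This forces the separate argument there. In the Euclidean case the defect is moreover blind to
  the addition of constants; the conserved sum decides which translate of the given structure is the
  limit.\<close>

text \<open>For \<open>s1 = s2 = s3 = 1\<close> the bracket \<open>A1 + B3\<close> is the length of
  the edge 12 times the signed distance from vertex 1 to the centre of that edge. By Menelaus the
  sum would vanish exactly when the three edge centres are collinear. Positivity comes from
  comparing the sum with \<open>2 * ?R^2 * ?S\<close> times the product of the three edge
  conditions, the differences being squares.\<close>

lemma menelaus_pos:
  fixes e1 e2 e3 h1 h2 h3 r1 r2 r3 s1 s2 s3 :: real
  defines "A1 \<equiv> e1 * r1\<^sup>2" and "A2 \<equiv> e2 * r2\<^sup>2" and "A3 \<equiv> e3 * r3\<^sup>2"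
    and "B1 \<equiv> h1 * r2 * r3" and "B2 \<equiv> h2 * r1 * r3" and "B3 \<equiv> h3 * r1 * r2"
  assumes e: "e1 \<in> {0,1}" "e2 \<in> {0,1}" "e3 \<in> {0,1}"
    and r: "r1 > 0" "r2 > 0" "r3 > 0" and s: "s1 > 0" "s2 > 0" "s3 > 0"
    and h: "e2*e3 + h1 > 0" "e1*e3 + h2 > 0" "e1*e2 + h3 > 0"
    and g: "e1*h1 + h2*h3 \<ge> 0" "e2*h2 + h1*h3 \<ge> 0" "e3*h3 + h1*h2 \<ge> 0"
  shows "(A1 * s2 + B3 * s1) * (A2 * s3 + B1 * s2) * (A3 * s1 + B2 * s3)
       + (A1 * s3 + B2 * s1) * (A3 * s2 + B1 * s3) * (A2 * s1 + B3 * s2) > 0" (is "?P > 0")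
proof -
  have sq: "e1\<^sup>2 = e1" "e2\<^sup>2 = e2" "e3\<^sup>2 = e3" using e by auto
  let ?R = "r1 * r2 * r3" and ?S = "s1 * s2 * s3"
  \<comment> \<open>Inequality of arithmetic and geometric means for the two vertices of one edge;
    \<open>e^2 = e\<close> returns the squared weights to weights.\<close>
  have t: "x1 * r1 * (r1 * r2 * r3) * s1 * (e2 * r2\<^sup>2 * s3\<^sup>2 + e3 * r3\<^sup>2 * s2\<^sup>2)
      \<ge> 2 * x1 * e2 * e3 * (r1 * r2 * r3)\<^sup>2 * (s1 * s2 * s3)"
    if "x1 \<ge> 0" "e2\<^sup>2 = e2" "e3\<^sup>2 = e3" "r1 > 0" "r2 > 0" "r3 > 0" "s1 > 0"
    for x1 e2 e3 r1 r2 r3 s1 s2 s3 :: real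
  proof -
    have "0 \<le> x1 * r1 * (r1 * r2 * r3) * s1 * (e2 * r2 * s3 - e3 * r3 * s2)\<^sup>2"
      using that by simp
    also have "\<dots> = x1 * r1 * (r1 * r2 * r3) * s1 * (e2\<^sup>2 * r2\<^sup>2 * s3\<^sup>2 + e3\<^sup>2 * r3\<^sup>2 * s2\<^sup>2)
        - 2 * x1 * e2 * e3 * (r1 * r2 * r3)\<^sup>2 * (s1 * s2 * s3)"
      by algebra
    also have "\<dots> = x1 * r1 * (r1 * r2 * r3) * s1 * (e2 * r2\<^sup>2 * s3\<^sup>2 + e3 * r3\<^sup>2 * s2\<^sup>2)
        - 2 * x1 * e2 * e3 * (r1 * r2 * r3)\<^sup>2 * (s1 * s2 * s3)"
      by (simp only: that(2,3))
    finally show ?thesis by simp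
  qed
  \<comment> \<open>Expanding the product of the edge conditions with \<open>e^2 = e\<close>
    produces exactly the expressions of the triangle condition, each with a nonnegative factor, so
    that \<open>t\<close> applies to them one by one.\<close>
  have "0 < (e2*e3 + h1) * (e1*e3 + h2) * (e1*e2 + h3)" using h by simp
  also have "\<dots> = (e1\<^sup>2*e2\<^sup>2*e3\<^sup>2 + h1*h2*h3 + (e1\<^sup>2*h1 + h2*h3)*e2*e3 + (e2\<^sup>2*h2 + h1*h3)*e1*e3 + (e3\<^sup>2*h3 + h1*h2)*e1*e2)"
    by algebra
  finally have "0 < 2 * ?R\<^sup>2 * ?S * (e1*e2*e3 + h1*h2*h3 + (e1*h1 + h2*h3)*e2*e3 + (e2*h2 + h1*h3)*e1*e3 + (e3*h3 + h1*h2)*e1*e2)"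
    using r s sq by simp
  also have "\<dots> = 2 * ?R\<^sup>2 * ?S * (e1*e2*e3 + h1*h2*h3) + 2 * (e1*h1 + h2*h3) * e2 * e3 * ?R\<^sup>2 * ?S
       + 2 * (e2*h2 + h1*h3) * e1 * e3 * ?R\<^sup>2 * ?S + 2 * (e3*h3 + h1*h2) * e1 * e2 * ?R\<^sup>2 * ?S"
    by algebra
  also have "\<dots> \<le> 2 * ?R\<^sup>2 * ?S * (e1*e2*e3 + h1*h2*h3)
       + (e1*h1 + h2*h3) * r1 * ?R * s1 * (e2 * r2\<^sup>2 * s3\<^sup>2 + e3 * r3\<^sup>2 * s2\<^sup>2)
       + (e2*h2 + h1*h3) * r2 * ?R * s2 * (e1 * r1\<^sup>2 * s3\<^sup>2 + e3 * r3\<^sup>2 * s1\<^sup>2)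
       + (e3*h3 + h1*h2) * r3 * ?R * s3 * (e1 * r1\<^sup>2 * s2\<^sup>2 + e2 * r2\<^sup>2 * s1\<^sup>2)"
    using t[OF g(1) sq(2,3) r(1,2,3) s(1), of s2 s3] t[OF g(2) sq(1,3) r(2,1,3) s(2), of s1 s3]
      t[OF g(3) sq(1,2) r(3,1,2) s(3), of s1 s2]
    by (simp add: mult_ac)
  also have "\<dots> = ?P" unfolding A1_def A2_def A3_def B1_def B2_def B3_def by algebra
  finally show ?thesis .
qed

text \<open>The form is a Laplacian on three vertices whose conductances \<open>N/L\<close> may be
  negative. Modulo constants it is a binary form, so its determinant and one pivot suffice. The
  determinant is \<open>N1 + N2 + N3\<close> times the expression \<open>P\<close>, over
  \<open>L1 * L2 * L3\<close>, and \<open>N1 + N2 + N3\<close> is four times the squared area of the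
  triangle.\<close>

lemma eucl_form_pos:
  fixes A1 A2 A3 B1 B2 B3 :: real
  defines "L1 \<equiv> A2 + A3 + 2*B1" and "L2 \<equiv> A1 + A3 + 2*B2" and "L3 \<equiv> A1 + A2 + 2*B3"
  defines "g1 \<equiv> A1*B1 + B2*B3" and "g2 \<equiv> A2*B2 + B1*B3" and "g3 \<equiv> A3*B3 + B1*B2"
  defines "N1 \<equiv> A2*A3 - B1\<^sup>2 + g2 + g3" and "N2 \<equiv> A1*A3 - B2\<^sup>2 + g1 + g3"
    and "N3 \<equiv> A1*A2 - B3\<^sup>2 + g1 + g2"
  assumes L: "L1 > 0" "L2 > 0" "L3 > 0"
    and D: "4*L2*L3 - (L2+L3-L1)\<^sup>2 > 0"
    and P: "(A1 + B3) * (A2 + B1) * (A3 + B2) + (A1 + B2) * (A3 + B1) * (A2 + B3) > 0"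
  shows "N1/L1 * (w2-w3)\<^sup>2 + N2/L2 * (w1-w3)\<^sup>2 + N3/L3 * (w1-w2)\<^sup>2 \<ge> 0" (is "?Q \<ge> 0")
    and "\<not> (w1 = w2 \<and> w2 = w3) \<Longrightarrow> N1/L1 * (w2-w3)\<^sup>2 + N2/L2 * (w1-w3)\<^sup>2 + N3/L3 * (w1-w2)\<^sup>2 > 0"
proof -
  have 0: "4 * (N1+N2+N3) = 4*L2*L3 - (L2+L3-L1)\<^sup>2"
    unfolding L1_def L2_def L3_def N1_def N2_def N3_def g1_def g2_def g3_def by algebra
  have 1: "N1*N2*L3 + N1*N3*L2 + N2*N3*L1 = (N1+N2+N3) *
     ((A1 + B3) * (A2 + B1) * (A3 + B2) + (A1 + B2) * (A3 + B1) * (A2 + B3))"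
    unfolding L1_def L2_def L3_def N1_def N2_def N3_def g1_def g2_def g3_def by algebra
  have S: "N1+N2+N3 > 0" using 0 D by simp
  have d: "N1*N2*L3 + N1*N3*L2 + N2*N3*L1 > 0" unfolding 1 using S P by simp
  have Lq: "(L2+L3-L1)\<^sup>2 \<le> 4*L2*L3" using D by simp
  have "N2\<^sup>2*L3 + N3\<^sup>2*L2 + N2*N3*(L2+L3-L1) \<ge> 0"
  proof -
    have "4 * L3 * (N2\<^sup>2*L3 + N3\<^sup>2*L2 + N2*N3*(L2+L3-L1))
       = (2*L3*N2 + N3*(L2+L3-L1))\<^sup>2 + N3\<^sup>2*(4*L2*L3 - (L2+L3-L1)\<^sup>2)" by algebra
    also have "\<dots> \<ge> 0" using D by simp
    finally show ?thesis using L(3) by (simp add: zero_le_mult_iff)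
  qed
  moreover have "(N1+N2+N3)*(N2*L3 + N3*L2) = (N1*N2*L3 + N1*N3*L2 + N2*N3*L1)
     + (N2\<^sup>2*L3 + N3\<^sup>2*L2 + N2*N3*(L2+L3-L1))" by algebra
  \<comment> \<open>The pivot times \<open>N1 + N2 + N3\<close> differs from the determinant only by
    a quadratic form in \<open>N2\<close> and \<open>N3\<close>, which is nonnegative because the
    triangle has positive area.\<close>
  ultimately have "(N1+N2+N3)*(N2*L3 + N3*L2) > 0" using d by linarith
  then have m: "N2*L3 + N3*L2 > 0" using S by (simp add: zero_less_mult_iff)
  define m' where "m' = N2*L3 + N3*L2"
  define T where "T = N1*N2*L3 + N1*N3*L2 + N2*N3*L1"
  define x y where "x = w2-w1" and "y = w3-w1"
  \<comment> \<open>Completion of the square with pivot \<open>m'\<close>; \<open>T\<close> is the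
    determinant cleared of denominators.\<close>
  have key: "m' * (L1*L2*L3) * ?Q = (m' * L1) * (N2*L3*y + N3*L2*x)\<^sup>2 / m' * 1 + T * (L2*L3) * (x-y)\<^sup>2"
  proof -
    have "L1*L2*L3 * ?Q = N1*L2*L3*(x-y)\<^sup>2 + N2*L1*L3*y\<^sup>2 + N3*L1*L2*x\<^sup>2"
      unfolding x_def y_def using L by (simp add: field_simps) (simp add: algebra_simps power2_eq_square)
    then have "m' * (L1*L2*L3) * ?Q = m' * (N1*L2*L3*(x-y)\<^sup>2 + N2*L1*L3*y\<^sup>2 + N3*L1*L2*x\<^sup>2)"
      by (metis mult.assoc)
    also have "\<dots> = L1 * (N2*L3*y + N3*L2*x)\<^sup>2 + T * (L2*L3) * (x-y)\<^sup>2"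
      unfolding m'_def T_def by algebra
    finally show ?thesis using m by (simp add: m'_def)
  qed
  have mp: "m' > 0" "T > 0" using m d by (auto simp: m'_def T_def)
  have "m' * (L1*L2*L3) * ?Q \<ge> 0" unfolding key using mp L by simp
  moreover have "m' * (L1*L2*L3) > 0" using mp L by simp
  ultimately show "?Q \<ge> 0" using mult_le_cancel_left_pos[of "m' * (L1*L2*L3)" 0 ?Q] by linarith
  assume w: "\<not> (w1 = w2 \<and> w2 = w3)"
  have "m' * (L1*L2*L3) * ?Q > 0"
  proof (cases "x = y")
    case True
    then have "x \<noteq> 0" using w by (auto simp: x_def y_def)
    have "(N2*L3*y + N3*L2*x) = m' * x" using True by (simp add: m'_def algebra_simps)
    then have "(N2*L3*y + N3*L2*x)\<^sup>2 > 0" using mp \<open>x \<noteq> 0\<close> by simp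
    then show ?thesis unfolding key using mp L True by simp
  next
    case False
    then have "T * (L2*L3) * (x-y)\<^sup>2 > 0" using mp L by simp
    moreover have "(m' * L1) * (N2*L3*y + N3*L2*x)\<^sup>2 / m' * 1 \<ge> 0" using mp L by simp
    ultimately show ?thesis unfolding key by linarith
  qed
  then show "?Q > 0" by (rule zero_less_mult_pos) (use mp L in simp)
qed

text \<open>Two completed squares: \<open>u\<close> absorbs \<open>x\<close>, \<open>v\<close>
  absorbs \<open>y\<close>, and the coefficient left on \<open>z\<close> is the determinant.\<close>

lemma sylvester3:
  fixes a b c d e f :: real
  assumes a: "a > 0" and m: "a*b - d\<^sup>2 > 0" and det: "a*b*c + 2*d*e*f - a*f\<^sup>2 - b*e\<^sup>2 - c*d\<^sup>2 > 0"
    and w: "\<not> (x = 0 \<and> y = 0 \<and> z = 0)"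
  shows "a*x\<^sup>2 + b*y\<^sup>2 + c*z\<^sup>2 + 2*d*x*y + 2*e*x*z + 2*f*y*z > 0"
proof -
  define M where "M = a*b - d\<^sup>2"
  define u where "u = a*x + d*y + e*z"
  define v where "v = M*y + (a*f - d*e)*z"
  have M: "M > 0" using m by (simp add: M_def)
  have "a * M * (a*x\<^sup>2 + b*y\<^sup>2 + c*z\<^sup>2 + 2*d*x*y + 2*e*x*z + 2*f*y*z)
     = M*u\<^sup>2 + v\<^sup>2 + a*(a*b*c + 2*d*e*f - a*f\<^sup>2 - b*e\<^sup>2 - c*d\<^sup>2)*z\<^sup>2"
    unfolding u_def v_def M_def by algebra
  also have "\<dots> > 0"
  proof (cases "z = 0")
    case True
    then have "u \<noteq> 0 \<or> v \<noteq> 0" using w a M by (auto simp: u_def v_def)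
    then have "M*u\<^sup>2 + v\<^sup>2 > 0" using M
      by (metis add_nonneg_pos add_pos_nonneg less_eq_real_def mult_nonneg_nonneg mult_pos_pos zero_le_power2 zero_less_power2)
    then show ?thesis using True by simp
  next
    case False
    then have "a*(a*b*c + 2*d*e*f - a*f\<^sup>2 - b*e\<^sup>2 - c*d\<^sup>2)*z\<^sup>2 > 0" using a det by simp
    moreover have "M*u\<^sup>2 + v\<^sup>2 \<ge> 0" using M by simp
    ultimately show ?thesis by linarith
  qed
  finally show ?thesis by (rule zero_less_mult_pos[OF _ mult_pos_pos[OF a M]])
qed

text \<open>Here \<open>s\<close> stands for the cosh radii, \<open>c\<close> for the hyperbolic
  cosines of the opposite edges and \<open>q\<close> for the squared sinh of these. A negative
  \<open>N3\<close> makes \<open>B3\<close> large, which fixes the signs of \<open>P12\<close>,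
  \<open>P21\<close>, \<open>P13\<close>, \<open>P23\<close> and of the cosines at vertices 1 and 2;
  these in turn force \<open>N1\<close> and \<open>N2\<close> to be positive. With the signs known,
  the leading minors of the form can be bounded below.\<close>

lemma hyp_form_pos_neg:
  fixes s1 s2 s3 B1 B2 B3 A1 A2 A3 c1 c2 c3 D q1 q2 q3 N1 N2 N3 g1 g2 P12 P21 P13 P31 P23 P32 :: real
  assumes A1_def: "A1 = s1\<^sup>2 - 1" and A2_def: "A2 = s2\<^sup>2 - 1" and A3_def: "A3 = s3\<^sup>2 - 1"
  assumes c1_def: "c1 = s2* s3 + B1" and c2_def: "c2 = s1* s3 + B2" and c3_def: "c3 = s1* s2 + B3"
  assumes D_def: "D = 1 + 2*c1*c2*c3 - c1\<^sup>2 - c2\<^sup>2 - c3\<^sup>2"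
  assumes q1_def: "q1 = c1\<^sup>2 - 1" and q2_def: "q2 = c2\<^sup>2 - 1" and q3_def: "q3 = c3\<^sup>2 - 1"
  assumes N1_def: "N1 = s1*(1-c1\<^sup>2) + s2*(c1*c2-c3) + s3*(c1*c3-c2)"
    and N2_def: "N2 = s2*(1-c2\<^sup>2) + s1*(c1*c2-c3) + s3*(c2*c3-c1)"
    and N3_def: "N3 = s3*(1-c3\<^sup>2) + s1*(c1*c3-c2) + s2*(c2*c3-c1)"
  assumes g1_def: "g1 = A1*B1 + B2*B3" and g2_def: "g2 = A2*B2 + B1*B3"
  assumes P12_def: "P12 = A1* s2 + B3* s1" and P21_def: "P21 = A2* s1 + B3* s2" and P13_def: "P13 = A1* s3 + B2* s1"
    and P31_def: "P31 = A3* s1 + B2* s3" and P23_def: "P23 = A2* s3 + B1* s2" and P32_def: "P32 = A3* s2 + B1* s3"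
  assumes s: "s1 > 0" "s2 > 0" "s3 > 0" and A: "A1 \<ge> 0" "A2 \<ge> 0"
    and B: "B1 > 0 \<or> B1\<^sup>2 < A2*A3" "B2 > 0 \<or> B2\<^sup>2 < A1*A3" "B3 > 0 \<or> B3\<^sup>2 < A1*A2"
    and g: "g1 \<ge> 0" "g2 \<ge> 0"
    and c: "c1 > 1" "c2 > 1" "c3 > 1" and D: "D > 0" and P: "P12*P23*P31 + P13*P32*P21 > 0"
    and N3: "N3 < 0" and w: "\<not> (w1 = 0 \<and> w2 = 0 \<and> w3 = 0)"
  shows "N1/q1 * (c1*w2\<^sup>2 - 2*w2*w3 + c1*w3\<^sup>2) + N2/q2 * (c2*w1\<^sup>2 - 2*w1*w3 + c2*w3\<^sup>2)
       + N3/q3 * (c3*w1\<^sup>2 - 2*w1*w2 + c3*w2\<^sup>2) > 0"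
proof -
  note N_defs = N1_def N2_def N3_def
  note P_defs = P12_def P21_def P13_def P31_def P23_def P32_def A1_def A2_def A3_def c1_def c2_def c3_def
  have q: "q1 > 0" "q2 > 0" "q3 > 0" using c by (auto simp: q1_def q2_def q3_def)
  have Pc: "P12 = s1*c3 - s2" "P21 = s2*c3 - s1" "P13 = s1*c2 - s3" "P31 = s3*c2 - s1"
    "P23 = s2*c1 - s3" "P32 = s3*c1 - s2" unfolding P_defs by algebra+
  have N3': "N3 = s3*(A1*A2 - B3\<^sup>2) + s1*g2 + s2*g1"
    unfolding N3_def c1_def c2_def c3_def g1_def g2_def A1_def A2_def by algebra
  have B3A: "B3\<^sup>2 > A1*A2"
  proof (rule ccontr)
    assume "\<not> ?thesis"
    then have "s3*(A1*A2 - B3\<^sup>2) + s1*g2 + s2*g1 \<ge> 0" using s g by simp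
    then show False using N3 N3' by simp
  qed
  then have B3: "B3 > 0" using B(3) by auto
  have P12: "P12 > 0" and P21: "P21 > 0" unfolding P12_def P21_def using A s B3
    by (simp_all add: add_nonneg_pos)
  \<comment> \<open>If \<open>P23\<close> were not positive, \<open>A2 * N3\<close> would be a sum
    of nonnegative terms, so that \<open>A2 = 0\<close>; then \<open>B\<close> leaves only
    \<open>B1 > 0\<close>, which makes \<open>P23\<close> positive.\<close>
  have P23: "P23 > 0"
  proof (rule ccontr)
    assume n: "\<not> ?thesis"
    have "A2*N3 = g2*P21 + (B3\<^sup>2 - A1*A2)*(-P23)"
      unfolding N3' g1_def g2_def P21_def P23_def by algebra
    also have "\<dots> \<ge> 0" using g P21 B3A n by (intro add_nonneg_nonneg mult_nonneg_nonneg) auto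
    finally have "A2 = 0" using N3 A(2) by (simp add: zero_le_mult_iff)
    then have "B1 > 0" using B(1) \<open>A2 = 0\<close> by simp
    then show False using n \<open>A2 = 0\<close> s by (simp add: P23_def)
  qed
  have P13: "P13 > 0"
  proof (rule ccontr)
    assume n: "\<not> ?thesis"
    have "A1*N3 = g1*P12 + (B3\<^sup>2 - A1*A2)*(-P13)"
      unfolding N3' g1_def g2_def P12_def P13_def by algebra
    also have "\<dots> \<ge> 0" using g P12 B3A n by (intro add_nonneg_nonneg mult_nonneg_nonneg) auto
    finally have "A1 = 0" using N3 A(1) by (simp add: zero_le_mult_iff)
    then have "B2 > 0" using B(2) \<open>A1 = 0\<close> by simp
    then show False using n \<open>A1 = 0\<close> s by (simp add: P13_def)
  qed
  \<comment> \<open>By the law of cosines these carry the signs of the cosines of the angles at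
    vertices 1 and 2.\<close>
  define k1 k2 where "k1 = c2*c3-c1" and "k2 = c1*c3-c2"
  have e1: "N3 = P13*q3 - k1*P12" and e2: "N3 = P23*q3 - k2*P21"
    and e3: "N2 = P12*q2 - k1*P13" and e4: "N1 = P21*q1 - k2*P23"
    unfolding Pc N_defs q1_def q2_def q3_def k1_def k2_def by algebra+
  have "P13*q3 > 0" "P23*q3 > 0" using P13 P23 q by auto
  then have "k1*P12 > 0" "k2*P21 > 0" using e1 e2 N3 by linarith+
  then have k1: "k1 > 0" and k2: "k2 > 0" using P12 P21 by (simp_all add: zero_less_mult_iff)
  have D1: "q2*q3 - k1\<^sup>2 = D" and D2: "q1*q3 - k2\<^sup>2 = D"
    unfolding D_def q1_def q2_def q3_def k1_def k2_def by algebra+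
  have f1: "k1*P12 > P13*q3" "k2*P21 > P23*q3" using e1 e2 N3 by linarith+
  \<comment> \<open>A nonpositive \<open>N2\<close> gives one inequality between \<open>q\<close>
    and \<open>k1\<close>, the negative \<open>N3\<close> gives another; their product contradicts
    \<open>D1\<close>.\<close>
  have N2: "N2 > 0"
  proof (rule ccontr)
    assume "\<not> ?thesis"
    then have "P12*q2 \<le> k1*P13" using e3 by linarith
    then have "(P12*q2)*(P13*q3) \<le> (k1*P13)*(k1*P12)"
      by (rule mult_mono) (use f1 P12 P13 q k1 \<open>P12*q2 \<le> k1*P13\<close> in auto)
    then have "(P12*P13)*(q2*q3 - k1\<^sup>2) \<le> 0" by (simp add: algebra_simps power2_eq_square)
    then show False using D1 D P12 P13 by (simp add: mult_le_0_iff)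
  qed
  have N1: "N1 > 0"
  proof (rule ccontr)
    assume "\<not> ?thesis"
    then have "P21*q1 \<le> k2*P23" using e4 by linarith
    then have "(P21*q1)*(P23*q3) \<le> (k2*P23)*(k2*P21)"
      by (rule mult_mono) (use f1 P21 P23 q k2 \<open>P21*q1 \<le> k2*P23\<close> in auto)
    then have "(P21*P23)*(q1*q3 - k2\<^sup>2) \<le> 0" by (simp add: algebra_simps power2_eq_square)
    then show False using D2 D P21 P23 by (simp add: mult_le_0_iff)
  qed
  \<comment> \<open>The matrix of the form has diagonal \<open>c3*X3 + c2*X2\<close>,
    \<open>c3*X3 + c1*X1\<close>, \<open>c2*X2 + c1*X1\<close> and off-diagonal entries
    \<open>-X3\<close>, \<open>-X2\<close>, \<open>-X1\<close>. Its determinant is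
    \<open>D^2 / (q1*q2*q3)\<close> times the cyclic expression in the \<open>P\<close>.\<close>
  define X1 X2 X3 where "X1 = N1/q1" and "X2 = N2/q2" and "X3 = N3/q3"
  have N: "N1 = X1*q1" "N2 = X2*q2" "N3 = X3*q3" using q by (auto simp: X1_def X2_def X3_def)
  have m11: "c3*X3 + c2*X2 > 0"
  proof -
    have "0 < P13*q3*(c2*D)" using P13 q c D by simp
    also have "\<dots> = (c1*c2-c3)*P13*q3*k1 + k2*q2*(P13*q3)"
      unfolding D_def q2_def k1_def k2_def by algebra
    also have "\<dots> \<le> (c1*c2-c3)*P13*q3*k1 + k2*q2*(k1*P12)"
      using f1 k2 q by (intro add_left_mono mult_left_mono) auto
    also have "\<dots> = k1*(c3*N3*q2 + c2*N2*q3)"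
      unfolding e1 e3 unfolding q2_def q3_def k1_def k2_def by algebra
    also have "\<dots> = (k1*q2*q3)*(c3*X3 + c2*X2)" unfolding N by algebra
    finally show ?thesis by (rule zero_less_mult_pos) (use k1 q in simp)
  qed
  \<comment> \<open>Each \<open>P\<close>, up to the factor \<open>D\<close>, is a combination of
    only two of the \<open>N\<close>. This translates what is known of the \<open>P\<close> into the
    minors, which are written in the \<open>N\<close>.\<close>
  have DP: "D*P12 = q3*N2 + k1*N3" "D*P21 = q3*N1 + k2*N3" "D*P13 = q2*N3 + k1*N2"
    "D*P31 = q2*N1 + (c1*c2-c3)*N2" "D*P23 = q1*N3 + k2*N1" "D*P32 = q1*N2 + (c1*c2-c3)*N1"
    unfolding Pc N_defs q1_def q2_def q3_def D_def k1_def k2_def by algebra+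
  have "0 < D*(c2*P13*N1 + c1*P23*N2 + D*P13*P23)"
    using D c P13 P23 N1 N2 by (simp add: add_pos_pos)
  also have "\<dots> = c2*N1*(D*P13) + c1*N2*(D*P23) + (D*P13)*(D*P23)" by algebra
  also have "\<dots> = c2*N1*(q2*N3 + k1*N2) + c1*N2*(q1*N3 + k2*N1) + (q2*N3 + k1*N2)*(q1*N3 + k2*N1)"
    unfolding DP ..
  also have "\<dots> = N3\<^sup>2*q1*q2 + c1*c3*N1*N3*q2 + c2*c3*N2*N3*q1 + c1*c2*N1*N2*q3"
    unfolding q1_def q2_def q3_def k1_def k2_def by algebra
  also have "\<dots> = (q1*q2*q3)*(X3\<^sup>2*q3 + c1*c3*X1*X3 + c2*c3*X2*X3 + c1*c2*X1*X2)"
    unfolding N by algebra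
  also have "\<dots> = (q1*q2*q3)*((c3*X3 + c2*X2)*(c3*X3 + c1*X1) - (-X3)\<^sup>2)"
    unfolding q3_def by algebra
  finally have m2: "(c3*X3 + c2*X2)*(c3*X3 + c1*X1) - (-X3)\<^sup>2 > 0"
    by (rule zero_less_mult_pos) (use q in simp)
  have "D * (D\<^sup>2 * (P12*P23*P31 + P13*P32*P21)) =
     (D*P12)*(D*P23)*(D*P31) + (D*P13)*(D*P32)*(D*P21)" by algebra
  also have "\<dots> = D * (N1\<^sup>2*(c2*N2*q3 + c3*N3*q2) + N2\<^sup>2*(c1*N1*q3+c3*N3*q1)
      + N3\<^sup>2*(c1*N1*q2+c2*N2*q1) + 2*(c1*c2*c3-1)*N1*N2*N3)"
    unfolding DP unfolding D_def q1_def q2_def q3_def k1_def k2_def by algebra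
  finally have "D\<^sup>2 * (P12*P23*P31 + P13*P32*P21) = (N1\<^sup>2*(c2*N2*q3 + c3*N3*q2) + N2\<^sup>2*(c1*N1*q3+c3*N3*q1)
      + N3\<^sup>2*(c1*N1*q2+c2*N2*q1) + 2*(c1*c2*c3-1)*N1*N2*N3)"
    using D by simp
  also have "\<dots> = (q1*q2*q3)*(q1*X1\<^sup>2*(c2*X2 + c3*X3) + q2*X2\<^sup>2*(c1*X1+c3*X3)
      + q3*X3\<^sup>2*(c1*X1+c2*X2) + 2*(c1*c2*c3-1)*X1*X2*X3)"
    unfolding N by algebra
  finally have "(q1*q2*q3)*(q1*X1\<^sup>2*(c2*X2 + c3*X3) + q2*X2\<^sup>2*(c1*X1+c3*X3)
      + q3*X3\<^sup>2*(c1*X1+c2*X2) + 2*(c1*c2*c3-1)*X1*X2*X3) > 0"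
    using D P by (metis mult_pos_pos zero_less_power)
  then have "q1*X1\<^sup>2*(c2*X2 + c3*X3) + q2*X2\<^sup>2*(c1*X1+c3*X3)
      + q3*X3\<^sup>2*(c1*X1+c2*X2) + 2*(c1*c2*c3-1)*X1*X2*X3 > 0"
    by (rule zero_less_mult_pos) (use q in simp)
  also have "q1*X1\<^sup>2*(c2*X2 + c3*X3) + q2*X2\<^sup>2*(c1*X1+c3*X3)
      + q3*X3\<^sup>2*(c1*X1+c2*X2) + 2*(c1*c2*c3-1)*X1*X2*X3 =
     (c3*X3 + c2*X2)*(c3*X3 + c1*X1)*(c2*X2 + c1*X1) + 2*(-X3)*(-X2)*(-X1) - (c3*X3 + c2*X2)*(-X1)\<^sup>2
     - (c3*X3 + c1*X1)*(-X2)\<^sup>2 - (c2*X2 + c1*X1)*(-X3)\<^sup>2"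
    unfolding q1_def q2_def q3_def by algebra
  finally have "0 < (c3*X3 + c2*X2)*w1\<^sup>2 + (c3*X3 + c1*X1)*w2\<^sup>2 + (c2*X2 + c1*X1)*w3\<^sup>2
      + 2*(-X3)*w1*w2 + 2*(-X2)*w1*w3 + 2*(-X1)*w2*w3"
    by (intro sylvester3[OF m11 m2 _ w])
  then show ?thesis unfolding X1_def[symmetric] X2_def[symmetric] X3_def[symmetric]
    by (simp add: algebra_simps)
qed

text \<open>Since \<open>c > 1\<close>, each of the three binary forms is positive definite, and any
  two of them involve all three variables. So two positive coefficients are enough; two vanishing
  ones would annihilate both products in \<open>P\<close>.\<close>

lemma hyp_form_pos_nonneg:
  fixes s1 s2 s3 B1 B2 B3 :: real
  defines "A1 \<equiv> s1\<^sup>2 - 1" and "A2 \<equiv> s2\<^sup>2 - 1" and "A3 \<equiv> s3\<^sup>2 - 1"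
  defines "c1 \<equiv> s2* s3 + B1" and "c2 \<equiv> s1* s3 + B2" and "c3 \<equiv> s1* s2 + B3"
  defines "D \<equiv> 1 + 2*c1*c2*c3 - c1\<^sup>2 - c2\<^sup>2 - c3\<^sup>2"
  defines "q1 \<equiv> c1\<^sup>2 - 1" and "q2 \<equiv> c2\<^sup>2 - 1" and "q3 \<equiv> c3\<^sup>2 - 1"
  defines "N1 \<equiv> s1*(1-c1\<^sup>2) + s2*(c1*c2-c3) + s3*(c1*c3-c2)"
    and "N2 \<equiv> s2*(1-c2\<^sup>2) + s1*(c1*c2-c3) + s3*(c2*c3-c1)"
    and "N3 \<equiv> s3*(1-c3\<^sup>2) + s1*(c1*c3-c2) + s2*(c2*c3-c1)"
  defines "P12 \<equiv> A1* s2 + B3* s1" and "P21 \<equiv> A2* s1 + B3* s2" and "P13 \<equiv> A1* s3 + B2* s1"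
    and "P31 \<equiv> A3* s1 + B2* s3" and "P23 \<equiv> A2* s3 + B1* s2" and "P32 \<equiv> A3* s2 + B1* s3"
  assumes c: "c1 > 1" "c2 > 1" "c3 > 1" and D: "D > 0" and P: "P12*P23*P31 + P13*P32*P21 > 0"
    and N: "N1 \<ge> 0" "N2 \<ge> 0" "N3 \<ge> 0" and w: "\<not> (w1 = 0 \<and> w2 = 0 \<and> w3 = 0)"
  shows "N1/q1 * (c1*w2\<^sup>2 - 2*w2*w3 + c1*w3\<^sup>2) + N2/q2 * (c2*w1\<^sup>2 - 2*w1*w3 + c2*w3\<^sup>2)
       + N3/q3 * (c3*w1\<^sup>2 - 2*w1*w2 + c3*w2\<^sup>2) > 0"
proof -
  note N_defs = N1_def N2_def N3_def
  note P_defs = P12_def P21_def P13_def P31_def P23_def P32_def A1_def A2_def A3_def c1_def c2_def c3_def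
  have q: "q1 > 0" "q2 > 0" "q3 > 0" using c by (auto simp: q1_def q2_def q3_def)
  have Pc: "P12 = s1*c3 - s2" "P21 = s2*c3 - s1" "P13 = s1*c2 - s3" "P31 = s3*c2 - s1"
    "P23 = s2*c1 - s3" "P32 = s3*c1 - s2" unfolding P_defs by algebra+
  have DP: "D*P12 = q3*N2 + (c2*c3-c1)*N3" "D*P21 = q3*N1 + (c1*c3-c2)*N3" "D*P13 = q2*N3 + (c2*c3-c1)*N2"
    "D*P31 = q2*N1 + (c1*c2-c3)*N2" "D*P23 = q1*N3 + (c1*c3-c2)*N1" "D*P32 = q1*N2 + (c1*c2-c3)*N1"
    unfolding Pc N_defs q1_def q2_def q3_def D_def by algebra+
  have "\<not> (N1 = 0 \<and> N2 = 0)"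
  proof
    assume "N1 = 0 \<and> N2 = 0"
    then have "P31 = 0" "P32 = 0" using DP D by auto
    then show False using P by simp
  qed
  moreover have "\<not> (N1 = 0 \<and> N3 = 0)"
  proof
    assume "N1 = 0 \<and> N3 = 0"
    then have "P21 = 0" "P23 = 0" using DP D by auto
    then show False using P by simp
  qed
  moreover have "\<not> (N2 = 0 \<and> N3 = 0)"
  proof
    assume "N2 = 0 \<and> N3 = 0"
    then have "P12 = 0" "P13 = 0" using DP D by auto
    then show False using P by simp
  qed
  ultimately have two: "N1 > 0 \<and> N2 > 0 \<or> N1 > 0 \<and> N3 > 0 \<or> N2 > 0 \<and> N3 > 0" using N by auto
  have E0: "c*x\<^sup>2 - 2*x*y + c*y\<^sup>2 = (x-y)\<^sup>2 + (c-1)*(x\<^sup>2+y\<^sup>2)" for c x y :: real by algebra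
  have E: "n/p * (c*x\<^sup>2 - 2*x*y + c*y\<^sup>2) \<ge> 0" if "n \<ge> 0" "p > 0" "c > 1" for n p c x y :: real
    unfolding E0 using that by simp
  have E': "n/p * (c*x\<^sup>2 - 2*x*y + c*y\<^sup>2) > 0" if "n > 0" "p > 0" "c > 1" "x \<noteq> 0 \<or> y \<noteq> 0" for n p c x y :: real
  proof -
    have "x\<^sup>2 + y\<^sup>2 > 0" using that(4) by (simp add: sum_power2_gt_zero_iff)
    then show ?thesis unfolding E0 using that by (simp add: add_nonneg_pos)
  qed
  note nn = E[OF N(1) q(1) c(1), of w2 w3] E[OF N(2) q(2) c(2), of w1 w3] E[OF N(3) q(3) c(3), of w1 w2]
  from w consider "w1 \<noteq> 0" | "w2 \<noteq> 0" | "w3 \<noteq> 0" by blast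
  then show ?thesis
  proof cases
    case 1
    from two consider "N2 > 0" | "N3 > 0" by blast
    then show ?thesis using nn E'[OF _ q(2) c(2), of N2 w1 w3] E'[OF _ q(3) c(3), of N3 w1 w2] 1
      by cases linarith+
  next
    case 2
    from two consider "N1 > 0" | "N3 > 0" by blast
    then show ?thesis using nn E'[OF _ q(1) c(1), of N1 w2 w3] E'[OF _ q(3) c(3), of N3 w1 w2] 2
      by cases linarith+
  next
    case 3
    from two consider "N1 > 0" | "N2 > 0" by blast
    then show ?thesis using nn E'[OF _ q(1) c(1), of N1 w2 w3] E'[OF _ q(2) c(2), of N2 w1 w3] 3
      by cases linarith+
  qed
qed

text \<open>The situation is symmetric in the vertices: exchanging 1 and 3, respectively 2 and 3,
  carries a negative \<open>N1\<close> or \<open>N2\<close> to the case of a negative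
  \<open>N3\<close>.\<close>

lemma hyp_form_pos:
  fixes s1 s2 s3 B1 B2 B3 :: real
  defines "A1 \<equiv> s1\<^sup>2 - 1" and "A2 \<equiv> s2\<^sup>2 - 1" and "A3 \<equiv> s3\<^sup>2 - 1"
  defines "c1 \<equiv> s2* s3 + B1" and "c2 \<equiv> s1* s3 + B2" and "c3 \<equiv> s1* s2 + B3"
  defines "D \<equiv> 1 + 2*c1*c2*c3 - c1\<^sup>2 - c2\<^sup>2 - c3\<^sup>2"
  defines "q1 \<equiv> c1\<^sup>2 - 1" and "q2 \<equiv> c2\<^sup>2 - 1" and "q3 \<equiv> c3\<^sup>2 - 1"
  defines "N1 \<equiv> s1*(1-c1\<^sup>2) + s2*(c1*c2-c3) + s3*(c1*c3-c2)"
    and "N2 \<equiv> s2*(1-c2\<^sup>2) + s1*(c1*c2-c3) + s3*(c2*c3-c1)"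
    and "N3 \<equiv> s3*(1-c3\<^sup>2) + s1*(c1*c3-c2) + s2*(c2*c3-c1)"
  assumes s: "s1 > 0" "s2 > 0" "s3 > 0" and A: "A1 \<ge> 0" "A2 \<ge> 0" "A3 \<ge> 0"
    and B: "B1 > 0 \<or> B1\<^sup>2 < A2*A3" "B2 > 0 \<or> B2\<^sup>2 < A1*A3" "B3 > 0 \<or> B3\<^sup>2 < A1*A2"
    and g: "A1*B1 + B2*B3 \<ge> 0" "A2*B2 + B1*B3 \<ge> 0" "A3*B3 + B1*B2 \<ge> 0"
    and c: "c1 > 1" "c2 > 1" "c3 > 1" and D: "D > 0"
    and P: "(A1 * s2 + B3 * s1) * (A2 * s3 + B1 * s2) * (A3 * s1 + B2 * s3)
       + (A1 * s3 + B2 * s1) * (A3 * s2 + B1 * s3) * (A2 * s1 + B3 * s2) > 0"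
    and w: "\<not> (w1 = 0 \<and> w2 = 0 \<and> w3 = 0)"
  shows "N1/q1 * (c1*w2\<^sup>2 - 2*w2*w3 + c1*w3\<^sup>2) + N2/q2 * (c2*w1\<^sup>2 - 2*w1*w3 + c2*w3\<^sup>2)
       + N3/q3 * (c3*w1\<^sup>2 - 2*w1*w2 + c3*w2\<^sup>2) > 0"
proof -
  have perm: "c3 = s2* s1 + B3" "c2 = s3* s1 + B2" "c1 = s3* s2 + B1"
    "c2 = s1* s3 + B2" "c3 = s1* s2 + B3"
    by (simp_all add: c1_def c2_def c3_def)
  have permD: "D = 1 + 2*c3*c2*c1 - c3\<^sup>2 - c2\<^sup>2 - c1\<^sup>2" "D = 1 + 2*c1*c3*c2 - c1\<^sup>2 - c3\<^sup>2 - c2\<^sup>2"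
    by (simp_all add: D_def mult_ac)
  have permN: "N1 = s1*(1-c1\<^sup>2) + s3*(c3*c1-c2) + s2*(c2*c1-c3)" "N1 = s1*(1-c1\<^sup>2) + s3*(c1*c3-c2) + s2*(c1*c2-c3)"
    "N2 = s2*(1-c2\<^sup>2) + s3*(c3*c2-c1) + s1*(c2*c1-c3)" "N2 = s2*(1-c2\<^sup>2) + s1*(c1*c2-c3) + s3*(c3*c2-c1)"
    "N3 = s3*(1-c3\<^sup>2) + s2*(c3*c2-c1) + s1*(c3*c1-c2)" "N3 = s3*(1-c3\<^sup>2) + s1*(c1*c3-c2) + s2*(c3*c2-c1)"
    by (simp_all add: N1_def N2_def N3_def mult_ac)
  consider "N1 \<ge> 0" "N2 \<ge> 0" "N3 \<ge> 0" | "N1 < 0" | "N2 < 0" | "N3 < 0" by linarith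
  then show ?thesis
  proof cases
    case 1
    then show ?thesis
      using c D P w unfolding A1_def A2_def A3_def c1_def c2_def c3_def D_def q1_def q2_def q3_def
        N1_def N2_def N3_def
      by (intro hyp_form_pos_nonneg)
  next
    case 2
    have "0 < N3/q3 * (c3*w2\<^sup>2 - 2*w2*w1 + c3*w1\<^sup>2) + N2/q2 * (c2*w3\<^sup>2 - 2*w3*w1 + c2*w1\<^sup>2)
       + N1/q1 * (c1*w3\<^sup>2 - 2*w3*w2 + c1*w2\<^sup>2)"
      by (rule hyp_form_pos_neg[where ?s1.0=s3 and ?s2.0=s2 and ?s3.0=s1 and ?B1.0=B3 and ?B2.0=B2 and ?B3.0=B1
            and D=D and ?c1.0=c3 and ?c2.0=c2 and ?c3.0=c1 and ?N1.0=N3 and ?N2.0=N2 and ?N3.0=N1,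
            OF A3_def[THEN meta_eq_to_obj_eq] A2_def[THEN meta_eq_to_obj_eq] A1_def[THEN meta_eq_to_obj_eq]
              perm(1,2,3) permD(1) q3_def[THEN meta_eq_to_obj_eq] q2_def[THEN meta_eq_to_obj_eq] q1_def[THEN meta_eq_to_obj_eq]
              permN(5,3,1) refl refl refl refl refl refl refl refl s(3,2,1) A(3,2)])
        (use B g c D P w 2 in \<open>auto simp: mult_ac add_ac\<close>)
    then show ?thesis by (simp add: algebra_simps)
  next
    case 3
    have "0 < N1/q1 * (c1*w3\<^sup>2 - 2*w3*w2 + c1*w2\<^sup>2) + N3/q3 * (c3*w1\<^sup>2 - 2*w1*w2 + c3*w2\<^sup>2)
       + N2/q2 * (c2*w1\<^sup>2 - 2*w1*w3 + c2*w3\<^sup>2)"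
      by (rule hyp_form_pos_neg[where ?s1.0=s1 and ?s2.0=s3 and ?s3.0=s2 and ?B1.0=B1 and ?B2.0=B3 and ?B3.0=B2
            and D=D and ?c1.0=c1 and ?c2.0=c3 and ?c3.0=c2 and ?N1.0=N1 and ?N2.0=N3 and ?N3.0=N2,
            OF A1_def[THEN meta_eq_to_obj_eq] A3_def[THEN meta_eq_to_obj_eq] A2_def[THEN meta_eq_to_obj_eq]
              perm(3,5,4) permD(2) q1_def[THEN meta_eq_to_obj_eq] q3_def[THEN meta_eq_to_obj_eq] q2_def[THEN meta_eq_to_obj_eq]
              permN(2,6,4) refl refl refl refl refl refl refl refl s(1,3,2) A(1,3)])
        (use B g c D P w 3 in \<open>auto simp: mult_ac add_ac\<close>)
    then show ?thesis by (simp add: algebra_simps)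
  next
    case 4
    then show ?thesis
      using s A B g c D P w
      by (intro hyp_form_pos_neg[OF A1_def[THEN meta_eq_to_obj_eq] A2_def[THEN meta_eq_to_obj_eq]
        A3_def[THEN meta_eq_to_obj_eq] c1_def[THEN meta_eq_to_obj_eq] c2_def[THEN meta_eq_to_obj_eq]
        c3_def[THEN meta_eq_to_obj_eq] D_def[THEN meta_eq_to_obj_eq]
        q1_def[THEN meta_eq_to_obj_eq] q2_def[THEN meta_eq_to_obj_eq] q3_def[THEN meta_eq_to_obj_eq]
        N1_def[THEN meta_eq_to_obj_eq] N2_def[THEN meta_eq_to_obj_eq] N3_def[THEN meta_eq_to_obj_eq]
        refl refl refl refl refl refl refl refl])
  qed
qed

section \<open>Angles as clamped arc cosines\<close>

definition clamped_arccos :: "real \<Rightarrow> real" where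
  "clamped_arccos x = arccos (max (-1) (min 1 x))"

lemma continuous_on_clamped_arccos [continuous_intros]:
  "continuous_on S f \<Longrightarrow> continuous_on S (\<lambda>x. clamped_arccos (f x))"
  unfolding clamped_arccos_def by (intro continuous_intros) auto

lemma clamped_arccos_bounds: "0 \<le> clamped_arccos x" "clamped_arccos x \<le> pi"
  unfolding clamped_arccos_def by (auto intro!: arccos_lbound arccos_ubound)

lemma clamped_arccos_degenerate: "\<bar>x\<bar> \<ge> 1 \<Longrightarrow> clamped_arccos x \<in> {0, pi}"
  by (cases "x \<ge> 1") (auto simp: clamped_arccos_def max_absorb1)

lemma clamped_arccos_eq: "\<bar>x\<bar> \<le> 1 \<Longrightarrow> clamped_arccos x = arccos x"
  by (auto simp: clamped_arccos_def)

lemma DERIV_clamped_arccos: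
  assumes "\<bar>x\<bar> < 1"
  shows "(clamped_arccos has_real_derivative - 1 / sqrt (1 - x\<^sup>2)) (at x)"
proof -
  have "(arccos has_real_derivative inverse (- sqrt (1 - x\<^sup>2))) (at x)"
    using assms by (intro DERIV_arccos) auto
  then have "(clamped_arccos has_real_derivative inverse (- sqrt (1 - x\<^sup>2))) (at x)"
    by (rule has_field_derivative_transform_within_open[where S="{-1<..<1}"])
       (use assms in \<open>auto simp: clamped_arccos_def\<close>)
  then show ?thesis by (simp add: divide_inverse)
qed

text \<open>In use, \<open>p\<close> and \<open>q\<close> are squared lengths, respectively squared
  sinh of lengths, of the sides at a vertex, so that no length has to be extracted. With this
  normalization \<open>p * q - n\<^sup>2\<close> is the same at all three vertices of a
  triangle.\<close>

definition cos_angle :: "real \<Rightarrow> real \<Rightarrow> real \<Rightarrow> real" where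
  "cos_angle n p q = clamped_arccos (n / sqrt (p * q))"

lemma cos_angle_commute: "cos_angle n p q = cos_angle n q p"
  by (simp add: cos_angle_def mult.commute)

lemma cos_angle_bounds: "0 \<le> cos_angle n p q" "cos_angle n p q \<le> pi"
  by (simp_all add: cos_angle_def clamped_arccos_bounds)

lemma cos_angle_degenerate:
  assumes "p > 0" "q > 0" "p * q \<le> n\<^sup>2"
  shows "cos_angle n p q \<in> {0, pi}"
  unfolding cos_angle_def
proof (rule clamped_arccos_degenerate)
  have "sqrt (p*q) \<le> \<bar>n\<bar>" using assms(3) real_sqrt_le_mono by fastforce
  then show "1 \<le> \<bar>n / sqrt (p * q)\<bar>" using assms(1,2) by (simp add: abs_divide)
qed

lemma cos_angle_lt_1:
  assumes "p > 0" "q > 0" "p * q - n\<^sup>2 > 0"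
  shows "\<bar>n / sqrt (p * q)\<bar> < (1::real)"
proof -
  have "\<bar>n\<bar> < sqrt (p*q)" using assms(3) by (simp add: real_less_rsqrt)
  then show ?thesis using assms(1,2) by (simp add: abs_divide)
qed

lemma continuous_on_cos_angle [continuous_intros]:
  assumes "continuous_on S n" "continuous_on S p" "continuous_on S q"
    and "\<And>x. x \<in> S \<Longrightarrow> p x > 0" "\<And>x. x \<in> S \<Longrightarrow> q x > 0"
  shows "continuous_on S (\<lambda>x. cos_angle (n x) (p x) (q x))"
  unfolding cos_angle_def
proof (intro continuous_intros assms ballI)
  fix x assume "x \<in> S"
  then show "sqrt (p x * q x) \<noteq> 0" using assms(4,5)[of x] by simp
qed

text \<open>Logarithmic derivatives of \<open>p\<close> and \<open>q\<close> bring everything over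
  the single root of \<open>p * q - n\<^sup>2\<close>. As that root is common to the three angles of
  a triangle, it factors out of a weighted angle sum and leaves a quadratic form.\<close>

lemma DERIV_cos_angle:
  assumes n: "(n has_real_derivative n') (at t)" and p: "(p has_real_derivative p') (at t)"
    and q: "(q has_real_derivative q') (at t)"
    and pos: "p t > 0" "q t > 0" "p t * q t - (n t)\<^sup>2 > 0"
  shows "((\<lambda>t. cos_angle (n t) (p t) (q t)) has_real_derivative
     - (n' - n t * (p' / (2 * p t) + q' / (2 * q t))) / sqrt (p t * q t - (n t)\<^sup>2)) (at t)"
proof -
  define S where "S = sqrt (p t * q t)"
  have S: "S > 0" "S\<^sup>2 = p t * q t" using pos by (auto simp: S_def)
  have d1: "((\<lambda>t. n t / sqrt (p t * q t)) has_real_derivative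
      (n' * S - n t * ((p' * q t + p t * q') / (2 * S))) / S\<^sup>2) (at t)"
    using mult_pos_pos[OF pos(1,2)] S(1) unfolding S_def
    by (auto intro!: derivative_eq_intros n p q simp: power2_eq_square divide_simps)
  have lt: "\<bar>n t / S\<bar> < 1" unfolding S_def by (rule cos_angle_lt_1[OF pos])
  have d2: "((\<lambda>t. clamped_arccos (n t / sqrt (p t * q t))) has_real_derivative
     (- 1 / sqrt (1 - (n t / S)\<^sup>2)) * ((n' * S - n t * ((p' * q t + p t * q') / (2 * S))) / S\<^sup>2)) (at t)"
    using DERIV_chain2[OF DERIV_clamped_arccos[OF lt, unfolded S_def] d1] by (simp add: S_def)
  have e1: "sqrt (1 - (n t / S)\<^sup>2) = sqrt (p t * q t - (n t)\<^sup>2) / S"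
  proof -
    have "1 - (n t / S)\<^sup>2 = (p t * q t - (n t)\<^sup>2) / S\<^sup>2"
      unfolding S(2)[symmetric] using S(1) by (simp add: power_divide diff_divide_distrib)
    then show ?thesis using S(1) by (simp add: real_sqrt_divide)
  qed
  have e2: "(n' * S - n t * ((p' * q t + p t * q') / (2 * S))) / S\<^sup>2 =
     (n' - n t * (p' / (2 * p t) + q' / (2 * q t))) / S"
  proof -
    have "(n' * S - n t * ((p' * q t + p t * q') / (2 * S))) / S\<^sup>2 =
       (n' - n t * (p' * q t + p t * q') / (2 * S\<^sup>2)) / S"
      using S(1) by (simp add: field_simps power2_eq_square)
    also have "(p' * q t + p t * q') / (2 * S\<^sup>2) = p' / (2 * p t) + q' / (2 * q t)"
      unfolding S(2) using pos by (simp add: field_simps)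
    then have "n t * (p' * q t + p t * q') / (2 * S\<^sup>2) = n t * (p' / (2 * p t) + q' / (2 * q t))"
      by (metis times_divide_eq_right)
    finally show ?thesis .
  qed
  have "sqrt (p t * q t - (n t)\<^sup>2) > 0" using pos by simp
  then have "(- 1 / sqrt (1 - (n t / S)\<^sup>2)) * ((n' * S - n t * ((p' * q t + p t * q') / (2 * S))) / S\<^sup>2)
     = - (n' - n t * (p' / (2 * p t) + q' / (2 * q t))) / sqrt (p t * q t - (n t)\<^sup>2)"
    unfolding e1 e2 using S(1) by (simp add: divide_simps)
  then show ?thesis using d2 unfolding cos_angle_def by simp
qed

text \<open>The exceptions are values, not parameters, so the exceptional set of parameters may be
  uncountable. If \<open>g b > g a\<close>, some level \<open>y\<close> outside \<open>V\<close>
  lies in between. At the last time with \<open>g \<le> y\<close> the value is \<open>y\<close>, and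
  nearby \<open>g\<close> avoids \<open>V\<close>, so \<open>g\<close> does not increase to the
  right of that time although it must exceed \<open>y\<close> there.\<close>

lemma nonincreasing_except_finite_values:
  fixes g :: "real \<Rightarrow> real"
  assumes ab: "a \<le> b" and cont: "continuous_on {a..b} g" and fin: "finite V"
    and der: "\<And>t. a < t \<Longrightarrow> t < b \<Longrightarrow> g t \<notin> V \<Longrightarrow> \<exists>d\<le>0. (g has_real_derivative d) (at t)"
  shows "g b \<le> g a"
proof (rule ccontr)
  assume "\<not> ?thesis"
  then have lt: "g a < g b" by simp
  have "infinite {g a<..<g b}" using lt by simp
  then obtain y where y: "g a < y" "y < g b" "y \<notin> V"
    using fin by (metis finite_subset greaterThanLessThan_iff subsetI)
  define T where "T = {t\<in>{a..b}. g t \<le> y}"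
  have T: "compact T" "T \<noteq> {}"
  proof -
    have "closed T" unfolding T_def
      using continuous_closed_preimage[OF cont closed_atLeastAtMost closed_atMost[of y]]
      by (simp add: vimage_def Int_def)
    moreover have "bounded T"
      by (rule bounded_subset[OF bounded_closed_interval[of a b]]) (auto simp: T_def)
    ultimately show "compact T" by (simp add: compact_eq_bounded_closed)
    show "T \<noteq> {}" using ab y by (auto simp: T_def)
  qed
  obtain s where s: "s \<in> T" "\<And>t. t \<in> T \<Longrightarrow> t \<le> s" using compact_attains_sup[OF T] by blast
  have sb: "a \<le> s" "s < b" using s(1) y by (auto simp: T_def less_le)
  have gt: "g t > y" if "s < t" "t \<le> b" for t using s(2)[of t] that sb by (force simp: T_def)
  have gs: "g s = y"
  proof (rule ccontr)
    assume "g s \<noteq> y"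
    then have "g s < y" using s(1) by (simp add: T_def)
    then obtain x where "s \<le> x" "x \<le> b" "g x = y"
      using IVT'[of g s y b] y sb continuous_on_subset[OF cont, of "{s..b}"] by force
    then show False using gt[of x] \<open>g s \<noteq> y\<close> by (cases "x = s") auto
  qed
  have sa: "a < s" using gs y sb by (metis less_eq_real_def less_irrefl)
  have "closed V" using fin by (rule finite_imp_closed)
  then have "open (-V)" by auto
  moreover have "isCont g s" using cont sa sb continuous_on_interior[of "{a..b}" g s] by simp
  ultimately have "eventually (\<lambda>t. g t \<in> -V) (at s)"
    using y(3) gs unfolding isCont_def by (metis ComplI topological_tendstoD)
  then obtain d where d: "d > 0" "\<And>t. t \<noteq> s \<Longrightarrow> dist t s < d \<Longrightarrow> g t \<notin> V"
    unfolding eventually_at by auto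
  define x where "x = min (s + d/2) ((s+b)/2)"
  have x: "s < x" "x < b" "x < s + d" using d(1) sb by (auto simp: x_def min_def)
  have "g x \<le> g s"
  proof (rule DERIV_nonpos_imp_nonincreasing[of s x g])
    show "s \<le> x" using x by simp
    fix t assume t: "s \<le> t" "t \<le> x"
    have "g t \<notin> V" using d(2)[of t] t x gs y(3) by (cases "t = s") (auto simp: dist_real_def)
    then show "\<exists>y. DERIV g t :> y \<and> y \<le> 0" using der[of t] t x sa by auto
  qed
  then show False using gt[of x] x gs by simp
qed

text \<open>The Cauchy-Schwarz inequality gives \<open>s1 * s2 \<ge> 1 + e1 * e2 * r1 * r2\<close>;
  the edge condition supplies the rest.\<close>

lemma hyp_len_gt_1:
  fixes e1 e2 h r1 r2 s1 s2 :: real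
  assumes "e1 \<in> {0,1}" "e2 \<in> {0,1}" "r1 > 0" "r2 > 0" "s1 > 0" "s2 > 0"
    and s: "s1\<^sup>2 = 1 + e1 * r1\<^sup>2" "s2\<^sup>2 = 1 + e2 * r2\<^sup>2" and h: "e1 * e2 + h > 0"
  shows "s1 * s2 + h * r1 * r2 > 1"
proof -
  have "1 + e1 * e2 * r1 * r2 \<le> s1 * s2"
  proof (rule power2_le_imp_le)
    have sq: "e1\<^sup>2 = e1" "e2\<^sup>2 = e2" using assms by auto
    have "(s1 * s2)\<^sup>2 = (1 + e1 * r1\<^sup>2) * (1 + e2 * r2\<^sup>2)" by (simp add: power_mult_distrib s)
    also have "\<dots> = (1 + e1 * e2 * r1 * r2)\<^sup>2 + (e1 * r1 - e2 * r2)\<^sup>2 + (e1-e1\<^sup>2) * r1\<^sup>2 + (e2-e2\<^sup>2) * r2\<^sup>2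
         + (e1*e2 - e1\<^sup>2*e2\<^sup>2) * r1\<^sup>2 * r2\<^sup>2" by algebra
    finally show "(1 + e1 * e2 * r1 * r2)\<^sup>2 \<le> (s1 * s2)\<^sup>2" by (simp add: sq)
  qed (use assms in auto)
  moreover have "0 < (e1 * e2 + h) * (r1 * r2)" using assms by simp
  ultimately show ?thesis by (simp add: algebra_simps)
qed

lemma eucl_len_pos:
  fixes e1 e2 h r1 r2 :: real
  assumes "e1 \<in> {0,1}" "e2 \<in> {0,1}" "r1 > 0" "r2 > 0" and h: "e1 * e2 + h > 0"
  shows "e1 * r1\<^sup>2 + e2 * r2\<^sup>2 + 2 * (h * r1 * r2) > 0"
proof -
  have sq: "e1\<^sup>2 = e1" "e2\<^sup>2 = e2" using assms by auto
  have "0 < 2 * (e1 * e2 + h) * (r1 * r2) + (e1 * r1 - e2 * r2)\<^sup>2" using assms by (simp add: add_pos_nonneg)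
  also have "\<dots> = e1\<^sup>2 * r1\<^sup>2 + e2\<^sup>2 * r2\<^sup>2 + 2 * (h * r1 * r2)" by algebra
  finally show ?thesis by (simp add: sq)
qed

text \<open>The \<open>d\<close> are the derivatives of the edge cosines \<open>c\<close> along
  \<open>w\<close>, and the left side is the weighted sum of the numerators of the angle
  derivatives. The \<open>s\<close> and \<open>c\<close> are free variables, so this is an identity
  of rational functions. Sorted by edges, each edge contributes its own binary form and a remainder
  \<open>Z\<close>; the three remainders cancel.\<close>

lemma hyp_bracket_identity:
  fixes s1 s2 s3 c1 c2 c3 w1 w2 w3 :: real
  defines "q1 \<equiv> c1\<^sup>2 - 1" and "q2 \<equiv> c2\<^sup>2 - 1" and "q3 \<equiv> c3\<^sup>2 - 1"
  defines "N1 \<equiv> s1*(1-c1\<^sup>2) + s2*(c1*c2-c3) + s3*(c1*c3-c2)"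
    and "N2 \<equiv> s2*(1-c2\<^sup>2) + s1*(c1*c2-c3) + s3*(c2*c3-c1)"
    and "N3 \<equiv> s3*(1-c3\<^sup>2) + s1*(c1*c3-c2) + s2*(c2*c3-c1)"
  defines "d1 \<equiv> w2 * (s2*c1 - s3) + w3 * (s3*c1 - s2)" and "d2 \<equiv> w1 * (s1*c2 - s3) + w3 * (s3*c2 - s1)"
    and "d3 \<equiv> w1 * (s1*c3 - s2) + w2 * (s2*c3 - s1)"
  assumes q: "q1 > 0" "q2 > 0" "q3 > 0"
  shows "w1 * ((d2*c3 + c2*d3 - d1) - (c2*c3-c1) * ((2*c2*d2)/(2*q2) + (2*c3*d3)/(2*q3)))
       + w2 * ((d1*c3 + c1*d3 - d2) - (c1*c3-c2) * ((2*c1*d1)/(2*q1) + (2*c3*d3)/(2*q3)))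
       + w3 * ((d1*c2 + c1*d2 - d3) - (c1*c2-c3) * ((2*c1*d1)/(2*q1) + (2*c2*d2)/(2*q2)))
     = N1/q1 * (c1*w2\<^sup>2 - 2*w2*w3 + c1*w3\<^sup>2) + N2/q2 * (c2*w1\<^sup>2 - 2*w1*w3 + c2*w3\<^sup>2)
       + N3/q3 * (c3*w1\<^sup>2 - 2*w1*w2 + c3*w2\<^sup>2)" (is "?L = ?R")
proof -
  \<comment> \<open>Reciprocals are treated as variables subject to \<open>i * q = 1\<close>, which
    keeps all identities polynomial.\<close>
  define i1 i2 i3 where "i1 = 1/q1" and "i2 = 1/q2" and "i3 = 1/q3"
  have i: "i1 * q1 = 1" "i2 * q2 = 1" "i3 * q3 = 1" using q by (auto simp: i1_def i2_def i3_def)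
  define Z1 Z2 Z3 where
    "Z1 = w2\<^sup>2*(s1*c1-s3*c3) + w3\<^sup>2*(s1*c1-s2*c2) + w2*w3*(c3* s2+c2* s3-2* s1) - w1*d1" and
    "Z2 = w1\<^sup>2*(s2*c2-s3*c3) + w3\<^sup>2*(s2*c2-s1*c1) + w1*w3*(c3* s1+c1* s3-2* s2) - w2*d2" and
    "Z3 = w1\<^sup>2*(s3*c3-s2*c2) + w2\<^sup>2*(s3*c3-s1*c1) + w1*w2*(c2* s1+c1* s2-2* s3) - w3*d3"
  have Z: "Z1 + Z2 + Z3 = 0"
    unfolding Z1_def Z2_def Z3_def d1_def d2_def d3_def by algebra
  have z1: "d1*(w2*(c1*c2-c3)+w3*(c1*c3-c2) - w1*q1) = N1 * (c1*w2\<^sup>2 - 2*w2*w3 + c1*w3\<^sup>2) + q1*Z1"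
    unfolding Z1_def N1_def q1_def d1_def by algebra
  have z2: "d2*(w1*(c1*c2-c3)+w3*(c2*c3-c1) - w2*q2) = N2 * (c2*w1\<^sup>2 - 2*w1*w3 + c2*w3\<^sup>2) + q2*Z2"
    unfolding Z2_def N2_def q2_def d2_def by algebra
  have z3: "d3*(w1*(c1*c3-c2)+w2*(c2*c3-c1) - w3*q3) = N3 * (c3*w1\<^sup>2 - 2*w1*w2 + c3*w2\<^sup>2) + q3*Z3"
    unfolding Z3_def N3_def q3_def d3_def by algebra
  have L: "?L = w1 * ((d2*c3 + c2*d3 - d1) - (c2*c3-c1) * (c2*d2*i2 + c3*d3*i3))
       + w2 * ((d1*c3 + c1*d3 - d2) - (c1*c3-c2) * (c1*d1*i1 + c3*d3*i3))
       + w3 * ((d1*c2 + c1*d2 - d3) - (c1*c2-c3) * (c1*d1*i1 + c2*d2*i2))"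
    by (simp add: i1_def i2_def i3_def)
  also have "\<dots> = i1 * (d1*(w2*(c1*c2-c3)+w3*(c1*c3-c2) - w1*q1))
     + i2 * (d2*(w1*(c1*c2-c3)+w3*(c2*c3-c1) - w2*q2))
     + i3 * (d3*(w1*(c1*c3-c2)+w2*(c2*c3-c1) - w3*q3))"
    using i unfolding q1_def q2_def q3_def by algebra
  also have "\<dots> = i1 * N1 * (c1*w2\<^sup>2 - 2*w2*w3 + c1*w3\<^sup>2) + i2 * N2 * (c2*w1\<^sup>2 - 2*w1*w3 + c2*w3\<^sup>2)
     + i3 * N3 * (c3*w1\<^sup>2 - 2*w1*w2 + c3*w2\<^sup>2) + (i1*q1)*Z1 + (i2*q2)*Z2 + (i3*q3)*Z3"
    unfolding z1 z2 z3 by algebra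
  also have "\<dots> = ?R" unfolding i using Z by (simp add: i1_def i2_def i3_def)
  finally show ?thesis .
qed

text \<open>The same cancellation of edge remainders with squared lengths in place of hyperbolic
  cosines. The \<open>d\<close> are half the derivatives of the squared lengths, and the
  \<open>n\<close> in the proof are the inner products of the two sides at a vertex, so that each
  squared length is a sum of two of them.\<close>

lemma eucl_bracket_identity:
  fixes A1 A2 A3 B1 B2 B3 w1 w2 w3 :: real
  defines "L1 \<equiv> A2 + A3 + 2*B1" and "L2 \<equiv> A1 + A3 + 2*B2" and "L3 \<equiv> A1 + A2 + 2*B3"
  defines "g1 \<equiv> A1*B1 + B2*B3" and "g2 \<equiv> A2*B2 + B1*B3" and "g3 \<equiv> A3*B3 + B1*B2"
  defines "N1 \<equiv> A2*A3 - B1\<^sup>2 + g2 + g3" and "N2 \<equiv> A1*A3 - B2\<^sup>2 + g1 + g3"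
    and "N3 \<equiv> A1*A2 - B3\<^sup>2 + g1 + g2"
  defines "d1 \<equiv> w2 * (A2 + B1) + w3 * (A3 + B1)" and "d2 \<equiv> w1 * (A1 + B2) + w3 * (A3 + B2)"
    and "d3 \<equiv> w1 * (A1 + B3) + w2 * (A2 + B3)"
  assumes L: "L1 > 0" "L2 > 0" "L3 > 0"
  shows "w1 * ((2*d2 + 2*d3 - 2*d1)/2 - (L2+L3-L1)/2 * ((2*d2)/(2*L2) + (2*d3)/(2*L3)))
       + w2 * ((2*d1 + 2*d3 - 2*d2)/2 - (L1+L3-L2)/2 * ((2*d1)/(2*L1) + (2*d3)/(2*L3)))
       + w3 * ((2*d1 + 2*d2 - 2*d3)/2 - (L1+L2-L3)/2 * ((2*d1)/(2*L1) + (2*d2)/(2*L2)))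
     = N1/L1 * (w2-w3)\<^sup>2 + N2/L2 * (w1-w3)\<^sup>2 + N3/L3 * (w1-w2)\<^sup>2" (is "?L = ?R")
proof -
  define i1 i2 i3 where "i1 = 1/L1" and "i2 = 1/L2" and "i3 = 1/L3"
  have i: "i1 * L1 = 1" "i2 * L2 = 1" "i3 * L3 = 1" using L by (auto simp: i1_def i2_def i3_def)
  define n1 n2 n3 where "n1 = A1+B3+B2-B1" and "n2 = A2+B3+B1-B2" and "n3 = A3+B1+B2-B3"
  have n: "L2+L3-L1 = 2*n1" "L1+L3-L2 = 2*n2" "L1+L2-L3 = 2*n3"
    unfolding n1_def n2_def n3_def L1_def L2_def L3_def by algebra+
  have Ln: "L1 = n2+n3" "L2 = n1+n3" "L3 = n1+n2"
    unfolding n1_def n2_def n3_def L1_def L2_def L3_def by algebra+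
  define Z1 Z2 Z3 where
    "Z1 = w2\<^sup>2*(B1-B3) + w3\<^sup>2*(B1-B2) + w2*w3*(A2+B3+A3+B2) - w1*d1" and
    "Z2 = w1\<^sup>2*(B2-B3) + w3\<^sup>2*(B2-B1) + w1*w3*(A1+B3+A3+B1) - w2*d2" and
    "Z3 = w1\<^sup>2*(B3-B2) + w2\<^sup>2*(B3-B1) + w1*w2*(A1+B2+A2+B1) - w3*d3"
  have Z: "Z1 + Z2 + Z3 = 0"
    unfolding Z1_def Z2_def Z3_def d1_def d2_def d3_def by algebra
  have z1: "d1*(w2*n3+w3*n2 - w1*L1) = N1 * (w2-w3)\<^sup>2 + L1*Z1"
    unfolding Z1_def N1_def L1_def d1_def n2_def n3_def g1_def g2_def g3_def by algebra
  have z2: "d2*(w1*n3+w3*n1 - w2*L2) = N2 * (w1-w3)\<^sup>2 + L2*Z2"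
    unfolding Z2_def N2_def L2_def d2_def n1_def n3_def g1_def g2_def g3_def by algebra
  have z3: "d3*(w1*n2+w2*n1 - w3*L3) = N3 * (w1-w2)\<^sup>2 + L3*Z3"
    unfolding Z3_def N3_def L3_def d3_def n2_def n1_def g1_def g2_def g3_def by algebra
  have "?L = w1 * (d2 + d3 - d1 - n1 * (d2*i2 + d3*i3))
       + w2 * (d1 + d3 - d2 - n2 * (d1*i1 + d3*i3)) + w3 * (d1 + d2 - d3 - n3 * (d1*i1 + d2*i2))"
    unfolding n by (simp add: i1_def i2_def i3_def diff_divide_distrib add_divide_distrib)
  also have "\<dots> = i1 * (d1*(w2*n3+w3*n2 - w1*L1)) + i2 * (d2*(w1*n3+w3*n1 - w2*L2))
      + i3 * (d3*(w1*n2+w2*n1 - w3*L3))"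
    using i unfolding Ln by algebra
  also have "\<dots> = i1 * N1 * (w2-w3)\<^sup>2 + i2 * N2 * (w1-w3)\<^sup>2 + i3 * N3 * (w1-w2)\<^sup>2
      + (i1*L1)*Z1 + (i2*L2)*Z2 + (i3*L3)*Z3"
    unfolding z1 z2 z3 by algebra
  also have "\<dots> = ?R" unfolding i using Z by (simp add: i1_def i2_def i3_def)
  finally show ?thesis .
qed

section \<open>Angle variation of a single triangle\<close>

text \<open>The differential equations assumed for \<open>r\<close> and \<open>s\<close> are those
  along a straight line in the coordinates \<open>u\<close>; they have the same shape for both
  weights, so no case distinction on \<open>e\<close> is made. The three angle derivatives share the
  denominator \<open>sqrt DD\<close>, and what remains is minus the form of
  \<open>hyp_form_pos\<close>.\<close>

lemma hyp_triangle_DERIV: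
  fixes r1 r2 r3 s1 s2 s3 :: "real \<Rightarrow> real" and e1 e2 e3 h1 h2 h3 w1 w2 w3 t :: real
  defines "C1 \<equiv> \<lambda>t. s2 t * s3 t + h1 * r2 t * r3 t" and "C2 \<equiv> \<lambda>t. s1 t * s3 t + h2 * r1 t * r3 t"
    and "C3 \<equiv> \<lambda>t. s1 t * s2 t + h3 * r1 t * r2 t"
  assumes e: "e1 \<in> {0,1}" "e2 \<in> {0,1}" "e3 \<in> {0,1}"
    and h: "e2*e3 + h1 > 0" "e1*e3 + h2 > 0" "e1*e2 + h3 > 0"
    and g: "e1*h1 + h2*h3 \<ge> 0" "e2*h2 + h1*h3 \<ge> 0" "e3*h3 + h1*h2 \<ge> 0"
    and r: "r1 t > 0" "r2 t > 0" "r3 t > 0" and s: "s1 t > 0" "s2 t > 0" "s3 t > 0"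
    and sr: "(s1 t)\<^sup>2 = 1 + e1 * (r1 t)\<^sup>2" "(s2 t)\<^sup>2 = 1 + e2 * (r2 t)\<^sup>2" "(s3 t)\<^sup>2 = 1 + e3 * (r3 t)\<^sup>2"
    and dr: "(r1 has_real_derivative r1 t * s1 t * w1) (at t)" "(r2 has_real_derivative r2 t * s2 t * w2) (at t)"
      "(r3 has_real_derivative r3 t * s3 t * w3) (at t)"
    and ds: "(s1 has_real_derivative e1 * (r1 t)\<^sup>2 * w1) (at t)" "(s2 has_real_derivative e2 * (r2 t)\<^sup>2 * w2) (at t)"
      "(s3 has_real_derivative e3 * (r3 t)\<^sup>2 * w3) (at t)"
    and D: "1 + 2 * C1 t * C2 t * C3 t - (C1 t)\<^sup>2 - (C2 t)\<^sup>2 - (C3 t)\<^sup>2 > 0"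
  shows "\<exists>d. ((\<lambda>t. w1 * cos_angle (C2 t * C3 t - C1 t) ((C2 t)\<^sup>2 - 1) ((C3 t)\<^sup>2 - 1)
           + w2 * cos_angle (C1 t * C3 t - C2 t) ((C1 t)\<^sup>2 - 1) ((C3 t)\<^sup>2 - 1)
           + w3 * cos_angle (C1 t * C2 t - C3 t) ((C1 t)\<^sup>2 - 1) ((C2 t)\<^sup>2 - 1)) has_real_derivative d) (at t)
       \<and> d \<le> 0 \<and> (\<not> (w1 = 0 \<and> w2 = 0 \<and> w3 = 0) \<longrightarrow> d < 0)"
proof -
  define a1 a2 a3 where "a1 = s1 t" and "a2 = s2 t" and "a3 = s3 t"
  define B1 B2 B3 where "B1 = h1 * r2 t * r3 t" and "B2 = h2 * r1 t * r3 t" and "B3 = h3 * r1 t * r2 t"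
  define c1 c2 c3 where "c1 = C1 t" and "c2 = C2 t" and "c3 = C3 t"
  have cB: "c1 = a2 * a3 + B1" "c2 = a1 * a3 + B2" "c3 = a1 * a2 + B3"
    by (auto simp: c1_def c2_def c3_def C1_def C2_def C3_def a1_def a2_def a3_def B1_def B2_def B3_def)
  have c: "c1 > 1" "c2 > 1" "c3 > 1"
    using hyp_len_gt_1[OF e(2,3) r(2,3) s(2,3) sr(2,3) h(1)] hyp_len_gt_1[OF e(1,3) r(1,3) s(1,3) sr(1,3) h(2)]
      hyp_len_gt_1[OF e(1,2) r(1,2) s(1,2) sr(1,2) h(3)]
    unfolding cB a1_def a2_def a3_def B1_def B2_def B3_def by auto
  have q: "c1\<^sup>2 - 1 > 0" "c2\<^sup>2 - 1 > 0" "c3\<^sup>2 - 1 > 0" using c by auto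
  define d1 d2 d3 where "d1 = w2 * (a2*c1 - a3) + w3 * (a3*c1 - a2)"
    and "d2 = w1 * (a1*c2 - a3) + w3 * (a3*c2 - a1)" and "d3 = w1 * (a1*c3 - a2) + w2 * (a2*c3 - a1)"
  have A: "e1 * (r1 t)\<^sup>2 = a1\<^sup>2 - 1" "e2 * (r2 t)\<^sup>2 = a2\<^sup>2 - 1" "e3 * (r3 t)\<^sup>2 = a3\<^sup>2 - 1"
    using sr by (auto simp: a1_def a2_def a3_def)
  have dC1: "(C1 has_real_derivative d1) (at t)"
  proof -
    have "(C1 has_real_derivative ((a2\<^sup>2 - 1) * w2 * a3 + (a3\<^sup>2 - 1) * w3 * a2 +
       (h1 * (r2 t * a2 * w2) * r3 t + (r3 t * a3 * w3) * (h1 * r2 t)))) (at t)"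
      unfolding C1_def a2_def a3_def
      by (rule derivative_eq_intros ds dr refl)+ (simp add: A a2_def a3_def)
    also have "(a2\<^sup>2 - 1) * w2 * a3 + (a3\<^sup>2 - 1) * w3 * a2 +
       (h1 * (r2 t * a2 * w2) * r3 t + (r3 t * a3 * w3) * (h1 * r2 t)) = d1"
      unfolding d1_def cB B1_def by algebra
    finally show ?thesis .
  qed
  have dC2: "(C2 has_real_derivative d2) (at t)"
  proof -
    have "(C2 has_real_derivative ((a1\<^sup>2 - 1) * w1 * a3 + (a3\<^sup>2 - 1) * w3 * a1 +
       (h2 * (r1 t * a1 * w1) * r3 t + (r3 t * a3 * w3) * (h2 * r1 t)))) (at t)"
      unfolding C2_def a1_def a3_def
      by (rule derivative_eq_intros ds dr refl)+ (simp add: A a1_def a3_def)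
    also have "(a1\<^sup>2 - 1) * w1 * a3 + (a3\<^sup>2 - 1) * w3 * a1 +
       (h2 * (r1 t * a1 * w1) * r3 t + (r3 t * a3 * w3) * (h2 * r1 t)) = d2"
      unfolding d2_def cB B2_def by algebra
    finally show ?thesis .
  qed
  have dC3: "(C3 has_real_derivative d3) (at t)"
  proof -
    have "(C3 has_real_derivative ((a1\<^sup>2 - 1) * w1 * a2 + (a2\<^sup>2 - 1) * w2 * a1 +
       (h3 * (r1 t * a1 * w1) * r2 t + (r2 t * a2 * w2) * (h3 * r1 t)))) (at t)"
      unfolding C3_def a1_def a2_def
      by (rule derivative_eq_intros ds dr refl)+ (simp add: A a1_def a2_def)
    also have "(a1\<^sup>2 - 1) * w1 * a2 + (a2\<^sup>2 - 1) * w2 * a1 +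
       (h3 * (r1 t * a1 * w1) * r2 t + (r2 t * a2 * w2) * (h3 * r1 t)) = d3"
      unfolding d3_def cB B3_def by algebra
    finally show ?thesis .
  qed
  have dn: "((\<lambda>t. C2 t * C3 t - C1 t) has_real_derivative d2*c3 + c2*d3 - d1) (at t)"
      "((\<lambda>t. C1 t * C3 t - C2 t) has_real_derivative d1*c3 + c1*d3 - d2) (at t)"
      "((\<lambda>t. C1 t * C2 t - C3 t) has_real_derivative d1*c2 + c1*d2 - d3) (at t)"
    by (rule derivative_eq_intros dC1 dC2 dC3 refl | simp add: c1_def c2_def c3_def)+
  have dq: "((\<lambda>t. (C1 t)\<^sup>2 - 1) has_real_derivative 2*c1*d1) (at t)"
    "((\<lambda>t. (C2 t)\<^sup>2 - 1) has_real_derivative 2*c2*d2) (at t)"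
    "((\<lambda>t. (C3 t)\<^sup>2 - 1) has_real_derivative 2*c3*d3) (at t)"
    by (rule derivative_eq_intros dC1 dC2 dC3 refl | simp add: c1_def c2_def c3_def)+
  define DD where "DD = 1 + 2 * c1 * c2 * c3 - c1\<^sup>2 - c2\<^sup>2 - c3\<^sup>2"
  have DD: "DD > 0" using D by (simp add: DD_def c1_def c2_def c3_def)
  have De: "(c2\<^sup>2 - 1) * (c3\<^sup>2 - 1) - (c2*c3 - c1)\<^sup>2 = DD" "(c1\<^sup>2 - 1) * (c3\<^sup>2 - 1) - (c1*c3 - c2)\<^sup>2 = DD"
    "(c1\<^sup>2 - 1) * (c2\<^sup>2 - 1) - (c1*c2 - c3)\<^sup>2 = DD"
    unfolding DD_def by algebra+
  note fold_c = c1_def[symmetric] c2_def[symmetric] c3_def[symmetric]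
  have t1: "((\<lambda>t. cos_angle (C2 t * C3 t - C1 t) ((C2 t)\<^sup>2 - 1) ((C3 t)\<^sup>2 - 1)) has_real_derivative
     - ((d2*c3 + c2*d3 - d1) - (c2*c3-c1) * ((2*c2*d2)/(2*(c2\<^sup>2-1)) + (2*c3*d3)/(2*(c3\<^sup>2-1)))) / sqrt DD) (at t)"
    using DERIV_cos_angle[OF dn(1) dq(2) dq(3)] q De DD by (simp only: fold_c)
  have t2: "((\<lambda>t. cos_angle (C1 t * C3 t - C2 t) ((C1 t)\<^sup>2 - 1) ((C3 t)\<^sup>2 - 1)) has_real_derivative
     - ((d1*c3 + c1*d3 - d2) - (c1*c3-c2) * ((2*c1*d1)/(2*(c1\<^sup>2-1)) + (2*c3*d3)/(2*(c3\<^sup>2-1)))) / sqrt DD) (at t)"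
    using DERIV_cos_angle[OF dn(2) dq(1) dq(3)] q De DD by (simp only: fold_c)
  have t3: "((\<lambda>t. cos_angle (C1 t * C2 t - C3 t) ((C1 t)\<^sup>2 - 1) ((C2 t)\<^sup>2 - 1)) has_real_derivative
     - ((d1*c2 + c1*d2 - d3) - (c1*c2-c3) * ((2*c1*d1)/(2*(c1\<^sup>2-1)) + (2*c2*d2)/(2*(c2\<^sup>2-1)))) / sqrt DD) (at t)"
    using DERIV_cos_angle[OF dn(3) dq(1) dq(2)] q De DD by (simp only: fold_c)
  define b1 b2 b3 where "b1 = (d2*c3 + c2*d3 - d1) - (c2*c3-c1) * ((2*c2*d2)/(2*(c2\<^sup>2-1)) + (2*c3*d3)/(2*(c3\<^sup>2-1)))"
    and "b2 = (d1*c3 + c1*d3 - d2) - (c1*c3-c2) * ((2*c1*d1)/(2*(c1\<^sup>2-1)) + (2*c3*d3)/(2*(c3\<^sup>2-1)))"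
    and "b3 = (d1*c2 + c1*d2 - d3) - (c1*c2-c3) * ((2*c1*d1)/(2*(c1\<^sup>2-1)) + (2*c2*d2)/(2*(c2\<^sup>2-1)))"
  define Q where "Q = w1 * b1 + w2 * b2 + w3 * b3"
  have der: "((\<lambda>t. w1 * cos_angle (C2 t * C3 t - C1 t) ((C2 t)\<^sup>2 - 1) ((C3 t)\<^sup>2 - 1)
           + w2 * cos_angle (C1 t * C3 t - C2 t) ((C1 t)\<^sup>2 - 1) ((C3 t)\<^sup>2 - 1)
           + w3 * cos_angle (C1 t * C2 t - C3 t) ((C1 t)\<^sup>2 - 1) ((C2 t)\<^sup>2 - 1)) has_real_derivative
        - Q / sqrt DD) (at t)"
  proof -
    have "- Q / sqrt DD = w1 * (- b1 / sqrt DD) + w2 * (- b2 / sqrt DD) + w3 * (- b3 / sqrt DD)"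
      by (simp add: Q_def add_divide_distrib diff_divide_distrib)
    then show ?thesis
      using DERIV_add[OF DERIV_add[OF DERIV_cmult[OF t1, of w1] DERIV_cmult[OF t2, of w2]] DERIV_cmult[OF t3, of w3]]
      unfolding b1_def b2_def b3_def by simp
  qed
  have sq: "e1\<^sup>2 = e1" "e2\<^sup>2 = e2" "e3\<^sup>2 = e3" using e by auto
  \<comment> \<open>By the edge condition a nonpositive \<open>h\<close> forces both weights to be 1
    and \<open>h\<close> to lie above -1.\<close>
  have Bpos: "h * x * y > 0 \<or> (h * x * y)\<^sup>2 < (e * x\<^sup>2) * (e' * y\<^sup>2)"
    if "e \<in> {0,1}" "e' \<in> {0,1}" "e * e' + h > 0" "x > 0" "y > 0" for e e' h x y :: real
  proof (cases "h > 0")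
    case True
    then show ?thesis using that by simp
  next
    case False
    then have e1: "e = 1" "e' = 1" using that by auto
    then have "h > -1" "h \<le> 0" using that(3) False by auto
    then have "h\<^sup>2 < 1" by (simp add: abs_square_less_1)
    then have "h\<^sup>2 * (x * y)\<^sup>2 < 1 * (x * y)\<^sup>2" using that by (intro mult_strict_right_mono) auto
    then show ?thesis by (simp add: e1 power_mult_distrib mult_ac)
  qed
  have gB: "(e1 * (r1 t)\<^sup>2) * B1 + B2 * B3 = (e1*h1 + h2*h3) * ((r1 t)\<^sup>2 * r2 t * r3 t)"
    "(e2 * (r2 t)\<^sup>2) * B2 + B1 * B3 = (e2*h2 + h1*h3) * ((r2 t)\<^sup>2 * r1 t * r3 t)"
    "(e3 * (r3 t)\<^sup>2) * B3 + B1 * B2 = (e3*h3 + h1*h2) * ((r3 t)\<^sup>2 * r1 t * r2 t)"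
    unfolding B1_def B2_def B3_def by algebra+
  have gB0: "(e1 * (r1 t)\<^sup>2) * B1 + B2 * B3 \<ge> 0" "(e2 * (r2 t)\<^sup>2) * B2 + B1 * B3 \<ge> 0"
    "(e3 * (r3 t)\<^sup>2) * B3 + B1 * B2 \<ge> 0"
    unfolding gB using g r by simp_all
  have A0: "e1 * (r1 t)\<^sup>2 \<ge> 0" "e2 * (r2 t)\<^sup>2 \<ge> 0" "e3 * (r3 t)\<^sup>2 \<ge> 0" using e by auto
  have Qpos: "Q > 0" if w: "\<not> (w1 = 0 \<and> w2 = 0 \<and> w3 = 0)"
    unfolding Q_def b1_def b2_def b3_def d1_def d2_def d3_def
    unfolding hyp_bracket_identity[OF q]
    unfolding cB
  proof (rule hyp_form_pos)
    show "a1 > 0" "a2 > 0" "a3 > 0" using s by (simp_all add: a1_def a2_def a3_def)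
    show "0 \<le> a1\<^sup>2 - 1" "0 \<le> a2\<^sup>2 - 1" "0 \<le> a3\<^sup>2 - 1" using A0 unfolding A by auto
    show "0 < B1 \<or> B1\<^sup>2 < (a2\<^sup>2 - 1) * (a3\<^sup>2 - 1)" "0 < B2 \<or> B2\<^sup>2 < (a1\<^sup>2 - 1) * (a3\<^sup>2 - 1)"
      "0 < B3 \<or> B3\<^sup>2 < (a1\<^sup>2 - 1) * (a2\<^sup>2 - 1)"
      unfolding A[symmetric] B1_def B2_def B3_def using Bpos e h r by simp_all
    show "0 \<le> (a1\<^sup>2 - 1) * B1 + B2 * B3" "0 \<le> (a2\<^sup>2 - 1) * B2 + B1 * B3" "0 \<le> (a3\<^sup>2 - 1) * B3 + B1 * B2"
      using gB0 unfolding A .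
    show "1 < a2 * a3 + B1" "1 < a1 * a3 + B2" "1 < a1 * a2 + B3" using c unfolding cB .
    show "0 < 1 + 2 * (a2 * a3 + B1) * (a1 * a3 + B2) * (a1 * a2 + B3) - (a2 * a3 + B1)\<^sup>2 -
        (a1 * a3 + B2)\<^sup>2 - (a1 * a2 + B3)\<^sup>2" using DD unfolding DD_def cB .
    show "0 < ((a1\<^sup>2 - 1) * a2 + B3 * a1) * ((a2\<^sup>2 - 1) * a3 + B1 * a2) * ((a3\<^sup>2 - 1) * a1 + B2 * a3) +
        ((a1\<^sup>2 - 1) * a3 + B2 * a1) * ((a3\<^sup>2 - 1) * a2 + B1 * a3) * ((a2\<^sup>2 - 1) * a1 + B3 * a2)"
      unfolding A[symmetric] unfolding B1_def B2_def B3_def a1_def a2_def a3_def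
      by (rule menelaus_pos[OF e r s h g])
  qed (use w in auto)
  have "d \<le> 0 \<and> (\<not> (w1 = 0 \<and> w2 = 0 \<and> w3 = 0) \<longrightarrow> d < 0)" if "d = - Q / sqrt DD" for d
  proof (cases "w1 = 0 \<and> w2 = 0 \<and> w3 = 0")
    case True
    then show ?thesis by (simp add: that Q_def)
  next
    case False
    then show ?thesis using Qpos DD that by simp
  qed
  then show ?thesis using der by blast
qed

text \<open>Strictness fails precisely for three equal weights \<open>w\<close>: that direction
  rescales the triangle and keeps its angles.\<close>

lemma eucl_triangle_DERIV:
  fixes r1 r2 r3 :: "real \<Rightarrow> real" and e1 e2 e3 h1 h2 h3 w1 w2 w3 t :: real
  defines "L1 \<equiv> \<lambda>t. e2 * (r2 t)\<^sup>2 + e3 * (r3 t)\<^sup>2 + 2 * (h1 * r2 t * r3 t)"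
    and "L2 \<equiv> \<lambda>t. e1 * (r1 t)\<^sup>2 + e3 * (r3 t)\<^sup>2 + 2 * (h2 * r1 t * r3 t)"
    and "L3 \<equiv> \<lambda>t. e1 * (r1 t)\<^sup>2 + e2 * (r2 t)\<^sup>2 + 2 * (h3 * r1 t * r2 t)"
  assumes e: "e1 \<in> {0,1}" "e2 \<in> {0,1}" "e3 \<in> {0,1}"
    and h: "e2*e3 + h1 > 0" "e1*e3 + h2 > 0" "e1*e2 + h3 > 0"
    and g: "e1*h1 + h2*h3 \<ge> 0" "e2*h2 + h1*h3 \<ge> 0" "e3*h3 + h1*h2 \<ge> 0"
    and r: "r1 t > 0" "r2 t > 0" "r3 t > 0"
    and dr: "(r1 has_real_derivative r1 t * w1) (at t)" "(r2 has_real_derivative r2 t * w2) (at t)"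
      "(r3 has_real_derivative r3 t * w3) (at t)"
    and D: "4 * L2 t * L3 t - (L2 t + L3 t - L1 t)\<^sup>2 > 0"
  shows "\<exists>d. ((\<lambda>t. w1 * cos_angle ((L2 t + L3 t - L1 t) / 2) (L2 t) (L3 t)
           + w2 * cos_angle ((L1 t + L3 t - L2 t) / 2) (L1 t) (L3 t)
           + w3 * cos_angle ((L1 t + L2 t - L3 t) / 2) (L1 t) (L2 t)) has_real_derivative d) (at t)
       \<and> d \<le> 0 \<and> (\<not> (w1 = w2 \<and> w2 = w3) \<longrightarrow> d < 0)"
proof -
  define A1 A2 A3 where "A1 = e1 * (r1 t)\<^sup>2" and "A2 = e2 * (r2 t)\<^sup>2" and "A3 = e3 * (r3 t)\<^sup>2"
  define B1 B2 B3 where "B1 = h1 * r2 t * r3 t" and "B2 = h2 * r1 t * r3 t" and "B3 = h3 * r1 t * r2 t"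
  define l1 l2 l3 where "l1 = L1 t" and "l2 = L2 t" and "l3 = L3 t"
  have lB: "l1 = A2 + A3 + 2*B1" "l2 = A1 + A3 + 2*B2" "l3 = A1 + A2 + 2*B3"
    by (auto simp: l1_def l2_def l3_def L1_def L2_def L3_def A1_def A2_def A3_def B1_def B2_def B3_def)
  have l: "l1 > 0" "l2 > 0" "l3 > 0"
    using eucl_len_pos[OF e(2,3) r(2,3) h(1)] eucl_len_pos[OF e(1,3) r(1,3) h(2)] eucl_len_pos[OF e(1,2) r(1,2) h(3)]
    unfolding lB A1_def A2_def A3_def B1_def B2_def B3_def by auto
  define d1 d2 d3 where "d1 = w2 * (A2 + B1) + w3 * (A3 + B1)" and "d2 = w1 * (A1 + B2) + w3 * (A3 + B2)"
    and "d3 = w1 * (A1 + B3) + w2 * (A2 + B3)"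
  have dL: "(L1 has_real_derivative 2*d1) (at t)" "(L2 has_real_derivative 2*d2) (at t)"
    "(L3 has_real_derivative 2*d3) (at t)"
    unfolding L1_def L2_def L3_def
    by (rule derivative_eq_intros dr refl | simp add: d1_def d2_def d3_def A1_def A2_def A3_def B1_def B2_def B3_def
         algebra_simps power2_eq_square)+
  have dn: "((\<lambda>t. (L2 t + L3 t - L1 t) / 2) has_real_derivative (2*d2 + 2*d3 - 2*d1)/2) (at t)"
      "((\<lambda>t. (L1 t + L3 t - L2 t) / 2) has_real_derivative (2*d1 + 2*d3 - 2*d2)/2) (at t)"
      "((\<lambda>t. (L1 t + L2 t - L3 t) / 2) has_real_derivative (2*d1 + 2*d2 - 2*d3)/2) (at t)"
    by (rule derivative_eq_intros dL refl | simp)+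
  define DD where "DD = l2 * l3 - ((l2 + l3 - l1)/2)\<^sup>2"
  have "4 * DD = 4 * l2 * l3 - (l2 + l3 - l1)\<^sup>2" unfolding DD_def by (simp add: power_divide)
  then have DD: "DD > 0" and DD4: "4 * l2 * l3 - (l2 + l3 - l1)\<^sup>2 > 0"
    using D by (simp_all add: l1_def l2_def l3_def)
  have De: "l2 * l3 - ((l2 + l3 - l1)/2)\<^sup>2 = DD" "l1 * l3 - ((l1 + l3 - l2)/2)\<^sup>2 = DD"
    "l1 * l2 - ((l1 + l2 - l3)/2)\<^sup>2 = DD"
    unfolding DD_def by (simp_all add: power2_eq_square field_simps)
  note fold_l = l1_def[symmetric] l2_def[symmetric] l3_def[symmetric]
  have t1: "((\<lambda>t. cos_angle ((L2 t + L3 t - L1 t) / 2) (L2 t) (L3 t)) has_real_derivative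
     - ((2*d2 + 2*d3 - 2*d1)/2 - (l2+l3-l1)/2 * ((2*d2)/(2*l2) + (2*d3)/(2*l3))) / sqrt DD) (at t)"
    using DERIV_cos_angle[OF dn(1) dL(2) dL(3)] l De DD by (simp only: fold_l)
  have t2: "((\<lambda>t. cos_angle ((L1 t + L3 t - L2 t) / 2) (L1 t) (L3 t)) has_real_derivative
     - ((2*d1 + 2*d3 - 2*d2)/2 - (l1+l3-l2)/2 * ((2*d1)/(2*l1) + (2*d3)/(2*l3))) / sqrt DD) (at t)"
    using DERIV_cos_angle[OF dn(2) dL(1) dL(3)] l De DD by (simp only: fold_l)
  have t3: "((\<lambda>t. cos_angle ((L1 t + L2 t - L3 t) / 2) (L1 t) (L2 t)) has_real_derivative
     - ((2*d1 + 2*d2 - 2*d3)/2 - (l1+l2-l3)/2 * ((2*d1)/(2*l1) + (2*d2)/(2*l2))) / sqrt DD) (at t)"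
    using DERIV_cos_angle[OF dn(3) dL(1) dL(2)] l De DD by (simp only: fold_l)
  define b1 b2 b3 where "b1 = (2*d2 + 2*d3 - 2*d1)/2 - (l2+l3-l1)/2 * ((2*d2)/(2*l2) + (2*d3)/(2*l3))"
    and "b2 = (2*d1 + 2*d3 - 2*d2)/2 - (l1+l3-l2)/2 * ((2*d1)/(2*l1) + (2*d3)/(2*l3))"
    and "b3 = (2*d1 + 2*d2 - 2*d3)/2 - (l1+l2-l3)/2 * ((2*d1)/(2*l1) + (2*d2)/(2*l2))"
  define Q where "Q = w1 * b1 + w2 * b2 + w3 * b3"
  have der: "((\<lambda>t. w1 * cos_angle ((L2 t + L3 t - L1 t) / 2) (L2 t) (L3 t)
           + w2 * cos_angle ((L1 t + L3 t - L2 t) / 2) (L1 t) (L3 t)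
           + w3 * cos_angle ((L1 t + L2 t - L3 t) / 2) (L1 t) (L2 t)) has_real_derivative
        - Q / sqrt DD) (at t)"
  proof -
    have "- Q / sqrt DD = w1 * (- b1 / sqrt DD) + w2 * (- b2 / sqrt DD) + w3 * (- b3 / sqrt DD)"
      by (simp add: Q_def add_divide_distrib diff_divide_distrib)
    then show ?thesis
      using DERIV_add[OF DERIV_add[OF DERIV_cmult[OF t1, of w1] DERIV_cmult[OF t2, of w2]] DERIV_cmult[OF t3, of w3]]
      unfolding b1_def b2_def b3_def by simp
  qed
  have P: "(A1 + B3) * (A2 + B1) * (A3 + B2) + (A1 + B2) * (A3 + B1) * (A2 + B3) > 0"
    using menelaus_pos[OF e r _ _ _ h g, of 1 1 1]
    unfolding A1_def A2_def A3_def B1_def B2_def B3_def by simp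
  have Q: "Q = (A2*A3 - B1\<^sup>2 + (A2*B2 + B1*B3) + (A3*B3 + B1*B2))/(A2 + A3 + 2*B1) * (w2-w3)\<^sup>2
     + (A1*A3 - B2\<^sup>2 + (A1*B1 + B2*B3) + (A3*B3 + B1*B2))/(A1 + A3 + 2*B2) * (w1-w3)\<^sup>2
     + (A1*A2 - B3\<^sup>2 + (A1*B1 + B2*B3) + (A2*B2 + B1*B3))/(A1 + A2 + 2*B3) * (w1-w2)\<^sup>2"
    unfolding Q_def b1_def b2_def b3_def d1_def d2_def d3_def lB
    by (rule eucl_bracket_identity[OF l[unfolded lB]])
  have "d \<le> 0 \<and> (\<not> (w1 = w2 \<and> w2 = w3) \<longrightarrow> d < 0)" if "d = - Q / sqrt DD" for d
    using eucl_form_pos[OF l[unfolded lB] DD4[unfolded lB] P, where ?w1.0=w1 and ?w2.0=w2 and ?w3.0=w3] DD that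
    unfolding Q[symmetric] by (auto simp: divide_nonneg_pos)
  then show ?thesis using der by blast
qed

section \<open>Angle defect in conformal coordinates\<close>

text \<open>The quotient of the law of cosines leaves the interval from -1 to 1 on the side that
  belongs to the constant prescribed there, so clamping reproduces the extension by
  constants.\<close>

lemma eucl_cos_cases:
  fixes a b c :: real
  assumes "a > 0" "b > 0" "c > 0"
  shows "a \<ge> b + c \<Longrightarrow> (b\<^sup>2 + c\<^sup>2 - a\<^sup>2) / (2*b*c) \<le> -1"
    and "b \<ge> a + c \<Longrightarrow> (b\<^sup>2 + c\<^sup>2 - a\<^sup>2) / (2*b*c) \<ge> 1"
    and "c \<ge> a + b \<Longrightarrow> (b\<^sup>2 + c\<^sup>2 - a\<^sup>2) / (2*b*c) \<ge> 1"
    and "a < b + c \<Longrightarrow> b < a + c \<Longrightarrow> c < a + b \<Longrightarrow> \<bar>(b\<^sup>2 + c\<^sup>2 - a\<^sup>2) / (2*b*c)\<bar> < 1"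
proof -
  have sq: "x\<^sup>2 \<le> y\<^sup>2" if "0 \<le> x" "x \<le> y" for x y :: real using that by (simp add: power_mono)
  have sq': "x\<^sup>2 < y\<^sup>2" if "\<bar>x\<bar> < \<bar>y\<bar>" for x y :: real using that by (metis abs_le_square_iff not_le)
  show "(b\<^sup>2 + c\<^sup>2 - a\<^sup>2) / (2*b*c) \<le> -1" if "a \<ge> b + c"
    using sq[of "b+c" a] that assms by (simp add: field_simps power2_sum)
  show "(b\<^sup>2 + c\<^sup>2 - a\<^sup>2) / (2*b*c) \<ge> 1" if "b \<ge> a + c"
    using sq[of a "b-c"] that assms by (simp add: field_simps power2_diff)
  show "(b\<^sup>2 + c\<^sup>2 - a\<^sup>2) / (2*b*c) \<ge> 1" if "c \<ge> a + b"
    using sq[of a "c-b"] that assms by (simp add: field_simps power2_diff)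
  show "\<bar>(b\<^sup>2 + c\<^sup>2 - a\<^sup>2) / (2*b*c)\<bar> < 1" if "a < b + c" "b < a + c" "c < a + b"
    using sq'[of a "b+c"] sq'[of "b-c" a] that assms
    by (simp add: abs_less_iff field_simps power2_diff power2_sum)
qed

text \<open>The quotient equals -1 and 1 when \<open>cosh a\<close> is \<open>cosh (b + c)\<close>
  and \<open>cosh (b - c)\<close>; the rest is monotonicity of cosh.\<close>

lemma hyp_cos_cases:
  fixes a b c :: real
  assumes "a > 0" "b > 0" "c > 0"
  shows "a \<ge> b + c \<Longrightarrow> (cosh b * cosh c - cosh a) / (sinh b * sinh c) \<le> -1"
    and "b \<ge> a + c \<Longrightarrow> (cosh b * cosh c - cosh a) / (sinh b * sinh c) \<ge> 1"
    and "c \<ge> a + b \<Longrightarrow> (cosh b * cosh c - cosh a) / (sinh b * sinh c) \<ge> 1"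
    and "a < b + c \<Longrightarrow> b < a + c \<Longrightarrow> c < a + b \<Longrightarrow> \<bar>(cosh b * cosh c - cosh a) / (sinh b * sinh c)\<bar> < 1"
proof -
  have S: "sinh b * sinh c > 0" using assms by simp
  have cm: "cosh x \<le> cosh y" if "0 \<le> x" "x \<le> y" for x y :: real
    using that by (simp add: cosh_real_nonneg_le_iff)
  have cm': "cosh x < cosh y" if "\<bar>x\<bar> < \<bar>y\<bar>" for x y :: real
    using that cosh_real_nonneg_less_iff[of "\<bar>x\<bar>" "\<bar>y\<bar>"] by simp
  show "(cosh b * cosh c - cosh a) / (sinh b * sinh c) \<le> -1" if "a \<ge> b + c"
    using cm[of "b+c" a] that assms S by (simp add: divide_le_eq cosh_add)
  show "(cosh b * cosh c - cosh a) / (sinh b * sinh c) \<ge> 1" if "b \<ge> a + c"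
    using cm[of a "b-c"] that assms S by (simp add: le_divide_eq cosh_diff)
  show "(cosh b * cosh c - cosh a) / (sinh b * sinh c) \<ge> 1" if "c \<ge> a + b"
    using cm[of a "c-b"] that assms S by (simp add: le_divide_eq cosh_diff mult.commute)
  show "\<bar>(cosh b * cosh c - cosh a) / (sinh b * sinh c)\<bar> < 1" if "a < b + c" "b < a + c" "c < a + b"
    using cm'[of a "b+c"] cm'[of "b-c" a] that assms S
    by (simp add: abs_less_iff minus_divide_left del: minus_divide_left[symmetric])
       (simp add: divide_less_eq cosh_diff cosh_add)
qed

lemma clamped_arccos_pi: "x \<le> -1 \<Longrightarrow> clamped_arccos x = pi"
  and clamped_arccos_0: "x \<ge> 1 \<Longrightarrow> clamped_arccos x = 0"
  by (simp_all add: clamped_arccos_def max_absorb1)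

lemma ext_tri_angle_eucl:
  assumes "a > 0" "b > 0" "c > 0"
  shows "ext_tri_angle Euclidean a b c = cos_angle ((b\<^sup>2 + c\<^sup>2 - a\<^sup>2) / 2) (b\<^sup>2) (c\<^sup>2)"
proof -
  define x where "x = (b\<^sup>2 + c\<^sup>2 - a\<^sup>2) / (2*b*c)"
  have "(b\<^sup>2 + c\<^sup>2 - a\<^sup>2) / 2 / sqrt (b\<^sup>2 * c\<^sup>2) = x"
    using assms by (simp add: real_sqrt_mult x_def)
  moreover have "tri_angle Euclidean a b c = arccos x" by (simp add: x_def)
  ultimately show ?thesis
    using eucl_cos_cases[OF assms, folded x_def] unfolding cos_angle_def ext_tri_angle_def
    by (auto simp: clamped_arccos_pi clamped_arccos_0 clamped_arccos_eq simp del: tri_angle.simps)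
qed

lemma sqrt_cosh: "x > 0 \<Longrightarrow> sqrt ((cosh x)\<^sup>2 - 1) = sinh (x::real)"
  by (simp add: cosh_square_eq)

lemma ext_tri_angle_hyp:
  assumes "a > 0" "b > 0" "c > 0"
  shows "ext_tri_angle Hyperbolic a b c
    = cos_angle (cosh b * cosh c - cosh a) ((cosh b)\<^sup>2 - 1) ((cosh c)\<^sup>2 - 1)"
proof -
  define x where "x = (cosh b * cosh c - cosh a) / (sinh b * sinh c)"
  have "(cosh b * cosh c - cosh a) / sqrt (((cosh b)\<^sup>2 - 1) * ((cosh c)\<^sup>2 - 1)) = x"
    using assms by (simp add: real_sqrt_mult sqrt_cosh x_def)
  moreover have "tri_angle Hyperbolic a b c = arccos x" by (simp add: x_def)
  ultimately show ?thesis
    using hyp_cos_cases[OF assms, folded x_def] unfolding cos_angle_def ext_tri_angle_def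
    by (auto simp: clamped_arccos_pi clamped_arccos_0 clamped_arccos_eq simp del: tri_angle.simps)
qed

section \<open>Conformal coordinates, radii and extended angles on a weighted surface\<close>

locale weighted_surface =
  fixes F :: "'v::finite set set" and eps :: "'v \<Rightarrow> real" and eta :: "'v set \<Rightarrow> real"
  assumes surface: "connected_closed_surface F"
    and weights: "admissible_weights F eps eta"
begin

lemma eps_01: "eps i \<in> {0,1}"
  using weights by (auto simp: admissible_weights_def)

lemma face_distinct:
  assumes "{i,j,k} \<in> F" shows "i \<noteq> j" "i \<noteq> k" "j \<noteq> k"
proof -
  have "card {i,j,k} = 3" using surface assms by (auto simp: connected_closed_surface_def)
  then show "i \<noteq> j" "i \<noteq> k" "j \<noteq> k" by (auto simp: card_insert_if split: if_splits)
qed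

lemma face_edges:
  assumes "{i,j,k} \<in> F" shows "{i,j} \<in> edges F" "{i,k} \<in> edges F" "{j,k} \<in> edges F"
proof -
  have "card {i,j} = 2" "card {i,k} = 2" "card {j,k} = 2" using face_distinct[OF assms] by simp_all
  moreover have "{i,j} \<subseteq> {i,j,k}" "{i,k} \<subseteq> {i,j,k}" "{j,k} \<subseteq> {i,j,k}" by simp_all
  ultimately show "{i,j} \<in> edges F" "{i,k} \<in> edges F" "{j,k} \<in> edges F"
    using assms unfolding edges_def by blast+
qed

lemma edge_weight: "{i,j} \<in> edges F \<Longrightarrow> eps i * eps j + eta {i,j} > 0"
  using weights by (auto simp: admissible_weights_def)

lemma face_weight: "{i,j,k} \<in> F \<Longrightarrow> eps i * eta {j,k} + eta {i,j} * eta {i,k} \<ge> 0"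
  using weights by (auto simp: admissible_weights_def)

lemma vertex_in_face: "\<exists>j k. {i,j,k} \<in> F"
proof -
  have U: "\<Union>F = UNIV" using surface unfolding connected_closed_surface_def by (elim conjE)
  have c: "\<forall>\<sigma>\<in>F. card \<sigma> = 3" using surface unfolding connected_closed_surface_def by (elim conjE)
  have "i \<in> \<Union>F" by (simp add: U)
  then obtain \<sigma> where s: "\<sigma> \<in> F" "i \<in> \<sigma>" by (rule UnionE)
  have "card \<sigma> = 3" using c s(1) by (rule bspec)
  then have "card (\<sigma> - {i}) = 2" using s by simp
  then obtain j k where "\<sigma> - {i} = {j,k}" by (meson card_2_iff)
  then have "\<sigma> = {i,j,k}" using s by (metis insert_Diff)
  then show ?thesis using s(1) by metis
qed

text \<open>The range of \<open>conf_coord g eps\<close>. It is open and convex, so two structures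
  can be joined by a segment in the coordinates \<open>u\<close>.\<close>

definition coord_dom :: "geometry \<Rightarrow> (real^'v) set" where
  "coord_dom g = {u. g = Hyperbolic \<longrightarrow> (\<forall>i. eps i \<noteq> 0 \<longrightarrow> u$i < 0)}"

text \<open>The radius \<open>exp (f i)\<close> as a function of \<open>u\<close>; for \<open>eps i = 1\<close> it is \<open>1 / sinh (- u i)\<close>.\<close>

definition radius :: "geometry \<Rightarrow> real^'v \<Rightarrow> 'v \<Rightarrow> real" where
  "radius g u i = (if g = Euclidean \<or> eps i = 0 then exp (u$i) else - 1 / sinh (u$i))"

text \<open>The inverse of \<open>conf_coord g eps\<close> on \<open>coord_dom g\<close>.\<close>

definition conf_point :: "geometry \<Rightarrow> real^'v \<Rightarrow> real^'v" where
  "conf_point g u = (\<chi> i. ln (radius g u i))"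

text \<open>The Euclidean value 1 makes the derivative of the radius along a line equal to
  \<open>radius * cosh_radius * w\<close> in both geometries.\<close>

definition cosh_radius :: "geometry \<Rightarrow> real^'v \<Rightarrow> 'v \<Rightarrow> real" where
  "cosh_radius g u i = (if g = Euclidean then 1 else sqrt (1 + eps i * (radius g u i)\<^sup>2))"

lemma coord_dom_Euclidean [simp]: "coord_dom Euclidean = UNIV"
  by (simp add: coord_dom_def)

lemma radius_pos: "u \<in> coord_dom g \<Longrightarrow> radius g u i > 0"
  by (cases g) (auto simp: radius_def coord_dom_def divide_neg_neg)

lemma exp_conf_point: "u \<in> coord_dom g \<Longrightarrow> exp (conf_point g u $ i) = radius g u i"
  by (simp add: conf_point_def radius_pos)

lemma cosh_radius_sq: "g = Hyperbolic \<Longrightarrow> (cosh_radius g u i)\<^sup>2 = 1 + eps i * (radius g u i)\<^sup>2"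
  and cosh_radius_ge_1: "cosh_radius g u i \<ge> 1"
  using eps_01[of i] by (auto simp: cosh_radius_def)

lemma open_coord_dom: "open (coord_dom g)"
proof -
  have "open {u::real^'v. u$i < 0}" for i by (intro open_Collect_less continuous_intros)
  then have "open {u::real^'v. eps i \<noteq> 0 \<longrightarrow> u$i < 0}" for i by (cases "eps i = 0") auto
  then have "open (\<Inter>i. {u::real^'v. eps i \<noteq> 0 \<longrightarrow> u$i < 0})" by (intro open_INT) auto
  moreover have "(\<Inter>i. {u::real^'v. eps i \<noteq> 0 \<longrightarrow> u$i < 0}) = {u. \<forall>i. eps i \<noteq> 0 \<longrightarrow> u$i < 0}" by auto
  ultimately have "open {u::real^'v. \<forall>i. eps i \<noteq> 0 \<longrightarrow> u$i < 0}" by simp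
  then show ?thesis by (cases g) (auto simp: coord_dom_def)
qed

lemma convex_coord_dom: "convex (coord_dom g)"
proof (rule convexI)
  fix u v :: "real^'v" and a b :: real
  assume uv: "u \<in> coord_dom g" "v \<in> coord_dom g" and ab: "0 \<le> a" "0 \<le> b" "a + b = 1"
  have "(a *\<^sub>R u + b *\<^sub>R v) $ i < 0" if "g = Hyperbolic" "eps i \<noteq> 0" for i
    using convex_bound_lt[of "u$i" 0 "v$i" a b] uv ab that by (simp add: coord_dom_def)
  then show "a *\<^sub>R u + b *\<^sub>R v \<in> coord_dom g" unfolding coord_dom_def by blast
qed

text \<open>The squared length of the edge, respectively its hyperbolic cosine.\<close>

definition edge_qty :: "geometry \<Rightarrow> real^'v \<Rightarrow> 'v \<Rightarrow> 'v \<Rightarrow> real" where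
  "edge_qty g u i j =
     (if g = Euclidean
      then eps i * (radius g u i)\<^sup>2 + eps j * (radius g u j)\<^sup>2 + 2 * (eta {i,j} * radius g u i * radius g u j)
      else cosh_radius g u i * cosh_radius g u j + eta {i,j} * radius g u i * radius g u j)"

lemma edge_qty_commute: "edge_qty g u i j = edge_qty g u j i"
  by (simp add: edge_qty_def insert_commute mult_ac add_ac)

lemma edge_qty_pos:
  assumes "u \<in> coord_dom g" "{i,j} \<in> edges F"
  shows "g = Euclidean \<Longrightarrow> edge_qty g u i j > 0" and "g = Hyperbolic \<Longrightarrow> edge_qty g u i j > 1"
proof -
  note r = radius_pos[OF assms(1)]
  have s: "cosh_radius g u i > 0" for i using cosh_radius_ge_1[of g u i] by linarith
  show "edge_qty g u i j > 0" if "g = Euclidean"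
    using eucl_len_pos[OF eps_01 eps_01 r r edge_weight[OF assms(2)]] that by (simp add: edge_qty_def)
  show "edge_qty g u i j > 1" if "g = Hyperbolic"
    using hyp_len_gt_1[OF eps_01 eps_01 r r s s cosh_radius_sq[OF that] cosh_radius_sq[OF that] edge_weight[OF assms(2)]] that
    by (simp add: edge_qty_def)
qed

lemma edge_len_eq:
  assumes "u \<in> coord_dom g"
  shows "g = Euclidean \<Longrightarrow> edge_len g eps eta (conf_point g u) i j = sqrt (edge_qty g u i j)"
    and "g = Hyperbolic \<Longrightarrow> edge_len g eps eta (conf_point g u) i j = arcosh (edge_qty g u i j)"
proof -
  have e: "exp (2 * conf_point g u $ i) = (radius g u i)\<^sup>2" for i
    using exp_conf_point[OF assms, of i] by (metis exp_double)
  show "edge_len g eps eta (conf_point g u) i j = sqrt (edge_qty g u i j)" if "g = Euclidean"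
    using that e exp_conf_point[OF assms] by (simp add: edge_qty_def exp_add)
  show "edge_len g eps eta (conf_point g u) i j = arcosh (edge_qty g u i j)" if "g = Hyperbolic"
    using that e exp_conf_point[OF assms]
    by (simp add: edge_qty_def exp_add cosh_radius_def real_sqrt_mult mult.assoc)
qed

lemma edge_len_pos:
  assumes "u \<in> coord_dom g" "{i,j} \<in> edges F"
  shows "edge_len g eps eta (conf_point g u) i j > 0"
  using edge_len_eq[OF assms(1)] edge_qty_pos[OF assms] by (cases g) auto

text \<open>With \<open>s = sqrt (1 + exp (2 * x))\<close> the coordinate satisfies
  \<open>exp (2 * y) = (s - 1) / (s + 1)\<close>, whence
  \<open>(sinh y)^2 = 1 / (s^2 - 1) = exp (- 2 * x)\<close>; the sign of \<open>y\<close> selects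
  the root.\<close>

lemma conf_point_conf_coord:
  "conf_coord g eps f \<in> coord_dom g" "conf_point g (conf_coord g eps f) = f"
proof -
  have "conf_coord g eps f \<in> coord_dom g \<and> conf_point g (conf_coord g eps f) = f"
  proof (cases g)
    case Euclidean
    then show ?thesis by (simp add: coord_dom_def conf_point_def radius_def vec_eq_iff)
  next
    case Hyperbolic
    have *: "1/2 * ln \<bar>(sqrt (1 + exp (2 * x)) - 1) / (sqrt (1 + exp (2 * x)) + 1)\<bar> < 0"
        "- 1 / sinh (1/2 * ln \<bar>(sqrt (1 + exp (2 * x)) - 1) / (sqrt (1 + exp (2 * x)) + 1)\<bar>) = exp x" for x :: real
    proof -
      define s where "s = sqrt (1 + exp (2 * x))"
      have s: "s > 1" "s\<^sup>2 = 1 + (exp x)\<^sup>2" by (auto simp: s_def add_nonneg_nonneg exp_double)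
      define y where "y = 1/2 * ln \<bar>(s - 1) / (s + 1)\<bar>"
      have q: "0 < (s - 1) / (s + 1)" "(s - 1) / (s + 1) < 1" using s by auto
      have "\<bar>(s - 1) / (s + 1)\<bar> = (s - 1) / (s + 1)" using q(1) by (rule abs_of_pos)
      then have "2 * y = ln ((s - 1) / (s + 1))" by (simp only: y_def)
      then have y2: "exp (2 * y) = (s - 1) / (s + 1)" using exp_ln[OF q(1)] by metis
      have "ln ((s - 1) / (s + 1)) < 0" using q by (rule ln_less_zero)
      then have y0: "y < 0" using \<open>2 * y = ln ((s - 1) / (s + 1))\<close> by linarith
      then show "1/2 * ln \<bar>(sqrt (1 + exp (2 * x)) - 1) / (sqrt (1 + exp (2 * x)) + 1)\<bar> < 0"
        unfolding y_def s_def .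
      have "(sinh y)\<^sup>2 = (exp y - exp (-y))\<^sup>2 / 4"
        by (simp add: sinh_def power_divide)
      also have "(exp y - exp (-y))\<^sup>2 = exp (2*y) + inverse (exp (2*y)) - 2"
        by (simp add: power2_diff exp_double exp_minus power_inverse)
      also have "\<dots> / 4 = 1 / (exp x)\<^sup>2"
      proof -
        have "(exp x)\<^sup>2 = (s-1)*(s+1)" using s(2) by (simp add: algebra_simps power2_eq_square)
        moreover have "(s - 1) / (s + 1) + inverse ((s - 1) / (s + 1)) - 2 = 4 / ((s-1)*(s+1))"
          using s(1) less_1_mult[OF s(1) s(1)] by (simp add: field_simps)
        ultimately show ?thesis unfolding y2 by simp
      qed
      finally have "(- sinh y)\<^sup>2 = (1 / exp x)\<^sup>2" by (simp add: power_divide)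
      then have "- sinh y = 1 / exp x" using y0 by (subst (asm) power2_eq_iff_nonneg) auto
      then have "sinh y = - 1 / exp x" by simp
      then have "- 1 / sinh y = exp x" by simp
      then show "- 1 / sinh (1/2 * ln \<bar>(sqrt (1 + exp (2 * x)) - 1) / (sqrt (1 + exp (2 * x)) + 1)\<bar>) = exp x"
        unfolding y_def s_def .
    qed
    show ?thesis using Hyperbolic * by (auto simp: coord_dom_def conf_point_def radius_def vec_eq_iff)
  qed
  then show "conf_coord g eps f \<in> coord_dom g" "conf_point g (conf_coord g eps f) = f" by auto
qed

text \<open>As \<open>conf_coord\<close> is already known to be a right inverse of
  \<open>conf_point\<close>, injectivity of \<open>conf_point\<close> on \<open>coord_dom\<close> is
  all that is missing.\<close>

lemma conf_coord_conf_point: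
  assumes "u \<in> coord_dom g" shows "conf_coord g eps (conf_point g u) = u"
proof -
  have inj: "conf_point g u = conf_point g v \<Longrightarrow> u = v" if "u \<in> coord_dom g" "v \<in> coord_dom g" for u v
  proof -
    assume "conf_point g u = conf_point g v"
    then have "radius g u i = radius g v i" for i
      using exp_conf_point[OF that(1), of i] exp_conf_point[OF that(2), of i] by simp
    note req = this
    have "u$i = v$i" for i
    proof (cases "g = Euclidean \<or> eps i = 0")
      case True
      then show ?thesis using req[of i] by (auto simp: radius_def)
    next
      case False
      then have "g = Hyperbolic" by (cases g) auto
      then have "u$i < 0" "v$i < 0" using that False by (auto simp: coord_dom_def)
      then have "sinh (u$i) \<noteq> 0" "sinh (v$i) \<noteq> 0" by auto
      then have "sinh (u$i) = sinh (v$i)" using req[of i] False by (simp add: radius_def field_simps)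
      then show ?thesis by (metis arsinh_sinh_real)
    qed
    then show "u = v" by (simp add: vec_eq_iff)
  qed
  show ?thesis using inj[OF conf_point_conf_coord(1) assms] conf_point_conf_coord(2) by simp
qed

text \<open>The extended angle at \<open>i\<close> as a function of \<open>u\<close>, fed with
  squared lengths or hyperbolic cosines instead of the lengths themselves.\<close>

definition theta :: "geometry \<Rightarrow> real^'v \<Rightarrow> 'v \<Rightarrow> 'v \<Rightarrow> 'v \<Rightarrow> real" where
  "theta g u i j k =
    (if g = Euclidean
     then cos_angle ((edge_qty g u i j + edge_qty g u i k - edge_qty g u j k) / 2) (edge_qty g u i j) (edge_qty g u i k)
     else cos_angle (edge_qty g u i j * edge_qty g u i k - edge_qty g u j k) ((edge_qty g u i j)\<^sup>2 - 1) ((edge_qty g u i k)\<^sup>2 - 1))"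

lemma theta_commute: "theta g u i j k = theta g u i k j"
  unfolding theta_def edge_qty_commute[of g u j k]
  by (subst (1 2) cos_angle_commute) (simp add: mult.commute add.commute)

lemma theta_bounds: "0 \<le> theta g u i j k" "theta g u i j k \<le> pi"
  by (simp_all add: theta_def cos_angle_bounds)

lemma theta_eq:
  assumes u: "u \<in> coord_dom g" and f: "{i,j,k} \<in> F"
  shows "ext_tri_angle g (edge_len g eps eta (conf_point g u) j k) (edge_len g eps eta (conf_point g u) i j)
     (edge_len g eps eta (conf_point g u) i k) = theta g u i j k"
proof (cases g)
  case Euclidean
  show ?thesis
    using edge_len_pos[OF u] face_edges[OF f] edge_len_eq(1)[OF u Euclidean] edge_qty_pos(1)[OF u _ Euclidean]
    unfolding Euclidean by (subst ext_tri_angle_eucl) (auto simp: theta_def less_imp_le)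
next
  case Hyperbolic
  show ?thesis
    using edge_len_pos[OF u] face_edges[OF f] edge_len_eq(2)[OF u Hyperbolic] edge_qty_pos(2)[OF u _ Hyperbolic]
    unfolding Hyperbolic by (subst ext_tri_angle_hyp) (auto simp: theta_def less_imp_le)
qed

definition ext_defect :: "geometry \<Rightarrow> real^'v \<Rightarrow> real^'v" where
  "ext_defect g u = (\<chi> i. 2 * pi - (\<Sum>(j,k)\<in>{(j,k). {i,j,k} \<in> F}. theta g u i j k) / 2)"

lemma ext_defect_eq:
  "angle_defect (ext_tri_angle g) g F eps eta f i = ext_defect g (conf_coord g eps f) $ i"
proof -
  have "ext_tri_angle g (edge_len g eps eta f j k) (edge_len g eps eta f i j) (edge_len g eps eta f i k)
      = theta g (conf_coord g eps f) i j k" if "{i,j,k} \<in> F" for j k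
    using theta_eq[OF conf_point_conf_coord(1) that] conf_point_conf_coord(2) by simp
  then show ?thesis unfolding angle_defect_def ext_defect_def by (auto intro!: sum.cong)
qed

end

section \<open>Monotonicity and coercivity of the angle defect\<close>

lemma differentiable_real_compose:
  fixes g :: "'a::real_normed_vector \<Rightarrow> real"
  assumes "(f has_real_derivative d) (at (g x))" "g differentiable (at x)"
  shows "(\<lambda>x. f (g x)) differentiable (at x)"
  using assms DERIV_compose_FDERIV unfolding differentiable_def by blast

lemma differentiable_cos_angle:
  fixes n p q :: "'a::real_normed_vector \<Rightarrow> real"
  assumes d: "n differentiable (at x)" "p differentiable (at x)" "q differentiable (at x)"
    and pos: "p x > 0" "q x > 0" "p x * q x - (n x)\<^sup>2 > 0"
  shows "(\<lambda>x. cos_angle (n x) (p x) (q x)) differentiable (at x)"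
proof -
  have "(\<lambda>x. sqrt (p x * q x)) differentiable (at x)"
    using pos d by (intro differentiable_real_compose[OF DERIV_real_sqrt, where g="\<lambda>x. p x * q x"]) auto
  then have "(\<lambda>x. n x / sqrt (p x * q x)) differentiable (at x)"
    using pos d(1) by (intro differentiable_divide) auto
  then show ?thesis unfolding cos_angle_def
    by (rule differentiable_real_compose[where g="\<lambda>x. n x / sqrt (p x * q x)",
          OF DERIV_clamped_arccos[OF cos_angle_lt_1[OF pos]]])
qed

text \<open>In a ball around \<open>p\<close> the linearization gives quadratic growth along
  \<open>S\<close>. Outside it, monotonicity on the remaining part of the segment from
  \<open>p\<close> to \<open>u\<close> preserves the growth already reached, which then is linear in
  the distance. Differentiability is used at \<open>p\<close> only. The subspace \<open>S\<close>
  serves the Euclidean case, where constants lie in the kernel of the derivative.\<close>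

lemma monotone_coercive:
  fixes k :: "'a::euclidean_space \<Rightarrow> 'a"
  assumes U: "convex U" "p \<in> U" and mono: "\<And>u v. u \<in> U \<Longrightarrow> v \<in> U \<Longrightarrow> (u - v) \<bullet> (k u - k v) \<ge> 0"
    and der: "(k has_derivative A) (at p)" and S: "subspace S"
    and pos: "\<And>w. w \<in> S \<Longrightarrow> w \<noteq> 0 \<Longrightarrow> w \<bullet> A w > 0"
  shows "\<exists>m>0. \<forall>u\<in>U. u - p \<in> S \<longrightarrow> (u - p) \<bullet> (k u - k p) \<ge> m * min (norm (u - p)) ((norm (u - p))\<^sup>2)"
proof -
  interpret A: bounded_linear A using der by (rule has_derivative_bounded_linear)
  have "\<exists>c>0. \<forall>w\<in>S. w \<bullet> A w \<ge> c * (norm w)\<^sup>2"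
  proof (cases "S \<inter> sphere 0 1 = {}")
    case True
    have "w = 0" if "w \<in> S" for w
    proof (rule ccontr)
      assume "w \<noteq> 0"
      then have "(1 / norm w) *\<^sub>R w \<in> S \<inter> sphere 0 1" using that S by (auto simp: subspace_mul)
      then show False using True by blast
    qed
    then have "1 * (norm w)\<^sup>2 \<le> w \<bullet> A w" if "w \<in> S" for w
    proof -
      have "w = 0" using that by fact
      then show ?thesis by simp
    qed
    then show ?thesis using zero_less_one by blast
  next
    case False
    have "compact (S \<inter> sphere 0 1)" using closed_subspace[OF S] by (metis closed_Int_compact compact_sphere)
    moreover have "continuous_on (S \<inter> sphere 0 1) (\<lambda>w. w \<bullet> A w)"
      by (intro continuous_intros A.continuous_on)
    ultimately obtain w0 where w0: "w0 \<in> S \<inter> sphere 0 1" "\<And>w. w \<in> S \<inter> sphere 0 1 \<Longrightarrow> w0 \<bullet> A w0 \<le> w \<bullet> A w"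
      using continuous_attains_inf[of "S \<inter> sphere 0 1" "\<lambda>w. w \<bullet> A w"] False by blast
    have "w0 \<bullet> A w0 * (norm w)\<^sup>2 \<le> w \<bullet> A w" if "w \<in> S" for w
    proof (cases "w = 0")
      case False
      have "(1 / norm w) *\<^sub>R w \<in> S \<inter> sphere 0 1" using that S False by (auto simp: subspace_mul)
      from w0(2)[OF this] have "w0 \<bullet> A w0 \<le> (w \<bullet> A w) / (norm w)\<^sup>2"
        by (simp add: A.scaleR power2_eq_square)
      then show ?thesis using False by (simp add: field_simps)
    qed (simp add: A.zero)
    moreover have "w0 \<bullet> A w0 > 0" using w0(1) by (intro pos) auto
    ultimately show ?thesis by blast
  qed
  then obtain c where c: "c > 0" "\<And>w. w \<in> S \<Longrightarrow> w \<bullet> A w \<ge> c * (norm w)\<^sup>2" by blast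
  obtain d where d: "d > 0" "\<And>y. norm (y - p) < d \<Longrightarrow> norm (k y - k p - A (y - p)) \<le> c/2 * norm (y - p)"
    using der[unfolded has_derivative_at_alt] c(1) half_gt_zero by metis
  have small: "w \<bullet> (k (p + w) - k p) \<ge> c/2 * (norm w)\<^sup>2" if "w \<in> S" "norm w < d" for w
  proof -
    have "\<bar>w \<bullet> (k (p + w) - k p - A w)\<bar> \<le> norm w * norm (k (p + w) - k p - A w)"
      by (rule Cauchy_Schwarz_ineq2)
    also have "\<dots> \<le> norm w * (c/2 * norm w)" using d(2)[of "p + w"] that by (intro mult_left_mono) auto
    finally have "\<bar>w \<bullet> (k (p + w) - k p - A w)\<bar> \<le> c/2 * (norm w)\<^sup>2" by (simp add: power2_eq_square mult_ac)
    moreover have "w \<bullet> (k (p + w) - k p) = w \<bullet> A w + w \<bullet> (k (p + w) - k p - A w)"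
      by (simp add: inner_diff_right)
    ultimately show ?thesis using c(2)[OF that(1)] by (simp add: field_simps abs_le_iff)
  qed
  \<comment> \<open>The first constant belongs to the ball of radius \<open>d\<close>, the second is
    the slope reached at distance \<open>d/2\<close> and carried outwards.\<close>
  define m where "m = min (c/2) (c * d / 4)"
  have m: "m > 0" using c d by (simp add: m_def)
  have "(u - p) \<bullet> (k u - k p) \<ge> m * min (norm (u - p)) ((norm (u - p))\<^sup>2)" if u: "u \<in> U" "u - p \<in> S" for u
  proof (cases "norm (u - p) < d")
    case True
    have "m * min (norm (u - p)) ((norm (u - p))\<^sup>2) \<le> c/2 * (norm (u - p))\<^sup>2"
      using c m by (intro mult_mono) (auto simp: m_def)
    then show ?thesis using small[OF u(2) True] by simp
  next
    case False
    define w where "w = u - p"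
    \<comment> \<open>Places \<open>p + s w\<close> at distance \<open>d/2\<close> from
      \<open>p\<close>, inside the ball where \<open>small\<close> applies.\<close>
    define s where "s = (d/2) / norm w"
    have nw: "norm w \<ge> d" using False by (simp add: w_def)
    have "norm w > 0" using nw d(1) by linarith
    then have s: "0 < s" "s < 1" using d(1) nw by (auto simp: s_def divide_less_eq)
    have v: "p + s *\<^sub>R w \<in> U"
    proof -
      have "(1 - s) *\<^sub>R p + s *\<^sub>R u \<in> U" using U u s by (intro convexD) auto
      then show ?thesis by (simp add: w_def algebra_simps)
    qed
    have "(1 - s) * (w \<bullet> (k u - k (p + s *\<^sub>R w))) = (u - (p + s *\<^sub>R w)) \<bullet> (k u - k (p + s *\<^sub>R w))"
      by (simp add: w_def inner_diff_left inner_add_left algebra_simps)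
    also have "\<dots> \<ge> 0" by (rule mono[OF u(1) v])
    finally have 1: "w \<bullet> (k u - k (p + s *\<^sub>R w)) \<ge> 0" using s by (simp add: zero_le_mult_iff)
    have ns: "norm (s *\<^sub>R w) = d/2" using \<open>norm w > 0\<close> d(1) s by (simp add: s_def)
    have "s *\<^sub>R w \<in> S" using u(2) S by (simp add: w_def subspace_mul)
    then have "(s *\<^sub>R w) \<bullet> (k (p + s *\<^sub>R w) - k p) \<ge> c/2 * (d/2)\<^sup>2"
      using small[of "s *\<^sub>R w"] ns d(1) unfolding ns by linarith
    then have "s * (w \<bullet> (k (p + s *\<^sub>R w) - k p)) \<ge> s * (c*d/4 * norm w)"
      using \<open>norm w > 0\<close> by (simp add: s_def power2_eq_square field_simps)
    then have "w \<bullet> (k (p + s *\<^sub>R w) - k p) \<ge> c*d/4 * norm w" using s by simp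
    then have "w \<bullet> (k u - k p) \<ge> c*d/4 * norm w" using 1 by (simp add: inner_diff_right)
    moreover have "m * min (norm w) ((norm w)\<^sup>2) \<le> c*d/4 * norm w"
      using c d m by (intro mult_mono) (auto simp: m_def)
    ultimately show ?thesis by (simp add: w_def)
  qed
  then show ?thesis using m by blast
qed

context weighted_surface
begin

lemma sinh_coord_ne_0: "u \<in> coord_dom g \<Longrightarrow> g \<noteq> Euclidean \<Longrightarrow> eps i \<noteq> 0 \<Longrightarrow> sinh (u$i) < 0"
  by (cases g) (auto simp: coord_dom_def)

lemma continuous_on_radius: "continuous_on (coord_dom g) (\<lambda>u. radius g u i)"
proof (cases "g = Euclidean \<or> eps i = 0")
  case True
  then show ?thesis unfolding radius_def by (auto intro!: continuous_intros)
next
  case False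
  then have "continuous_on (coord_dom g) (\<lambda>u. - 1 / sinh (u$i))"
    using sinh_coord_ne_0[of _ g i] by (intro continuous_intros) force
  then show ?thesis using False by (simp add: radius_def)
qed

lemma continuous_on_cosh_radius: "continuous_on (coord_dom g) (\<lambda>u. cosh_radius g u i)"
proof (cases "g = Euclidean")
  case True
  then show ?thesis by (simp add: cosh_radius_def)
next
  case False
  then show ?thesis unfolding cosh_radius_def if_not_P[OF False]
    by (intro continuous_intros continuous_on_radius)
qed

lemma continuous_on_edge_qty: "continuous_on (coord_dom g) (\<lambda>u. edge_qty g u i j)"
proof (cases "g = Euclidean")
  case True
  show ?thesis unfolding edge_qty_def if_P[OF True]
    by (intro continuous_intros continuous_on_radius)
next
  case False
  show ?thesis unfolding edge_qty_def if_not_P[OF False]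
    by (intro continuous_intros continuous_on_radius continuous_on_cosh_radius)
qed

lemma edge_qty_face:
  assumes "u \<in> coord_dom g" "{i,j,k} \<in> F"
  shows "g = Euclidean \<Longrightarrow> edge_qty g u i j > 0 \<and> edge_qty g u i k > 0 \<and> edge_qty g u j k > 0"
    and "g = Hyperbolic \<Longrightarrow> edge_qty g u i j > 1 \<and> edge_qty g u i k > 1 \<and> edge_qty g u j k > 1"
  using edge_qty_pos[OF assms(1)] face_edges[OF assms(2)] by blast+

lemma continuous_on_theta:
  assumes f: "{i,j,k} \<in> F" shows "continuous_on (coord_dom g) (\<lambda>u. theta g u i j k)"
proof (cases "g = Euclidean")
  case True
  show ?thesis unfolding theta_def if_P[OF True]
    by (intro continuous_intros continuous_on_edge_qty) (use edge_qty_face(1)[OF _ f True] in auto)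
next
  case False
  then have "g = Hyperbolic" by (cases g) auto
  from edge_qty_face(2)[OF _ f this] show ?thesis unfolding theta_def if_not_P[OF False]
    by (intro continuous_intros continuous_on_edge_qty) auto
qed

lemma continuous_on_ext_defect: "continuous_on (coord_dom g) (ext_defect g)"
  unfolding ext_defect_def
  by (intro continuous_on_vec_lambda continuous_intros)
     (auto intro!: continuous_intros continuous_on_theta simp: split_beta)

lemma ext_defect_bounded: "\<bar>ext_defect g u $ i\<bar> \<le> 2 * pi + real (card (UNIV :: ('v \<times> 'v) set)) * pi"
proof -
  let ?P = "{(j,k). {i,j,k} \<in> F}"
  let ?S = "(\<Sum>(j,k)\<in>?P. theta g u i j k)"
  have "?S \<ge> 0" by (rule sum_nonneg) (auto simp: theta_bounds)
  moreover have "?S \<le> (\<Sum>(j,k)\<in>?P. pi)" by (rule sum_mono) (auto simp: theta_bounds)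
  moreover have "(\<Sum>(j,k)\<in>?P. pi) = real (card ?P) * pi" by (simp add: split_beta)
  moreover have "real (card ?P) * pi \<le> real (card (UNIV :: ('v \<times> 'v) set)) * pi"
    by (intro mult_right_mono of_nat_mono card_mono) auto
  moreover have "pi > 0" by simp
  moreover have "ext_defect g u $ i = 2 * pi - ?S / 2" by (simp add: ext_defect_def)
  ultimately show ?thesis unfolding abs_le_iff by linarith
qed

definition ordered_faces :: "('v \<times> 'v \<times> 'v) set" where
  "ordered_faces = {(i,j,k). {i,j,k} \<in> F}"

lemma sum_ordered_faces_rotate:
  "(\<Sum>(i,j,k)\<in>ordered_faces. h j k i) = (\<Sum>(i,j,k)\<in>ordered_faces. h i j k)"
  by (rule sum.reindex_bij_witness[of _ "\<lambda>(i,j,k). (k,i,j)" "\<lambda>(i,j,k). (j,k,i)"])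
     (auto simp: ordered_faces_def insert_commute)

text \<open>The arguments of \<open>theta\<close> are ordered so that the edges appear as in the
  triangle lemmas, numbered by the opposite vertex.\<close>

definition tri_sum :: "geometry \<Rightarrow> real^'v \<Rightarrow> real^'v \<Rightarrow> 'v \<times> 'v \<times> 'v \<Rightarrow> real" where
  "tri_sum g w u = (\<lambda>(i,j,k). w$i * theta g u i k j + w$j * theta g u j k i + w$k * theta g u k j i)"

text \<open>The divisor 6 is the factor 1/2 of the defect times a factor 1/3: summed over all
  ordered faces, the three angles in \<open>tri_sum\<close> contribute equally by rotation.\<close>

lemma inner_ext_defect:
  "w \<bullet> ext_defect g u = 2 * pi * (\<Sum>i\<in>UNIV. w$i) - (\<Sum>x\<in>ordered_faces. tri_sum g w u x) / 6"
proof -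
  define h where "h = (\<lambda>i j k. w$i * theta g u i j k)"
  have "(\<Sum>x\<in>ordered_faces. tri_sum g w u x)
     = (\<Sum>(i,j,k)\<in>ordered_faces. h i j k + (h j k i + h k i j))"
    by (rule sum.cong) (auto simp: tri_sum_def h_def theta_commute[of g u _ _ _])
  also have "\<dots> = (\<Sum>(i,j,k)\<in>ordered_faces. h i j k) + ((\<Sum>(i,j,k)\<in>ordered_faces. h j k i) + (\<Sum>(i,j,k)\<in>ordered_faces. h k i j))"
    by (simp add: sum.distrib split_beta)
  also have "(\<Sum>(i,j,k)\<in>ordered_faces. h k i j) = (\<Sum>(i,j,k)\<in>ordered_faces. h j k i)"
    by (rule sum_ordered_faces_rotate[of "\<lambda>i j k. h j k i"])
  finally have 1: "(\<Sum>x\<in>ordered_faces. tri_sum g w u x) = 3 * (\<Sum>(i,j,k)\<in>ordered_faces. h i j k)"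
    by (simp add: sum_ordered_faces_rotate[of h])
  have T: "ordered_faces = Sigma UNIV (\<lambda>i. {(j,k). {i,j,k} \<in> F})" by (auto simp: ordered_faces_def)
  have "(\<Sum>(i,j,k)\<in>ordered_faces. h i j k) = (\<Sum>i\<in>UNIV. \<Sum>(j,k)\<in>{(j,k). {i,j,k} \<in> F}. h i j k)"
    unfolding T by (subst sum.Sigma[symmetric]) auto
  then have "(\<Sum>(i,j,k)\<in>ordered_faces. h i j k) = (\<Sum>i\<in>UNIV. w$i * (\<Sum>(j,k)\<in>{(j,k). {i,j,k} \<in> F}. theta g u i j k))"
    by (simp add: h_def sum_distrib_left split_beta)
  moreover have "w \<bullet> ext_defect g u = (\<Sum>i\<in>UNIV. w$i * (2*pi) - w$i * (\<Sum>(j,k)\<in>{(j,k). {i,j,k} \<in> F}. theta g u i j k) / 2)"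
    by (simp add: inner_vec_def ext_defect_def right_diff_distrib)
  ultimately have "w \<bullet> ext_defect g u = (\<Sum>i\<in>UNIV. w$i * (2*pi)) - (\<Sum>(i,j,k)\<in>ordered_faces. h i j k) / 2"
    by (simp add: sum_subtractf sum_divide_distrib)
  then show ?thesis using 1 by (simp add: sum_distrib_left mult_ac)
qed

text \<open>Sixteen times the squared area of the triangle, respectively the determinant of the
  symmetric matrix with unit diagonal and the hyperbolic cosines of the lengths off it. It is
  symmetric in the vertices, so its sign decides degeneracy at all three angles at once.\<close>

definition discr :: "geometry \<Rightarrow> real^'v \<Rightarrow> 'v \<Rightarrow> 'v \<Rightarrow> 'v \<Rightarrow> real" where
  "discr g u i j k =
    (if g = Euclidean
     then 4 * edge_qty g u i k * edge_qty g u i j - (edge_qty g u i k + edge_qty g u i j - edge_qty g u j k)\<^sup>2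
     else 1 + 2 * edge_qty g u j k * edge_qty g u i k * edge_qty g u i j
        - (edge_qty g u j k)\<^sup>2 - (edge_qty g u i k)\<^sup>2 - (edge_qty g u i j)\<^sup>2)"

lemma discr_commute: "discr g u i j k = discr g u j i k" "discr g u i j k = discr g u i k j"
  unfolding discr_def edge_qty_commute[of g u j i] edge_qty_commute[of g u k i] edge_qty_commute[of g u k j]
  by (auto simp: power2_eq_square algebra_simps)

lemma theta_discr:
  "g = Euclidean \<Longrightarrow> edge_qty g u i j * edge_qty g u i k - ((edge_qty g u i j + edge_qty g u i k - edge_qty g u j k) / 2)\<^sup>2
     = discr g u i j k / 4"
  "g = Hyperbolic \<Longrightarrow> ((edge_qty g u i j)\<^sup>2 - 1) * ((edge_qty g u i k)\<^sup>2 - 1)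
     - (edge_qty g u i j * edge_qty g u i k - edge_qty g u j k)\<^sup>2 = discr g u i j k"
  by (simp_all add: discr_def power2_eq_square field_simps)

lemma theta_degenerate:
  assumes u: "u \<in> coord_dom g" and f: "{i,j,k} \<in> F" and d: "discr g u i j k \<le> 0"
  shows "theta g u i j k \<in> {0, pi}"
proof (cases g)
  case Euclidean
  show ?thesis unfolding theta_def if_P[OF Euclidean]
    by (rule cos_angle_degenerate)
      (use edge_qty_face(1)[OF u f Euclidean] theta_discr(1)[OF Euclidean, of u i j k] d in linarith)+
next
  case Hyperbolic
  then have nE: "g \<noteq> Euclidean" by simp
  have "(edge_qty g u i j)\<^sup>2 - 1 > 0" "(edge_qty g u i k)\<^sup>2 - 1 > 0"
    using edge_qty_face(2)[OF u f Hyperbolic] by auto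
  then show ?thesis unfolding theta_def if_not_P[OF nE]
    by (rule cos_angle_degenerate)
      (use theta_discr(2)[OF Hyperbolic, of u i j k] d in linarith)
qed

lemma dcs_triangle:
  assumes d: "f \<in> dcs g F eps eta" and f: "{i,j,k} \<in> F"
  shows "edge_len g eps eta f j k < edge_len g eps eta f i j + edge_len g eps eta f i k"
    and "edge_len g eps eta f i j < edge_len g eps eta f j k + edge_len g eps eta f i k"
    and "edge_len g eps eta f i k < edge_len g eps eta f j k + edge_len g eps eta f i j"
proof -
  have sym: "edge_len g eps eta f x y = edge_len g eps eta f y x" for x y
    by (cases g) (simp_all add: insert_commute algebra_simps)
  have f': "{j,i,k} \<in> F" "{k,i,j} \<in> F" using f by (simp_all add: insert_commute)
  have D: "edge_len g eps eta f y z < edge_len g eps eta f x y + edge_len g eps eta f x z"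
    if "{x,y,z} \<in> F" for x y z
    using d that by (simp add: dcs_def)
  show "edge_len g eps eta f j k < edge_len g eps eta f i j + edge_len g eps eta f i k"
    "edge_len g eps eta f i j < edge_len g eps eta f j k + edge_len g eps eta f i k"
    "edge_len g eps eta f i k < edge_len g eps eta f j k + edge_len g eps eta f i j"
    using D[OF f] D[OF f'(1)] D[OF f'(2)] sym[of j i] sym[of k i] sym[of k j] by simp_all
qed

lemma discr_pos:
  assumes u: "u \<in> coord_dom g" and f: "{i,j,k} \<in> F" and d: "conf_point g u \<in> dcs g F eps eta"
  shows "discr g u i j k > 0"
proof -
  define a b c where "a = edge_len g eps eta (conf_point g u) j k"
    and "b = edge_len g eps eta (conf_point g u) i j" and "c = edge_len g eps eta (conf_point g u) i k"
  have pos: "a > 0" "b > 0" "c > 0" using edge_len_pos[OF u] face_edges[OF f] by (auto simp: a_def b_def c_def)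
  have sq: "x\<^sup>2 < y\<^sup>2" if "\<bar>x\<bar> < \<bar>y\<bar>" for x y :: real using that by (metis abs_le_square_iff not_le)
  have tri: "a < b + c" "b < a + c" "c < a + b"
    unfolding a_def b_def c_def by (rule dcs_triangle[OF d f])+
  show ?thesis
  proof (cases g)
    case Euclidean
    have "a\<^sup>2 = edge_qty g u j k" "b\<^sup>2 = edge_qty g u i j" "c\<^sup>2 = edge_qty g u i k"
      using edge_len_eq(1)[OF u Euclidean] edge_qty_face(1)[OF u f Euclidean]
      by (auto simp: a_def b_def c_def)
    moreover have "(b\<^sup>2 + c\<^sup>2 - a\<^sup>2)\<^sup>2 < (2*b*c)\<^sup>2"
      using eucl_cos_cases(4)[OF pos] tri pos by (intro sq) (simp add: abs_divide abs_mult)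
    ultimately show ?thesis using Euclidean by (simp add: discr_def power_mult_distrib algebra_simps)
  next
    case Hyperbolic
    have c: "cosh a = edge_qty g u j k" "cosh b = edge_qty g u i j" "cosh c = edge_qty g u i k"
      using edge_len_eq(2)[OF u Hyperbolic] edge_qty_face(2)[OF u f Hyperbolic]
      by (auto simp: a_def b_def c_def)
    have "(cosh b * cosh c - cosh a)\<^sup>2 < (sinh b * sinh c)\<^sup>2"
      using hyp_cos_cases(4)[OF pos] tri pos by (intro sq) (simp add: abs_divide abs_mult)
    then have "(cosh b * cosh c - cosh a)\<^sup>2 < ((cosh b)\<^sup>2 - 1) * ((cosh c)\<^sup>2 - 1)"
      by (simp add: power_mult_distrib sinh_square_eq)
    then show ?thesis using theta_discr(2)[OF Hyperbolic, of u i j k] unfolding c by simp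
  qed
qed

end

context weighted_surface
begin

text \<open>At a vertex of weight 1 the derivative of \<open>- 1 / sinh y\<close> is
  \<open>cosh y / (sinh y)^2\<close>, the product of the radius and of
  \<open>cosh y / (- sinh y) = sqrt (1 + radius^2)\<close>.\<close>

lemma DERIV_radius_line:
  assumes u: "u + t *\<^sub>R w \<in> coord_dom g"
  shows "((\<lambda>t. radius g (u + t *\<^sub>R w) i) has_real_derivative
     radius g (u + t *\<^sub>R w) i * cosh_radius g (u + t *\<^sub>R w) i * w$i) (at t)"
proof -
  define y where "y = u$i + t * w$i"
  have dy: "((\<lambda>t. u$i + t * w$i) has_real_derivative w$i) (at t)"
    by (auto intro!: derivative_eq_intros)
  show ?thesis
  proof (cases "g = Euclidean \<or> eps i = 0")
    case True
    have "((\<lambda>t. exp (u$i + t * w$i)) has_real_derivative exp (u$i + t * w$i) * w$i) (at t)"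
      by (rule DERIV_fun_exp[OF dy])
    moreover have "cosh_radius g v i = 1" "radius g v i = exp (v$i)" for v
      using True by (auto simp: cosh_radius_def radius_def)
    ultimately show ?thesis by simp
  next
    case False
    then have g: "g = Hyperbolic" by (cases g) auto
    have e: "eps i = 1" using False eps_01[of i] by auto
    have y: "y < 0" using u False g by (auto simp: coord_dom_def y_def)
    then have S: "sinh y < 0" by simp
    have d: "((\<lambda>t. - 1 / sinh (u$i + t * w$i)) has_real_derivative cosh y * w$i / (sinh y)\<^sup>2) (at t)"
      using S by (auto intro!: derivative_eq_intros simp: y_def power2_eq_square)
    have c: "sqrt (1 + (- 1 / sinh y)\<^sup>2) = cosh y / (- sinh y)"
    proof -
      have "1 + (- 1 / sinh y)\<^sup>2 = (cosh y / (- sinh y))\<^sup>2"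
        using S by (simp add: power_divide cosh_square_eq field_simps)
      then show ?thesis using S by (simp add: divide_le_0_iff)
    qed
    have "cosh y * w$i / (sinh y)\<^sup>2 = (- 1 / sinh y) * (cosh y / (- sinh y)) * w$i"
      using S by (simp add: power2_eq_square)
    then show ?thesis using d False g e unfolding c[symmetric]
      by (simp add: radius_def cosh_radius_def y_def)
  qed
qed

lemma DERIV_cosh_radius_line:
  assumes u: "u + t *\<^sub>R w \<in> coord_dom g" and g: "g = Hyperbolic"
  shows "((\<lambda>t. cosh_radius g (u + t *\<^sub>R w) i) has_real_derivative
     eps i * (radius g (u + t *\<^sub>R w) i)\<^sup>2 * w$i) (at t)"
proof -
  let ?r = "radius g (u + t *\<^sub>R w) i" and ?s = "cosh_radius g (u + t *\<^sub>R w) i"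
  have s: "?s > 0" using cosh_radius_ge_1[of g "u + t *\<^sub>R w" i] by linarith
  have p: "1 + eps i * ?r\<^sup>2 > 0" using eps_01[of i] by (auto intro: add_pos_nonneg)
  have 1: "((\<lambda>t. 1 + eps i * (radius g (u + t *\<^sub>R w) i)\<^sup>2) has_real_derivative eps i * (2 * ?r * (?r * ?s * w$i))) (at t)"
    by (auto intro!: derivative_eq_intros DERIV_radius_line[OF u])
  have 2: "((\<lambda>t. sqrt (1 + eps i * (radius g (u + t *\<^sub>R w) i)\<^sup>2)) has_real_derivative
     inverse (sqrt (1 + eps i * ?r\<^sup>2)) / 2 * (eps i * (2 * ?r * (?r * ?s * w$i)))) (at t)"
    by (rule DERIV_chain2[OF DERIV_real_sqrt[OF p] 1])
  have 3: "sqrt (1 + eps i * ?r\<^sup>2) = ?s" using g by (simp add: cosh_radius_def)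
  have 4: "inverse ?s / 2 * (eps i * (2 * ?r * (?r * ?s * w$i))) = eps i * ?r\<^sup>2 * w$i"
    using s by (simp add: field_simps power2_eq_square)
  have "(\<lambda>t. cosh_radius g (u + t *\<^sub>R w) i) = (\<lambda>t. sqrt (1 + eps i * (radius g (u + t *\<^sub>R w) i)\<^sup>2))"
    using g by (simp add: cosh_radius_def)
  then show ?thesis using 2[unfolded 3 4] by metis
qed

lemma tri_sum_DERIV:
  assumes u: "u + t *\<^sub>R w \<in> coord_dom g" and f: "{i,j,k} \<in> F" and d: "discr g (u + t *\<^sub>R w) i j k > 0"
  shows "\<exists>d. ((\<lambda>t. tri_sum g w (u + t *\<^sub>R w) (i,j,k)) has_real_derivative d) (at t) \<and> d \<le> 0
     \<and> ((if g = Euclidean then \<not> (w$i = w$j \<and> w$j = w$k) else \<not> (w$i = 0 \<and> w$j = 0 \<and> w$k = 0)) \<longrightarrow> d < 0)"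
proof -
  define x where "x = (\<lambda>t. u + t *\<^sub>R w)"
  have u': "x t \<in> coord_dom g" using u by (simp add: x_def)
  note e = eps_01[of i] eps_01[of j] eps_01[of k]
  note ed = face_edges[OF f]
  have h: "eps j * eps k + eta {j,k} > 0" "eps i * eps k + eta {i,k} > 0" "eps i * eps j + eta {i,j} > 0"
    using ed by (auto intro: edge_weight)
  have f': "{j,i,k} \<in> F" "{k,i,j} \<in> F" using f by (simp_all add: insert_commute)
  have g': "eps i * eta {j,k} + eta {i,k} * eta {i,j} \<ge> 0" "eps j * eta {i,k} + eta {j,k} * eta {i,j} \<ge> 0"
    "eps k * eta {i,j} + eta {j,k} * eta {i,k} \<ge> 0"
    using face_weight[OF f] face_weight[OF f'(1)] face_weight[OF f'(2)]
    by (simp_all add: insert_commute mult.commute)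
  note r = radius_pos[OF u', of i] radius_pos[OF u', of j] radius_pos[OF u', of k]
  have s: "cosh_radius g (x t) i' > 0" for i' using cosh_radius_ge_1[of g "x t" i'] by linarith
  have dr: "((\<lambda>t. radius g (x t) i') has_real_derivative radius g (x t) i' * cosh_radius g (x t) i' * w$i') (at t)" for i'
    using DERIV_radius_line[OF u] unfolding x_def .
  show ?thesis
  proof (cases "g = Euclidean")
    case True
    have q: "edge_qty g (x t) a b = eps a * (radius g (x t) a)\<^sup>2 + eps b * (radius g (x t) b)\<^sup>2 + 2 * (eta {a,b} * radius g (x t) a * radius g (x t) b)" for a b t
      using True by (simp add: edge_qty_def)
    have dr': "((\<lambda>t. radius g (x t) i') has_real_derivative radius g (x t) i' * w$i') (at t)" for i'
      using dr[of i'] True by (simp add: cosh_radius_def)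
    have eq: "tri_sum g w (x t) (i,j,k) =
        w$i * cos_angle ((edge_qty g (x t) i k + edge_qty g (x t) i j - edge_qty g (x t) j k) / 2) (edge_qty g (x t) i k) (edge_qty g (x t) i j)
      + w$j * cos_angle ((edge_qty g (x t) j k + edge_qty g (x t) i j - edge_qty g (x t) i k) / 2) (edge_qty g (x t) j k) (edge_qty g (x t) i j)
      + w$k * cos_angle ((edge_qty g (x t) j k + edge_qty g (x t) i k - edge_qty g (x t) i j) / 2) (edge_qty g (x t) j k) (edge_qty g (x t) i k)" for t
      unfolding tri_sum_def theta_def if_P[OF True]
      by (simp add: edge_qty_commute[of g "x t" k j] edge_qty_commute[of g "x t" j i] edge_qty_commute[of g "x t" k i])
    have D: "4 * edge_qty g (x t) i k * edge_qty g (x t) i j - (edge_qty g (x t) i k + edge_qty g (x t) i j - edge_qty g (x t) j k)\<^sup>2 > 0"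
      using d unfolding discr_def if_P[OF True] x_def .
    show ?thesis using eucl_triangle_DERIV[OF e h g' r dr' dr' dr' D[unfolded q]] True
      unfolding q[symmetric] eq[symmetric] unfolding x_def by simp
  next
    case False
    then have H: "g = Hyperbolic" by (cases g) auto
    have q: "edge_qty g (x t) a b = cosh_radius g (x t) a * cosh_radius g (x t) b + eta {a,b} * radius g (x t) a * radius g (x t) b" for a b t
      using False by (simp add: edge_qty_def)
    have ds: "((\<lambda>t. cosh_radius g (x t) i') has_real_derivative eps i' * (radius g (x t) i')\<^sup>2 * w$i') (at t)" for i'
      using DERIV_cosh_radius_line[OF u H] unfolding x_def .
    have eq: "tri_sum g w (x t) (i,j,k) =
        w$i * cos_angle (edge_qty g (x t) i k * edge_qty g (x t) i j - edge_qty g (x t) j k) ((edge_qty g (x t) i k)\<^sup>2 - 1) ((edge_qty g (x t) i j)\<^sup>2 - 1)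
      + w$j * cos_angle (edge_qty g (x t) j k * edge_qty g (x t) i j - edge_qty g (x t) i k) ((edge_qty g (x t) j k)\<^sup>2 - 1) ((edge_qty g (x t) i j)\<^sup>2 - 1)
      + w$k * cos_angle (edge_qty g (x t) j k * edge_qty g (x t) i k - edge_qty g (x t) i j) ((edge_qty g (x t) j k)\<^sup>2 - 1) ((edge_qty g (x t) i k)\<^sup>2 - 1)" for t
      unfolding tri_sum_def theta_def if_not_P[OF False]
      by (simp add: edge_qty_commute[of g "x t" k j] edge_qty_commute[of g "x t" j i] edge_qty_commute[of g "x t" k i])
    have D: "1 + 2 * edge_qty g (x t) j k * edge_qty g (x t) i k * edge_qty g (x t) i j - (edge_qty g (x t) j k)\<^sup>2
       - (edge_qty g (x t) i k)\<^sup>2 - (edge_qty g (x t) i j)\<^sup>2 > 0"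
      using d unfolding discr_def if_not_P[OF False] x_def .
    show ?thesis using hyp_triangle_DERIV[OF e h g' r s s s cosh_radius_sq[OF H] cosh_radius_sq[OF H] cosh_radius_sq[OF H]
        dr dr dr ds ds ds D[unfolded q]] False
      unfolding q[symmetric] eq[symmetric] unfolding x_def by simp
  qed
qed

text \<open>At a degenerate triangle each angle is 0 or \<pi>, so for fixed \<open>w\<close> at most
  eight values occur. They form the exceptional set in the comparison along a segment.\<close>

lemma tri_sum_degenerate:
  assumes u: "u \<in> coord_dom g" and f: "{i,j,k} \<in> F" and d: "discr g u i j k \<le> 0"
  shows "tri_sum g w u (i,j,k) \<in> (\<lambda>(a,b,c). w$i * a + w$j * b + w$k * c) ` ({0,pi} \<times> {0,pi} \<times> {0,pi})"
proof -
  have f': "{i,k,j} \<in> F" "{j,k,i} \<in> F" "{k,j,i} \<in> F" using f by (simp_all add: insert_commute)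
  have d': "discr g u i k j \<le> 0" "discr g u j k i \<le> 0" "discr g u k j i \<le> 0"
    using d discr_commute by metis+
  have "(theta g u i k j, theta g u j k i, theta g u k j i) \<in> {0,pi} \<times> {0,pi} \<times> {0,pi}"
    using theta_degenerate[OF u f'(1) d'(1)] theta_degenerate[OF u f'(2) d'(2)] theta_degenerate[OF u f'(3) d'(3)]
    by (intro SigmaI)
  then show ?thesis unfolding tri_sum_def by (rule rev_image_eqI) simp
qed

lemma continuous_on_tri_sum:
  assumes f: "{i,j,k} \<in> F" shows "continuous_on (coord_dom g) (\<lambda>u. tri_sum g w u (i,j,k))"
proof -
  have f': "{i,k,j} \<in> F" "{j,k,i} \<in> F" "{k,j,i} \<in> F" using f by (simp_all add: insert_commute)
  show ?thesis unfolding tri_sum_def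
    by (simp, intro continuous_intros continuous_on_theta f')
qed

text \<open>Only \<open>discr > 0\<close> yields a derivative along the segment; where it fails, the
  value of the sum belongs to the finite set \<open>V\<close>, and that is all
  \<open>nonincreasing_except_finite_values\<close> asks for.\<close>

lemma tri_sum_mono:
  assumes u: "u \<in> coord_dom g" "u + w \<in> coord_dom g" and f: "{i,j,k} \<in> F"
  shows "tri_sum g w (u + w) (i,j,k) \<le> tri_sum g w u (i,j,k)"
proof -
  define x where "x = (\<lambda>t. u + t *\<^sub>R w)"
  define V where "V = (\<lambda>(a,b,c). w$i * a + w$j * b + w$k * c) ` ({0,pi} \<times> {0,pi} \<times> {0,pi})"
  have x: "x t \<in> coord_dom g" if "0 \<le> t" "t \<le> 1" for t
  proof -
    have "(1 - t) *\<^sub>R u + t *\<^sub>R (u + w) \<in> coord_dom g"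
      using convex_coord_dom u that by (intro convexD) auto
    then show ?thesis by (simp add: x_def algebra_simps)
  qed
  have "tri_sum g w (x 1) (i,j,k) \<le> tri_sum g w (x 0) (i,j,k)"
  proof (rule nonincreasing_except_finite_values[where V=V and g="\<lambda>t. tri_sum g w (x t) (i,j,k)"])
    show "continuous_on {0..1} (\<lambda>t. tri_sum g w (x t) (i,j,k))"
      by (rule continuous_on_compose2[OF continuous_on_tri_sum[OF f, of g w]])
        (use x in \<open>auto simp: x_def intro!: continuous_intros\<close>)
    show "finite V" by (simp add: V_def)
    fix t :: real assume t: "0 < t" "t < 1" "tri_sum g w (x t) (i,j,k) \<notin> V"
    then have xt: "x t \<in> coord_dom g" using x by simp
    have "discr g (x t) i j k > 0"
      using tri_sum_degenerate[OF xt f, of w] t(3) unfolding V_def by linarith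
    then show "\<exists>d\<le>0. ((\<lambda>t. tri_sum g w (x t) (i,j,k)) has_real_derivative d) (at t)"
      using tri_sum_DERIV[of u t w g i j k] xt f unfolding x_def by blast
  qed simp
  then show ?thesis by (simp add: x_def)
qed

lemma ext_defect_mono:
  assumes u: "u \<in> coord_dom g" and v: "v \<in> coord_dom g"
  shows "(u - v) \<bullet> (ext_defect g u - ext_defect g v) \<ge> 0"
proof -
  have "(\<Sum>x\<in>ordered_faces. tri_sum g (u - v) u x) \<le> (\<Sum>x\<in>ordered_faces. tri_sum g (u - v) v x)"
  proof (rule sum_mono)
    fix x assume "x \<in> ordered_faces"
    then obtain i j k where "x = (i,j,k)" "{i,j,k} \<in> F" by (auto simp: ordered_faces_def)
    then show "tri_sum g (u - v) u x \<le> tri_sum g (u - v) v x"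
      using tri_sum_mono[OF v, of "u - v" i j k] u by simp
  qed
  then show ?thesis unfolding inner_diff_right inner_ext_defect by simp
qed

end

section \<open>Angle sum of extended Euclidean triangles\<close>

lemma cos_angle_scale: "a > 0 \<Longrightarrow> cos_angle (a * n) (a * p) (a * q) = cos_angle n p q"
proof -
  assume a: "a > 0"
  have "sqrt (a * p * (a * q)) = a * sqrt (p * q)"
    using a real_sqrt_mult[of "a * a" "p * q"] by (simp add: mult_ac)
  then show ?thesis using a by (simp add: cos_angle_def)
qed

lemma cos_angle_signs:
  assumes "p > 0" "q > 0" "p * q \<le> n\<^sup>2"
  shows "n > 0 \<Longrightarrow> cos_angle n p q = 0" and "n < 0 \<Longrightarrow> cos_angle n p q = pi"
proof -
  have s: "sqrt (p*q) \<le> \<bar>n\<bar>" "sqrt (p * q) > 0" using assms real_sqrt_le_mono[of "p*q" "n\<^sup>2"] by auto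
  show "cos_angle n p q = 0" if "n > 0"
    unfolding cos_angle_def using s that by (intro clamped_arccos_0) simp
  show "cos_angle n p q = pi" if "n < 0"
    unfolding cos_angle_def using s that by (intro clamped_arccos_pi) (simp add: divide_le_eq)
qed

text \<open>The sum stays \<pi> beyond the triangle inequalities: if \<open>D \<le> 0\<close>,
  exactly one of the numerators is negative, giving the angles \<pi>, 0, 0. Otherwise the addition
  theorem identifies the cosine of two of the angles together with minus the cosine of the
  third.\<close>

lemma eucl_angle_sum:
  assumes L: "L1 > 0" "L2 > 0" "L3 > 0"
  shows "cos_angle ((L2+L3-L1)/2) L2 L3 + cos_angle ((L1+L3-L2)/2) L1 L3 + cos_angle ((L1+L2-L3)/2) L1 L2 = pi"
proof -
  define n1 n2 n3 where "n1 = (L2+L3-L1)/2" and "n2 = (L1+L3-L2)/2" and "n3 = (L1+L2-L3)/2"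
  have Ln: "L1 = n2 + n3" "L2 = n1 + n3" "L3 = n1 + n2" unfolding n1_def n2_def n3_def by (simp_all add: field_simps)
  define D where "D = n1*n2 + n1*n3 + n2*n3"
  have D: "L2*L3 - n1\<^sup>2 = D" "L1*L3 - n2\<^sup>2 = D" "L1*L2 - n3\<^sup>2 = D"
    unfolding Ln D_def by algebra+
  have "cos_angle n1 L2 L3 + cos_angle n2 L1 L3 + cos_angle n3 L1 L2 = pi"
  proof (cases "D > 0")
    case False
    then have le: "L2*L3 \<le> n1\<^sup>2" "L1*L3 \<le> n2\<^sup>2" "L1*L2 \<le> n3\<^sup>2" using D by auto
    have nz: "n1 \<noteq> 0" "n2 \<noteq> 0" "n3 \<noteq> 0"
      using le mult_pos_pos[OF L(2,3)] mult_pos_pos[OF L(1,3)] mult_pos_pos[OF L(1,2)] by auto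
    have "\<not> (n1 > 0 \<and> n2 > 0 \<and> n3 > 0)"
    proof
      assume "n1 > 0 \<and> n2 > 0 \<and> n3 > 0"
      then have "D > 0" unfolding D_def by (simp add: add_pos_pos)
      then show False using False by simp
    qed
    \<comment> \<open>Any two of the \<open>n\<close> have a positive sum, so at most one of them is
      negative.\<close>
    then consider "n1 < 0" "n2 > 0" "n3 > 0" | "n1 > 0" "n2 < 0" "n3 > 0" | "n1 > 0" "n2 > 0" "n3 < 0"
      using nz L unfolding Ln by linarith
    then show ?thesis
      by cases (simp_all add: cos_angle_signs[OF L(2,3) le(1)] cos_angle_signs[OF L(1,3) le(2)] cos_angle_signs[OF L(1,2) le(3)])
  next
    case True
    define x1 x2 x3 where "x1 = n1 / sqrt (L2*L3)" and "x2 = n2 / sqrt (L1*L3)" and "x3 = n3 / sqrt (L1*L2)"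
    have x: "\<bar>x1\<bar> < 1" "\<bar>x2\<bar> < 1" "\<bar>x3\<bar> < 1"
      using cos_angle_lt_1[OF L(2,3), of n1] cos_angle_lt_1[OF L(1,3), of n2] cos_angle_lt_1[OF L(1,2), of n3] True D
      by (simp_all add: x1_def x2_def x3_def)
    have a: "cos_angle n1 L2 L3 = arccos x1" "cos_angle n2 L1 L3 = arccos x2" "cos_angle n3 L1 L2 = arccos x3"
      using x unfolding cos_angle_def x1_def x2_def x3_def by (auto intro!: clamped_arccos_eq)
    have sq: "sqrt (1 - x1\<^sup>2) = sqrt D / sqrt (L2*L3)" "sqrt (1 - x2\<^sup>2) = sqrt D / sqrt (L1*L3)"
    proof -
      have "1 - x1\<^sup>2 = (L2*L3 - n1\<^sup>2) / (L2*L3)" "1 - x2\<^sup>2 = (L1*L3 - n2\<^sup>2) / (L1*L3)"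
        using L by (simp_all add: x1_def x2_def power_divide diff_divide_distrib)
      then show "sqrt (1 - x1\<^sup>2) = sqrt D / sqrt (L2*L3)" "sqrt (1 - x2\<^sup>2) = sqrt D / sqrt (L1*L3)"
        unfolding D by (simp_all add: real_sqrt_divide)
    qed
    have den: "sqrt (L2*L3) * sqrt (L1*L3) = L3 * sqrt (L1*L2)"
      using L by (simp add: real_sqrt_mult)
    have cs: "cos (arccos x1) = x1" "cos (arccos x2) = x2" "sin (arccos x1) = sqrt (1 - x1\<^sup>2)" "sin (arccos x2) = sqrt (1 - x2\<^sup>2)"
      using x by (auto intro!: cos_arccos sin_arccos)
    have "cos (arccos x1 + arccos x2) = (n1*n2 - D) / (sqrt (L2*L3) * sqrt (L1*L3))"
      using True unfolding cos_add cs sq by (simp add: x1_def x2_def diff_divide_distrib)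
    also have "n1*n2 - D = - (L3 * n3)" unfolding D_def Ln by algebra
    also have "- (L3 * n3) / (sqrt (L2*L3) * sqrt (L1*L3)) = - x3"
      unfolding den using L by (simp add: x3_def)
    finally have c: "cos (arccos x1 + arccos x2) = - x3" .
    have "sin (arccos x1 + arccos x2) = sqrt D * (n1 + n2) / (sqrt (L2*L3) * sqrt (L1*L3))"
      unfolding sin_add cs sq by (simp add: x1_def x2_def add_divide_distrib algebra_simps)
    also have "\<dots> > 0" using True L by (simp add: Ln(3)[symmetric])
    finally have s: "sin (arccos x1 + arccos x2) > 0" .
    have b: "0 \<le> arccos x1" "arccos x1 < pi" "0 \<le> arccos x2" "arccos x2 < pi"
      using x arccos_lt_bounded[of x1] arccos_lt_bounded[of x2] by (auto simp: abs_less_iff less_imp_le)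
    \<comment> \<open>The positive sine confines the sum to the range on which the arc cosine
      inverts the cosine.\<close>
    have "arccos x1 + arccos x2 \<le> pi"
    proof (rule ccontr)
      assume "\<not> ?thesis"
      then have "sin (arccos x1 + arccos x2) \<le> 0" using b by (intro sin_le_zero) auto
      then show False using s by simp
    qed
    then have "arccos x1 + arccos x2 = arccos (- x3)"
      using arccos_cos[of "arccos x1 + arccos x2"] b c by simp
    also have "\<dots> = pi - arccos x3" using x by (intro arccos_minus) auto
    finally show ?thesis unfolding a by simp
  qed
  then show ?thesis unfolding n1_def n2_def n3_def .
qed

section \<open>Derivative of the defect at nondegenerate structures\<close>

context weighted_surface
begin

lemma differentiable_vec_nth: "(\<lambda>u::real^'v. u$i) differentiable (at u)"
  by (rule bounded_linear_imp_differentiable[OF bounded_linear_vec_nth])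

lemma differentiable_radius:
  assumes u: "u \<in> coord_dom g" shows "(\<lambda>u. radius g u i) differentiable (at u)"
proof (cases "g = Euclidean \<or> eps i = 0")
  case True
  have "(\<lambda>u::real^'v. exp (u$i)) differentiable (at u)"
    by (rule differentiable_real_compose[OF DERIV_exp differentiable_vec_nth])
  then show ?thesis using True by (simp add: radius_def)
next
  case False
  have S: "sinh (u$i) < 0" using sinh_coord_ne_0[OF u] False by auto
  have "((\<lambda>y. - 1 / sinh y) has_real_derivative cosh (u$i) / (sinh (u$i))\<^sup>2) (at (u$i))"
    using S by (auto intro!: derivative_eq_intros simp: power2_eq_square)
  then have "(\<lambda>u::real^'v. - 1 / sinh (u$i)) differentiable (at u)"
    by (rule differentiable_real_compose[OF _ differentiable_vec_nth])
  then show ?thesis using False by (simp add: radius_def)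
qed

lemma differentiable_cosh_radius:
  assumes u: "u \<in> coord_dom g" shows "(\<lambda>u. cosh_radius g u i) differentiable (at u)"
proof (cases "g = Euclidean")
  case True then show ?thesis by (simp add: cosh_radius_def)
next
  case False
  have p: "1 + eps i * (radius g u i)\<^sup>2 > 0" using eps_01[of i] by (auto intro: add_pos_nonneg)
  have "(\<lambda>u. 1 + eps i * (radius g u i)\<^sup>2) differentiable (at u)"
    using differentiable_radius[OF u] by (intro derivative_intros) auto
  then have "(\<lambda>u. sqrt (1 + eps i * (radius g u i)\<^sup>2)) differentiable (at u)"
    by (rule differentiable_real_compose[where g="\<lambda>u. 1 + eps i * (radius g u i)\<^sup>2", OF DERIV_real_sqrt[OF p]])
  then show ?thesis using False by (simp add: cosh_radius_def)
qed

lemma differentiable_edge_qty: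
  assumes u: "u \<in> coord_dom g" shows "(\<lambda>u. edge_qty g u i j) differentiable (at u)"
proof (cases "g = Euclidean")
  case True
  show ?thesis unfolding edge_qty_def if_P[OF True]
    using differentiable_radius[OF u] by (intro derivative_intros) auto
next
  case False
  show ?thesis unfolding edge_qty_def if_not_P[OF False]
    using differentiable_radius[OF u] differentiable_cosh_radius[OF u] by (intro derivative_intros) auto
qed

lemma differentiable_theta:
  assumes u: "u \<in> coord_dom g" and f: "{i,j,k} \<in> F" and d: "discr g u i j k > 0"
  shows "(\<lambda>u. theta g u i j k) differentiable (at u)"
proof (cases g)
  case Euclidean
  show ?thesis unfolding theta_def if_P[OF Euclidean]
    using edge_qty_face(1)[OF u f Euclidean] theta_discr(1)[OF Euclidean, of u i j k] d
    by (intro differentiable_cos_angle derivative_intros differentiable_edge_qty[OF u]) auto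
next
  case Hyperbolic
  then have nE: "g \<noteq> Euclidean" by simp
  show ?thesis unfolding theta_def if_not_P[OF nE]
    using edge_qty_face(2)[OF u f Hyperbolic] theta_discr(2)[OF Hyperbolic, of u i j k] d
    by (intro differentiable_cos_angle derivative_intros differentiable_edge_qty[OF u]) auto
qed

lemma differentiable_ext_defect:
  assumes u: "u \<in> coord_dom g" and d: "conf_point g u \<in> dcs g F eps eta"
  shows "ext_defect g differentiable (at u)"
proof -
  have "(\<lambda>u. 2 * pi - (\<Sum>(j,k)\<in>{(j,k). {i,j,k} \<in> F}. theta g u i j k) / 2) differentiable (at u)" for i
    using differentiable_theta[OF u _ discr_pos[OF u _ d]]
    by (intro derivative_intros) (auto simp: split_beta)
  then have "(\<lambda>u. ext_defect g u \<bullet> b) differentiable (at u)" if "b \<in> Basis" for b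
    using that by (auto simp: Basis_vec_def inner_axis ext_defect_def)
  then show ?thesis using differentiable_componentwise_within[of "ext_defect g" u UNIV] by blast
qed

text \<open>\<open>w \<bullet> A w\<close> is the derivative at 0 of
  \<open>w \<bullet> ext_defect g (u + t w)\<close>, hence minus one sixth of the sum of the
  derivatives \<open>D\<close> over all ordered faces. None of these is positive, and the face
  supplied by \<open>w\<close> has a negative one.\<close>

lemma ext_defect_derivative_pos:
  assumes u: "u \<in> coord_dom g" and d: "conf_point g u \<in> dcs g F eps eta"
    and A: "(ext_defect g has_derivative A) (at u)"
    and w: "\<exists>i j k. {i,j,k} \<in> F \<and>
      (if g = Euclidean then \<not> (w$i = w$j \<and> w$j = w$k) else \<not> (w$i = 0 \<and> w$j = 0 \<and> w$k = 0))"
  shows "w \<bullet> A w > 0"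
proof -
  define x where "x = (\<lambda>t::real. u + t *\<^sub>R w)"
  define P where "P = (\<lambda>(i,j,k) d. ((\<lambda>t. tri_sum g w (x t) (i,j,k)) has_real_derivative d) (at 0) \<and> d \<le> 0
     \<and> ((if g = Euclidean then \<not> (w$i = w$j \<and> w$j = w$k) else \<not> (w$i = 0 \<and> w$j = 0 \<and> w$k = 0)) \<longrightarrow> d < 0))"
  have "\<exists>d. P y d" if y0: "y \<in> ordered_faces" for y
  proof -
    obtain i j k where y: "y = (i,j,k)" "{i,j,k} \<in> F" using y0 by (auto simp: ordered_faces_def)
    show ?thesis using tri_sum_DERIV[of u 0 w g i j k] u y(2) discr_pos[OF u y(2) d] unfolding y(1) P_def x_def by simp
  qed
  then obtain D where D: "\<And>y. y \<in> ordered_faces \<Longrightarrow> P y (D y)" by metis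
  have D1: "((\<lambda>t. tri_sum g w (x t) y) has_real_derivative D y) (at 0)" "D y \<le> 0" if "y \<in> ordered_faces" for y
    using D[OF that] by (cases y; simp add: P_def)+
  have 1: "((\<lambda>t. w \<bullet> ext_defect g (x t)) has_real_derivative 0 - (\<Sum>y\<in>ordered_faces. D y) / 6) (at 0)"
    unfolding inner_ext_defect by (intro DERIV_diff DERIV_const DERIV_cdivide DERIV_sum D1)
  have "((\<lambda>t. x t) has_derivative (\<lambda>t. t *\<^sub>R w)) (at 0)"
    unfolding x_def by (auto intro!: derivative_eq_intros)
  then have "((\<lambda>t. w \<bullet> ext_defect g (x t)) has_derivative (\<lambda>t. w \<bullet> A (t *\<^sub>R w))) (at 0)"
    using has_derivative_compose[of x "\<lambda>t. t *\<^sub>R w" 0 UNIV "ext_defect g" A] A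
    by (intro has_derivative_inner_right) (simp add: x_def)
  then have 2: "((\<lambda>t. w \<bullet> ext_defect g (x t)) has_real_derivative w \<bullet> A w) (at 0)"
    using linear_scale[OF has_derivative_linear[OF A]]
    by (simp add: has_field_derivative_def mult_commute_abs)
  obtain i j k where ijk: "{i,j,k} \<in> F"
    "if g = Euclidean then \<not> (w$i = w$j \<and> w$j = w$k) else \<not> (w$i = 0 \<and> w$j = 0 \<and> w$k = 0)" using w by blast
  have T: "(i,j,k) \<in> ordered_faces" using ijk by (simp add: ordered_faces_def)
  have "D (i,j,k) < 0" using D[OF T] ijk(2) unfolding P_def by simp
  then have "(\<Sum>y\<in>ordered_faces. D y) < (\<Sum>y\<in>ordered_faces. 0)"
    using T D1(2) by (intro sum_strict_mono_ex1) auto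
  then show ?thesis using DERIV_unique[OF 1 2] by simp
qed

text \<open>The end points of an edge lie in a common face, and edge paths connect all
  vertices.\<close>

lemma constant_on_faces_imp_constant:
  assumes "\<And>i j k. {i,j,k} \<in> F \<Longrightarrow> h i = h j \<and> h j = h k"
  shows "h i = h j"
proof -
  have con: "(i, j) \<in> {(a, b). {a, b} \<in> edges F}\<^sup>*"
    using surface unfolding connected_closed_surface_def by (elim conjE, elim allE)
  have "h a = h b" if e: "{a,b} \<in> edges F" for a b
  proof -
    obtain \<sigma> where s: "\<sigma> \<in> F" "{a,b} \<subseteq> \<sigma>" and c: "card {a,b} = 2" using e by (auto simp: edges_def)
    have "card \<sigma> = 3" using surface s by (auto simp: connected_closed_surface_def)
    then have "card (\<sigma> - {a,b}) = 1" using s(2) c by (simp add: card_Diff_subset)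
    then obtain k where "\<sigma> - {a,b} = {k}" by (meson card_1_singletonE)
    then have "\<sigma> = {a,b,k}" using s(2) by auto
    then show ?thesis using assms[of a b k] s(1) by simp
  qed
  with con show ?thesis by (induction rule: rtrancl_induct) auto
qed

section \<open>Coercivity in both geometries and the Gauss-Bonnet formula\<close>

lemma hyp_coercive:
  assumes p: "p \<in> coord_dom Hyperbolic" "conf_point Hyperbolic p \<in> dcs Hyperbolic F eps eta"
  shows "\<exists>m>0. \<forall>u\<in>coord_dom Hyperbolic. (u - p) \<bullet> (ext_defect Hyperbolic u - ext_defect Hyperbolic p)
     \<ge> m * min (norm (u - p)) ((norm (u - p))\<^sup>2)"
proof -
  obtain A where A: "(ext_defect Hyperbolic has_derivative A) (at p)"
    using differentiable_ext_defect[OF p] by (auto simp: differentiable_def)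
  have "w \<bullet> A w > 0" if w0: "w \<noteq> 0" for w
  proof (rule ext_defect_derivative_pos[OF p A])
    obtain i where "w$i \<noteq> 0" using w0 by (auto simp: vec_eq_iff)
    moreover obtain j k where "{i,j,k} \<in> F" using vertex_in_face by blast
    ultimately show "\<exists>i j k. {i, j, k} \<in> F \<and> (if Hyperbolic = Euclidean then \<not> (w $ i = w $ j \<and> w $ j = w $ k)
       else \<not> (w $ i = 0 \<and> w $ j = 0 \<and> w $ k = 0))" by (simp, blast)
  qed
  then show ?thesis
    using monotone_coercive[OF convex_coord_dom p(1) ext_defect_mono A subspace_UNIV] by simp
qed

lemma edge_qty_shift:
  "edge_qty Euclidean (u + (\<chi> i. c)) i j = exp (2 * c) * edge_qty Euclidean u i j"
proof -
  have "exp (2 * c) = exp c * exp c" by (simp flip: exp_add)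
  then show ?thesis by (simp add: edge_qty_def radius_def exp_add algebra_simps power2_eq_square)
qed

text \<open>Adding a constant multiplies all squared lengths by \<open>exp (2 * c)\<close>, which
  cancels in the quotients before clamping and so affects no angle, degenerate or not.\<close>

lemma ext_defect_shift: "ext_defect Euclidean (u + (\<chi> i. c)) = ext_defect Euclidean u"
proof -
  have "theta Euclidean (u + (\<chi> i. c)) i j k = theta Euclidean u i j k" for i j k
  proof -
    have "(exp (2*c) * edge_qty Euclidean u i j + exp (2*c) * edge_qty Euclidean u i k - exp (2*c) * edge_qty Euclidean u j k) / 2
       = exp (2*c) * ((edge_qty Euclidean u i j + edge_qty Euclidean u i k - edge_qty Euclidean u j k) / 2)"
      by (simp add: algebra_simps)
    then show ?thesis unfolding theta_def edge_qty_shift if_P[OF refl] by (simp only:) (rule cos_angle_scale, simp)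
  qed
  then show ?thesis by (simp add: ext_defect_def)
qed

lemma card_ordered_faces: "card ordered_faces = 6 * card F"
proof -
  have c3: "card \<sigma> = 3" if "\<sigma> \<in> F" for \<sigma> using surface that by (auto simp: connected_closed_surface_def)
  have "card {(i,j,k). {i,j,k} = \<sigma>} = 6" if "\<sigma> \<in> F" for \<sigma>
  proof -
    have fin: "finite \<sigma>" by simp
    have "{(i,j,k). {i,j,k} = \<sigma>} = (SIGMA i:\<sigma>. SIGMA j:\<sigma>-{i}. \<sigma>-{i}-{j})"
    proof (rule set_eqI)
      fix x :: "'v \<times> 'v \<times> 'v"
      obtain i j k where x: "x = (i,j,k)" by (cases x)
      have "{i,j,k} = \<sigma> \<longleftrightarrow> i \<in> \<sigma> \<and> j \<in> \<sigma> - {i} \<and> k \<in> \<sigma> - {i} - {j}"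
      proof
        assume e: "{i,j,k} = \<sigma>"
        then show "i \<in> \<sigma> \<and> j \<in> \<sigma> - {i} \<and> k \<in> \<sigma> - {i} - {j}" using face_distinct[of i j k] \<open>\<sigma> \<in> F\<close> by auto
      next
        assume a: "i \<in> \<sigma> \<and> j \<in> \<sigma> - {i} \<and> k \<in> \<sigma> - {i} - {j}"
        then have "{i,j,k} \<subseteq> \<sigma>" "card {i,j,k} = 3" by auto
        then show "{i,j,k} = \<sigma>" using c3[OF \<open>\<sigma> \<in> F\<close>] fin by (intro card_subset_eq) auto
      qed
      then show "x \<in> {(i,j,k). {i,j,k} = \<sigma>} \<longleftrightarrow> x \<in> (SIGMA i:\<sigma>. SIGMA j:\<sigma>-{i}. \<sigma>-{i}-{j})"
        unfolding x by simp
    qed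
    also have "card \<dots> = (\<Sum>i\<in>\<sigma>. \<Sum>j\<in>\<sigma>-{i}. card (\<sigma>-{i}-{j}))"
      using fin by (subst card_SigmaI; simp)
    also have "\<dots> = (\<Sum>i\<in>\<sigma>. \<Sum>j\<in>\<sigma>-{i}. 1)" using c3[OF that] by (intro sum.cong) auto
    also have "\<dots> = (\<Sum>i\<in>\<sigma>. 2)" using c3[OF that] by (intro sum.cong) auto
    also have "\<dots> = 6" using c3[OF that] by simp
    finally show ?thesis .
  qed
  moreover have "ordered_faces = (\<Union>\<sigma>\<in>F. {(i,j,k). {i,j,k} = \<sigma>})" by (auto simp: ordered_faces_def)
  moreover have "card (\<Union>\<sigma>\<in>F. {(i,j,k). {i,j,k} = \<sigma>}) = (\<Sum>\<sigma>\<in>F. card {(i,j,k). {i,j,k} = \<sigma>})"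
    by (rule card_UN_disjoint) auto
  ultimately show ?thesis by simp
qed

text \<open>Incidences counted twice: three edges in each face, two faces at each edge.\<close>

lemma faces_edges_count: "3 * card F = 2 * card (edges F)"
proof -
  have c3: "card \<sigma> = 3" if "\<sigma> \<in> F" for \<sigma> using surface that by (auto simp: connected_closed_surface_def)
  have c2: "\<forall>e\<in>edges F. card {\<sigma>\<in>F. e \<subseteq> \<sigma>} = 2"
    using surface unfolding connected_closed_surface_def by (elim conjE)
  have "card {e\<in>edges F. e \<subseteq> \<sigma>} = 3" if "\<sigma> \<in> F" for \<sigma>
  proof -
    have "{e\<in>edges F. e \<subseteq> \<sigma>} = {e. e \<subseteq> \<sigma> \<and> card e = 2}" using that by (auto simp: edges_def)
    then show ?thesis using n_subsets[of \<sigma> 2] c3[OF that] by (simp add: eval_nat_numeral)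
  qed
  then have "(\<Sum>e\<in>edges F. card {\<sigma>\<in>F. e \<subseteq> \<sigma>}) = 3 * card F"
    by (intro sum_multicount) auto
  then show ?thesis using c2 by simp
qed

text \<open>The defect is paired with the constant vector 1. All of \<open>u\<close> is allowed
  because the extended angles of a degenerate triangle also sum to \<pi>.\<close>

lemma gauss_bonnet: "(\<Sum>i\<in>UNIV. ext_defect Euclidean u $ i) = 2 * pi * euler_char F"
proof -
  define w where "w = ((\<chi> i. 1) :: real^'v)"
  have "tri_sum Euclidean w u x = pi" if x0: "x \<in> ordered_faces" for x
  proof -
    obtain i j k where x: "x = (i,j,k)" "{i,j,k} \<in> F" using x0 by (auto simp: ordered_faces_def)
    have pos: "edge_qty Euclidean u i j > 0" "edge_qty Euclidean u i k > 0" "edge_qty Euclidean u j k > 0"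
      using edge_qty_face(1)[OF _ x(2), of u] by auto
    show ?thesis using eucl_angle_sum[OF pos(3,2,1)]
      by (simp add: x(1) tri_sum_def w_def theta_def edge_qty_commute[of _ u k j] edge_qty_commute[of _ u j i]
          edge_qty_commute[of _ u k i])
  qed
  then have "w \<bullet> ext_defect Euclidean u = 2 * pi * real CARD('v) - real (card ordered_faces) * pi / 6"
    unfolding inner_ext_defect by (simp add: w_def)
  also have "\<dots> = 2 * pi * (real CARD('v) - real (card F) / 2)"
    unfolding card_ordered_faces by (simp add: algebra_simps)
  also have "real (card F) / 2 = real (card (edges F)) - real (card F)"
    using faces_edges_count by linarith
  finally show ?thesis by (simp add: euler_char_def w_def inner_vec_def algebra_simps)
qed

text \<open>The derivative is definite only on vectors of sum zero, whereas for nonzero \<alpha> the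
  flow conserves an exponential sum. That sum forces \<open>u - p\<close> to have components of both
  signs, and such a vector is controlled by its part of sum zero: the inner product ignores the
  constant part by shift invariance and Gauss-Bonnet.\<close>

lemma eucl_coercive:
  assumes p: "p \<in> dcs Euclidean F eps eta"
  shows "\<exists>m>0. \<forall>u. (\<exists>i. (u - p)$i \<ge> 0) \<and> (\<exists>i. (u - p)$i \<le> 0) \<longrightarrow>
     (u - p) \<bullet> (ext_defect Euclidean u - ext_defect Euclidean p) \<ge> m * min (norm (u - p)) ((norm (u - p))\<^sup>2)"
proof -
  have cp: "conf_point Euclidean p = p" by (simp add: conf_point_def radius_def vec_eq_iff)
  obtain A where A: "(ext_defect Euclidean has_derivative A) (at p)"
    using differentiable_ext_defect[of p Euclidean] p cp by (auto simp: differentiable_def)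
  define S where "S = {w::real^'v. (\<Sum>i\<in>UNIV. w$i) = 0}"
  have S: "subspace S" unfolding S_def subspace_def by (auto simp: sum.distrib sum_distrib_left[symmetric])
  have "w \<bullet> A w > 0" if "w \<in> S" "w \<noteq> 0" for w
  proof (rule ext_defect_derivative_pos[OF _ _ A])
    show "\<exists>i j k. {i, j, k} \<in> F \<and> (if Euclidean = Euclidean then \<not> (w $ i = w $ j \<and> w $ j = w $ k)
       else \<not> (w $ i = 0 \<and> w $ j = 0 \<and> w $ k = 0))"
    proof (rule ccontr)
      assume "\<not> ?thesis"
      then have nex: "w$i = w$j \<and> w$j = w$k" if "{i,j,k} \<in> F" for i j k using that by auto
      have "w$i = w$j" for i j by (rule constant_on_faces_imp_constant[of "\<lambda>i. w$i", OF nex])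
      then have "\<exists>c. \<forall>i. w$i = c" by blast
      then obtain c where c: "\<And>i. w$i = c" by blast
      then have "real CARD('v) * c = 0" using that(1) by (simp add: S_def)
      then show False using that(2) c by (simp add: vec_eq_iff)
    qed
  qed (use p cp in auto)
  then obtain m where m: "m > 0" "\<And>u. u - p \<in> S \<Longrightarrow> (u - p) \<bullet> (ext_defect Euclidean u - ext_defect Euclidean p)
     \<ge> m * min (norm (u - p)) ((norm (u - p))\<^sup>2)"
    using monotone_coercive[OF convex_coord_dom[of Euclidean] _ ext_defect_mono A S] by auto
  define N where "N = 1 + norm ((\<chi> i. 1) :: real^'v)"
  have N: "N \<ge> 1" by (simp add: N_def)
  have "(u - p) \<bullet> (ext_defect Euclidean u - ext_defect Euclidean p) \<ge> m / N\<^sup>2 * min (norm (u - p)) ((norm (u - p))\<^sup>2)"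
    if b: "(u - p)$i0 \<ge> 0" "(u - p)$j0 \<le> 0" for u i0 j0
  proof -
    define s where "s = (\<Sum>i\<in>UNIV. (u - p)$i) / real CARD('v)"
    define v where "v = u + (\<chi> i. - s)"
    have vS: "v - p \<in> S" unfolding S_def v_def by (simp add: sum.distrib sum_subtractf s_def)
    have uv: "u - p = (v - p) + s *\<^sub>R (\<chi> i. 1)" by (simp add: v_def vec_eq_iff)
    have "(\<chi> i. 1) \<bullet> (ext_defect Euclidean u - ext_defect Euclidean p) = 0"
      by (simp add: inner_vec_def sum_subtractf gauss_bonnet)
    then have eq: "(u - p) \<bullet> (ext_defect Euclidean u - ext_defect Euclidean p)
        = (v - p) \<bullet> (ext_defect Euclidean v - ext_defect Euclidean p)"
      unfolding uv inner_add_left inner_scaleR_left unfolding v_def ext_defect_shift by simp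
    have "- s \<le> (v - p)$i0" "(v - p)$j0 \<le> - s" using b by (simp_all add: v_def)
    \<comment> \<open>The components at \<open>i0\<close> and \<open>j0\<close> enclose the mean:
      whichever sign \<open>s\<close> has, one of them is at least as large in modulus.\<close>
    then have "\<bar>s\<bar> \<le> norm (v - p)"
      using component_le_norm_cart[of "v - p" i0] component_le_norm_cart[of "v - p" j0] by linarith
    then have "norm (u - p) \<le> norm (v - p) + norm (v - p) * norm ((\<chi> i. 1) :: real^'v)"
      unfolding uv by (intro norm_triangle_le add_left_mono) (simp add: mult_right_mono)
    also have "\<dots> = N * norm (v - p)" by (simp add: N_def algebra_simps)
    finally have nu: "norm (u - p) / N \<le> norm (v - p)" using N by (simp add: divide_le_eq mult.commute)
    have "min (norm (u - p)) ((norm (u - p))\<^sup>2) / N\<^sup>2 \<le> min (norm (v - p)) ((norm (v - p))\<^sup>2)"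
    proof (rule min.boundedI)
      have "min (norm (u - p)) ((norm (u - p))\<^sup>2) / N\<^sup>2 \<le> norm (u - p) / N"
        using N by (intro frac_le) (auto simp: power2_eq_square)
      then show "min (norm (u - p)) ((norm (u - p))\<^sup>2) / N\<^sup>2 \<le> norm (v - p)" using nu by linarith
      have "min (norm (u - p)) ((norm (u - p))\<^sup>2) / N\<^sup>2 \<le> (norm (u - p) / N)\<^sup>2"
        unfolding power_divide using N by (intro divide_right_mono) auto
      also have "\<dots> \<le> (norm (v - p))\<^sup>2" using nu N by (intro power_mono) auto
      finally show "min (norm (u - p)) ((norm (u - p))\<^sup>2) / N\<^sup>2 \<le> (norm (v - p))\<^sup>2" .
    qed
    then have "m * (min (norm (u - p)) ((norm (u - p))\<^sup>2) / N\<^sup>2) \<le> m * min (norm (v - p)) ((norm (v - p))\<^sup>2)"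
      using m(1) by (intro mult_left_mono) auto
    then show ?thesis using m(2)[OF vS] eq by simp
  qed
  moreover have "m / N\<^sup>2 > 0" using m N by simp
  ultimately show ?thesis by blast
qed

section \<open>Hyperbolic angles at a vertex of large radius\<close>

lemma hyp_len_lower_bound:
  fixes e h r r' s s' :: real
  assumes e: "e \<in> {0,1}" and h: "e + h > 0" and r: "r > 0" "r' > 0" and s: "s > 0" "s' > 0"
    and sr: "s\<^sup>2 = 1 + r\<^sup>2" "s'\<^sup>2 = 1 + e * r'\<^sup>2"
  shows "min 1 (e + h) / 2 * (r * (1 + r')) \<le> s * s' + h * r * r'"
proof -
  have rs: "r \<le> s" by (rule power2_le_imp_le) (use sr(1) s in linarith)+
  have "e * r'\<^sup>2 \<ge> 0" using e by auto
  then have s1: "1 \<le> s'" by (intro power2_le_imp_le[of 1 s']) (use sr(2) s in simp_all)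
  let ?x = "r * (1 + r')"
  have x: "?x \<ge> 0" "r * r' \<ge> 0" using r by simp_all
  show ?thesis
  proof (cases "e = 0")
    case True
    then have h0: "h > 0" and "s'\<^sup>2 = 1" using h sr(2) by simp_all
    then have s'1: "s' = 1" using s(2) by (simp add: power2_eq_1_iff)
    have "min 1 h / 2 * ?x \<le> min 1 h * ?x" using h0 x by (intro mult_right_mono) auto
    also have "\<dots> = min 1 h * r + min 1 h * (r * r')" by (simp add: algebra_simps)
    also have "\<dots> \<le> 1 * r + h * (r * r')"
      by (intro add_mono mult_right_mono) (use x r in simp_all)
    also have "\<dots> \<le> s + h * (r * r')" using rs by simp
    finally show ?thesis using True s'1 by (simp add: mult.assoc)
  next
    case False
    then have e1: "e = 1" using e by auto
    have rs': "r' \<le> s'" by (rule power2_le_imp_le) (use sr(2) s e1 in simp_all)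
    have "1 + r' \<le> 2 * s'" using rs' s1 by simp
    then have "r * (1 + r') \<le> s * (2 * s')" by (rule mult_mono[OF rs]) (use r s in simp_all)
    then have xs: "?x / 2 \<le> s * s'" by simp
    have m: "min 1 (e + h) * (?x / 2) \<le> min 1 (e + h) * (s * s')"
      by (rule mult_left_mono[OF xs]) (use h in simp)
    have "min 1 (1 + h) * (s * s') \<le> s * s' + h * (r * r')"
    proof (cases "h \<ge> 0")
      case True
      then have "h * (r * r') \<ge> 0" using x(2) by (rule mult_nonneg_nonneg)
      then show ?thesis using True by simp
    next
      case False
      have "r * r' \<le> s * s'" by (rule mult_mono[OF rs rs']) (use r s in simp_all)
      then have "h * (s * s') \<le> h * (r * r')" by (rule mult_left_mono_neg) (use False in simp)
      then show ?thesis using False by (simp add: algebra_simps)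
    qed
    then show ?thesis using m e1 by (simp add: mult_ac)
  qed
qed

text \<open>The cosine at \<open>i\<close> is \<open>(c3 * c2 - c1) / S\<close> with
  \<open>S \<le> c3 * c2\<close>. Here \<open>c1\<close> is at most a constant times
  \<open>(1 + rj) * (1 + rk)\<close>, while \<open>c3 * c2\<close> exceeds a constant times
  \<open>ri^2\<close> times the same product. So \<open>c1\<close> is negligible for large
  \<open>ri\<close>, uniformly in the other two radii, and the cosine tends to 1.\<close>

lemma hyp_angle_small:
  assumes i: "eps i = 1" and d: "\<delta> > 0"
  shows "\<exists>R>0. \<forall>u\<in>coord_dom Hyperbolic. radius Hyperbolic u i \<ge> R \<longrightarrow> {i,j,k} \<in> F \<longrightarrow> theta Hyperbolic u i j k \<le> \<delta>"
proof (cases "{i,j,k} \<in> F")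
  case True
  \<comment> \<open>The cap at 1, which is below \<pi>/2, makes \<open>cos \<delta>'\<close>
    positive and thus \<open>\<epsilon> < 1\<close>.\<close>
  define \<delta>' where "\<delta>' = min \<delta> 1"
  define \<epsilon> where "\<epsilon> = 1 - cos \<delta>'"
  have d': "0 < \<delta>'" "\<delta>' \<le> \<delta>" "\<delta>' \<le> 1" using d by (auto simp: \<delta>'_def)
  have dp: "\<delta>' < pi/2" using d' pi_gt3 by linarith
  have e: "0 < \<epsilon>" "\<epsilon> < 1"
    using cos_monotone_0_pi[of 0 \<delta>'] cos_gt_zero[of \<delta>'] d' dp by (auto simp: \<epsilon>_def)
  define a where "a = min 1 (eps j + eta {i,j}) / 2"
  define b where "b = min 1 (eps k + eta {i,k}) / 2"
  have ej: "eps j + eta {i,j} > 0" "eps k + eta {i,k} > 0"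
    using edge_weight[of i j] edge_weight[of i k] face_edges[OF True] i by auto
  have ab: "a > 0" "b > 0" using ej by (auto simp: a_def b_def)
  define M where "M = 1 + \<bar>eta {j,k}\<bar>"
  define R where "R = 1 + M / (\<epsilon> * a * b)"
  have "M / (\<epsilon> * a * b) \<ge> 0" using e ab by (simp add: M_def)
  then have R: "R \<ge> 1" by (simp add: R_def)
  have RM: "M \<le> \<epsilon> * a * b * R\<^sup>2"
  proof -
    have "M = \<epsilon> * a * b * (M / (\<epsilon> * a * b))" using e ab by simp
    also have "\<dots> \<le> \<epsilon> * a * b * R" using e ab by (intro mult_left_mono) (auto simp: R_def)
    also have "\<dots> \<le> \<epsilon> * a * b * R\<^sup>2" using e ab R by (intro mult_left_mono) (auto simp: power2_eq_square)
    finally show ?thesis .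
  qed
  have "theta Hyperbolic u i j k \<le> \<delta>" if u: "u \<in> coord_dom Hyperbolic" and r: "radius Hyperbolic u i \<ge> R" for u
  proof -
    define ri rj rk where "ri = radius Hyperbolic u i" and "rj = radius Hyperbolic u j" and "rk = radius Hyperbolic u k"
    define si sj sk where "si = cosh_radius Hyperbolic u i" and "sj = cosh_radius Hyperbolic u j" and "sk = cosh_radius Hyperbolic u k"
    have rp: "ri > 0" "rj > 0" "rk > 0" using radius_pos[OF u] by (auto simp: ri_def rj_def rk_def)
    have sp: "si > 0" "sj > 0" "sk > 0"
      unfolding si_def sj_def sk_def by (rule less_le_trans[OF zero_less_one cosh_radius_ge_1])+
    have sr: "si\<^sup>2 = 1 + ri\<^sup>2" "sj\<^sup>2 = 1 + eps j * rj\<^sup>2" "sk\<^sup>2 = 1 + eps k * rk\<^sup>2"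
      using cosh_radius_sq[of Hyperbolic u] i by (auto simp: si_def sj_def sk_def ri_def rj_def rk_def)
    have s_le: "s \<le> 1 + r" if "s\<^sup>2 = 1 + eps l * r\<^sup>2" "r > 0" "s > 0" for s r l
    proof (rule power2_le_imp_le)
      have "eps l * r\<^sup>2 \<le> 1 * r\<^sup>2" using eps_01[of l] by (intro mult_right_mono) auto
      moreover have "(1 + r)\<^sup>2 = 1 + 2 * r + r\<^sup>2" by (simp add: power2_sum)
      ultimately show "s\<^sup>2 \<le> (1 + r)\<^sup>2" using that(1,2) by linarith
    qed (use that(2) in simp)
    define c1 c2 c3 where "c1 = edge_qty Hyperbolic u j k" and "c2 = edge_qty Hyperbolic u i k" and "c3 = edge_qty Hyperbolic u i j"
    have c: "c1 > 1" "c2 > 1" "c3 > 1" using edge_qty_face(2)[OF u True] by (auto simp: c1_def c2_def c3_def)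
    have cs: "c1 = sj * sk + eta {j,k} * rj * rk" "c2 = si * sk + eta {i,k} * ri * rk" "c3 = si * sj + eta {i,j} * ri * rj"
      by (auto simp: c1_def c2_def c3_def edge_qty_def si_def sj_def sk_def ri_def rj_def rk_def)
    have l3: "a * (ri * (1 + rj)) \<le> c3" unfolding cs a_def
      by (rule hyp_len_lower_bound[OF eps_01 ej(1) rp(1,2) sp(1,2) sr(1,2)])
    have l2: "b * (ri * (1 + rk)) \<le> c2" unfolding cs b_def
      by (rule hyp_len_lower_bound[OF eps_01 ej(2) rp(1,3) sp(1,3) sr(1,3)])
    have x: "rj * rk \<le> (1 + rj) * (1 + rk)" by (rule mult_mono) (use rp in simp_all)
    have "c1 \<le> (1 + rj) * (1 + rk) + \<bar>eta {j,k}\<bar> * ((1 + rj) * (1 + rk))"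
    proof -
      have "sj * sk \<le> (1 + rj) * (1 + rk)"
        using s_le[OF sr(2) rp(2) sp(2)] s_le[OF sr(3) rp(3) sp(3)] sp rp by (intro mult_mono) simp_all
      moreover have "eta {j,k} * (rj * rk) \<le> \<bar>eta {j,k}\<bar> * ((1 + rj) * (1 + rk))"
        by (rule mult_mono[OF abs_ge_self x]) (use rp in simp_all)
      ultimately show ?thesis unfolding cs by (simp add: mult.assoc)
    qed
    also have "\<dots> = M * ((1 + rj) * (1 + rk))" by (simp add: M_def algebra_simps)
    also have "\<dots> \<le> (\<epsilon> * a * b * ri\<^sup>2) * ((1 + rj) * (1 + rk))"
    proof (rule mult_right_mono)
      have "R\<^sup>2 \<le> ri\<^sup>2" using r R unfolding ri_def by (intro power_mono) auto
      then have "\<epsilon> * a * b * R\<^sup>2 \<le> \<epsilon> * a * b * ri\<^sup>2" using e ab by (intro mult_left_mono) auto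
      then show "M \<le> \<epsilon> * a * b * ri\<^sup>2" using RM by linarith
    qed (use rp in auto)
    also have "\<dots> = \<epsilon> * ((a * (ri * (1 + rj))) * (b * (ri * (1 + rk))))" by (simp add: power2_eq_square mult_ac)
    also have "\<dots> \<le> \<epsilon> * (c3 * c2)"
      by (rule mult_left_mono[OF mult_mono[OF l3 l2]]) (use e ab rp c in simp_all)
    finally have c1: "c1 \<le> \<epsilon> * (c3 * c2)" .
    define S where "S = sqrt ((c3\<^sup>2 - 1) * (c2\<^sup>2 - 1))"
    have S0: "S > 0" using c by (simp add: S_def)
    have "S \<le> c3 * c2"
    proof -
      have "(c3\<^sup>2 - 1) * (c2\<^sup>2 - 1) \<le> c3\<^sup>2 * c2\<^sup>2" by (rule mult_mono) (use c in simp_all)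
      then have "S \<le> sqrt (c3\<^sup>2 * c2\<^sup>2)" by (simp add: S_def)
      then show ?thesis using c by (simp add: real_sqrt_mult)
    qed
    then have "(1 - \<epsilon>) * S \<le> (1 - \<epsilon>) * (c3 * c2)" using e by (intro mult_left_mono) auto
    also have "\<dots> \<le> c3 * c2 - c1" using c1 by (simp add: algebra_simps)
    finally have "cos \<delta>' \<le> (c3 * c2 - c1) / S" using S0 by (simp add: \<epsilon>_def le_divide_eq)
    then have "clamped_arccos ((c3 * c2 - c1) / S) \<le> arccos (cos \<delta>')"
      unfolding clamped_arccos_def by (intro arccos_le_arccos) (auto simp: le_max_iff_disj)
    also have "\<dots> = \<delta>'" using d' dp by (intro arccos_cos) auto
    finally show ?thesis using d' unfolding theta_def cos_angle_def S_def c1_def c2_def c3_def by simp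
  qed
  then show ?thesis using R by (intro exI[of _ R]) auto
qed (intro exI[of _ 1], simp)

text \<open>A radius \<open>- 1 / sinh (u i)\<close> is large exactly when \<open>u i\<close> is
  close to 0; then all angles at \<open>i\<close> are small. The choice of \<open>b\<close> turns
  the threshold on the radius into one on \<open>u\<close>.\<close>

lemma hyp_defect_near_boundary:
  assumes i: "eps i = 1" and d: "\<delta> > 0"
  shows "\<exists>b<0. \<forall>u\<in>coord_dom Hyperbolic. b \<le> u$i \<longrightarrow> ext_defect Hyperbolic u $ i \<ge> 2 * pi - \<delta>"
proof -
  define N where "N = real (card (UNIV :: ('v \<times> 'v) set))"
  have N: "N > 0" unfolding N_def by (simp add: finite_UNIV_card_ge_0)
  \<comment> \<open>\<open>N\<close> bounds the number of ordered pairs completing \<open>i\<close>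
    to a face; the 2 offsets the factor 1/2 in the defect.\<close>
  define \<delta>' where "\<delta>' = 2 * \<delta> / N"
  have "\<delta>' > 0" using d N by (simp add: \<delta>'_def)
  then obtain R where R: "\<And>j k. R j k > 0"
    "\<And>j k u. u \<in> coord_dom Hyperbolic \<Longrightarrow> radius Hyperbolic u i \<ge> R j k \<Longrightarrow> {i,j,k} \<in> F \<Longrightarrow> theta Hyperbolic u i j k \<le> \<delta>'"
    using hyp_angle_small[OF i] by metis
  define R0 where "R0 = (\<Sum>j\<in>UNIV. \<Sum>k\<in>UNIV. R j k)"
  have R0: "R j k \<le> R0" for j k
  proof -
    have "R j k \<le> (\<Sum>k\<in>UNIV. R j k)" using R(1) by (intro member_le_sum) (auto simp: less_imp_le)
    also have "\<dots> \<le> R0" unfolding R0_def using R(1)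
      by (intro member_le_sum[where f="\<lambda>j. \<Sum>k\<in>UNIV. R j k"]) (auto simp: less_imp_le intro!: sum_nonneg)
    finally show ?thesis .
  qed
  have R0p: "R0 > 0" using R(1) R0 by (meson less_le_trans)
  define b where "b = - arsinh (1 / R0)"
  have b: "b < 0" "sinh b = - 1 / R0" using R0p arsinh_real_strict_mono[of 0 "1/R0"] by (auto simp: b_def)
  have "ext_defect Hyperbolic u $ i \<ge> 2 * pi - \<delta>" if u: "u \<in> coord_dom Hyperbolic" and ub: "b \<le> u$i" for u
  proof -
    have u0: "sinh (u$i) < 0" using sinh_coord_ne_0[OF u] i by simp
    have "- 1 / R0 \<le> sinh (u$i)" using ub b(2) sinh_real_le_iff[of b "u$i"] by simp
    then have "radius Hyperbolic u i \<ge> R0" using u0 R0p i by (simp add: radius_def field_simps)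
    then have t: "theta Hyperbolic u i j k \<le> \<delta>'" if "{i,j,k} \<in> F" for j k
      using R(2)[OF u _ that] R0[of j k] by linarith
    let ?P = "{(j,k). {i,j,k} \<in> F}"
    have "(\<Sum>(j,k)\<in>?P. theta Hyperbolic u i j k) \<le> (\<Sum>(j,k)\<in>?P. \<delta>')" using t by (intro sum_mono) auto
    also have "\<dots> = real (card ?P) * \<delta>'" by (simp add: split_beta)
    also have "\<dots> \<le> N * \<delta>'" unfolding N_def using \<open>\<delta>' > 0\<close> by (intro mult_right_mono of_nat_mono card_mono) auto
    also have "\<dots> = 2 * \<delta>" using N by (simp add: \<delta>'_def)
    finally show ?thesis by (simp add: ext_defect_def)
  qed
  then show ?thesis using b(1) by blast
qed

end

section \<open>Existence of solutions\<close>

text \<open>The times outside the open set \<open>S\<close> form a compact set, so there is an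
  earliest one.\<close>

lemma first_exit:
  fixes x :: "real \<Rightarrow> 'a::topological_space"
  assumes x: "continuous_on {a..b} x" and O: "open S" "x a \<in> S" and s: "a \<le> s" "s \<le> b" "x s \<notin> S"
  shows "\<exists>\<tau>. a < \<tau> \<and> \<tau> \<le> s \<and> x \<tau> \<notin> S \<and> (\<forall>t. a \<le> t \<and> t < \<tau> \<longrightarrow> x t \<in> S)"
proof -
  define E where "E = {t\<in>{a..s}. x t \<in> - S}"
  have "closed E" unfolding E_def
    using continuous_closed_preimage[OF continuous_on_subset[OF x, of "{a..s}"], of "- S"] O(1) s(2)
    by (simp add: closed_Compl vimage_def Int_def)
  moreover have "bounded E" by (rule bounded_subset[OF bounded_closed_interval[of a s]]) (auto simp: E_def)
  ultimately have "compact E" by (simp add: compact_eq_bounded_closed)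
  moreover have "s \<in> E" using s by (simp add: E_def)
  ultimately obtain \<tau> where t: "\<tau> \<in> E" "\<And>t. t \<in> E \<Longrightarrow> \<tau> \<le> t"
    using compact_attains_inf[of E] by blast
  have "x \<tau> \<notin> S" "a \<le> \<tau>" "\<tau> \<le> s" using t(1) by (auto simp: E_def)
  moreover have "x t \<in> S" if "a \<le> t" "t < \<tau>" for t
    using t(2)[of t] that \<open>\<tau> \<le> s\<close> by (force simp: E_def)
  moreover have "a \<noteq> \<tau>" using O(2) \<open>x \<tau> \<notin> S\<close> by blast
  ultimately show ?thesis by (intro exI[of _ \<tau>]) auto
qed

text \<open>Tonelli's method: the delayed equation is solved exactly by iteration.\<close>

primrec delayed :: "('a::euclidean_space \<Rightarrow> 'a) \<Rightarrow> 'a \<Rightarrow> real \<Rightarrow> nat \<Rightarrow> real \<Rightarrow> 'a" where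
  "delayed g x0 d 0 = (\<lambda>t. x0)"
| "delayed g x0 d (Suc k) = (\<lambda>t. x0 + integral {0..max 0 t} (\<lambda>s. g (delayed g x0 d k (s - d))))"

lemma integral_diff_bound:
  fixes h :: "real \<Rightarrow> 'a::euclidean_space"
  assumes h: "continuous_on UNIV h" and B: "\<And>s. norm (h s) \<le> B" and ab: "0 \<le> a" "0 \<le> b"
  shows "norm (integral {0..a} h - integral {0..b} h) \<le> B * \<bar>a - b\<bar>"
proof -
  have *: "norm (integral {0..b} h - integral {0..a} h) \<le> B * (b - a)" if "0 \<le> a" "a \<le> b" for a b
  proof -
    have i: "h integrable_on {c..d}" for c d
      by (rule integrable_continuous_real[OF continuous_on_subset[OF h]]) simp
    have "integral {0..b} h - integral {0..a} h = integral {a..b} h"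
      using Henstock_Kurzweil_Integration.integral_combine[OF that i] by (simp add: algebra_simps)
    then show ?thesis
      using integral_bound[of a b h B] that B continuous_on_subset[OF h] by simp
  qed
  show ?thesis using *[of a b] *[of b a] ab by (cases "a \<le> b") (auto simp: norm_minus_commute)
qed

text \<open>The last claim is what makes finitely many iterations enough: the integrand looks back
  by \<open>d\<close>, so if two iterates agree up to time \<open>k d\<close>, the next ones agree
  up to \<open>(k + 1) d\<close>.\<close>

lemma delayed_props:
  fixes g :: "'a::euclidean_space \<Rightarrow> 'a"
  assumes g: "continuous_on UNIV g" and B: "\<And>x. norm (g x) \<le> B" and d: "d > 0"
  shows "norm (delayed g x0 d k t - delayed g x0 d k s) \<le> B * \<bar>t - s\<bar>"
    and "continuous_on UNIV (delayed g x0 d k)"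
    and "t \<le> real k * d \<Longrightarrow> delayed g x0 d (Suc k) t = delayed g x0 d k t"
proof -
  have B0: "B \<ge> 0" using B[of 0] norm_ge_zero order_trans by blast
  have A: "continuous_on UNIV (delayed g x0 d k) \<and> (\<forall>t s. norm (delayed g x0 d k t - delayed g x0 d k s) \<le> B * \<bar>t - s\<bar>)" for k
  proof (induction k)
    case 0 then show ?case using B0 by simp
  next
    case (Suc k)
    have c: "continuous_on UNIV (\<lambda>s. g (delayed g x0 d k (s - d)))"
      by (rule continuous_on_compose2[OF g continuous_on_compose2[OF conjunct1[OF Suc.IH]]])
         (auto intro!: continuous_intros)
    have l: "norm (delayed g x0 d (Suc k) t - delayed g x0 d (Suc k) s) \<le> B * \<bar>t - s\<bar>" for t s
    proof -
      have "norm (delayed g x0 d (Suc k) t - delayed g x0 d (Suc k) s) \<le> B * \<bar>max 0 t - max 0 s\<bar>"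
        using integral_diff_bound[OF c B, of "max 0 t" "max 0 s"] by simp
      also have "\<dots> \<le> B * \<bar>t - s\<bar>" using B0 by (intro mult_left_mono) (auto simp: max_def)
      finally show ?thesis .
    qed
    have "B-lipschitz_on UNIV (delayed g x0 d (Suc k))"
      using l B0 by (intro lipschitz_onI) (auto simp: dist_norm)
    then show ?case using l lipschitz_on_continuous_on by blast
  qed
  show "norm (delayed g x0 d k t - delayed g x0 d k s) \<le> B * \<bar>t - s\<bar>"
    "continuous_on UNIV (delayed g x0 d k)" using A by blast+
  show "t \<le> real k * d \<Longrightarrow> delayed g x0 d (Suc k) t = delayed g x0 d k t"
  proof (induction k arbitrary: t)
    case 0 then show ?case by simp
  next
    case (Suc k)
    have "integral {0..max 0 t} (\<lambda>s. g (delayed g x0 d (Suc k) (s - d)))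
        = integral {0..max 0 t} (\<lambda>s. g (delayed g x0 d k (s - d)))"
    proof (rule integral_cong)
      fix s assume "s \<in> {0..max 0 t}"
      then have "s \<le> max 0 t" by simp
      also have "max 0 t \<le> real (Suc k) * d" using Suc.prems d by (simp add: max_def)
      finally have "s - d \<le> real k * d" by (simp add: algebra_simps)
      then show "g (delayed g x0 d (Suc k) (s - d)) = g (delayed g x0 d k (s - d))"
        using Suc.IH by metis
    qed
    then show ?case by simp
  qed
qed

text \<open>All delayed solutions are Lipschitz with the same constant \<open>B\<close>, so a
  subsequence converges uniformly by Arzela-Ascoli. The delay changes an argument by at most
  \<open>B * d\<close>, and dominated convergence passes to the limit in the integral
  equation.\<close>

theorem peano:
  fixes g :: "'a::euclidean_space \<Rightarrow> 'a"
  assumes g: "continuous_on UNIV g" and B: "\<And>x. norm (g x) \<le> B" and L: "L > 0"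
  shows "\<exists>x. x 0 = x0 \<and> (\<forall>t\<in>{0..L}. (x has_vector_derivative g (x t)) (at t within {0..L}))"
proof -
  have B0: "B \<ge> 0" using B[of 0] norm_ge_zero order_trans by blast
  define d where "d n = 1 / real (Suc n)" for n
  have d: "d n > 0" for n by (simp add: d_def)
  have d0: "d \<longlonglongrightarrow> 0" unfolding d_def using LIMSEQ_inverse_real_of_nat by (simp add: inverse_eq_divide)
  \<comment> \<open>The number of steps of length \<open>d n\<close> that covers the interval up to
    \<open>L\<close>.\<close>
  define K where "K n = nat \<lceil>L / d n\<rceil>" for n
  have K: "L \<le> real (K n) * d n" for n
  proof -
    have "L / d n \<le> real (K n)" unfolding K_def by linarith
    then show ?thesis using d[of n] by (simp add: divide_le_eq)
  qed
  define y where "y n = delayed g x0 (d n) (K n)" for n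
  have y_eq: "y n t = x0 + integral {0..t} (\<lambda>s. g (y n (s - d n)))" if "t \<in> {0..L}" for n t
    using delayed_props(3)[OF g B d, of t "K n" n x0] K[of n] that by (simp add: y_def max_def)
  have y_lip: "norm (y n t - y n s) \<le> B * \<bar>t - s\<bar>" for n t s
    unfolding y_def by (rule delayed_props(1)[OF g B d])
  have y_cont: "continuous_on UNIV (y n)" for n unfolding y_def by (rule delayed_props(2)[OF g B d])
  have y0: "y n 0 = x0" for n using y_eq[of 0 n] L by simp
  obtain x k where x: "continuous_on {0..L} x" "strict_mono (k :: nat \<Rightarrow> nat)"
    "\<And>e. 0 < e \<Longrightarrow> \<exists>N. \<forall>n t. n \<ge> N \<and> t \<in> {0..L} \<longrightarrow> norm (y (k n) t - x t) < e"
  proof (rule Arzela_Ascoli[of "{0..L}" y "norm x0 + B * L"])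
    fix n t assume "t \<in> {0..L}"
    have "norm (y n t) \<le> norm (y n 0) + norm (y n t - y n 0)" by (metis norm_triangle_sub)
    also have "norm (y n t - y n 0) \<le> B * \<bar>t - 0\<bar>" by (rule y_lip)
    also have "B * \<bar>t - 0\<bar> \<le> B * L" using \<open>t \<in> {0..L}\<close> B0 by (intro mult_left_mono) auto
    finally show "norm (y n t) \<le> norm x0 + B * L" by (simp add: y0)
  next
    fix t e :: real assume "0 < e"
    have "norm (y n t - y n s) < e" if "norm (t - s) < e / (B + 1)" for n s
    proof -
      have "norm (y n t - y n s) \<le> B * \<bar>t - s\<bar>" by (rule y_lip)
      also have "\<dots> \<le> (B + 1) * \<bar>t - s\<bar>" by (intro mult_right_mono) auto
      also have "\<dots> < e" using that B0 by (simp add: field_simps)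
      finally show ?thesis .
    qed
    then show "\<exists>d>0. \<forall>n s. s \<in> {0..L} \<and> norm (t - s) < d \<longrightarrow> norm (y n t - y n s) < e"
      using \<open>0 < e\<close> B0 by (intro exI[of _ "e / (B + 1)"]) auto
  qed auto
  have lim: "(\<lambda>n. y (k n) t) \<longlonglongrightarrow> x t" if "t \<in> {0..L}" for t
    unfolding LIMSEQ_iff using x(3) that by blast
  have dk: "(\<lambda>n. d (k n)) \<longlonglongrightarrow> 0" using LIMSEQ_subseq_LIMSEQ[OF d0 x(2)] by (simp add: o_def)
  have lim': "(\<lambda>n. g (y (k n) (s - d (k n)))) \<longlonglongrightarrow> g (x s)" if "s \<in> {0..L}" for s
  proof -
    have "(\<lambda>n. y (k n) (s - d (k n)) - y (k n) s) \<longlonglongrightarrow> 0"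
    proof (rule tendsto_norm_zero_cancel[OF tendsto_sandwich[of "\<lambda>_. 0" _ _ "\<lambda>n. B * d (k n)"]])
      show "\<forall>\<^sub>F n in sequentially. norm (y (k n) (s - d (k n)) - y (k n) s) \<le> B * d (k n)"
        using y_lip[of _ "s - d _" s] d by (intro always_eventually allI) (metis abs_minus_cancel abs_of_pos add_diff_cancel_left' diff_add_cancel minus_diff_eq uminus_add_conv_diff)
      show "(\<lambda>n. B * d (k n)) \<longlonglongrightarrow> 0" using tendsto_mult_left[OF dk, of B] by simp
    qed auto
    then have "(\<lambda>n. (y (k n) (s - d (k n)) - y (k n) s) + y (k n) s) \<longlonglongrightarrow> 0 + x s"
      by (intro tendsto_add lim[OF that])
    then have "(\<lambda>n. y (k n) (s - d (k n))) \<longlonglongrightarrow> x s" by simp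
    moreover have "isCont g (x s)" using g by (simp add: continuous_on_eq_continuous_at)
    ultimately show ?thesis by (rule isCont_tendsto_compose[rotated])
  qed
  have gx: "continuous_on {0..L} (\<lambda>s. g (x s))"
    by (rule continuous_on_compose2[OF g x(1)]) auto
  have eq: "x t = x0 + integral {0..t} (\<lambda>s. g (x s))" if t: "t \<in> {0..L}" for t
  proof -
    have "(\<lambda>n. integral {0..t} (\<lambda>s. g (y (k n) (s - d (k n))))) \<longlonglongrightarrow> integral {0..t} (\<lambda>s. g (x s))"
    proof (rule dominated_convergence(2)[where h="\<lambda>_. B"])
      show "(\<lambda>s. g (y (k n) (s - d (k n)))) integrable_on {0..t}" for n
        by (intro integrable_continuous_real continuous_on_compose2[OF g continuous_on_compose2[OF y_cont]])
           (auto intro!: continuous_intros)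
      show "(\<lambda>n. g (y (k n) (s - d (k n)))) \<longlonglongrightarrow> g (x s)" if "s \<in> {0..t}" for s
        using that t by (intro lim') auto
    qed (auto simp: B)
    then have "(\<lambda>n. y (k n) t) \<longlonglongrightarrow> x0 + integral {0..t} (\<lambda>s. g (x s))"
      unfolding y_eq[OF t] by (intro tendsto_intros)
    then show ?thesis using lim[OF t] LIMSEQ_unique by blast
  qed
  have "(x has_vector_derivative g (x t)) (at t within {0..L})" if t: "t \<in> {0..L}" for t
  proof -
    have "((\<lambda>u. x0 + integral {0..u} (\<lambda>s. g (x s))) has_vector_derivative 0 + g (x t)) (at t within {0..L})"
      by (intro has_vector_derivative_add has_vector_derivative_const integral_has_vector_derivative[OF gx t])
    then show ?thesis
      using has_vector_derivative_transform[OF t, of x "\<lambda>u. x0 + integral {0..u} (\<lambda>s. g (x s))"] eq by simp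
  qed
  moreover have "x 0 = x0" using eq[of 0] L by simp
  ultimately show ?thesis by blast
qed

lemma time_dom_real [simp]: "time_dom (ereal L) = {0..<L}"
  by (auto simp: time_dom_def)

lemma time_dom_infinity [simp]: "time_dom \<infinity> = {0..}"
  by (auto simp: time_dom_def)

lemma time_dom_interval: "t \<in> time_dom T \<Longrightarrow> {0..t} \<subseteq> time_dom T"
  by (auto simp: time_dom_def intro: le_less_trans[of "ereal _" "ereal t" T])

lemma at_within_time_dom:
  assumes "0 < t" "t \<in> time_dom T" shows "at t within time_dom T = at t"
proof (rule at_within_open_subset[of t "{0<..} \<inter> {s. ereal s < T}"])
  have "open {s. ereal s < T}" by (cases T) (auto simp: open_lessThan[unfolded lessThan_def])
  then show "open ({0<..} \<inter> {s. ereal s < T})" by auto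
qed (use assms in \<open>auto simp: time_dom_def\<close>)

text \<open>Both domains start at 0 and extend beyond \<open>t\<close>, so they coincide near
  \<open>t\<close>. This allows pieces with different life spans to be glued.\<close>

lemma at_within_time_dom_less:
  assumes "t \<in> time_dom T" "t \<in> time_dom T'" shows "at t within time_dom T = at t within time_dom T'"
proof (rule at_within_nhd[of t "{s. ereal s < T} \<inter> {s. ereal s < T'}"])
  have "open {s. ereal s < T}" for T by (cases T) (auto simp: open_lessThan[unfolded lessThan_def])
  then show "open ({s. ereal s < T} \<inter> {s. ereal s < T'})" by auto
qed (use assms in \<open>auto simp: time_dom_def\<close>)

section \<open>Flows of monotone fields\<close>

text \<open>The interface between geometry and dynamics: \<open>k\<close> is the extended defect in
  the coordinates \<open>u\<close> and \<open>U\<close> their range, so both geometries are treated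
  together.\<close>

locale curvature_flow =
  fixes U :: "(real^'n) set" and k :: "real^'n \<Rightarrow> real^'n" and a :: real and R :: "'n \<Rightarrow> real" and C :: real
  assumes open_U: "open U" and cont_k: "continuous_on U k"
    and mono_k: "\<And>u v. u \<in> U \<Longrightarrow> v \<in> U \<Longrightarrow> (u - v) \<bullet> (k u - k v) \<ge> 0"
    and bound_k: "\<And>u i. \<bar>k u $ i\<bar> \<le> C"
begin

definition field :: "real^'n \<Rightarrow> real^'n" where
  "field u = (\<chi> i. R i - k u $ i / exp (a * u$i))"

definition is_sol :: "ereal \<Rightarrow> (real \<Rightarrow> real^'n) \<Rightarrow> bool" where
  "is_sol T u \<longleftrightarrow> (\<forall>t\<in>time_dom T. u t \<in> U \<and>
     (\<forall>i. ((\<lambda>s. u s $ i) has_real_derivative field (u t) $ i) (at t within time_dom T)))"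

lemma C_nonneg: "C \<ge> 0" using bound_k[of 0 undefined] abs_ge_zero order_trans by blast

lemma continuous_on_field: "continuous_on U field"
  unfolding field_def
  by (intro continuous_on_vec_lambda continuous_intros continuous_on_component cont_k) auto

lemma sol_in: "is_sol T u \<Longrightarrow> t \<in> time_dom T \<Longrightarrow> u t \<in> U"
  by (simp add: is_sol_def)

lemma sol_continuous: "is_sol T u \<Longrightarrow> continuous_on (time_dom T) u"
proof -
  assume s: "is_sol T u"
  have "continuous_on (time_dom T) (\<lambda>t. u t $ i)" for i
    using s unfolding is_sol_def by (intro DERIV_continuous_on[where D="\<lambda>t. field (u t) $ i"]) auto
  then have "continuous_on (time_dom T) (\<lambda>t. \<chi> i. u t $ i)" by (intro continuous_on_vec_lambda)
  then show ?thesis by simp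
qed

lemma sol_DERIV: "is_sol T u \<Longrightarrow> t \<in> time_dom T \<Longrightarrow> 0 < t \<Longrightarrow> ((\<lambda>s. u s $ i) has_real_derivative field (u t) $ i) (at t)"
  using at_within_time_dom[of t T] by (auto simp: is_sol_def)

lemma sol_continuous_interval: "is_sol T u \<Longrightarrow> t \<in> time_dom T \<Longrightarrow> continuous_on {0..t} u"
  using sol_continuous continuous_on_subset time_dom_interval by blast

lemma sol_restrict:
  assumes "is_sol T u" "T' \<le> T" shows "is_sol T' u"
proof -
  have sub: "time_dom T' \<subseteq> time_dom T" using assms(2) by (auto simp: time_dom_def)
  show ?thesis using assms(1) sub has_field_derivative_subset[OF _ sub] unfolding is_sol_def by blast
qed

lemma exp_field: "exp (a * u$i) * field u $ i = R i * exp (a * u$i) - k u $ i"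
  by (simp add: field_def algebra_simps)

text \<open>Multiplied by \<open>exp (a u)\<close> the right-hand side is a monotone term plus a Lipschitz one, so the
  weighted square distance of two solutions satisfies a Gronwall inequality.\<close>

lemma weighted_distance_gronwall:
  assumes uv: "u \<in> U" "v \<in> U" and K: "\<And>i. \<bar>u$i\<bar> \<le> K" "\<And>i. \<bar>v$i\<bar> \<le> K"
  defines "B \<equiv> \<bar>a\<bar> * ((\<Sum>i\<in>UNIV. \<bar>R i\<bar>) * exp (\<bar>a\<bar> * K) + C) + 2 * \<bar>a\<bar> * exp (\<bar>a\<bar> * (2 * K)) * C"
  shows "(\<Sum>i\<in>UNIV. a * field u $ i * exp (a * u$i) * (u$i - v$i)\<^sup>2 + exp (a * u$i) * (2 * (field u $ i - field v $ i) * (u$i - v$i)))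
    \<le> B * exp (\<bar>a\<bar> * K) * (\<Sum>i\<in>UNIV. exp (a * u$i) * (u$i - v$i)\<^sup>2)"
proof -
  have B0: "B \<ge> 0" unfolding B_def using C_nonneg by (intro add_nonneg_nonneg mult_nonneg_nonneg sum_nonneg) auto
  have aK: "\<bar>a * x\<bar> \<le> \<bar>a\<bar> * c" if "\<bar>x\<bar> \<le> c" for x c
    using that by (simp add: abs_mult mult_left_mono)
  have summand: "a * field u $ i * exp (a * u$i) * (u$i - v$i)\<^sup>2 + exp (a * u$i) * (2 * (field u $ i - field v $ i) * (u$i - v$i))
     \<le> B * (u$i - v$i)\<^sup>2 - 2 * ((u$i - v$i) * (k u $ i - k v $ i))" for i
  proof -
    define d where "d = u$i - v$i"
    define E where "E = exp (a * u$i)"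
    have E: "E \<le> exp (\<bar>a\<bar> * K)" "E > 0" using aK[OF K(1)[of i]] by (auto simp: E_def)
    have Ri: "\<bar>R i\<bar> \<le> (\<Sum>i\<in>UNIV. \<bar>R i\<bar>)" by (rule member_le_sum) auto
    have "\<bar>R i * E - k u $ i\<bar> \<le> \<bar>R i\<bar> * E + C"
      using bound_k[of u i] E(2) abs_triangle_ineq4[of "R i * E" "k u $ i"] by (simp add: abs_mult)
    also have "\<dots> \<le> (\<Sum>i\<in>UNIV. \<bar>R i\<bar>) * exp (\<bar>a\<bar> * K) + C"
      using mult_mono[OF Ri E(1)] E(2) by (simp add: sum_nonneg)
    finally have G: "\<bar>R i * E - k u $ i\<bar> \<le> (\<Sum>i\<in>UNIV. \<bar>R i\<bar>) * exp (\<bar>a\<bar> * K) + C" .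
    have "a * (R i * E - k u $ i) \<le> \<bar>a\<bar> * ((\<Sum>i\<in>UNIV. \<bar>R i\<bar>) * exp (\<bar>a\<bar> * K) + C)"
      using abs_ge_self[of "a * (R i * E - k u $ i)"] mult_left_mono[OF G, of "\<bar>a\<bar>"] by (simp add: abs_mult)
    then have 1: "a * (R i * E - k u $ i) * d\<^sup>2 \<le> \<bar>a\<bar> * ((\<Sum>i\<in>UNIV. \<bar>R i\<bar>) * exp (\<bar>a\<bar> * K) + C) * d\<^sup>2"
      by (rule mult_right_mono) simp
    have ad: "\<bar>a * d\<bar> \<le> \<bar>a\<bar> * (2 * K)" unfolding d_def using K(1)[of i] K(2)[of i] by (intro aK) linarith
    have ex: "\<bar>exp (a * d) - 1\<bar> \<le> \<bar>a * d\<bar> * exp (\<bar>a\<bar> * (2 * K))"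
    proof -
      have p: "exp x - 1 \<le> x * exp x" for x :: real
        using exp_ge_add_one_self[of "-x"] by (simp add: exp_minus field_simps)
      have "\<bar>exp x - 1\<bar> \<le> \<bar>x\<bar> * exp \<bar>x\<bar>" for x :: real
      proof (cases "x \<ge> 0")
        case True then show ?thesis using p[of x] by simp
      next
        case False
        have "1 - exp x \<le> - x" using exp_ge_add_one_self[of x] by linarith
        also have "- x \<le> - x * exp (- x)" using False by (simp add: mult_le_cancel_left1)
        finally show ?thesis using False by simp
      qed
      from this[of "a * d"] show ?thesis
        using mult_left_mono[of "exp \<bar>a * d\<bar>" "exp (\<bar>a\<bar> * (2 * K))" "\<bar>a * d\<bar>"] ad by simp
    qed
    have "(exp (a * d) - 1) * k v $ i * d \<le> \<bar>(exp (a * d) - 1) * k v $ i * d\<bar>" by (rule abs_ge_self)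
    also have "\<dots> = \<bar>exp (a * d) - 1\<bar> * \<bar>k v $ i\<bar> * \<bar>d\<bar>" by (simp add: abs_mult)
    also have "\<dots> \<le> (\<bar>a * d\<bar> * exp (\<bar>a\<bar> * (2 * K))) * C * \<bar>d\<bar>"
      using ex bound_k[of v i] by (intro mult_right_mono mult_mono) auto
    also have "\<dots> = (\<bar>a * d\<bar> * \<bar>d\<bar>) * (exp (\<bar>a\<bar> * (2 * K)) * C)" by (simp only: mult_ac)
    also have "\<bar>a * d\<bar> * \<bar>d\<bar> = \<bar>a\<bar> * d\<^sup>2" by (simp add: abs_mult power2_eq_square mult.assoc)
    also have "\<bar>a\<bar> * d\<^sup>2 * (exp (\<bar>a\<bar> * (2 * K)) * C) = \<bar>a\<bar> * exp (\<bar>a\<bar> * (2 * K)) * C * d\<^sup>2" by (simp only: mult_ac)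
    finally have 2: "(exp (a * d) - 1) * k v $ i * d \<le> \<bar>a\<bar> * exp (\<bar>a\<bar> * (2 * K)) * C * d\<^sup>2" .
    \<comment> \<open>The rate of \<open>v\<close> has to be weighed with the exponential of
      \<open>u\<close>. Splitting off \<open>exp (a * d)\<close> leaves the error
      \<open>(exp (a * d) - 1) * k v\<close>, which is of order \<open>d\<close> and is absorbed
      into \<open>B\<close>.\<close>
    have ee: "exp (a * d) * exp (a * v$i) = E"
      by (simp add: E_def d_def right_diff_distrib flip: exp_add)
    have "E * field v $ i = exp (a * d) * (exp (a * v$i) * field v $ i)"
      unfolding ee[symmetric] by (rule mult.assoc)
    also have "\<dots> = R i * (exp (a * d) * exp (a * v$i)) - exp (a * d) * k v $ i"
      unfolding exp_field by (simp add: right_diff_distrib)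
    also have "\<dots> = R i * E - exp (a * d) * k v $ i" unfolding ee ..
    finally have Ev: "E * field v $ i = R i * E - exp (a * d) * k v $ i" .
    have Eu: "E * field u $ i = R i * E - k u $ i" unfolding E_def by (rule exp_field)
    have "a * field u $ i * E * d\<^sup>2 + E * (2 * (field u $ i - field v $ i) * d)
        = a * (E * field u $ i) * d\<^sup>2 + 2 * d * (E * field u $ i - E * field v $ i)" by algebra
    also have "\<dots> = a * (R i * E - k u $ i) * d\<^sup>2 + 2 * ((exp (a * d) - 1) * k v $ i * d) - 2 * (d * (k u $ i - k v $ i))"
      unfolding Eu Ev by algebra
    also have "\<dots> \<le> B * d\<^sup>2 - 2 * (d * (k u $ i - k v $ i))"
      using 1 2 unfolding B_def by (simp add: algebra_simps)
    finally show ?thesis unfolding d_def E_def .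
  qed
  have "(\<Sum>i\<in>UNIV. a * field u $ i * exp (a * u$i) * (u$i - v$i)\<^sup>2 + exp (a * u$i) * (2 * (field u $ i - field v $ i) * (u$i - v$i)))
     \<le> (\<Sum>i\<in>UNIV. B * (u$i - v$i)\<^sup>2 - 2 * ((u$i - v$i) * (k u $ i - k v $ i)))"
    by (rule sum_mono) (rule summand)
  also have "\<dots> = B * (\<Sum>i\<in>UNIV. (u$i - v$i)\<^sup>2) - 2 * ((u - v) \<bullet> (k u - k v))"
    by (simp add: sum_subtractf sum_distrib_left inner_vec_def)
  also have "\<dots> \<le> B * (\<Sum>i\<in>UNIV. (u$i - v$i)\<^sup>2)" using mono_k[OF uv] by simp
  also have "\<dots> \<le> B * (exp (\<bar>a\<bar> * K) * (\<Sum>i\<in>UNIV. exp (a * u$i) * (u$i - v$i)\<^sup>2))"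
  proof (rule mult_left_mono[OF _ B0])
    have "(u$i - v$i)\<^sup>2 \<le> exp (\<bar>a\<bar> * K) * (exp (a * u$i) * (u$i - v$i)\<^sup>2)" for i
    proof -
      have "1 \<le> exp (\<bar>a\<bar> * K + a * u$i)" using aK[OF K(1)[of i]] by simp
      then have "1 * (u$i - v$i)\<^sup>2 \<le> exp (\<bar>a\<bar> * K + a * u$i) * (u$i - v$i)\<^sup>2" by (rule mult_right_mono) simp
      then show ?thesis by (simp add: exp_add mult_ac)
    qed
    then show "(\<Sum>i\<in>UNIV. (u$i - v$i)\<^sup>2) \<le> exp (\<bar>a\<bar> * K) * (\<Sum>i\<in>UNIV. exp (a * u$i) * (u$i - v$i)\<^sup>2)"
      unfolding sum_distrib_left by (rule sum_mono)
  qed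
  finally show ?thesis by (simp add: mult.assoc)
qed

text \<open>On the compact interval up to \<open>t\<close> both solutions are bounded, which fixes
  the Gronwall constant \<open>M\<close>. The weighted square distance \<open>e\<close>, multiplied
  by \<open>exp (- M * s)\<close>, does not increase and starts at 0.\<close>

lemma sol_unique:
  assumes s: "is_sol T1 u" "is_sol T2 v" and 0: "u 0 = v 0" and t: "t \<in> time_dom T1" "t \<in> time_dom T2"
  shows "u t = v t"
proof -
  have t0: "0 \<le> t" using t by (simp add: time_dom_def)
  have cu: "continuous_on {0..t} u" and cv: "continuous_on {0..t} v"
    using sol_continuous_interval s t by blast+
  obtain K1 where "\<forall>y\<in>u ` {0..t}. norm y \<le> K1"
    using compact_imp_bounded[OF compact_continuous_image[OF cu compact_Icc]] unfolding bounded_iff by blast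
  then have K1: "norm (u s) \<le> K1" if "s \<in> {0..t}" for s using that by blast
  obtain K2 where "\<forall>y\<in>v ` {0..t}. norm y \<le> K2"
    using compact_imp_bounded[OF compact_continuous_image[OF cv compact_Icc]] unfolding bounded_iff by blast
  then have K2: "norm (v s) \<le> K2" if "s \<in> {0..t}" for s using that by blast
  define K where "K = max K1 K2"
  have K: "\<bar>u s $ i\<bar> \<le> K" "\<bar>v s $ i\<bar> \<le> K" if "s \<in> {0..t}" for s i
    using K1[OF that] K2[OF that] component_le_norm_cart[of "u s" i] component_le_norm_cart[of "v s" i]
    unfolding K_def by linarith+
  define M where "M = (\<bar>a\<bar> * ((\<Sum>i\<in>UNIV. \<bar>R i\<bar>) * exp (\<bar>a\<bar> * K) + C) + 2 * \<bar>a\<bar> * exp (\<bar>a\<bar> * (2 * K)) * C) * exp (\<bar>a\<bar> * K)"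
  define e where "e = (\<lambda>s. \<Sum>i\<in>UNIV. exp (a * u s $ i) * (u s $ i - v s $ i)\<^sup>2)"
  have ec: "continuous_on {0..t} e"
    unfolding e_def by (intro continuous_intros continuous_on_component cu cv)
  have "e t * exp (- M * t) \<le> e 0 * exp (- M * 0)"
  proof (rule nonincreasing_except_finite_values[where V="{}" and g="\<lambda>s. e s * exp (- M * s)"])
    show "continuous_on {0..t} (\<lambda>s. e s * exp (- M * s))" by (intro continuous_intros ec)
    fix s assume s': "0 < s" "s < t"
    have sT: "s \<in> time_dom T1" "s \<in> time_dom T2" using s' time_dom_interval[OF t(1)] time_dom_interval[OF t(2)] by auto
    define e' where "e' = (\<Sum>i\<in>UNIV. a * field (u s) $ i * exp (a * u s $ i) * (u s $ i - v s $ i)\<^sup>2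
        + exp (a * u s $ i) * (2 * (field (u s) $ i - field (v s) $ i) * (u s $ i - v s $ i)))"
    have de: "(e has_real_derivative e') (at s)"
      unfolding e_def e'_def
    proof (rule DERIV_sum)
      fix i
      note du = sol_DERIV[OF s(1) sT(1) s'(1), of i] and dv = sol_DERIV[OF s(2) sT(2) s'(1), of i]
      show "((\<lambda>s. exp (a * u s $ i) * (u s $ i - v s $ i)\<^sup>2) has_real_derivative
         a * field (u s) $ i * exp (a * u s $ i) * (u s $ i - v s $ i)\<^sup>2
        + exp (a * u s $ i) * (2 * (field (u s) $ i - field (v s) $ i) * (u s $ i - v s $ i))) (at s)"
        by (auto intro!: derivative_eq_intros du dv simp: algebra_simps)
    qed
    have "e' \<le> M * e s"
      unfolding e'_def M_def e_def
      by (rule weighted_distance_gronwall) (use sol_in[OF s(1) sT(1)] sol_in[OF s(2) sT(2)] K s' in auto)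
    moreover have "((\<lambda>s. e s * exp (- M * s)) has_real_derivative (e' - M * e s) * exp (- M * s)) (at s)"
      by (auto intro!: derivative_eq_intros de simp: algebra_simps)
    ultimately show "\<exists>d\<le>0. ((\<lambda>s. e s * exp (- M * s)) has_real_derivative d) (at s)"
      by (intro exI[of _ "(e' - M * e s) * exp (- M * s)"]) (simp add: mult_nonpos_nonneg)
  qed (use t0 in auto)
  also have "e 0 = 0" by (simp add: e_def 0)
  finally have "e t \<le> 0" by (simp add: mult_le_0_iff not_le)
  moreover have nn: "exp (a * u t $ i) * (u t $ i - v t $ i)\<^sup>2 \<ge> 0" for i by simp
  ultimately have "e t = 0" by (simp add: e_def sum_nonneg antisym)
  then have "exp (a * u t $ i) * (u t $ i - v t $ i)\<^sup>2 = 0" for i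
    unfolding e_def using nn by (subst (asm) sum_nonneg_eq_0_iff) auto
  then show ?thesis by (simp add: vec_eq_iff)
qed

text \<open>Composing the field with the projection onto a closed box makes it bounded and
  continuous on the whole space, as \<open>peano\<close> demands. The result solves the true
  equation for as long as it stays in the open box.\<close>

lemma boxed_solution:
  assumes box: "cbox lo hi \<subseteq> U" "u0 \<in> box lo hi" and L: "L > 0"
  shows "\<exists>u \<tau>. 0 < \<tau> \<and> \<tau> \<le> L \<and> u 0 = u0 \<and> is_sol (ereal \<tau>) u \<and> continuous_on {0..\<tau>} u \<and> (\<tau> = L \<or> u \<tau> \<notin> box lo hi)"
proof -
  have ne: "cbox lo hi \<noteq> {}" using box(2) box_subset_cbox by blast
  define g where "g = (\<lambda>u. field (clamp lo hi u))"
  have cl: "clamp lo hi u \<in> cbox lo hi" for u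
    using ne by (intro clamp_in_interval) (simp add: box_ne_empty)
  have clc: "continuous_on UNIV (clamp lo hi)"
    by (rule clamp_continuous_on[OF continuous_on_id])
  have g: "continuous_on UNIV g" unfolding g_def
    using cl box(1) by (intro continuous_on_compose2[OF continuous_on_field clc]) auto
  have cf: "compact (field ` cbox lo hi)"
    using continuous_on_subset[OF continuous_on_field box(1)] by (intro compact_continuous_image) auto
  obtain B where "\<forall>y\<in>field ` cbox lo hi. norm y \<le> B"
    using compact_imp_bounded[OF cf] unfolding bounded_iff by blast
  then have B: "norm (field u) \<le> B" if "u \<in> cbox lo hi" for u using that by blast
  have Bg: "norm (g x) \<le> B" for x unfolding g_def by (rule B[OF cl])
  obtain u where u: "u 0 = u0" "\<And>t. t \<in> {0..L} \<Longrightarrow> (u has_vector_derivative g (u t)) (at t within {0..L})"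
    using peano[OF g Bg L, of u0] by blast
  have uc: "continuous_on {0..L} u" by (rule continuous_on_vector_derivative[OF u(2)])
  have "\<exists>\<tau>. 0 < \<tau> \<and> \<tau> \<le> L \<and> (\<tau> = L \<or> u \<tau> \<notin> box lo hi) \<and> (\<forall>t. 0 \<le> t \<and> t < \<tau> \<longrightarrow> u t \<in> box lo hi)"
  proof (cases "\<exists>s\<in>{0..L}. u s \<notin> box lo hi")
    case True
    then obtain s where "0 \<le> s" "s \<le> L" "u s \<notin> box lo hi" by auto
    have "u 0 \<in> box lo hi" using u(1) box(2) by simp
    from first_exit[OF uc open_box this \<open>0 \<le> s\<close> \<open>s \<le> L\<close> \<open>u s \<notin> box lo hi\<close>] obtain \<tau>
      where "0 < \<tau>" "\<tau> \<le> s" "u \<tau> \<notin> box lo hi" "\<forall>t. 0 \<le> t \<and> t < \<tau> \<longrightarrow> u t \<in> box lo hi" by blast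
    then show ?thesis using \<open>s \<le> L\<close> by (intro exI[of _ \<tau>]) auto
  next
    case False
    then show ?thesis using L by (intro exI[of _ L]) auto
  qed
  then obtain \<tau> where t: "0 < \<tau>" "\<tau> \<le> L" "\<tau> = L \<or> u \<tau> \<notin> box lo hi" "\<And>t. 0 \<le> t \<Longrightarrow> t < \<tau> \<Longrightarrow> u t \<in> box lo hi"
    by blast
  have "is_sol (ereal \<tau>) u" unfolding is_sol_def
  proof (intro ballI conjI allI)
    fix r i assume r: "r \<in> time_dom (ereal \<tau>)"
    then have b: "u r \<in> box lo hi" using t(4) by simp
    then have c: "u r \<in> cbox lo hi" using box_subset_cbox[of lo hi] by (rule subsetD[rotated])
    show "u r \<in> U" using c box(1) by (rule subsetD[rotated])
    have "g (u r) = field (u r)" unfolding g_def clamp_cancel_cbox[OF c] ..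
    then have "(u has_vector_derivative field (u r)) (at r within {0..L})" using u(2)[of r] r t by simp
    then have "((\<lambda>s. u s $ i) has_vector_derivative field (u r) $ i) (at r within {0..L})"
      by (rule bounded_linear.has_vector_derivative[OF bounded_linear_vec_nth])
    then have "((\<lambda>s. u s $ i) has_real_derivative field (u r) $ i) (at r within {0..L})"
      by (simp add: has_real_derivative_iff_has_vector_derivative)
    then show "((\<lambda>s. u s $ i) has_real_derivative field (u r) $ i) (at r within time_dom (ereal \<tau>))"
      by (rule has_field_derivative_subset) (use t in auto)
  qed
  moreover have "continuous_on {0..\<tau>} u" using uc t by (auto intro: continuous_on_subset)
  ultimately show ?thesis using t(1-3) u(1) by (intro exI[of _ u] exI[of _ \<tau>]) simp
qed

lemma local_solution:
  assumes "u0 \<in> U" shows "\<exists>\<tau> u. 0 < \<tau> \<and> is_sol (ereal \<tau>) u \<and> u 0 = u0"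
proof -
  obtain lo hi where b: "cbox lo hi \<subseteq> U" "u0 \<in> box lo hi"
    using open_UNIV open_contains_cbox[OF open_U assms] by metis
  show ?thesis using boxed_solution[OF b, of 1] by auto
qed

text \<open>The a priori set \<open>K\<close> is closed and inside the open box, so the end point of
  a boxed solution, a limit of points of \<open>K\<close>, has not left the box; the solution lasts
  for any prescribed time.\<close>

lemma global_solution:
  assumes K: "closed K" "K \<subseteq> box lo hi" "cbox lo hi \<subseteq> U" and u0: "u0 \<in> K"
    and apriori: "\<And>T u t. 0 < T \<Longrightarrow> is_sol T u \<Longrightarrow> u 0 = u0 \<Longrightarrow> t \<in> time_dom T \<Longrightarrow> u t \<in> K"
  shows "\<exists>u. is_sol \<infinity> u \<and> u 0 = u0"
proof -
  have "\<exists>u. is_sol (ereal (real n + 1)) u \<and> u 0 = u0" for n :: nat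
  proof -
    obtain u \<tau> where u: "0 < \<tau>" "\<tau> \<le> real n + 1" "u 0 = u0" "is_sol (ereal \<tau>) u" "continuous_on {0..\<tau>} u"
      "\<tau> = real n + 1 \<or> u \<tau> \<notin> box lo hi"
      using boxed_solution[OF K(3), of u0 "real n + 1"] K(2) u0 by auto
    have "u \<tau> \<in> K"
    proof (rule ccontr)
      assume "u \<tau> \<notin> K"
      have "closure {0..<\<tau>} = {0..\<tau>}" using u(1) by simp
      moreover have "u ` {0..<\<tau>} \<subseteq> K" using apriori[OF _ u(4,3)] u(1) by auto
      ultimately have "u ` {0..\<tau>} \<subseteq> K"
        using image_closure_subset[of "{0..<\<tau>}" u K] u(5) K(1) by simp
      moreover have "u \<tau> \<in> u ` {0..\<tau>}" using u(1) by simp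
      ultimately show False using \<open>u \<tau> \<notin> K\<close> by blast
    qed
    then show ?thesis using u K(2) by auto
  qed
  then obtain x where x: "\<And>n. is_sol (ereal (real n + 1)) (x n)" "\<And>n. x n 0 = u0" by metis
  \<comment> \<open>Any index \<open>n\<close> with \<open>t < n + 1\<close> would give the same
    value by uniqueness; rounding up selects one.\<close>
  define h where "h = (\<lambda>t. x (nat \<lceil>t\<rceil>) t)"
  have hx: "h t = x n t" if "0 \<le> t" "t < real n + 1" for n t
    unfolding h_def
  proof (rule sol_unique[OF x(1) x(1)])
    have "t < real (nat \<lceil>t\<rceil>) + 1" by linarith
    then show "t \<in> time_dom (ereal (real (nat \<lceil>t\<rceil>) + 1))" using that(1) unfolding time_dom_real by (simp only: atLeastLessThan_iff)
  qed (use x(2) that in auto)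
  have "is_sol \<infinity> h" unfolding is_sol_def
  proof (intro ballI conjI allI)
    fix t i assume t: "t \<in> time_dom \<infinity>"
    define n where "n = nat \<lceil>t\<rceil>"
    have tn: "0 \<le> t" "t < real n + 1" using t unfolding n_def by (auto simp: less_eq_real_def) linarith+
    then have td: "t \<in> time_dom (ereal (real n + 1))" by simp
    show "h t \<in> U" using hx[OF tn] sol_in[OF x(1) td] by simp
    have "((\<lambda>s. x n s $ i) has_real_derivative field (x n t) $ i) (at t within time_dom (ereal (real n + 1)))"
      using x(1)[of n] td unfolding is_sol_def by blast
    then have "((\<lambda>s. h s $ i) has_real_derivative field (x n t) $ i) (at t within time_dom (ereal (real n + 1)))"
      by (rule has_field_derivative_transform_within[OF _ zero_less_one td]) (use hx in auto)
    then show "((\<lambda>s. h s $ i) has_real_derivative field (h t) $ i) (at t within time_dom \<infinity>)"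
      using at_within_time_dom_less[OF td t] hx[OF tn] by simp
  qed
  moreover have "h 0 = u0" using hx[of 0 0] x(2) by simp
  ultimately show ?thesis by blast
qed

lemma sol_speed:
  assumes s: "is_sol T u" and t: "t1 \<in> time_dom T" "0 \<le> t0" "t0 \<le> t1"
    and B: "\<And>t. t0 < t \<Longrightarrow> t < t1 \<Longrightarrow> norm (field (u t)) \<le> B"
  shows "norm (u t1 - u t0) \<le> real CARD('n) * B * (t1 - t0)"
proof (cases "t0 = t1")
  case False
  then have lt: "t0 < t1" using t by simp
  have "\<bar>u t1 $ i - u t0 $ i\<bar> \<le> B * (t1 - t0)" for i
  proof -
    have "continuous_on {t0..t1} (\<lambda>t. u t $ i)"
      by (intro continuous_on_component continuous_on_subset[OF sol_continuous_interval[OF s t(1)]]) (use t in auto)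
    moreover have d: "((\<lambda>t. u t $ i) has_real_derivative field (u t) $ i) (at t)" if "t0 < t" "t < t1" for t
      using that t time_dom_interval[OF t(1)] by (intro sol_DERIV[OF s]) auto
    ultimately obtain l z where z: "t0 < z" "z < t1" "((\<lambda>t. u t $ i) has_real_derivative l) (at z)"
      "u t1 $ i - u t0 $ i = (t1 - t0) * l"
      using MVT[OF lt, of "\<lambda>t. u t $ i"] by (meson real_differentiable_def)
    have "l = field (u z) $ i" using DERIV_unique[OF z(3) d[OF z(1,2)]] .
    then have "\<bar>l\<bar> \<le> B" using B[OF z(1,2)] component_le_norm_cart[of "field (u z)" i] by simp
    then show ?thesis using lt unfolding z(4) by (simp add: abs_mult mult.commute mult_right_mono)
  qed
  then have "(\<Sum>i\<in>UNIV. \<bar>(u t1 - u t0) $ i\<bar>) \<le> (\<Sum>i\<in>(UNIV::'n set). B * (t1 - t0))"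
    by (intro sum_mono) simp
  then show ?thesis using norm_le_l1_cart[of "u t1 - u t0"] by (simp add: mult.assoc)
qed simp

text \<open>Convergence along one sequence of times becomes convergence for all times: near
  \<open>q\<close> the speed is bounded, so once \<open>u (t n)\<close> is within half the radius of
  \<open>q\<close>, the time left before \<open>\<tau>\<close> is too short to leave the
  ball.\<close>

lemma sol_limit:
  assumes s: "is_sol (ereal \<tau>) u" and tn: "\<And>n. t n \<in> {0..<\<tau>}" "t \<longlonglongrightarrow> \<tau>"
    and q: "(\<lambda>n. u (t n)) \<longlonglongrightarrow> q" "q \<in> U" and e: "e > 0"
  shows "\<exists>d<\<tau>. \<forall>r. d < r \<and> r < \<tau> \<longrightarrow> dist (u r) q < e"
proof -
  obtain e0 where e0: "e0 > 0" "cball q e0 \<subseteq> U" using open_U q(2) open_contains_cball by blast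
  define \<epsilon> where "\<epsilon> = min e e0"
  have eps: "\<epsilon> > 0" "cball q \<epsilon> \<subseteq> U" using e e0 by (auto simp: \<epsilon>_def)
  have cf: "compact (field ` cball q \<epsilon>)"
    using continuous_on_subset[OF continuous_on_field eps(2)] by (intro compact_continuous_image) auto
  obtain B where "\<forall>y\<in>field ` cball q \<epsilon>. norm y \<le> B"
    using compact_imp_bounded[OF cf] unfolding bounded_iff by blast
  then have B: "norm (field u) \<le> B" if "u \<in> cball q \<epsilon>" for u using that by blast
  define M where "M = real CARD('n) * \<bar>B\<bar> + 1"
  have M: "M > 0" by (simp add: M_def add_nonneg_pos)
  have "\<forall>\<^sub>F n in sequentially. dist (u (t n)) q < \<epsilon>/2" "\<forall>\<^sub>F n in sequentially. dist (t n) \<tau> < \<epsilon>/2/M"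
    using tendstoD[OF q(1), of "\<epsilon>/2"] tendstoD[OF tn(2), of "\<epsilon>/2/M"] eps M by auto
  then have "\<forall>\<^sub>F n in sequentially. dist (u (t n)) q < \<epsilon>/2 \<and> dist (t n) \<tau> < \<epsilon>/2/M"
    by (rule eventually_conj)
  then obtain n where n: "dist (u (t n)) q < \<epsilon>/2" "dist (t n) \<tau> < \<epsilon>/2/M"
    by (auto simp: eventually_sequentially)
  have tn': "0 \<le> t n" "t n < \<tau>" using tn(1)[of n] by auto
  have "u r \<in> ball q \<epsilon>" if r: "t n < r" "r < \<tau>" for r
  proof (rule ccontr)
    assume nb: "u r \<notin> ball q \<epsilon>"
    have cont: "continuous_on {t n..r} u"
      using sol_continuous_interval[OF s, of r] r tn' by (auto intro: continuous_on_subset)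
    have "u (t n) \<in> ball q \<epsilon>" using n eps by (auto simp: dist_commute)
    from first_exit[OF cont open_ball this _ _ nb] r obtain \<sigma> where
      sg: "t n < \<sigma>" "\<sigma> \<le> r" "u \<sigma> \<notin> ball q \<epsilon>" "\<And>x. t n \<le> x \<Longrightarrow> x < \<sigma> \<Longrightarrow> u x \<in> ball q \<epsilon>" by auto
    have "norm (u \<sigma> - u (t n)) \<le> real CARD('n) * \<bar>B\<bar> * (\<sigma> - t n)"
    proof (rule sol_speed[OF s])
      fix x assume "t n < x" "x < \<sigma>"
      then show "norm (field (u x)) \<le> \<bar>B\<bar>" using B[of "u x"] sg(4)[of x] by (force simp: mem_ball mem_cball)
    qed (use tn' sg r in auto)
    also have "\<dots> \<le> M * (\<tau> - t n)" using sg r M by (intro mult_mono) (auto simp: M_def)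
    also have "\<dots> < \<epsilon>/2" using n(2) tn' M by (simp add: dist_real_def pos_less_divide_eq mult_ac)
    finally have "dist (u \<sigma>) q < \<epsilon>" using n(1) dist_triangle[of "u \<sigma>" q "u (t n)"] by (simp add: dist_norm)
    then show False using sg(3) by (simp add: dist_commute)
  qed
  then show ?thesis using tn' by (intro exI[of _ "t n"]) (auto simp: \<epsilon>_def dist_commute)
qed

text \<open>The solution is continued by a local solution started at \<open>q\<close>. At
  \<open>\<tau>\<close> itself the derivative comes from the integral equation: \<open>h\<close> is
  continuous and solves the differential equation off \<open>\<tau>\<close>, and the fundamental
  theorem tolerates one exceptional point.\<close>

lemma sol_extend:
  assumes \<tau>: "0 < \<tau>" and s: "is_sol (ereal \<tau>) u" and tn: "\<And>n. t n \<in> {0..<\<tau>}" "t \<longlonglongrightarrow> \<tau>"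
    and q: "(\<lambda>n. u (t n)) \<longlonglongrightarrow> q" "q \<in> U"
  shows "\<exists>T h. \<tau> < T \<and> is_sol (ereal T) h \<and> (\<forall>r\<in>{0..<\<tau>}. h r = u r)"
proof -
  obtain \<sigma> v where v: "0 < \<sigma>" "is_sol (ereal \<sigma>) v" "v 0 = q" using local_solution[OF q(2)] by blast
  define h where "h = (\<lambda>r. if r < \<tau> then u r else v (r - \<tau>))"
  \<comment> \<open>Half of the life span of \<open>v\<close>, so that \<open>h\<close> is
    continuous on the closed interval up to \<open>T\<close>.\<close>
  define T where "T = \<tau> + \<sigma> / 2"
  have T: "\<tau> < T" "T < \<tau> + \<sigma>" using v(1) by (auto simp: T_def)
  have hU: "h r \<in> U" if "0 \<le> r" "r \<le> T" for r
    using sol_in[OF s] sol_in[OF v(2)] that T by (auto simp: h_def)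
  have ctv: "continuous_on {\<tau>..T} (\<lambda>r. v (r - \<tau>))"
    by (rule continuous_on_compose2[OF sol_continuous[OF v(2)]]) (use T in \<open>auto intro!: continuous_intros\<close>)
  have hc: "continuous_on {0..T} h"
  proof -
    have cu: "continuous_on {0..\<tau>} (\<lambda>r. if r = \<tau> then q else u r)"
      unfolding continuous_on_eq_continuous_within
    proof
      fix r assume r: "r \<in> {0..\<tau>}"
      show "continuous (at r within {0..\<tau>}) (\<lambda>r. if r = \<tau> then q else u r)"
      proof (cases "r = \<tau>")
        case True
        show ?thesis unfolding True continuous_within_eps_delta
        proof (intro allI impI)
          fix e :: real assume e: "e > 0"
          obtain d where d: "d < \<tau>" "\<And>r. d < r \<Longrightarrow> r < \<tau> \<Longrightarrow> dist (u r) q < e"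
            using sol_limit[OF s tn q e] by blast
          have "dist (if x' = \<tau> then q else u x') (if \<tau> = \<tau> then q else u \<tau>) < e"
            if "x' \<in> {0..\<tau>}" "dist x' \<tau> < \<tau> - d" for x'
            using that d(2)[of x'] e by (auto simp: dist_real_def)
          then show "\<exists>d>0. \<forall>x'\<in>{0..\<tau>}. dist x' \<tau> < d \<longrightarrow>
              dist (if x' = \<tau> then q else u x') (if \<tau> = \<tau> then q else u \<tau>) < e"
            using d(1) by (intro exI[of _ "\<tau> - d"]) auto
        qed
      next
        case False
        then have rt: "r \<in> {0..<\<tau>}" using r by auto
        then have "continuous (at r within {0..<\<tau>}) u"
          using sol_continuous[OF s] by (simp add: continuous_on_eq_continuous_within)
        moreover have "at r within {0..\<tau>} = at r within {0..<\<tau>}"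
          by (rule at_within_nhd[of r "{..<\<tau>}"]) (use rt in auto)
        ultimately have "continuous (at r within {0..\<tau>}) u" by simp
        then show ?thesis
          by (rule continuous_transform_within[where \<delta>="\<tau> - r"]) (use rt in \<open>auto simp: dist_real_def\<close>)
      qed
    qed
    define f1 f2 where "f1 = (\<lambda>r. if r = \<tau> then q else u r)" and "f2 = (\<lambda>r. v (r - \<tau>))"
    have heq: "h = (\<lambda>r. if r < \<tau> then f1 r else f2 r)"
      unfolding h_def f1_def f2_def by (rule ext) simp
    have agree: "f1 x = f2 x" if "x = \<tau>" for x using that v(3) by (simp add: f1_def f2_def)
    have "continuous_on ({0..\<tau>} \<union> {\<tau>..T}) h" unfolding heq
    proof (rule continuous_on_If)
      show "continuous_on {0..\<tau>} f1" unfolding f1_def by (rule cu)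
      show "continuous_on {\<tau>..T} f2" unfolding f2_def by (rule ctv)
    qed (use agree in auto)
    moreover have "{0..\<tau>} \<union> {\<tau>..T} = {0..T}" using \<tau> T by auto
    ultimately show ?thesis by simp
  qed
  have fc: "continuous_on {0..T} (\<lambda>r. field (h r) $ i)" for i
    by (intro continuous_on_component continuous_on_compose2[OF continuous_on_field hc]) (use hU in auto)
  have deriv: "((\<lambda>s. h s $ i) has_vector_derivative field (h r) $ i) (at r)" if r: "0 < r" "r < T" "r \<noteq> \<tau>" for r i
  proof (cases "r < \<tau>")
    case True
    have "((\<lambda>s. u s $ i) has_real_derivative field (u r) $ i) (at r)" by (rule sol_DERIV[OF s]) (use r True in auto)
    then have "((\<lambda>s. h s $ i) has_real_derivative field (u r) $ i) (at r)"
      by (rule has_field_derivative_transform_within_open[where S="{..<\<tau>}"]) (use True in \<open>auto simp: h_def\<close>)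
    then show ?thesis using True by (simp add: h_def has_real_derivative_iff_has_vector_derivative)
  next
    case False
    then have rt: "r > \<tau>" using r by simp
    have "((\<lambda>s. v s $ i) has_real_derivative field (v (r - \<tau>)) $ i) (at (r - \<tau>))"
      by (rule sol_DERIV[OF v(2)]) (use r rt T in auto)
    then have "((\<lambda>s. v (s - \<tau>) $ i) has_real_derivative field (v (r - \<tau>)) $ i) (at r)"
      using DERIV_shift[of "\<lambda>s. v s $ i" "field (v (r - \<tau>)) $ i" r "- \<tau>"] by simp
    then have "((\<lambda>s. h s $ i) has_real_derivative field (v (r - \<tau>)) $ i) (at r)"
      by (rule has_field_derivative_transform_within_open[where S="{\<tau><..}"]) (use rt in \<open>auto simp: h_def\<close>)
    then show ?thesis using rt by (simp add: h_def has_real_derivative_iff_has_vector_derivative)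
  qed
  have int: "h r $ i = h 0 $ i + integral {0..r} (\<lambda>s. field (h s) $ i)" if r: "r \<in> {0..T}" for r i
  proof -
    have c: "continuous_on {0..r} (\<lambda>s. h s $ i)"
      by (intro continuous_on_component continuous_on_subset[OF hc]) (use r in simp)
    have "((\<lambda>s. field (h s) $ i) has_integral (h r $ i - h 0 $ i)) {0..r}"
    proof (rule fundamental_theorem_of_calculus_interior_strong[OF _ _ _ c])
      show "finite {\<tau>}" "0 \<le> r" using r by simp_all
      fix s assume "s \<in> {0<..<r} - {\<tau>}"
      then show "((\<lambda>s. h s $ i) has_vector_derivative field (h s) $ i) (at s)" by (intro deriv) (use r in auto)
    qed
    from integral_unique[OF this] show ?thesis by simp
  qed
  have "is_sol (ereal T) h" unfolding is_sol_def
  proof (intro ballI conjI allI)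
    fix r i assume r: "r \<in> time_dom (ereal T)"
    show "h r \<in> U" using r hU by simp
    have rT: "r \<in> {0..T}" using r by simp
    have "((\<lambda>x. h 0 $ i + integral {0..x} (\<lambda>s. field (h s) $ i)) has_vector_derivative 0 + field (h r) $ i) (at r within {0..T})"
      by (intro has_vector_derivative_add has_vector_derivative_const integral_has_vector_derivative[OF fc rT])
    then have "((\<lambda>x. h x $ i) has_vector_derivative 0 + field (h r) $ i) (at r within {0..T})"
      by (rule has_vector_derivative_transform[where f="\<lambda>x. h 0 $ i + integral {0..x} (\<lambda>s. field (h s) $ i)",
            OF rT int, rotated])
    then have "((\<lambda>x. h x $ i) has_real_derivative field (h r) $ i) (at r within {0..T})"
      by (simp add: has_real_derivative_iff_has_vector_derivative)
    then show "((\<lambda>x. h x $ i) has_real_derivative field (h r) $ i) (at r within time_dom (ereal T))"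
      by (rule has_field_derivative_subset) auto
  qed
  moreover have "\<forall>r\<in>{0..<\<tau>}. h r = u r" by (simp add: h_def)
  ultimately show ?thesis using T(1) by blast
qed

end

section \<open>Convergence by a Lyapunov function\<close>

text \<open>Coercivity is required only along solutions from \<open>u0\<close>: in the Euclidean
  case it needs the quantity conserved by the flow. \<open>I\<close> lists the coordinates confined
  to negative values, and \<open>barrier\<close> says that the field does not push them further
  towards 0.\<close>

locale converging_flow = curvature_flow U k a R C
  for U :: "(real^'n) set" and k :: "real^'n \<Rightarrow> real^'n" and a :: real and R :: "'n \<Rightarrow> real" and C :: real +
  fixes I :: "'n set" and p u0 :: "real^'n" and m :: real
  assumes U_eq: "U = {u. \<forall>i\<in>I. u$i < 0}"
    and p: "p \<in> U" "\<And>i. k p $ i = R i * exp (a * p$i)"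
    and sgn_R: "\<And>i. a * R i \<le> 0"
    and m: "m > 0" and u0: "u0 \<in> U"
    and coercive: "\<And>T u t. 0 < T \<Longrightarrow> is_sol T u \<Longrightarrow> u 0 = u0 \<Longrightarrow> t \<in> time_dom T \<Longrightarrow>
       (u t - p) \<bullet> (k (u t) - k p) \<ge> m * min (norm (u t - p)) ((norm (u t - p))\<^sup>2)"
    and barrier: "\<And>i. i \<in> I \<Longrightarrow> \<exists>b<0. \<forall>u\<in>U. b \<le> u$i \<longrightarrow> field u $ i \<le> 0"
begin

definition trajectory :: "ereal \<Rightarrow> (real \<Rightarrow> real^'n) \<Rightarrow> bool" where
  "trajectory T u \<longleftrightarrow> 0 < T \<and> is_sol T u \<and> u 0 = u0"

text \<open>The antiderivative of \<open>exp (a x) (x - p i)\<close> vanishing at \<open>p i\<close>; the sum over \<open>i\<close> is a Lyapunov function.\<close>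

definition psi :: "'n \<Rightarrow> real \<Rightarrow> real" where
  "psi i x = (if a = 0 then (x - p$i)\<^sup>2 / 2 else (exp (a * x) * (a * (x - p$i) - 1) + exp (a * p$i)) / a\<^sup>2)"

lemma DERIV_psi: "(psi i has_real_derivative exp (a * x) * (x - p$i)) (at x)"
proof (cases "a = 0")
  case True
  have "((\<lambda>x. (x - p$i)\<^sup>2 / 2) has_real_derivative x - p$i) (at x)"
    by (auto intro!: derivative_eq_intros)
  moreover have "psi i = (\<lambda>x. (x - p$i)\<^sup>2 / 2)" by (rule ext) (simp only: psi_def if_P[OF True])
  ultimately show ?thesis using True by simp
next
  case False
  have "((\<lambda>x. (exp (a * x) * (a * (x - p$i) - 1) + exp (a * p$i)) / a\<^sup>2) has_real_derivative exp (a * x) * (x - p$i)) (at x)"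
    using False by (auto intro!: derivative_eq_intros simp: field_simps power2_eq_square)
  moreover have "psi i = (\<lambda>x. (exp (a * x) * (a * (x - p$i) - 1) + exp (a * p$i)) / a\<^sup>2)"
    by (rule ext) (simp only: psi_def if_not_P[OF False])
  ultimately show ?thesis by simp
qed

lemma psi_at_p: "psi i (p$i) = 0" by (simp add: psi_def)

text \<open>The difference of \<open>psi i\<close> and \<open>c / 2 * (x - p i)^2\<close> has
  derivative \<open>(exp (a * y) - c) * (y - p i)\<close>. With \<open>c\<close> a bound of the
  exponential on the interval, the difference has an extremum at \<open>p i\<close>, where it
  vanishes.\<close>

lemma psi_bounds:
  assumes B: "\<bar>x\<bar> \<le> B" "\<bar>p$i\<bar> \<le> B"
  shows "exp (- \<bar>a\<bar> * B) / 2 * (x - p$i)\<^sup>2 \<le> psi i x" and "psi i x \<le> exp (\<bar>a\<bar> * B) / 2 * (x - p$i)\<^sup>2"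
proof -
  have d: "((\<lambda>x. psi i x - c / 2 * (x - p$i)\<^sup>2) has_real_derivative (exp (a * y) - c) * (y - p$i)) (at y)" for c y
    by (auto intro!: derivative_eq_intros DERIV_psi simp: field_simps)
  have d': "((\<lambda>x. c / 2 * (x - p$i)\<^sup>2 - psi i x) has_real_derivative (c - exp (a * y)) * (y - p$i)) (at y)" for c y
    by (auto intro!: derivative_eq_intros DERIV_psi simp: field_simps)
  have e: "exp (- \<bar>a\<bar> * B) \<le> exp (a * y)" "exp (a * y) \<le> exp (\<bar>a\<bar> * B)" if "\<bar>y\<bar> \<le> B" for y
  proof -
    have "\<bar>a * y\<bar> \<le> \<bar>a\<bar> * B" using that by (simp add: abs_mult mult_left_mono)
    then show "exp (- \<bar>a\<bar> * B) \<le> exp (a * y)" "exp (a * y) \<le> exp (\<bar>a\<bar> * B)" by auto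
  qed
  have min_at: "h (p$i) \<le> h x" if h: "\<And>y. (h has_real_derivative h' y * (y - p$i)) (at y)" "\<And>y. \<bar>y\<bar> \<le> B \<Longrightarrow> h' y \<ge> 0"
    for h h' :: "real \<Rightarrow> real"
  proof (cases "p$i \<le> x")
    case True
    then show ?thesis
    proof (rule DERIV_nonneg_imp_nondecreasing)
      fix y assume "p$i \<le> y" "y \<le> x"
      then show "\<exists>d. (h has_real_derivative d) (at y) \<and> 0 \<le> d"
        using h(1)[of y] h(2)[of y] B by (intro exI[of _ "h' y * (y - p$i)"]) (auto simp: abs_le_iff)
    qed
  next
    case False
    then have "x \<le> p$i" by simp
    then show ?thesis
    proof (rule DERIV_nonpos_imp_nonincreasing)
      fix y assume "x \<le> y" "y \<le> p$i"
      then show "\<exists>d. (h has_real_derivative d) (at y) \<and> d \<le> 0"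
        using h(1)[of y] h(2)[of y] B by (intro exI[of _ "h' y * (y - p$i)"]) (auto simp: abs_le_iff mult_nonneg_nonpos)
    qed
  qed
  show "exp (- \<bar>a\<bar> * B) / 2 * (x - p$i)\<^sup>2 \<le> psi i x"
    using min_at[OF d, of "exp (- \<bar>a\<bar> * B)"] e by (simp add: psi_at_p)
  show "psi i x \<le> exp (\<bar>a\<bar> * B) / 2 * (x - p$i)\<^sup>2"
    using min_at[OF d', of "exp (\<bar>a\<bar> * B)"] e by (simp add: psi_at_p)
qed

lemma psi_nonneg: "psi i x \<ge> 0"
  using order_trans[OF _ psi_bounds(1)[of x "max \<bar>x\<bar> \<bar>p$i\<bar>" i]] by simp

lemma DERIV_psi_sol:
  assumes "is_sol T u" "t \<in> time_dom T" "0 < t"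
  shows "((\<lambda>s. psi i (u s $ i)) has_real_derivative (u t $ i - p$i) * (R i * exp (a * u t $ i) - k (u t) $ i)) (at t)"
proof -
  have "exp (a * u t $ i) * (u t $ i - p$i) * field (u t) $ i = (u t $ i - p$i) * (exp (a * u t $ i) * field (u t) $ i)"
    by (simp add: mult_ac)
  then show ?thesis using DERIV_chain2[OF DERIV_psi sol_DERIV[OF assms, of i], of i] unfolding exp_field by metis
qed

lemma continuous_on_psi: "continuous_on S (psi i)"
  by (rule DERIV_continuous_on[OF has_field_derivative_at_within[OF DERIV_psi]])

lemma continuous_on_psi_sol: "is_sol T u \<Longrightarrow> t \<in> time_dom T \<Longrightarrow> continuous_on {0..t} (\<lambda>s. psi i (u s $ i))"
  by (rule continuous_on_compose2[OF continuous_on_psi[of UNIV] continuous_on_component[OF sol_continuous_interval]]) auto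

text \<open>Subtracting the equation for \<open>p\<close> splits the derivative of the Lyapunov
  function in two. The part with \<open>R\<close> is nonpositive because the exponential is monotone
  and \<open>a * R \<le> 0\<close>; the part with \<open>k\<close> is the coercive one.\<close>

lemma dissipation:
  assumes tr: "trajectory T u" and t: "t \<in> time_dom T"
  shows "(\<Sum>i\<in>UNIV. (u t $ i - p$i) * (R i * exp (a * u t $ i) - k (u t) $ i))
    \<le> - m * min (norm (u t - p)) ((norm (u t - p))\<^sup>2)"
proof -
  have sg: "R i * ((x - y) * (exp (a * x) - exp (a * y))) \<le> 0" for i x y
  proof (cases "a = 0")
    case False
    have "(a * x - a * y) * (exp (a * x) - exp (a * y)) \<ge> 0"
      by (cases "a * x \<le> a * y") (auto intro: mult_nonpos_nonpos)
    then have "(a * R i) * ((a * x - a * y) * (exp (a * x) - exp (a * y))) \<le> 0"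
      using sgn_R[of i] by (rule mult_nonpos_nonneg[rotated])
    also have "(a * R i) * ((a * x - a * y) * (exp (a * x) - exp (a * y))) = a\<^sup>2 * (R i * ((x - y) * (exp (a * x) - exp (a * y))))"
      by (simp add: power2_eq_square algebra_simps)
    finally show ?thesis using False by (simp add: mult_le_0_iff)
  qed simp
  have "(\<Sum>i\<in>UNIV. (u t $ i - p$i) * (R i * exp (a * u t $ i) - k (u t) $ i))
     = (\<Sum>i\<in>UNIV. R i * ((u t $ i - p$i) * (exp (a * u t $ i) - exp (a * p$i))) - (u t $ i - p$i) * (k (u t) $ i - k p $ i))"
    by (rule sum.cong) (auto simp: p(2) algebra_simps)
  also have "\<dots> = (\<Sum>i\<in>UNIV. R i * ((u t $ i - p$i) * (exp (a * u t $ i) - exp (a * p$i)))) - (u t - p) \<bullet> (k (u t) - k p)"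
    by (simp add: sum_subtractf inner_vec_def)
  also have "(\<Sum>i\<in>UNIV. R i * ((u t $ i - p$i) * (exp (a * u t $ i) - exp (a * p$i)))) \<le> 0"
    by (rule sum_nonpos) (rule sg)
  finally show ?thesis using coercive[of T u t] tr t by (simp add: trajectory_def)
qed

lemma lyapunov_le:
  assumes tr: "trajectory T u" and t: "t \<in> time_dom T"
  shows "(\<Sum>i\<in>UNIV. psi i (u t $ i)) \<le> (\<Sum>i\<in>UNIV. psi i (u0 $ i))"
proof -
  have s: "is_sol T u" "u 0 = u0" using tr by (auto simp: trajectory_def)
  have "(\<Sum>i\<in>UNIV. psi i (u t $ i)) \<le> (\<Sum>i\<in>UNIV. psi i (u 0 $ i))"
  proof (rule nonincreasing_except_finite_values[where V="{}" and g="\<lambda>r. \<Sum>i\<in>UNIV. psi i (u r $ i)"])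
    show "continuous_on {0..t} (\<lambda>r. \<Sum>i\<in>UNIV. psi i (u r $ i))"
      by (intro continuous_on_sum continuous_on_psi_sol[OF s(1) t])
    fix r assume r: "0 < r" "r < t"
    then have rT: "r \<in> time_dom T" using time_dom_interval[OF t] by auto
    have "((\<lambda>r. \<Sum>i\<in>UNIV. psi i (u r $ i)) has_real_derivative
        (\<Sum>i\<in>UNIV. (u r $ i - p$i) * (R i * exp (a * u r $ i) - k (u r) $ i))) (at r)"
      by (intro DERIV_sum DERIV_psi_sol[OF s(1) rT r(1)])
    moreover have "- m * min (norm (u r - p)) ((norm (u r - p))\<^sup>2) \<le> 0" using m by simp
    note order_trans[OF dissipation[OF tr rT] this]
    ultimately show "\<exists>d\<le>0. ((\<lambda>r. \<Sum>i\<in>UNIV. psi i (u r $ i)) has_real_derivative d) (at r)"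
      by (intro exI conjI)
  qed (use t in \<open>auto simp: time_dom_def\<close>)
  then show ?thesis by (simp add: s)
qed

lemma psi_le_initial:
  assumes "trajectory T u" "t \<in> time_dom T"
  shows "psi i (u t $ i) \<le> (\<Sum>i\<in>UNIV. psi i (u0 $ i))"
proof (rule order_trans[OF _ lyapunov_le[OF assms]])
  show "psi i (u t $ i) \<le> (\<Sum>i\<in>UNIV. psi i (u t $ i))"
    by (rule member_le_sum[where f="\<lambda>i. psi i (u t $ i)"]) (auto simp: psi_nonneg)
qed

text \<open>The tangent inequality \<open>2 - z \<le> exp (1 - z)\<close> bounds
  \<open>exp z\<close> by \<open>exp z * (z - 1)\<close> up to the constant \<open>exp 1\<close>,
  hence the exponential by \<open>psi\<close>, which stays below the initial value of the Lyapunov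
  function.\<close>

lemma exp_upper_bound:
  assumes a: "a \<noteq> 0"
  shows "\<exists>Y>0. \<forall>T u t i. trajectory T u \<longrightarrow> t \<in> time_dom T \<longrightarrow> exp (a * u t $ i) \<le> Y"
proof -
  define V0 where "V0 = (\<Sum>i\<in>UNIV. psi i (u0 $ i))"
  have V0: "V0 \<ge> 0" unfolding V0_def by (intro sum_nonneg psi_nonneg)
  define Y where "Y = a\<^sup>2 * V0 + exp 1 * (\<Sum>i\<in>UNIV. exp (a * p$i))"
  have S: "(\<Sum>i\<in>UNIV. exp (a * p$i)) > 0" by (intro sum_pos) auto
  have "exp (a * u t $ i) \<le> Y" if "trajectory T u" "t \<in> time_dom T" for T u t i
  proof -
    define z where "z = a * (u t $ i - p$i)"
    have "2 - z \<le> exp (1 - z)" using exp_ge_add_one_self[of "1 - z"] by simp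
    then have "(2 - z) * exp z \<le> exp (1 - z) * exp z" by (rule mult_right_mono) simp
    then have z: "exp z - exp 1 \<le> exp z * (z - 1)" by (simp add: algebra_simps flip: exp_add)
    have ez: "exp (a * u t $ i) = exp (a * p$i) * exp z" by (simp add: z_def algebra_simps flip: exp_add)
    have "a\<^sup>2 * psi i (u t $ i) = exp (a * u t $ i) * (z - 1) + exp (a * p$i)"
      using a by (simp add: psi_def z_def)
    also have "\<dots> = exp (a * p$i) * (exp z * (z - 1) + 1)" unfolding ez by (simp add: algebra_simps)
    also have "\<dots> \<ge> exp (a * p$i) * (exp z - exp 1)" using z by (intro mult_left_mono) auto
    finally have "exp (a * u t $ i) \<le> a\<^sup>2 * psi i (u t $ i) + exp 1 * exp (a * p$i)"
      unfolding ez by (simp add: algebra_simps)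
    also have "\<dots> \<le> Y" unfolding Y_def
      using psi_le_initial[OF that, of i] member_le_sum[of i UNIV "\<lambda>i. exp (a * p$i)"]
      by (intro add_mono mult_left_mono) (auto simp: V0_def)
    finally show ?thesis .
  qed
  moreover have "Y > 0" unfolding Y_def using S V0 by (intro add_nonneg_pos mult_nonneg_nonneg mult_pos_pos) auto
  ultimately show ?thesis by blast
qed

text \<open>Near a point of the boundary \<open>exp (a u i) = 0\<close>, \<open>i \<in> Z\<close>, coercivity makes the part
  \<open>\<Sum>i\<in>Z. psi i\<close> of the Lyapunov function strictly decreasing, whereas on the boundary itself
  that part attains its maximum; hence the boundary cannot be approached.\<close>

lemma exp_lower_bound:
  assumes a: "a \<noteq> 0"
  shows "\<exists>\<rho>>0. \<forall>T u t i. trajectory T u \<longrightarrow> t \<in> time_dom T \<longrightarrow> \<rho> \<le> exp (a * u t $ i)"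
proof (rule ccontr)
  assume neg: "\<not> ?thesis"
  have "\<exists>T u t i. trajectory T u \<and> t \<in> time_dom T \<and> exp (a * u t $ i) < 1 / (real n + 1)" for n :: nat
  proof (rule ccontr)
    assume "\<not> ?thesis"
    then have "\<forall>T u t i. trajectory T u \<longrightarrow> t \<in> time_dom T \<longrightarrow> 1 / (real n + 1) \<le> exp (a * u t $ i)"
      by (simp only: not_ex de_Morgan_conj not_less) blast
    moreover have "1 / (real n + 1) > 0" by simp
    ultimately have "\<exists>\<rho>>0. \<forall>T u t i. trajectory T u \<longrightarrow> t \<in> time_dom T \<longrightarrow> \<rho> \<le> exp (a * u t $ i)"
      by (intro exI[of _ "1 / (real n + 1)"] conjI)
    then show False using neg by (rule notE[rotated])
  qed
  then obtain T u t i where traj: "\<And>n. trajectory (T n) (u n)" "\<And>n. t n \<in> time_dom (T n)"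
      "\<And>n::nat. exp (a * u n (t n) $ i n) < 1 / (real n + 1)" by metis
  obtain Y where Y: "Y > 0" "\<And>T u t i. trajectory T u \<Longrightarrow> t \<in> time_dom T \<Longrightarrow> exp (a * u t $ i) \<le> Y"
    using exp_upper_bound[OF a] by blast
  \<comment> \<open>In the variables \<open>exp (a u)\<close> the points lie in a compact cube, so a
    limit \<open>l\<close> on its boundary exists; \<open>Z\<close> collects the coordinates in
    which the limit is 0.\<close>
  define y where "y n = (\<chi> i. exp (a * u n (t n) $ i))" for n
  have "y n \<in> cbox 0 (\<chi> i. Y)" for n using Y(2)[OF traj(1,2)] by (simp add: y_def mem_box_cart)
  then obtain l r where l: "l \<in> cbox 0 (\<chi> i. Y)" and r: "strict_mono r" "(y \<circ> r) \<longlonglongrightarrow> l"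
    using compact_cbox[of 0 "\<chi> i::'n. Y"] unfolding compact_def by metis
  have l0: "l$i \<ge> 0" for i using l by (simp add: mem_box_cart)
  have yl: "(\<lambda>n. y (r n) $ i) \<longlonglongrightarrow> l$i" for i using tendsto_vec_nth[OF r(2)] by (simp add: o_def)
  define Z where "Z = {i. l$i = 0}"
  have "Z \<noteq> {}"
  proof
    assume "Z = {}"
    then have lp: "l$i > 0" for i using l0[of i] by (auto simp: Z_def less_le)
    have "\<forall>\<^sub>F n in sequentially. y (r n) $ j > l$j / 2" for j
      using order_tendstoD(1)[OF yl[of j], of "l$j/2"] lp[of j] by simp
    moreover have "\<forall>\<^sub>F n in sequentially. 1 / (real n + 1) < l$j / 2" for j
    proof -
      have "(\<lambda>n. 1 / (real n + 1)) \<longlonglongrightarrow> 0" using LIMSEQ_inverse_real_of_nat by (simp add: inverse_eq_divide add.commute)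
      then show ?thesis by (rule order_tendstoD(2)) (use lp[of j] in simp)
    qed
    ultimately have "\<forall>\<^sub>F n in sequentially. \<forall>j. y (r n) $ j > l$j / 2 \<and> 1 / (real n + 1) < l$j / 2"
      by (intro eventually_all_finite eventually_conj)
    from eventually_happens'[OF sequentially_bot this] obtain n
      where n: "\<And>j. y (r n) $ j > l$j / 2" "\<And>j. 1 / (real n + 1) < l$j / 2" by blast
    have "y (r n) $ i (r n) < 1 / (real (r n) + 1)" using traj(3)[of "r n"] by (simp add: y_def)
    also have "\<dots> \<le> 1 / (real n + 1)" using seq_suble[OF r(1), of n] by (intro divide_left_mono) auto
    finally show False using n[of "i (r n)"] by linarith
  qed
  then obtain z0 where z0: "z0 \<in> Z" by blast
  define G where "G = (\<Sum>i\<in>UNIV. \<bar>R i\<bar>) * Y + C"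
  have G0: "G \<ge> 0" unfolding G_def using Y(1) C_nonneg by (intro add_nonneg_nonneg mult_nonneg_nonneg sum_nonneg) auto
  have G: "\<bar>R i * exp (a * v s $ i) - k (v s) $ i\<bar> \<le> G" if "trajectory T v" "s \<in> time_dom T" for T v s i
  proof -
    have "\<bar>R i * exp (a * v s $ i) - k (v s) $ i\<bar> \<le> \<bar>R i\<bar> * exp (a * v s $ i) + \<bar>k (v s) $ i\<bar>"
      using abs_triangle_ineq4[of "R i * exp (a * v s $ i)" "k (v s) $ i"] by (simp add: abs_mult)
    also have "\<dots> \<le> (\<Sum>i\<in>UNIV. \<bar>R i\<bar>) * Y + C"
      using Y(2)[OF that, of i] bound_k[of "v s" i] member_le_sum[of i UNIV "\<lambda>i. \<bar>R i\<bar>"]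
      by (intro add_mono mult_mono) (auto intro!: sum_nonneg)
    finally show ?thesis by (simp add: G_def)
  qed
  define W where "W = (\<Sum>i\<in>UNIV. (\<bar>ln (l$i/2)\<bar> + \<bar>ln Y\<bar>) / \<bar>a\<bar> + \<bar>p$i\<bar>)"
  have W: "\<bar>x - p$i\<bar> \<le> W" if "l$i > 0" "l$i/2 \<le> exp (a * x)" "exp (a * x) \<le> Y" for x i
  proof -
    have "ln (l$i/2) \<le> a * x" "a * x \<le> ln Y"
      using that Y(1) ln_le_cancel_iff[of "l$i/2" "exp (a*x)"] ln_le_cancel_iff[of "exp (a*x)" Y] by auto
    then have "\<bar>a * x\<bar> \<le> \<bar>ln (l$i/2)\<bar> + \<bar>ln Y\<bar>" by linarith
    then have "\<bar>x\<bar> \<le> (\<bar>ln (l$i/2)\<bar> + \<bar>ln Y\<bar>) / \<bar>a\<bar>" using a by (simp add: abs_mult pos_le_divide_eq mult.commute)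
    then have "\<bar>x - p$i\<bar> \<le> (\<bar>ln (l$i/2)\<bar> + \<bar>ln Y\<bar>) / \<bar>a\<bar> + \<bar>p$i\<bar>" by linarith
    also have "\<dots> \<le> W" unfolding W_def
      by (rule member_le_sum[where f="\<lambda>i. (\<bar>ln (l$i/2)\<bar> + \<bar>ln Y\<bar>) / \<bar>a\<bar> + \<bar>p$i\<bar>"]) auto
    finally show ?thesis .
  qed
  have W0: "W \<ge> 0" unfolding W_def by (intro sum_nonneg add_nonneg_nonneg divide_nonneg_nonneg) auto
  \<comment> \<open>If some coordinate is \<open>\<Lambda>\<close> away from \<open>p\<close>, total
    dissipation exceeds by 1 what the coordinates outside \<open>Z\<close>, each contributing at
    most \<open>W * G\<close>, can account for. The lower bound 1 makes the norm the smaller of the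
    norm and its square.\<close>
  define \<Lambda> where "\<Lambda> = max 1 ((real CARD('n) * (W * G) + 1) / m)"
  have L: "\<Lambda> \<ge> 1" "m * \<Lambda> \<ge> real CARD('n) * (W * G) + 1"
    using m by (auto simp: \<Lambda>_def max_def field_simps)
  \<comment> \<open>The radius of a neighbourhood of \<open>l\<close> on which coordinates outside
    \<open>Z\<close> keep \<open>exp (a u) \<ge> l/2\<close>, coordinates in \<open>Z\<close> are at
    least \<open>\<Lambda>\<close> away from \<open>p\<close>, and from which \<open>u0\<close> is
    excluded.\<close>
  define q where "q i = min (if i \<in> Z then 1 else l$i/2) (min (exp (a * u0$i) / 2) (exp (a * p$i - \<bar>a\<bar> * \<Lambda>)))" for i
  have lZ: "l$i > 0" if "i \<notin> Z" for i using l0[of i] that by (auto simp: Z_def less_le)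
  have q: "q i > 0" for i using lZ[of i] by (simp add: q_def)
  define r0 where "r0 = Min (range q)"
  have r0: "r0 > 0" "r0 \<le> q i" for i unfolding r0_def using q by (auto simp: Min_gr_iff)
  define near where "near v = (\<forall>i. \<bar>exp (a * v$i) - l$i\<bar> < r0)" for v :: "real^'n"
  have nearZ: "exp (a * v$i) < r0" if "near v" "i \<in> Z" for v i
    using that by (auto simp: near_def Z_def) (metis abs_exp_cancel diff_zero)
  have nearZ': "exp (a * v$i) \<le> exp (a * p$i)" "\<bar>v$i - p$i\<bar> \<ge> \<Lambda>" if "near v" "i \<in> Z" for v i
  proof -
    have "q i \<le> exp (a * p$i - \<bar>a\<bar> * \<Lambda>)" unfolding q_def by (rule min.coboundedI2) (rule min.cobounded2)
    then have "exp (a * v$i) < exp (a * p$i - \<bar>a\<bar> * \<Lambda>)"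
      using nearZ[OF that] r0(2)[of i] by linarith
    then have 1: "a * v$i < a * p$i - \<bar>a\<bar> * \<Lambda>" by simp
    have 2: "0 \<le> \<bar>a\<bar> * \<Lambda>" using L(1) by simp
    have "a * v$i \<le> a * p$i" using 1 2 by linarith
    then show "exp (a * v$i) \<le> exp (a * p$i)" by simp
    have "\<bar>a\<bar> * \<Lambda> \<le> \<bar>a * v$i - a * p$i\<bar>" using 1 2 by linarith
    also have "\<dots> = \<bar>a\<bar> * \<bar>v$i - p$i\<bar>" unfolding abs_mult[symmetric] right_diff_distrib ..
    finally show "\<bar>v$i - p$i\<bar> \<ge> \<Lambda>" using a by simp
  qed
  have nearW: "\<bar>v s $ i - p$i\<bar> \<le> W" if v: "trajectory T v" "s \<in> time_dom T" and n: "near (v s)" and i: "i \<notin> Z" for T v s i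
  proof (rule W)
    show "l$i > 0" using i l0[of i] by (auto simp: Z_def less_le)
    have "r0 \<le> l$i/2" using r0(2)[of i] i by (simp add: q_def)
    moreover have "\<bar>exp (a * v s $ i) - l$i\<bar> < r0" using n by (simp add: near_def)
    ultimately show "l$i/2 \<le> exp (a * v s $ i)" by linarith
    show "exp (a * v s $ i) \<le> Y" by (rule Y(2)[OF v])
  qed
  have decr: "(\<Sum>i\<in>Z. (v s $ i - p$i) * (R i * exp (a * v s $ i) - k (v s) $ i)) \<le> - 1"
    if v: "trajectory T v" "s \<in> time_dom T" and n: "near (v s)" for T v s
  proof -
    let ?g = "\<lambda>i. (v s $ i - p$i) * (R i * exp (a * v s $ i) - k (v s) $ i)"
    have "\<Lambda> \<le> norm (v s - p)" using nearZ'(2)[OF n z0] component_le_norm_cart[of "v s - p" z0] by simp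
    moreover have "norm (v s - p) \<le> (norm (v s - p))\<^sup>2"
      using calculation L(1) by (simp add: power2_eq_square mult_le_cancel_left1)
    ultimately have "\<Lambda> \<le> min (norm (v s - p)) ((norm (v s - p))\<^sup>2)" by simp
    then have "m * \<Lambda> \<le> m * min (norm (v s - p)) ((norm (v s - p))\<^sup>2)" using m by (intro mult_left_mono) auto
    then have 1: "sum ?g UNIV \<le> - (real CARD('n) * (W * G) + 1)" using dissipation[OF v] L(2) by linarith
    have "- (W * G) \<le> ?g i" if "i \<notin> Z" for i
    proof -
      have "\<bar>?g i\<bar> \<le> W * G" unfolding abs_mult using nearW[OF v n that] G[OF v, of i] W0 by (intro mult_mono) auto
      then show ?thesis using abs_ge_minus_self[of "?g i"] by linarith
    qed
    then have "(\<Sum>i\<in>-Z. - (W * G)) \<le> sum ?g (-Z)" by (intro sum_mono) auto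
    moreover have "- (real CARD('n) * (W * G)) \<le> (\<Sum>i\<in>-Z. - (W * G))"
    proof -
      have "real (card (-Z)) * (W * G) \<le> real CARD('n) * (W * G)"
        using W0 G0 by (intro mult_right_mono of_nat_mono card_mono) auto
      then show ?thesis by simp
    qed
    moreover have "sum ?g UNIV = sum ?g Z + sum ?g (-Z)"
      using sum.union_disjoint[of Z "-Z" ?g] by simp
    ultimately show ?thesis using 1 by linarith
  qed
  define S where "S = (\<Sum>i\<in>Z. exp (a * p$i) / a\<^sup>2)"
  have psi_eq: "psi i x = exp (a * p$i) / a\<^sup>2 + exp (a * x) * (a * (x - p$i) - 1) / a\<^sup>2" for i x
    using a by (simp add: psi_def add_divide_distrib)
  have psi_up: "psi i (v$i) \<le> exp (a * p$i) / a\<^sup>2" if "near v" "i \<in> Z" for v i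
  proof -
    have "a * v$i \<le> a * p$i" using nearZ'(1)[OF that] by simp
    then have "exp (a * v$i) * (a * (v$i - p$i) - 1) / a\<^sup>2 \<le> 0"
      by (intro divide_nonpos_nonneg mult_nonneg_nonpos) (auto simp: right_diff_distrib)
    then show ?thesis by (simp add: psi_eq)
  qed
  \<comment> \<open>With \<open>psi_up\<close> this pins \<open>psi i\<close> to
    \<open>exp (a * p i) / a^2\<close>, the limiting value on the boundary, up to an error vanishing
    with \<open>exp (a * x)\<close>.\<close>
  have psi_low: "psi i x \<ge> exp (a * p$i) / a\<^sup>2 - 2 * sqrt (exp (a * p$i) * exp (a * x)) / a\<^sup>2" for i x
  proof -
    define z where "z = a * (x - p$i)"
    have "1 - z \<le> 2 * exp (- z / 2)" using exp_ge_add_one_self[of "- z / 2"] by simp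
    then have "exp (a * x) * (1 - z) \<le> exp (a * x) * (2 * exp (- z / 2))" by (intro mult_left_mono) auto
    also have "\<dots> = 2 * exp ((a * p$i + a * x) / 2)" by (simp add: z_def field_simps flip: exp_add)
    also have "exp ((a * p$i + a * x) / 2) = sqrt (exp (a * p$i) * exp (a * x))"
      by (rule real_sqrt_unique[symmetric]) (auto simp: power2_eq_square simp flip: exp_add)
    finally have "- (2 * sqrt (exp (a * p$i) * exp (a * x))) \<le> exp (a * x) * (z - 1)" by (simp add: algebra_simps)
    then have "- (2 * sqrt (exp (a * p$i) * exp (a * x))) / a\<^sup>2 \<le> exp (a * x) * (z - 1) / a\<^sup>2"
      by (rule divide_right_mono) simp
    then show ?thesis unfolding psi_eq z_def by simp
  qed
  \<comment> \<open>\<open>\<bar>a\<bar> * G\<close> bounds the speed of \<open>exp (a u)\<close>,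
    so a trajectory within \<open>r0/2\<close> of \<open>l\<close> at time \<open>t1\<close> was
    within \<open>r0\<close> of it during the preceding time \<open>\<tau>\<close>.\<close>
  define \<tau> where "\<tau> = r0 / (2 * (\<bar>a\<bar> * G + 1))"
  have aG: "\<bar>a\<bar> * G + 1 > 0" using G0 by (simp add: add_nonneg_pos)
  have tau: "\<tau> > 0" "\<bar>a\<bar> * G * \<tau> < r0 / 2"
  proof -
    show "\<tau> > 0" using r0(1) aG by (simp add: \<tau>_def)
    then have "\<bar>a\<bar> * G * \<tau> < (\<bar>a\<bar> * G + 1) * \<tau>" by (simp add: algebra_simps)
    also have "x * (r0 / (2 * x)) = r0 / 2" if "x > 0" for x :: real using that by simp
    from this[OF aG] have "(\<bar>a\<bar> * G + 1) * \<tau> = r0 / 2" by (simp only: \<tau>_def)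
    finally show "\<bar>a\<bar> * G * \<tau> < r0 / 2" .
  qed
  have "(\<lambda>n. \<Sum>i\<in>Z. 2 * sqrt (exp (a * p$i) * y (r n) $ i) / a\<^sup>2) \<longlonglongrightarrow> (\<Sum>i\<in>Z. 2 * sqrt (exp (a * p$i) * l$i) / a\<^sup>2)"
    by (intro tendsto_sum tendsto_divide tendsto_mult tendsto_const tendsto_real_sqrt yl) (use a in simp)
  also have "(\<Sum>i\<in>Z. 2 * sqrt (exp (a * p$i) * l$i) / a\<^sup>2) = 0"
    by (rule sum.neutral) (simp add: Z_def)
  finally have lim0: "(\<lambda>n. \<Sum>i\<in>Z. 2 * sqrt (exp (a * p$i) * y (r n) $ i) / a\<^sup>2) \<longlonglongrightarrow> 0" .
  have ev1: "\<forall>\<^sub>F n in sequentially. (\<Sum>i\<in>Z. 2 * sqrt (exp (a * p$i) * y (r n) $ i) / a\<^sup>2) < \<tau>"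
    by (rule order_tendstoD(2)[OF lim0 tau(1)])
  have "\<forall>\<^sub>F n in sequentially. \<bar>y (r n) $ i - l$i\<bar> < r0 / 2" for i
    using tendstoD[OF yl[of i], of "r0/2"] r0(1) by (simp add: dist_real_def)
  then have ev2: "\<forall>\<^sub>F n in sequentially. \<forall>i. \<bar>y (r n) $ i - l$i\<bar> < r0 / 2" by (intro eventually_all_finite)
  obtain n where n: "(\<Sum>i\<in>Z. 2 * sqrt (exp (a * p$i) * y (r n) $ i) / a\<^sup>2) < \<tau>" "\<And>i. \<bar>y (r n) $ i - l$i\<bar> < r0 / 2"
    using eventually_happens'[OF sequentially_bot eventually_conj[OF ev1 ev2]] by blast
  define v where "v = u (r n)"
  define t1 where "t1 = t (r n)"
  define T1 where "T1 = T (r n)"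
  have v: "trajectory T1 v" "t1 \<in> time_dom T1" using traj by (auto simp: v_def t1_def T1_def)
  have sv: "is_sol T1 v" "v 0 = u0" using v(1) by (auto simp: trajectory_def)
  have t1: "0 \<le> t1" using v(2) by (simp add: time_dom_def)
  have yv: "y (r n) $ i = exp (a * v t1 $ i)" for i by (simp add: y_def v_def t1_def)
  have near: "near (v s)" if s: "0 \<le> s" "s \<le> t1" "t1 - s \<le> \<tau>" for s
    unfolding near_def
  proof
    fix i
    have "\<bar>exp (a * v t1 $ i) - exp (a * v s $ i)\<bar> \<le> \<bar>a\<bar> * G * \<tau>"
    proof (cases "s = t1")
      case True then show ?thesis using tau(1) G0 by simp
    next
      case False
      then have lt: "s < t1" using s by simp
      have cont: "continuous_on {s..t1} (\<lambda>x. exp (a * v x $ i))"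
        by (intro continuous_intros continuous_on_component continuous_on_subset[OF sol_continuous_interval[OF sv(1) v(2)]])
          (use s in auto)
      have d: "((\<lambda>x. exp (a * v x $ i)) has_real_derivative a * (R i * exp (a * v x $ i) - k (v x) $ i)) (at x)"
        if "s < x" "x < t1" for x
      proof -
        have "x \<in> time_dom T1" using that s time_dom_interval[OF v(2)] by auto
        then have dv: "((\<lambda>x. v x $ i) has_real_derivative field (v x) $ i) (at x)"
          using sol_DERIV[OF sv(1), of x i] that s by simp
        have "((\<lambda>x. exp (a * v x $ i)) has_real_derivative exp (a * v x $ i) * (a * field (v x) $ i)) (at x)"
          by (auto intro!: derivative_eq_intros dv)
        moreover have "exp (a * v x $ i) * (a * field (v x) $ i) = a * (exp (a * v x $ i) * field (v x) $ i)" by simp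
        ultimately show ?thesis unfolding exp_field by simp
      qed
      obtain c x where x: "s < x" "x < t1" "((\<lambda>x. exp (a * v x $ i)) has_real_derivative c) (at x)"
          "exp (a * v t1 $ i) - exp (a * v s $ i) = (t1 - s) * c"
        using MVT[OF lt cont] d by (meson real_differentiable_def)
      have xT: "x \<in> time_dom T1" using x s time_dom_interval[OF v(2)] by auto
      have "c = a * (R i * exp (a * v x $ i) - k (v x) $ i)" using DERIV_unique[OF x(3) d[OF x(1,2)]] .
      then have "\<bar>c\<bar> \<le> \<bar>a\<bar> * G" using G[OF v(1) xT, of i] by (simp add: abs_mult mult_left_mono)
      then have "(t1 - s) * \<bar>c\<bar> \<le> \<tau> * (\<bar>a\<bar> * G)" using s lt by (intro mult_mono) auto
      then show ?thesis unfolding x(4) abs_mult using lt by (simp add: mult_ac)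
    qed
    then show "\<bar>exp (a * v s $ i) - l$i\<bar> < r0" using n(2)[of i] tau(2) unfolding yv by linarith
  qed
  have t1tau: "\<tau> \<le> t1"
  proof (rule ccontr)
    assume "\<not> ?thesis"
    then have "near (v 0)" using t1 by (intro near) auto
    from nearZ[OF this z0] have "exp (a * u0 $ z0) < r0" by (simp add: sv)
    moreover have "r0 \<le> exp (a * u0 $ z0) / 2" using r0(2)[of z0] by (simp add: q_def)
    moreover have "exp (a * u0 $ z0) > 0" by simp
    ultimately show False by linarith
  qed
  \<comment> \<open>Over this stretch the partial sum over \<open>Z\<close> falls by at least
    \<open>\<tau>\<close> from a value not above \<open>S\<close>, yet at \<open>t1\<close> it is
    less than \<open>\<tau>\<close> below \<open>S\<close>.\<close>
  have "(\<Sum>i\<in>Z. psi i (v t1 $ i)) + t1 \<le> (\<Sum>i\<in>Z. psi i (v (t1 - \<tau>) $ i)) + (t1 - \<tau>)"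
  proof (rule nonincreasing_except_finite_values[where V="{}" and g="\<lambda>s. (\<Sum>i\<in>Z. psi i (v s $ i)) + s"])
    show "continuous_on {t1 - \<tau>..t1} (\<lambda>s. (\<Sum>i\<in>Z. psi i (v s $ i)) + s)"
      by (intro continuous_intros continuous_on_subset[OF continuous_on_psi_sol[OF sv(1) v(2)]]) (use t1tau in auto)
    fix s assume s: "t1 - \<tau> < s" "s < t1"
    have s0: "0 < s" using s t1tau by linarith
    have sT: "s \<in> time_dom T1" using s s0 time_dom_interval[OF v(2)] by auto
    have "near (v s)" using s s0 by (intro near) auto
    note dec = decr[OF v(1) sT this]
    have "((\<lambda>s. (\<Sum>i\<in>Z. psi i (v s $ i)) + s) has_real_derivative
        (\<Sum>i\<in>Z. (v s $ i - p$i) * (R i * exp (a * v s $ i) - k (v s) $ i)) + 1) (at s)"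
      by (intro DERIV_add DERIV_sum DERIV_psi_sol[OF sv(1) sT s0] DERIV_ident)
    then show "\<exists>d\<le>0. ((\<lambda>s. (\<Sum>i\<in>Z. psi i (v s $ i)) + s) has_real_derivative d) (at s)"
      using dec by (intro exI conjI[rotated]) (assumption, simp)
  qed (use tau(1) in auto)
  moreover have "(\<Sum>i\<in>Z. psi i (v (t1 - \<tau>) $ i)) \<le> S" unfolding S_def
    by (rule sum_mono) (use near[of "t1 - \<tau>"] t1tau tau(1) psi_up in auto)
  moreover have "S - (\<Sum>i\<in>Z. 2 * sqrt (exp (a * p$i) * y (r n) $ i) / a\<^sup>2) \<le> (\<Sum>i\<in>Z. psi i (v t1 $ i))"
    unfolding S_def yv sum_subtractf[symmetric] by (rule sum_mono) (rule psi_low)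
  ultimately show False using n(1) by linarith
qed

lemma trajectory_bounded:
  "\<exists>B. \<forall>T u t i. trajectory T u \<longrightarrow> t \<in> time_dom T \<longrightarrow> \<bar>u t $ i\<bar> \<le> B"
proof (cases "a = 0")
  case True
  define V0 where "V0 = (\<Sum>i\<in>UNIV. psi i (u0 $ i))"
  have "\<bar>u t $ i\<bar> \<le> sqrt (2 * V0) + (\<Sum>i\<in>UNIV. \<bar>p$i\<bar>)" if tr: "trajectory T u" "t \<in> time_dom T" for T u t i
  proof -
    have "(u t $ i - p$i)\<^sup>2 / 2 \<le> V0" using psi_le_initial[OF tr, of i] unfolding psi_def if_P[OF True] V0_def by simp
    then have "\<bar>u t $ i - p$i\<bar> \<le> sqrt (2 * V0)" by (intro real_le_rsqrt) simp
    moreover have "\<bar>p$i\<bar> \<le> (\<Sum>i\<in>UNIV. \<bar>p$i\<bar>)" by (rule member_le_sum) auto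
    ultimately show ?thesis by linarith
  qed
  then show ?thesis by blast
next
  case False
  obtain Y where Y: "Y > 0" "\<And>T u t i. trajectory T u \<Longrightarrow> t \<in> time_dom T \<Longrightarrow> exp (a * u t $ i) \<le> Y"
    using exp_upper_bound[OF False] by blast
  obtain \<rho> where r: "\<rho> > 0" "\<And>T u t i. trajectory T u \<Longrightarrow> t \<in> time_dom T \<Longrightarrow> \<rho> \<le> exp (a * u t $ i)"
    using exp_lower_bound[OF False] by blast
  have "\<bar>u t $ i\<bar> \<le> (\<bar>ln \<rho>\<bar> + \<bar>ln Y\<bar>) / \<bar>a\<bar>" if tr: "trajectory T u" "t \<in> time_dom T" for T u t i
  proof -
    have "ln \<rho> \<le> a * u t $ i" "a * u t $ i \<le> ln Y"
      using Y(1) r(1) Y(2)[OF tr, of i] r(2)[OF tr, of i] by (simp_all add: ln_ge_iff ln_le_cancel_iff[symmetric, of "exp _"] del: ln_le_cancel_iff)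
        (metis exp_le_cancel_iff exp_ln)
    then have "\<bar>a * u t $ i\<bar> \<le> \<bar>ln \<rho>\<bar> + \<bar>ln Y\<bar>" by linarith
    then show ?thesis using False by (simp add: abs_mult pos_le_divide_eq mult.commute)
  qed
  then show ?thesis by blast
qed

text \<open>Above \<open>b\<close> the coordinate cannot increase. A time with
  \<open>u i > \<beta>\<close> would be preceded by a last time with
  \<open>u i \<le> \<beta>\<close>, and in between the coordinate is nonincreasing.\<close>

lemma trajectory_barrier:
  assumes i: "i \<in> I"
  shows "\<exists>\<beta><0. \<forall>T u t. trajectory T u \<longrightarrow> t \<in> time_dom T \<longrightarrow> u t $ i \<le> \<beta>"
proof -
  obtain b where b: "b < 0" "\<And>u. u \<in> U \<Longrightarrow> b \<le> u$i \<Longrightarrow> field u $ i \<le> 0" using barrier[OF i] by blast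
  define \<beta> where "\<beta> = max b (u0$i)"
  have "\<beta> < 0" using b(1) u0 i unfolding \<beta>_def U_eq by simp
  moreover have "u t $ i \<le> \<beta>" if tr: "trajectory T u" and t: "t \<in> time_dom T" for T u t
  proof (rule ccontr)
    assume n: "\<not> ?thesis"
    have s: "is_sol T u" "u 0 = u0" using tr by (auto simp: trajectory_def)
    have t0: "0 \<le> t" using t by (simp add: time_dom_def)
    \<comment> \<open>Reversing time turns the last entry before \<open>t\<close> into a first
      exit.\<close>
    define x where "x = (\<lambda>r. u (t - r) $ i)"
    have ui: "continuous_on {0..t} (\<lambda>r. u r $ i)"
      by (intro continuous_on_component sol_continuous_interval[OF s(1) t])
    have xc: "continuous_on {0..t} x" unfolding x_def
      by (rule continuous_on_compose2[OF ui]) (auto intro!: continuous_intros)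
    have "x 0 \<in> {\<beta><..}" using n by (simp add: x_def)
    moreover have "x t \<notin> {\<beta><..}" by (simp add: x_def s \<beta>_def)
    ultimately obtain \<sigma> where sg: "0 < \<sigma>" "\<sigma> \<le> t" "x \<sigma> \<notin> {\<beta><..}" "\<And>r. 0 \<le> r \<Longrightarrow> r < \<sigma> \<Longrightarrow> x r \<in> {\<beta><..}"
      using first_exit[OF xc open_greaterThan _ t0 order_refl] by blast
    have "u t $ i \<le> u (t - \<sigma>) $ i"
    proof (rule nonincreasing_except_finite_values[where V="{}" and g="\<lambda>r. u r $ i"])
      show "continuous_on {t - \<sigma>..t} (\<lambda>r. u r $ i)" by (rule continuous_on_subset[OF ui]) (use sg in auto)
      fix r assume r: "t - \<sigma> < r" "r < t"
      have r0: "0 < r" using r sg by linarith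
      have rT: "r \<in> time_dom T" using r r0 time_dom_interval[OF t] by auto
      have "x (t - r) \<in> {\<beta><..}" using r by (intro sg(4)) auto
      then have "field (u r) $ i \<le> 0" using b(2)[OF sol_in[OF s(1) rT]] by (simp add: x_def \<beta>_def)
      then show "\<exists>d\<le>0. ((\<lambda>r. u r $ i) has_real_derivative d) (at r)" using sol_DERIV[OF s(1) rT r0, of i] by blast
    qed (use sg in auto)
    moreover have "u (t - \<sigma>) $ i \<le> \<beta>" using sg(3) by (simp add: x_def)
    ultimately show False using n by linarith
  qed
  ultimately show ?thesis by blast
qed

text \<open>One compact set serves all trajectories from \<open>u0\<close>, whatever their life
  span; this uniformity is what \<open>global_solution\<close> needs.\<close>

lemma a_priori_box:
  "\<exists>K lo hi. compact K \<and> K \<subseteq> box lo hi \<and> cbox lo hi \<subseteq> U \<and> u0 \<in> K \<and>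
     (\<forall>T u t. trajectory T u \<longrightarrow> t \<in> time_dom T \<longrightarrow> u t \<in> K)"
proof -
  obtain B where B: "\<And>T u t i. trajectory T u \<Longrightarrow> t \<in> time_dom T \<Longrightarrow> \<bar>u t $ i\<bar> \<le> B"
    using trajectory_bounded by blast
  have "\<forall>i. \<exists>\<beta>. i \<in> I \<longrightarrow> \<beta> < 0 \<and> (\<forall>T u t. trajectory T u \<longrightarrow> t \<in> time_dom T \<longrightarrow> u t $ i \<le> \<beta>)"
    using trajectory_barrier by blast
  then obtain \<beta> where be: "\<And>i. i \<in> I \<Longrightarrow> \<beta> i < 0"
    "\<And>i T u t. i \<in> I \<Longrightarrow> trajectory T u \<Longrightarrow> t \<in> time_dom T \<Longrightarrow> u t $ i \<le> \<beta> i" by metis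
  define K where "K = cbox (\<chi> i. - B) (\<chi> i. if i \<in> I then min B (\<beta> i) else B)"
  define lo where "lo = (\<chi> i::'n. - B - 1)"
  \<comment> \<open>For \<open>i\<close> in \<open>I\<close>, half of the negative bound lies
    strictly between \<open>K\<close> and 0.\<close>
  define hi where "hi = (\<chi> i. if i \<in> I then \<beta> i / 2 else B + 1)"
  have inK: "u t \<in> K" if "trajectory T u" "t \<in> time_dom T" for T u t
    using B[OF that] be(2)[OF _ that] by (auto simp: K_def mem_box_cart abs_le_iff minus_le_iff)
  obtain \<tau> v where v: "0 < \<tau>" "is_sol (ereal \<tau>) v" "v 0 = u0" using local_solution[OF u0] by blast
  have "u0 \<in> K" using inK[of "ereal \<tau>" v 0] v by (simp add: trajectory_def)
  moreover have "K \<subseteq> box lo hi"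
  proof
    fix x assume x: "x \<in> K"
    have "lo$i < x$i \<and> x$i < hi$i" for i
      using x be(1)[of i] by (cases "i \<in> I") (auto simp: K_def lo_def hi_def mem_box_cart dest!: spec[of _ i])
    then show "x \<in> box lo hi" by (simp add: mem_box_cart)
  qed
  moreover have "cbox lo hi \<subseteq> U"
  proof
    fix x assume x: "x \<in> cbox lo hi"
    have "x$i < 0" if "i \<in> I" for i
      using x be(1)[OF that] that by (auto simp: hi_def mem_box_cart dest!: spec[of _ i])
    then show "x \<in> U" by (simp add: U_eq)
  qed
  moreover have "compact K" by (simp add: K_def)
  ultimately show ?thesis using inK by blast
qed

lemma global_trajectory: "\<exists>u. trajectory \<infinity> u"
proof -
  obtain K lo hi where K: "compact K" "K \<subseteq> box lo hi" "cbox lo hi \<subseteq> U" "u0 \<in> K"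
    "\<And>T u t. trajectory T u \<Longrightarrow> t \<in> time_dom T \<Longrightarrow> u t \<in> K" using a_priori_box by blast
  have "\<exists>u. is_sol \<infinity> u \<and> u 0 = u0"
    by (rule global_solution[OF compact_imp_closed[OF K(1)] K(2,3,4)]) (rule K(5), auto simp: trajectory_def)
  then show ?thesis by (auto simp: trajectory_def)
qed

text \<open>Since the distance to \<open>p\<close> never exceeds \<open>W\<close>, coercivity is at
  least quadratic with factor \<open>m / (1 + W)\<close>, and \<open>psi_bounds\<close> makes the
  Lyapunov function comparable to the squared distance. It therefore decays at the rate
  \<open>l\<close>, and the distance at the rate \<open>l/2\<close>.\<close>

lemma trajectory_converges:
  assumes tr: "trajectory \<infinity> u"
  shows "\<exists>C c. C > 0 \<and> c > 0 \<and> (\<forall>t\<ge>0. norm (u t - p) \<le> C * exp (- c * t))"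
proof -
  have s: "is_sol \<infinity> u" "u 0 = u0" using tr by (auto simp: trajectory_def)
  obtain B0 where B0: "\<And>T u t i. trajectory T u \<Longrightarrow> t \<in> time_dom T \<Longrightarrow> \<bar>u t $ i\<bar> \<le> B0"
    using trajectory_bounded by blast
  define B where "B = \<bar>B0\<bar> + (\<Sum>i\<in>UNIV. \<bar>p$i\<bar>)"
  have pB: "\<bar>p$i\<bar> \<le> B" for i using member_le_sum[of i UNIV "\<lambda>i. \<bar>p$i\<bar>"] by (simp add: B_def)
  have uB: "\<bar>u t $ i\<bar> \<le> B" if "t \<ge> 0" for t i
  proof -
    have "\<bar>u t $ i\<bar> \<le> B0" using B0[OF tr, of t i] that by simp
    moreover have "(\<Sum>i\<in>UNIV. \<bar>p$i\<bar>) \<ge> 0" by (rule sum_nonneg) simp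
    ultimately show ?thesis unfolding B_def by linarith
  qed
  define W where "W = real CARD('n) * (2 * B)"
  have nW: "norm (u t - p) \<le> W" if "t \<ge> 0" for t
  proof -
    have "norm (u t - p) \<le> (\<Sum>i\<in>UNIV. \<bar>(u t - p) $ i\<bar>)" by (rule norm_le_l1_cart)
    also have "\<dots> \<le> (\<Sum>i\<in>(UNIV::'n set). 2 * B)"
    proof (rule sum_mono)
      fix i show "\<bar>(u t - p) $ i\<bar> \<le> 2 * B" using uB[OF that, of i] pB[of i] by simp
    qed
    finally show ?thesis by (simp add: W_def)
  qed
  have W0: "W \<ge> 0" using nW[of 0] norm_ge_zero[of "u 0 - p"] by linarith
  define c2 c3 where "c2 = exp (\<bar>a\<bar> * B) / 2" and "c3 = exp (- \<bar>a\<bar> * B) / 2"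
  have c: "c2 > 0" "c3 > 0" by (simp_all add: c2_def c3_def)
  define V where "V = (\<lambda>t. \<Sum>i\<in>UNIV. psi i (u t $ i))"
  have nsq: "(norm (u t - p))\<^sup>2 = (\<Sum>i\<in>UNIV. (u t $ i - p$i)\<^sup>2)" for t
    unfolding power2_norm_eq_inner inner_vec_def by (simp add: power2_eq_square)
  have Vu: "V t \<le> c2 * (norm (u t - p))\<^sup>2" and Vl: "c3 * (norm (u t - p))\<^sup>2 \<le> V t" if "t \<ge> 0" for t
    unfolding V_def nsq sum_distrib_left c2_def c3_def
    using psi_bounds[OF uB[OF that] pB] by (auto intro!: sum_mono)
  define l where "l = m / ((1 + W) * c2)"
  have l: "l > 0" using m W0 c by (simp add: l_def)
  have Vexp: "V t * exp (l * t) \<le> V 0" if t: "t \<ge> 0" for t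
  proof -
    have tT: "t \<in> time_dom \<infinity>" using t by simp
    have "V t * exp (l * t) \<le> V 0 * exp (l * 0)"
    proof (rule nonincreasing_except_finite_values[where V="{}" and g="\<lambda>t. V t * exp (l * t)"])
      show "continuous_on {0..t} (\<lambda>t. V t * exp (l * t))" unfolding V_def
        by (intro continuous_intros continuous_on_psi_sol[OF s(1) tT])
      fix r assume r: "0 < r" "r < t"
      then have rT: "r \<in> time_dom \<infinity>" by simp
      define V' where "V' = (\<Sum>i\<in>UNIV. (u r $ i - p$i) * (R i * exp (a * u r $ i) - k (u r) $ i))"
      define n where "n = norm (u r - p)"
      have dV: "(V has_real_derivative V') (at r)" unfolding V_def V'_def
        by (intro DERIV_sum DERIV_psi_sol[OF s(1) rT r(1)])
      have n: "0 \<le> n" "n \<le> W" using nW[of r] r by (auto simp: n_def)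
      have "n\<^sup>2 / (1 + W) \<le> n"
      proof -
        have "n * n \<le> n * (1 + W)" using n by (intro mult_left_mono) auto
        then show ?thesis using W0 by (simp add: divide_le_eq power2_eq_square)
      qed
      moreover have "n\<^sup>2 / (1 + W) \<le> n\<^sup>2 / 1" by (rule divide_left_mono) (use W0 in auto)
      ultimately have "n\<^sup>2 / (1 + W) \<le> min n (n\<^sup>2)" by simp
      then have "m * (n\<^sup>2 / (1 + W)) \<le> m * min n (n\<^sup>2)" using m by (intro mult_left_mono) auto
      then have "V' \<le> - (m * (n\<^sup>2 / (1 + W)))" using dissipation[OF tr rT] unfolding V'_def n_def by linarith
      moreover have "l * V r \<le> m * (n\<^sup>2 / (1 + W))"
      proof -
        have "l * V r \<le> l * (c2 * n\<^sup>2)" using Vu[of r] r l unfolding n_def by (intro mult_left_mono) auto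
        also have "\<dots> = m * (n\<^sup>2 / (1 + W))" using c W0 by (simp add: l_def)
        finally show ?thesis .
      qed
      ultimately have le: "V' + l * V r \<le> 0" by linarith
      have "((\<lambda>t. V t * exp (l * t)) has_real_derivative (V' + l * V r) * exp (l * r)) (at r)"
        by (auto intro!: derivative_eq_intros dV simp: algebra_simps)
      moreover have "(V' + l * V r) * exp (l * r) \<le> 0" using le by (intro mult_nonpos_nonneg) auto
      ultimately show "\<exists>d\<le>0. ((\<lambda>t. V t * exp (l * t)) has_real_derivative d) (at r)" by blast
    qed (use t in auto)
    then show ?thesis by simp
  qed
  have V0: "V 0 \<ge> 0" unfolding V_def by (intro sum_nonneg psi_nonneg)
  define C' where "C' = sqrt (V 0 / c3) + 1"
  have "norm (u t - p) \<le> C' * exp (- (l/2) * t)" if t: "t \<ge> 0" for t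
  proof -
    have "V t \<le> V 0 * exp (- l * t)" using Vexp[OF t] by (simp add: exp_minus field_simps)
    then have "c3 * (norm (u t - p))\<^sup>2 \<le> V 0 * exp (- l * t)" using Vl[OF t] by linarith
    then have "(norm (u t - p))\<^sup>2 \<le> V 0 / c3 * exp (- l * t)" using c by (simp add: field_simps)
    then have "norm (u t - p) \<le> sqrt (V 0 / c3 * exp (- l * t))" by (rule real_le_rsqrt)
    also have "\<dots> = sqrt (V 0 / c3) * exp (- (l/2) * t)"
    proof -
      have "sqrt (exp (- l * t)) = exp (- (l/2) * t)"
        by (rule real_sqrt_unique) (auto simp: power2_eq_square simp flip: exp_add)
      then show ?thesis by (simp only: real_sqrt_mult)
    qed
    also have "\<dots> \<le> C' * exp (- (l/2) * t)" by (intro mult_right_mono) (auto simp: C'_def)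
    finally show ?thesis .
  qed
  moreover have "C' > 0" using V0 c by (simp add: C'_def add_nonneg_pos)
  moreover have "l / 2 > 0" using l by simp
  ultimately show ?thesis by blast
qed

end

section \<open>Combinatorial Ricci flows\<close>

context weighted_surface
begin

lemma continuous_on_conf_point: "continuous_on (coord_dom g) (conf_point g)"
  unfolding conf_point_def
  by (intro continuous_on_vec_lambda continuous_on_ln continuous_on_radius) (auto simp: less_imp_neq[OF radius_pos, symmetric])

lemma continuous_on_conf_coord: "continuous_on UNIV (conf_coord g eps)"
proof (cases g)
  case Euclidean
  have "conf_coord Euclidean eps = (\<lambda>f. f)" by (rule ext) simp
  then show ?thesis unfolding Euclidean by simp
next
  case Hyperbolic
  have "continuous_on UNIV (\<lambda>f::real^'v. 1/2 * ln \<bar>(sqrt (1 + exp (2 * f$i)) - 1) / (sqrt (1 + exp (2 * f$i)) + 1)\<bar>)" for i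
  proof -
    have s: "sqrt (1 + exp (2 * f$i)) > 1" for f :: "real^'v" by simp
    have ne: "sqrt (1 + exp (2 * f$i)) + 1 \<noteq> 0" "\<bar>(sqrt (1 + exp (2 * f$i)) - 1) / (sqrt (1 + exp (2 * f$i)) + 1)\<bar> \<noteq> 0"
      for f :: "real^'v" using s[of f] by (auto simp del: real_sqrt_gt_1_iff)
    show ?thesis by (intro continuous_intros ballI ne)
  qed
  then have "continuous_on UNIV (\<lambda>f::real^'v. if eps i = 0 then f$i
      else 1/2 * ln \<bar>(sqrt (1 + exp (2 * f$i)) - 1) / (sqrt (1 + exp (2 * f$i)) + 1)\<bar>)" for i
    by (cases "eps i = 0") (auto intro!: continuous_intros)
  then have "continuous_on UNIV (\<lambda>f::real^'v. \<chi> i. if eps i = 0 then f$i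
      else 1/2 * ln \<bar>(sqrt (1 + exp (2 * f$i)) - 1) / (sqrt (1 + exp (2 * f$i)) + 1)\<bar>)"
    by (rule continuous_on_vec_lambda)
  moreover have "conf_coord Hyperbolic eps = (\<lambda>f. \<chi> i. if eps i = 0 then f$i
      else 1/2 * ln \<bar>(sqrt (1 + exp (2 * f$i)) - 1) / (sqrt (1 + exp (2 * f$i)) + 1)\<bar>)" by (rule ext) simp
  ultimately show ?thesis unfolding Hyperbolic by metis
qed

lemma continuous_on_edge_len:
  assumes e: "{i,j} \<in> edges F" shows "continuous_on UNIV (\<lambda>f. edge_len g eps eta f i j)"
proof -
  have eq: "edge_len g eps eta f i j = edge_len g eps eta (conf_point g (conf_coord g eps f)) i j" for f
    by (simp add: conf_point_conf_coord(2))
  have c: "continuous_on UNIV (\<lambda>f. edge_qty g (conf_coord g eps f) i j)"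
    by (rule continuous_on_compose2[OF continuous_on_edge_qty continuous_on_conf_coord]) (auto simp: conf_point_conf_coord(1))
  show ?thesis
  proof (cases g)
    case Euclidean
    then show ?thesis using c edge_len_eq(1)[OF conf_point_conf_coord(1) Euclidean]
      by (subst eq) (auto intro!: continuous_intros)
  next
    case Hyperbolic
    have "continuous_on UNIV (\<lambda>f. arcosh (edge_qty g (conf_coord g eps f) i j))"
      by (rule continuous_on_compose2[OF continuous_on_arcosh[of "{1..}"] c])
         (use edge_qty_pos(2)[OF conf_point_conf_coord(1) e Hyperbolic] in \<open>auto intro: less_imp_le\<close>)
    then show ?thesis by (subst eq) (simp only: edge_len_eq(2)[OF conf_point_conf_coord(1) Hyperbolic])
  qed
qed

lemma open_dcs: "open (dcs g F eps eta)"
proof -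
  define S where "S = (\<lambda>(i,j,k). {f. edge_len g eps eta f j k < edge_len g eps eta f i j + edge_len g eps eta f i k})"
  have "open (S x)" if x0: "x \<in> ordered_faces" for x
  proof -
    obtain i j k where x: "x = (i,j,k)" and f: "{i,j,k} \<in> F" using x0 by (auto simp: ordered_faces_def)
    show ?thesis unfolding x S_def prod.case
      by (intro open_Collect_less continuous_on_add continuous_on_edge_len face_edges[OF f])
  qed
  then have "open (\<Inter>x\<in>ordered_faces. S x)" by (intro open_INT) auto
  moreover have "(\<Inter>x\<in>ordered_faces. S x) = dcs g F eps eta"
    by (auto simp: dcs_def S_def ordered_faces_def)
  ultimately show ?thesis by simp
qed

lemma curv_eq_ext_curv:
  assumes "f \<in> dcs g F eps eta" shows "curv g F eps eta \<alpha> f i = ext_curv g F eps eta \<alpha> f i"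
proof -
  have "tri_angle g (edge_len g eps eta f j k) (edge_len g eps eta f i j) (edge_len g eps eta f i k)
     = ext_tri_angle g (edge_len g eps eta f j k) (edge_len g eps eta f i j) (edge_len g eps eta f i k)"
    if "{i,j,k} \<in> F" for j k
    using dcs_triangle[OF assms that] unfolding ext_tri_angle_def by (simp add: add.commute)
  then have "angle_defect (tri_angle g) g F eps eta f i = angle_defect (ext_tri_angle g) g F eps eta f i"
    unfolding angle_defect_def by (auto intro!: sum.cong)
  then show ?thesis by (simp add: curv_def ext_curv_def alpha_curv_def)
qed

lemma ext_curv_eq: "ext_curv g F eps eta \<alpha> f i = ext_defect g (conf_coord g eps f) $ i / exp (\<alpha> * conf_coord g eps f $ i)"
  by (simp add: ext_curv_def alpha_curv_def ext_defect_eq)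

text \<open>The original flow is the extended flow confined to \<open>dcs\<close>, where the
  curvatures agree; statements about it reduce to whether an extended solution stays there.\<close>

lemma sol_M_iff:
  "sol_M g F eps eta \<alpha> Rb T f \<longleftrightarrow> ext_sol_M g F eps eta \<alpha> Rb T f \<and> (\<forall>t\<in>time_dom T. f t \<in> dcs g F eps eta)"
  unfolding sol_M_def ext_sol_M_def flow_solution_def by (auto simp: curv_eq_ext_curv)

lemma sol_N_iff:
  "sol_N F eps eta \<alpha> T f \<longleftrightarrow> ext_sol_N F eps eta \<alpha> T f \<and> (\<forall>t\<in>time_dom T. f t \<in> dcs Euclidean F eps eta)"
  unfolding sol_N_def ext_sol_N_def flow_solution_def by (auto simp: curv_eq_ext_curv)

definition defect_bound :: real where
  "defect_bound = 2 * pi + real (card (UNIV :: ('v \<times> 'v) set)) * pi"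

lemma curvature_flow: "curvature_flow (coord_dom g) (ext_defect g) defect_bound"
  by (rule curvature_flow.intro)
     (use ext_defect_mono ext_defect_bounded in \<open>auto simp: defect_bound_def open_coord_dom continuous_on_ext_defect\<close>)

end

section \<open>Transfer of existence, uniqueness and convergence from u to f\<close>

locale surface_flow = weighted_surface F eps eta
  for F :: "'v::finite set set" and eps :: "'v \<Rightarrow> real" and eta :: "'v set \<Rightarrow> real" +
  fixes g :: geometry and \<alpha> :: real and Rb :: "'v \<Rightarrow> real"

sublocale surface_flow \<subseteq> curvature_flow "coord_dom g" "ext_defect g" \<alpha> Rb defect_bound
  by (rule curvature_flow)

context surface_flow
begin

lemma ext_sol_iff:
  "ext_sol_M g F eps eta \<alpha> Rb T f \<longleftrightarrow> 0 < T \<and> is_sol T (\<lambda>t. conf_coord g eps (f t))"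
  unfolding ext_sol_M_def flow_solution_def is_sol_def
  by (simp add: conf_point_conf_coord(1) ext_curv_eq field_def)

text \<open>Needed because \<open>conf_coord\<close> undoes \<open>conf_point\<close> only on
  \<open>coord_dom\<close>, so the two curves are known to agree only at times of the
  domain.\<close>

lemma is_sol_cong:
  assumes "is_sol T u" "\<And>t. t \<in> time_dom T \<Longrightarrow> v t = u t" shows "is_sol T v"
  unfolding is_sol_def
proof (intro ballI conjI allI)
  fix t i assume t: "t \<in> time_dom T"
  show "v t \<in> coord_dom g" using assms(2)[OF t] sol_in[OF assms(1) t] by simp
  have "((\<lambda>s. u s $ i) has_real_derivative field (u t) $ i) (at t within time_dom T)"
    using assms(1) t by (simp add: is_sol_def)
  then have "((\<lambda>s. v s $ i) has_real_derivative field (u t) $ i) (at t within time_dom T)"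
    by (rule has_field_derivative_transform_within[OF _ zero_less_one t]) (simp add: assms(2))
  then show "((\<lambda>s. v s $ i) has_real_derivative field (v t) $ i) (at t within time_dom T)"
    using assms(2)[OF t] by simp
qed

lemma ext_sol_conf_point:
  assumes T: "0 < T" and h: "is_sol T h" shows "ext_sol_M g F eps eta \<alpha> Rb T (\<lambda>t. conf_point g (h t))"
  unfolding ext_sol_iff using T
  by (intro conjI is_sol_cong[OF h] conf_coord_conf_point) (auto intro: sol_in[OF h])

text \<open>At a removable singularity in finite time some sequence converges to a point
  \<open>q\<close>, which need not be nondegenerate; the extended field is defined there and
  \<open>sol_extend\<close> continues the solution.\<close>

lemma solutions_extend_M:
  "solutions_extend (dcs g F eps eta) (sol_M g F eps eta \<alpha> Rb) (ext_sol_M g F eps eta \<alpha> Rb)"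
  unfolding solutions_extend_def
proof (intro allI impI)
  fix T f assume "sol_M g F eps eta \<alpha> Rb T f"
  then have e: "ext_sol_M g F eps eta \<alpha> Rb T f" by (simp add: sol_M_iff)
  then have T: "0 < T" and s: "is_sol T (\<lambda>t. conf_coord g eps (f t))" by (auto simp: ext_sol_iff)
  show "\<exists>T' h. T \<le> T' \<and> ext_sol_M g F eps eta \<alpha> Rb T' h \<and> (\<forall>t\<in>time_dom T. h t = f t) \<and>
      (T < \<infinity> \<and> removable_sing (dcs g F eps eta) T f \<longrightarrow> T < T')"
  proof (cases "T < \<infinity> \<and> removable_sing (dcs g F eps eta) T f")
    case False
    then show ?thesis using e by (intro exI[of _ T] exI[of _ f]) simp
  next
    case True
    then obtain \<tau> where tau: "T = ereal \<tau>" using T by (cases T) auto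
    have t0: "0 < \<tau>" using T tau by simp
    obtain t q where t: "\<And>n. t n \<in> time_dom T" "(\<lambda>n. ereal (t n)) \<longlonglongrightarrow> T" "(\<lambda>n. f (t n)) \<longlonglongrightarrow> q"
      using True unfolding removable_sing_def by metis
    have tn: "t n \<in> {0..<\<tau>}" for n using t(1)[of n] unfolding tau by simp
    have tl: "t \<longlonglongrightarrow> \<tau>" using t(2) unfolding tau by simp
    have ul: "(\<lambda>n. conf_coord g eps (f (t n))) \<longlonglongrightarrow> conf_coord g eps q"
      using continuous_on_tendsto_compose[OF continuous_on_conf_coord t(3)] by simp
    obtain T' h where h: "\<tau> < T'" "is_sol (ereal T') h" "\<And>r. r \<in> {0..<\<tau>} \<Longrightarrow> h r = conf_coord g eps (f r)"
      using sol_extend[OF t0 s[unfolded tau] tn tl ul conf_point_conf_coord(1)] by blast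
    have "conf_point g (h r) = f r" if "r \<in> time_dom T" for r
      using h(3)[of r] that unfolding tau by (simp add: conf_point_conf_coord(2))
    moreover have "ext_sol_M g F eps eta \<alpha> Rb (ereal T') (\<lambda>t. conf_point g (h t))"
      by (rule ext_sol_conf_point[OF _ h(2)]) (use t0 h(1) in simp)
    ultimately show ?thesis using h(1) unfolding tau
      by (intro exI[of _ "ereal T'"] exI[of _ "\<lambda>t. conf_point g (h t)"]) simp
  qed
qed

lemma unique_solution_M: "unique_solution (ext_sol_M g F eps eta \<alpha> Rb) f0"
  unfolding unique_solution_def
proof (intro conjI allI impI ballI)
  obtain \<tau> u where u: "0 < \<tau>" "is_sol (ereal \<tau>) u" "u 0 = conf_coord g eps f0"
    using local_solution[OF conf_point_conf_coord(1)] by blast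
  then show "\<exists>T f. ext_sol_M g F eps eta \<alpha> Rb T f \<and> f 0 = f0"
    using ext_sol_conf_point[OF _ u(2)] by (intro exI[of _ "ereal \<tau>"] exI[of _ "\<lambda>t. conf_point g (u t)"])
      (simp add: conf_point_conf_coord(2))
next
  fix T1 T2 f1 f2 t
  assume a: "ext_sol_M g F eps eta \<alpha> Rb T1 f1 \<and> ext_sol_M g F eps eta \<alpha> Rb T2 f2 \<and> f1 0 = f0 \<and> f2 0 = f0"
    and t: "t \<in> time_dom T1 \<inter> time_dom T2"
  have "conf_coord g eps (f1 t) = conf_coord g eps (f2 t)"
    by (rule sol_unique[of T1 "\<lambda>t. conf_coord g eps (f1 t)" T2 "\<lambda>t. conf_coord g eps (f2 t)"])
       (use a t in \<open>auto simp: ext_sol_iff\<close>)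
  then show "f1 t = f2 t" using conf_point_conf_coord(2) by metis
qed

text \<open>\<open>conf_point\<close> carries the a priori compact set to a bounded one, which
  excludes essential singularities, and carries the limit \<open>p\<close> into the open set
  \<open>dcs\<close>, away from its frontier. For the original flow, the first time at which the
  global extended solution left \<open>dcs\<close> would be a removable singularity in finite
  time.\<close>

lemma convergence:
  assumes cf: "converging_flow (coord_dom g) (ext_defect g) \<alpha> Rb defect_bound I p (conf_coord g eps f0) m"
    and pd: "conf_point g p \<in> dcs g F eps eta"
  shows "ext_sol_M g F eps eta \<alpha> Rb T f \<Longrightarrow> f 0 = f0 \<Longrightarrow> \<not> essential_sing T f"
    and "exists_and_converges g eps (ext_sol_M g F eps eta \<alpha> Rb) f0"
    and "f0 \<in> dcs g F eps eta \<Longrightarrow>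
      (\<forall>T f. sol_M g F eps eta \<alpha> Rb T f \<and> f 0 = f0 \<and> T < \<infinity> \<longrightarrow> \<not> removable_sing (dcs g F eps eta) T f) \<Longrightarrow>
      exists_and_converges g eps (sol_M g F eps eta \<alpha> Rb) f0"
    and "ext_sol_M g F eps eta \<alpha> Rb \<infinity> f \<Longrightarrow> f 0 = f0 \<Longrightarrow> \<not> removable_sing (dcs g F eps eta) \<infinity> f"
proof -
  interpret cf: converging_flow "coord_dom g" "ext_defect g" \<alpha> Rb defect_bound I p "conf_coord g eps f0" m by (rule cf)
  have traj: "cf.trajectory T (\<lambda>t. conf_coord g eps (f t))" if "ext_sol_M g F eps eta \<alpha> Rb T f" "f 0 = f0" for T f
    using that by (simp add: cf.trajectory_def ext_sol_iff)
  have p: "p \<in> coord_dom g" by (rule cf.p(1))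
  show "\<not> essential_sing T f" if f: "ext_sol_M g F eps eta \<alpha> Rb T f" "f 0 = f0" for T f
  proof
    assume "essential_sing T f"
    then obtain i t where t: "\<And>n. t n \<in> time_dom T"
      "filterlim (\<lambda>n. f (t n) $ i) at_top sequentially \<or> filterlim (\<lambda>n. f (t n) $ i) at_bot sequentially"
      unfolding essential_sing_def by blast
    obtain K lo hi where K: "compact K" "K \<subseteq> box lo hi" "cbox lo hi \<subseteq> coord_dom g"
      "\<And>T u t. cf.trajectory T u \<Longrightarrow> t \<in> time_dom T \<Longrightarrow> u t \<in> K" using cf.a_priori_box by blast
    have "K \<subseteq> coord_dom g" by (rule order_trans[OF order_trans[OF K(2) box_subset_cbox] K(3)])
    then have "compact (conf_point g ` K)"
      using K(1) continuous_on_subset[OF continuous_on_conf_point] by (intro compact_continuous_image) auto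
    then obtain B where B: "\<forall>y\<in>conf_point g ` K. norm y \<le> B"
      using compact_imp_bounded[of "conf_point g ` K"] unfolding bounded_iff by blast
    have fb: "\<bar>f (t n) $ i\<bar> \<le> B" for n
    proof -
      have "conf_coord g eps (f (t n)) \<in> K" by (rule K(4)[OF traj[OF f] t(1)])
      then have "norm (conf_point g (conf_coord g eps (f (t n)))) \<le> B" using B by blast
      then show ?thesis using component_le_norm_cart[of "f (t n)" i] by (simp add: conf_point_conf_coord(2))
    qed
    from t(2) show False
    proof
      assume "filterlim (\<lambda>n. f (t n) $ i) at_top sequentially"
      then have "\<forall>\<^sub>F n in sequentially. B < f (t n) $ i" by (simp add: filterlim_at_top_dense)
      from eventually_happens'[OF sequentially_bot this] obtain n where "B < f (t n) $ i" by blast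
      then show False using fb[of n] by simp
    next
      assume "filterlim (\<lambda>n. f (t n) $ i) at_bot sequentially"
      then have "\<forall>\<^sub>F n in sequentially. f (t n) $ i < - B" by (simp add: filterlim_at_bot_dense)
      from eventually_happens'[OF sequentially_bot this] obtain n where "f (t n) $ i < - B" by blast
      then show False using fb[of n] by simp
    qed
  qed
  obtain u where u: "cf.trajectory \<infinity> u" using cf.global_trajectory by blast
  then have us: "is_sol \<infinity> u" and u0: "u 0 = conf_coord g eps f0" by (auto simp: cf.trajectory_def)
  define h where "h = (\<lambda>t. conf_point g (u t))"
  have h: "ext_sol_M g F eps eta \<alpha> Rb \<infinity> h" "h 0 = f0"
    unfolding h_def using ext_sol_conf_point[OF _ us] u0 by (simp_all add: conf_point_conf_coord(2))
  have conv: "exp_convergent g eps f" if f: "ext_sol_M g F eps eta \<alpha> Rb \<infinity> f" "f 0 = f0" for f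
    using cf.trajectory_converges[OF traj[OF f]] conf_coord_conf_point[OF p] unfolding exp_convergent_def by metis
  show "exists_and_converges g eps (ext_sol_M g F eps eta \<alpha> Rb) f0"
    unfolding exists_and_converges_def using h conv by blast
  show "\<not> removable_sing (dcs g F eps eta) \<infinity> f" if f: "ext_sol_M g F eps eta \<alpha> Rb \<infinity> f" "f 0 = f0" for f
  proof
    assume "removable_sing (dcs g F eps eta) \<infinity> f"
    then obtain t q where t: "\<And>n. t n \<in> time_dom \<infinity>" "(\<lambda>n. ereal (t n)) \<longlonglongrightarrow> \<infinity>" "(\<lambda>n. f (t n)) \<longlonglongrightarrow> q"
      "q \<in> frontier (dcs g F eps eta)" unfolding removable_sing_def by metis
    obtain C c where c: "C > 0" "c > 0" "\<And>s. s \<ge> 0 \<Longrightarrow> norm (conf_coord g eps (f s) - p) \<le> C * exp (- c * s)"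
      using cf.trajectory_converges[OF traj[OF f]] by metis
    have "filterlim t at_top sequentially" using t(2) by (simp add: tendsto_PInfty_eq_at_top)
    then have "filterlim (\<lambda>n. c * t n) at_top sequentially"
      using c(2) by (intro filterlim_tendsto_pos_mult_at_top[OF tendsto_const]) auto
    then have "filterlim (\<lambda>n. - c * t n) at_bot sequentially"
      by (simp add: filterlim_uminus_at_bot)
    then have "(\<lambda>n. exp (- c * t n)) \<longlonglongrightarrow> 0" by (rule filterlim_compose[OF exp_at_bot])
    then have e0: "(\<lambda>n. C * exp (- c * t n)) \<longlonglongrightarrow> 0" using tendsto_mult_left[of _ 0 sequentially C] by simp
    have "(\<lambda>n. conf_coord g eps (f (t n)) - p) \<longlonglongrightarrow> 0"
      by (rule tendsto_0_le[OF e0, where K=1]) (use c t(1) in \<open>auto intro!: always_eventually\<close>)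
    then have "(\<lambda>n. conf_coord g eps (f (t n))) \<longlonglongrightarrow> p" by (simp add: LIM_zero_iff)
    then have "(\<lambda>n. conf_point g (conf_coord g eps (f (t n)))) \<longlonglongrightarrow> conf_point g p"
      by (rule continuous_on_tendsto_compose[OF continuous_on_conf_point _ p]) (simp add: conf_point_conf_coord(1))
    then have "q = conf_point g p" using t(3) LIMSEQ_unique by (simp add: conf_point_conf_coord(2))
    then show False using t(4) pd open_dcs by (simp add: frontier_def interior_open)
  qed
  show "exists_and_converges g eps (sol_M g F eps eta \<alpha> Rb) f0"
    if f0: "f0 \<in> dcs g F eps eta" and nr: "\<forall>T f. sol_M g F eps eta \<alpha> Rb T f \<and> f 0 = f0 \<and> T < \<infinity> \<longrightarrow> \<not> removable_sing (dcs g F eps eta) T f"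
  proof -
    have hc: "continuous_on {0..s} h" if "s \<ge> 0" for s
      unfolding h_def
      by (rule continuous_on_compose2[OF continuous_on_conf_point sol_continuous_interval[OF us]])
         (use that sol_in[OF us] in auto)
    have "h s \<in> dcs g F eps eta" if s0: "s \<ge> 0" for s
    proof (rule ccontr)
      assume n: "h s \<notin> dcs g F eps eta"
      have "h 0 \<in> dcs g F eps eta" using f0 h(2) by simp
      from first_exit[OF hc[OF s0] open_dcs this s0 order_refl n] obtain \<tau> where
        tau: "0 < \<tau>" "\<tau> \<le> s" "h \<tau> \<notin> dcs g F eps eta" "\<And>t. 0 \<le> t \<Longrightarrow> t < \<tau> \<Longrightarrow> h t \<in> dcs g F eps eta" by blast
      have "is_sol (ereal \<tau>) (\<lambda>t. conf_coord g eps (h t))"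
        by (rule sol_restrict[of \<infinity>]) (use h(1) in \<open>simp_all add: ext_sol_iff\<close>)
      then have sM: "sol_M g F eps eta \<alpha> Rb (ereal \<tau>) h" using tau by (simp add: sol_M_iff ext_sol_iff)
      \<comment> \<open>A sequence in the half-open interval that tends to its end; it witnesses the
        singularity.\<close>
      define t where "t n = \<tau> - \<tau> / real (Suc n)" for n
      have tn: "t n \<in> {0..<\<tau>}" for n using tau(1) by (auto simp: t_def field_simps)
      have "(\<lambda>n. \<tau> - \<tau> * inverse (real (Suc n))) \<longlonglongrightarrow> \<tau> - \<tau> * 0"
        by (intro tendsto_intros LIMSEQ_inverse_real_of_nat)
      moreover have "t = (\<lambda>n. \<tau> - \<tau> * inverse (real (Suc n)))" by (rule ext) (simp only: t_def divide_inverse)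
      ultimately have tl: "t \<longlonglongrightarrow> \<tau>" by (simp only: mult_zero_right diff_zero)
      have hl: "(\<lambda>n. h (t n)) \<longlonglongrightarrow> h \<tau>"
      proof (rule continuous_on_tendsto_compose[OF hc[OF less_imp_le[OF tau(1)]] tl])
        show "\<tau> \<in> {0..\<tau>}" using tau(1) by simp
        have "t n \<in> {0..\<tau>}" for n using tn[of n] by simp
        then show "\<forall>\<^sub>F n in sequentially. t n \<in> {0..\<tau>}" by (intro always_eventually allI)
      qed
      have "h (t n) \<in> dcs g F eps eta" for n using tau(4)[of "t n"] tn[of n] by simp
      then have "h \<tau> \<in> closure (dcs g F eps eta)"
        using hl unfolding closure_sequential by (intro exI[of _ "\<lambda>n. h (t n)"]) simp
      then have "h \<tau> \<in> frontier (dcs g F eps eta)" using tau(3) open_dcs by (simp add: frontier_def interior_open)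
      then have "removable_sing (dcs g F eps eta) (ereal \<tau>) h"
        unfolding removable_sing_def using tn tl hl by (intro exI[of _ t] exI[of _ "h \<tau>"]) simp
      then show False using nr[rule_format, of "ereal \<tau>" h] sM h(2) by simp
    qed
    then have "sol_M g F eps eta \<alpha> Rb \<infinity> h" using h(1) by (simp add: sol_M_iff)
    then show ?thesis unfolding exists_and_converges_def using h(2) conv by (auto simp: sol_M_iff)
  qed
qed

end

section \<open>The conserved sum and the reduction of (N) to (M)\<close>

context weighted_surface
begin

lemma exp_ext_curv: "exp (\<alpha> * f$i) * (c - ext_curv Euclidean F eps eta \<alpha> f i) = c * exp (\<alpha> * f$i) - ext_defect Euclidean f $ i"
  by (simp add: ext_curv_eq algebra_simps)

lemma sum_exp_pos: "(\<Sum>i\<in>UNIV. exp (\<alpha> * (f::real^'v)$i)) > 0"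
  by (intro sum_pos) auto

text \<open>The exponentials cancel the denominators of the curvatures, and Gauss-Bonnet evaluates
  the remaining sum of defects.\<close>

lemma DERIV_sum_exp:
  assumes d: "\<And>i. ((\<lambda>s. f s $ i) has_real_derivative c - ext_curv Euclidean F eps eta \<alpha> (f t) i) (at t within S)"
  shows "((\<lambda>s. \<Sum>i\<in>UNIV. exp (\<alpha> * f s $ i)) has_real_derivative
     \<alpha> * (c * (\<Sum>i\<in>UNIV. exp (\<alpha> * f t $ i)) - 2 * pi * euler_char F)) (at t within S)"
proof -
  have "((\<lambda>s. \<Sum>i\<in>UNIV. exp (\<alpha> * f s $ i)) has_real_derivative
     (\<Sum>i\<in>UNIV. \<alpha> * (c * exp (\<alpha> * f t $ i) - ext_defect Euclidean (f t) $ i))) (at t within S)"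
  proof (rule DERIV_sum)
    fix i
    have "((\<lambda>s. exp (\<alpha> * f s $ i)) has_real_derivative exp (\<alpha> * f t $ i) * (\<alpha> * (c - ext_curv Euclidean F eps eta \<alpha> (f t) i))) (at t within S)"
      by (auto intro!: derivative_eq_intros d)
    also have "exp (\<alpha> * f t $ i) * (\<alpha> * (c - ext_curv Euclidean F eps eta \<alpha> (f t) i))
       = \<alpha> * (exp (\<alpha> * f t $ i) * (c - ext_curv Euclidean F eps eta \<alpha> (f t) i))" by simp
    finally show "((\<lambda>s. exp (\<alpha> * f s $ i)) has_real_derivative \<alpha> * (c * exp (\<alpha> * f t $ i) - ext_defect Euclidean (f t) $ i)) (at t within S)"
      unfolding exp_ext_curv .
  qed
  then show ?thesis by (simp add: sum_distrib_left[symmetric] sum_subtractf gauss_bonnet)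
qed

lemma constant_on_time_dom:
  fixes \<phi> :: "real \<Rightarrow> real"
  assumes d: "\<And>t. t \<in> time_dom T \<Longrightarrow> (\<phi> has_real_derivative 0) (at t within time_dom T)" and t: "t \<in> time_dom T"
  shows "\<phi> t = \<phi> 0"
proof (cases "t = 0")
  case False
  then have t0: "0 < t" using t by (simp add: time_dom_def)
  have "continuous_on (time_dom T) \<phi>" by (rule DERIV_continuous_on[OF d])
  then have c: "continuous_on {0..t} \<phi>" using time_dom_interval[OF t] by (rule continuous_on_subset)
  have "(\<phi> has_real_derivative 0) (at s)" if "0 < s" "s < t" for s
  proof -
    have "s \<in> time_dom T" using that time_dom_interval[OF t] by auto
    then show ?thesis using d[of s] at_within_time_dom[of s T] that by simp
  qed
  then show ?thesis using DERIV_isconst2[OF t0 c, of t] t0 by simp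
qed simp

text \<open>With the average curvature frozen at its initial value, the deviation of the sum from
  its start satisfies a homogeneous linear equation with initial value 0.\<close>

lemma sum_exp_const_M:
  assumes s: "ext_sol_M Euclidean F eps eta \<alpha> (\<lambda>_. curv_av F \<alpha> (f 0)) T f" and t: "t \<in> time_dom T"
  shows "(\<Sum>i\<in>UNIV. exp (\<alpha> * f t $ i)) = (\<Sum>i\<in>UNIV. exp (\<alpha> * f 0 $ i))"
proof -
  define S where "S = (\<lambda>t. \<Sum>i\<in>UNIV. exp (\<alpha> * f t $ i))"
  define c where "c = curv_av F \<alpha> (f 0)"
  have c: "c * S 0 = 2 * pi * euler_char F" using sum_exp_pos[of \<alpha> "f 0"] by (simp add: c_def curv_av_def S_def)
  have dS: "(S has_real_derivative \<alpha> * (c * S t - 2 * pi * euler_char F)) (at t within time_dom T)" if "t \<in> time_dom T" for t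
    unfolding S_def using s that
    by (intro DERIV_sum_exp) (simp add: ext_sol_M_def flow_solution_def c_def)
  have "(S t - S 0) * exp (- (\<alpha> * c * t)) = (S 0 - S 0) * exp (- (\<alpha> * c * 0))"
  proof (rule constant_on_time_dom[where \<phi>="\<lambda>t. (S t - S 0) * exp (- (\<alpha> * c * t))", OF _ t])
    fix t assume t: "t \<in> time_dom T"
    have "((\<lambda>t. (S t - S 0) * exp (- (\<alpha> * c * t))) has_real_derivative
       (\<alpha> * (c * S t - 2 * pi * euler_char F)) * exp (- (\<alpha> * c * t)) + (S t - S 0) * (exp (- (\<alpha> * c * t)) * (- (\<alpha> * c)))) (at t within time_dom T)"
      by (auto intro!: derivative_eq_intros dS[OF t])
    moreover have "(\<alpha> * (c * S t - 2 * pi * euler_char F)) * exp (- (\<alpha> * c * t)) + (S t - S 0) * (exp (- (\<alpha> * c * t)) * (- (\<alpha> * c))) = 0"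
      unfolding c[symmetric] by (simp add: algebra_simps)
    ultimately show "((\<lambda>t. (S t - S 0) * exp (- (\<alpha> * c * t))) has_real_derivative 0) (at t within time_dom T)" by metis
  qed
  then show ?thesis by (simp add: S_def)
qed

lemma sum_exp_const_N:
  assumes s: "ext_sol_N F eps eta \<alpha> T f" and t: "t \<in> time_dom T"
  shows "(\<Sum>i\<in>UNIV. exp (\<alpha> * f t $ i)) = (\<Sum>i\<in>UNIV. exp (\<alpha> * f 0 $ i))"
proof (rule constant_on_time_dom[where \<phi>="\<lambda>t. \<Sum>i\<in>UNIV. exp (\<alpha> * f t $ i)", OF _ t])
  fix t assume t: "t \<in> time_dom T"
  have "((\<lambda>s. \<Sum>i\<in>UNIV. exp (\<alpha> * f s $ i)) has_real_derivative
     \<alpha> * (curv_av F \<alpha> (f t) * (\<Sum>i\<in>UNIV. exp (\<alpha> * f t $ i)) - 2 * pi * euler_char F)) (at t within time_dom T)"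
    using s t by (intro DERIV_sum_exp) (simp add: ext_sol_N_def flow_solution_def)
  moreover have "curv_av F \<alpha> (f t) * (\<Sum>i\<in>UNIV. exp (\<alpha> * f t $ i)) = 2 * pi * euler_char F"
    using sum_exp_pos[of \<alpha> "f t"] by (simp add: curv_av_def)
  ultimately show "((\<lambda>t. \<Sum>i\<in>UNIV. exp (\<alpha> * f t $ i)) has_real_derivative 0) (at t within time_dom T)" by simp
qed

text \<open>As \<open>\<Sum>i. exp (\<alpha> f i)\<close> is conserved, the average curvature is a constant along (N).\<close>

lemma ext_sol_N_iff_M:
  "ext_sol_N F eps eta \<alpha> T f \<longleftrightarrow> ext_sol_M Euclidean F eps eta \<alpha> (\<lambda>_. curv_av F \<alpha> (f 0)) T f"
proof
  assume s: "ext_sol_N F eps eta \<alpha> T f"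
  have "curv_av F \<alpha> (f t) = curv_av F \<alpha> (f 0)" if "t \<in> time_dom T" for t
    using sum_exp_const_N[OF s that] by (simp add: curv_av_def)
  then show "ext_sol_M Euclidean F eps eta \<alpha> (\<lambda>_. curv_av F \<alpha> (f 0)) T f"
    using s by (simp add: ext_sol_N_def ext_sol_M_def flow_solution_def)
next
  assume s: "ext_sol_M Euclidean F eps eta \<alpha> (\<lambda>_. curv_av F \<alpha> (f 0)) T f"
  have "curv_av F \<alpha> (f t) = curv_av F \<alpha> (f 0)" if "t \<in> time_dom T" for t
    using sum_exp_const_M[OF s that] by (simp add: curv_av_def)
  then show "ext_sol_N F eps eta \<alpha> T f"
    using s by (simp add: ext_sol_N_def ext_sol_M_def flow_solution_def)
qed

lemma sol_N_iff_M:
  "sol_N F eps eta \<alpha> T f \<longleftrightarrow> sol_M Euclidean F eps eta \<alpha> (\<lambda>_. curv_av F \<alpha> (f 0)) T f"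
  unfolding sol_N_iff sol_M_iff ext_sol_N_iff_M ..

lemma dcs_shift:
  assumes "f \<in> dcs Euclidean F eps eta" shows "f + (\<chi> i. c) \<in> dcs Euclidean F eps eta"
proof -
  have el: "edge_len Euclidean eps eta (f + (\<chi> i. c)) i j = exp c * edge_len Euclidean eps eta f i j" for i j
  proof -
    have e: "exp (2 * (f$k + c)) = (exp c)\<^sup>2 * exp (2 * f$k)" "exp ((f$i + c) + (f$j + c)) = (exp c)\<^sup>2 * exp (f$i + f$j)" for k
      by (simp_all only: power2_eq_square exp_add[symmetric]) (rule arg_cong[of _ _ exp], simp)+
    have m: "a * (x * A) + b * (x * B) + d * (x * D) = x * (a * A + b * B + d * D)" for a b d x A B D :: real
      by (simp add: distrib_left)
    have "edge_len Euclidean eps eta (f + (\<chi> i. c)) i j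
      = sqrt ((exp c)\<^sup>2 * (eps i * exp (2 * f$i) + eps j * exp (2 * f$j) + 2 * eta {i, j} * exp (f$i + f$j)))"
      unfolding edge_len.simps vector_add_component vec_lambda_beta e m ..
    then show ?thesis by (simp only: edge_len.simps real_sqrt_mult real_sqrt_abs abs_exp_cancel)
  qed
  have lt: "exp c * x < exp c * y + exp c * z \<longleftrightarrow> x < y + z" for x y z
    by (simp only: distrib_left[symmetric] mult_less_cancel_left_pos exp_gt_zero)
  show ?thesis using assms unfolding dcs_def mem_Collect_eq el lt .
qed

text \<open>For \<alpha> = 0 the exponential sum carries no information, so the plain sum of the
  coordinates takes its place. Applied with \<open>u\<close> and \<open>p\<close> in either order,
  this yields components of both signs.\<close>

lemma balanced:
  fixes u p :: "real^'v"
  assumes "if \<alpha> = 0 then (\<Sum>i\<in>UNIV. u$i) = (\<Sum>i\<in>UNIV. p$i)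
     else (\<Sum>i\<in>UNIV. exp (\<alpha> * u$i)) = (\<Sum>i\<in>UNIV. exp (\<alpha> * p$i))"
  shows "\<exists>i. (u - p)$i \<le> 0"
proof (rule ccontr)
  assume "\<not> ?thesis"
  then have lt: "p$i < u$i" for i by (simp add: not_le)
  consider "\<alpha> = 0" | "\<alpha> > 0" | "\<alpha> < 0" by linarith
  then show False
  proof cases
    case 1
    have "(\<Sum>i\<in>UNIV. p$i) < (\<Sum>i\<in>UNIV. u$i)" by (rule sum_strict_mono) (auto simp: lt)
    then show False using assms 1 by simp
  next
    case 2
    have "(\<Sum>i\<in>UNIV. exp (\<alpha> * p$i)) < (\<Sum>i\<in>UNIV. exp (\<alpha> * u$i))" by (rule sum_strict_mono) (auto simp: lt 2)
    then show False using assms 2 by simp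
  next
    case 3
    have "(\<Sum>i\<in>UNIV. exp (\<alpha> * u$i)) < (\<Sum>i\<in>UNIV. exp (\<alpha> * p$i))" by (rule sum_strict_mono) (auto simp: lt 3)
    then show False using assms 3 by simp
  qed
qed

text \<open>Translation keeps the defect and the triangle inequalities, so a translate
  \<open>p\<close> of the given structure can share the conserved quantity of \<open>f0\<close>; its
  curvature is then the average curvature of \<open>f0\<close>.\<close>

lemma eucl_converging:
  assumes fs: "fs \<in> dcs Euclidean F eps eta" and c: "\<And>i. curv Euclidean F eps eta \<alpha> fs i = c"
    and chi: "\<alpha> * euler_char F \<le> 0"
  shows "\<exists>p m. p \<in> dcs Euclidean F eps eta \<and>
    converging_flow (coord_dom Euclidean) (ext_defect Euclidean) \<alpha> (\<lambda>_. curv_av F \<alpha> f0) defect_bound {} p f0 m"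
proof -
  interpret fl: surface_flow F eps eta Euclidean \<alpha> "\<lambda>_. curv_av F \<alpha> f0" ..
  define S0 where "S0 = (\<Sum>i\<in>UNIV. exp (\<alpha> * f0$i))"
  define Ss where "Ss = (\<Sum>i\<in>UNIV. exp (\<alpha> * fs$i))"
  have S: "S0 > 0" "Ss > 0" by (simp_all add: S0_def Ss_def sum_exp_pos)
  have ef: "ext_defect Euclidean fs $ i = c * exp (\<alpha> * fs$i)" for i
    using c[of i] unfolding curv_eq_ext_curv[OF fs] ext_curv_eq by (simp add: field_simps)
  have cS: "c * Ss = 2 * pi * euler_char F"
    using gauss_bonnet[of fs] by (simp add: ef Ss_def sum_distrib_left)
  \<comment> \<open>Solves for equal exponential sums, or for equal coordinate sums if \<alpha> = 0;
    in both cases \<open>exp (\<alpha> * s) = S0 / Ss\<close>.\<close>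
  define s where "s = (if \<alpha> = 0 then ((\<Sum>i\<in>UNIV. f0$i) - (\<Sum>i\<in>UNIV. fs$i)) / real CARD('v) else ln (S0 / Ss) / \<alpha>)"
  define p where "p = fs + (\<chi> i. s)"
  have pd: "p \<in> dcs Euclidean F eps eta" unfolding p_def by (rule dcs_shift[OF fs])
  have es: "exp (\<alpha> * s) = S0 / Ss"
    using S by (cases "\<alpha> = 0") (auto simp: s_def S0_def Ss_def)
  have ep: "exp (\<alpha> * p$i) = S0 / Ss * exp (\<alpha> * fs$i)" for i
    unfolding es[symmetric] by (simp add: p_def distrib_left exp_add)
  have kp: "ext_defect Euclidean p $ i = curv_av F \<alpha> f0 * exp (\<alpha> * p$i)" for i
    unfolding ep unfolding p_def ext_defect_shift ef
    using S cS by (simp add: curv_av_def S0_def[symmetric] field_simps)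
  have Sp: "(\<Sum>i\<in>UNIV. exp (\<alpha> * p$i)) = S0"
    unfolding ep by (simp only: sum_distrib_left[symmetric] Ss_def[symmetric]) (use S in simp)
  have Sp0: "(\<Sum>i\<in>UNIV. p$i) = (\<Sum>i\<in>UNIV. f0$i)" if "\<alpha> = 0"
    using that by (simp add: p_def s_def sum.distrib)
  obtain m where m: "m > 0" "\<And>u. (\<exists>i. (u - p)$i \<ge> 0) \<Longrightarrow> (\<exists>i. (u - p)$i \<le> 0) \<Longrightarrow>
     (u - p) \<bullet> (ext_defect Euclidean u - ext_defect Euclidean p) \<ge> m * min (norm (u - p)) ((norm (u - p))\<^sup>2)"
    using eucl_coercive[OF pd] by blast
  have "converging_flow (coord_dom Euclidean) (ext_defect Euclidean) \<alpha> (\<lambda>_. curv_av F \<alpha> f0) defect_bound {} p f0 m"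
  proof (unfold_locales)
    show "coord_dom Euclidean = {u. \<forall>i\<in>{}. u $ i < 0}" by simp
    show "p \<in> coord_dom Euclidean" "f0 \<in> coord_dom Euclidean" by simp_all
    show "ext_defect Euclidean p $ i = curv_av F \<alpha> f0 * exp (\<alpha> * p$i)" for i by (rule kp)
    show "\<alpha> * curv_av F \<alpha> f0 \<le> 0"
    proof -
      have "\<alpha> * curv_av F \<alpha> f0 = (2 * pi * (\<alpha> * euler_char F)) / S0" by (simp add: curv_av_def S0_def)
      also have "\<dots> \<le> 0" by (rule divide_nonpos_pos[OF mult_nonneg_nonpos[OF _ chi] S(1)]) simp
      finally show ?thesis .
    qed
    show "0 < m" by (rule m(1))
    fix T u t assume T: "0 < T" and u: "fl.is_sol T u" "u 0 = f0" and t: "t \<in> time_dom T"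
    have e: "ext_sol_M Euclidean F eps eta \<alpha> (\<lambda>_. curv_av F \<alpha> (u 0)) T u"
      using fl.ext_sol_iff[of T u] T u by simp
    have bal: "if \<alpha> = 0 then (\<Sum>i\<in>UNIV. u t$i) = (\<Sum>i\<in>UNIV. p$i)
       else (\<Sum>i\<in>UNIV. exp (\<alpha> * u t$i)) = (\<Sum>i\<in>UNIV. exp (\<alpha> * p$i))"
    proof (cases "\<alpha> = 0")
      case False
      then show ?thesis using sum_exp_const_M[OF e t] Sp u(2) by (simp add: S0_def)
    next
      case True
      have "(\<Sum>i\<in>UNIV. u t $ i) = (\<Sum>i\<in>UNIV. u 0 $ i)"
      proof (rule constant_on_time_dom[where \<phi>="\<lambda>t. \<Sum>i\<in>UNIV. u t $ i", OF _ t])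
        fix r assume r: "r \<in> time_dom T"
        have "((\<lambda>t. \<Sum>i\<in>UNIV. u t $ i) has_real_derivative (\<Sum>i\<in>UNIV. fl.field (u r) $ i)) (at r within time_dom T)"
          by (rule DERIV_sum) (use u(1) r in \<open>unfold fl.is_sol_def, blast\<close>)
        moreover have "(\<Sum>i\<in>UNIV. fl.field (u r) $ i) = 0"
          unfolding fl.field_def using True by (simp add: sum_subtractf gauss_bonnet curv_av_def)
        ultimately show "((\<lambda>t. \<Sum>i\<in>UNIV. u t $ i) has_real_derivative 0) (at r within time_dom T)" by simp
      qed
      then show ?thesis using True Sp0 u(2) by simp
    qed
    have "\<exists>i. (p - u t)$i \<le> 0" by (rule balanced[of \<alpha>]) (use bal in \<open>auto split: if_splits\<close>)
    then have "\<exists>i. (u t - p)$i \<ge> 0" by simp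
    then show "(u t - p) \<bullet> (ext_defect Euclidean (u t) - ext_defect Euclidean p) \<ge> m * min (norm (u t - p)) ((norm (u t - p))\<^sup>2)"
      using m(2) balanced[OF bal] by blast
  qed simp
  then show ?thesis using pd by blast
qed

text \<open>The bound \<open>Rb i < 2 * pi\<close> provides the barrier: as \<open>u i\<close> tends
  to 0 the defect approaches at least \<open>2 * pi\<close>, while
  \<open>Rb i * exp (\<alpha> * u i)\<close> tends to \<open>Rb i\<close>.\<close>

lemma hyp_converging:
  assumes fs: "fs \<in> dcs Hyperbolic F eps eta" and c: "\<And>i. curv Hyperbolic F eps eta \<alpha> fs i = Rb i"
    and sgn: "\<And>i. \<alpha> * Rb i \<le> 0" and lt: "\<And>i. Rb i < 2 * pi"
  shows "\<exists>m. converging_flow (coord_dom Hyperbolic) (ext_defect Hyperbolic) \<alpha> Rb defect_bound {i. eps i \<noteq> 0}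
     (conf_coord Hyperbolic eps fs) (conf_coord Hyperbolic eps f0) m"
proof -
  interpret fl: surface_flow F eps eta Hyperbolic \<alpha> Rb ..
  define p where "p = conf_coord Hyperbolic eps fs"
  have p: "p \<in> coord_dom Hyperbolic" "conf_point Hyperbolic p = fs" unfolding p_def by (rule conf_point_conf_coord)+
  have kp: "ext_defect Hyperbolic p $ i = Rb i * exp (\<alpha> * p$i)" for i
    using c[of i] unfolding curv_eq_ext_curv[OF fs] ext_curv_eq p_def by (simp add: field_simps)
  obtain m where m: "m > 0" "\<And>u. u \<in> coord_dom Hyperbolic \<Longrightarrow>
     (u - p) \<bullet> (ext_defect Hyperbolic u - ext_defect Hyperbolic p) \<ge> m * min (norm (u - p)) ((norm (u - p))\<^sup>2)"
    using hyp_coercive[OF p(1)] p(2) fs by auto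
  have bar: "\<exists>b<0. \<forall>u\<in>coord_dom Hyperbolic. b \<le> u$i \<longrightarrow> fl.field u $ i \<le> 0" if i: "eps i \<noteq> 0" for i
  proof -
    have e1: "eps i = 1" using eps_01[of i] i by auto
    \<comment> \<open>Half of the gap, shared between the error of the defect and that of the
      exponential.\<close>
    define d where "d = (2 * pi - Rb i) / 2"
    have d: "d > 0" "Rb i + d = 2 * pi - d" using lt[of i] by (auto simp: d_def field_simps)
    obtain b where b: "b < 0" "\<And>u. u \<in> coord_dom Hyperbolic \<Longrightarrow> b \<le> u$i \<Longrightarrow> ext_defect Hyperbolic u $ i \<ge> 2 * pi - d"
      using hyp_defect_near_boundary[OF e1 d(1)] by blast
    have "((\<lambda>x. Rb i * exp (\<alpha> * x)) \<longlongrightarrow> Rb i * exp (\<alpha> * 0)) (at 0)" by (intro tendsto_intros)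
    then have "\<forall>\<^sub>F x in at 0. Rb i * exp (\<alpha> * x) < Rb i + d" using d(1) by (intro order_tendstoD(2)) auto
    then obtain e where e: "e > 0" "\<And>x. x \<noteq> 0 \<Longrightarrow> \<bar>x\<bar> < e \<Longrightarrow> Rb i * exp (\<alpha> * x) < Rb i + d"
      unfolding eventually_at by (auto simp: dist_real_def)
    have "fl.field u $ i \<le> 0" if u: "u \<in> coord_dom Hyperbolic" "max b (- e / 2) \<le> u$i" for u
    proof -
      have u0: "u$i < 0" using u(1) i by (simp add: coord_dom_def)
      then have "Rb i * exp (\<alpha> * u$i) < Rb i + d" using u(2) e(1) by (intro e(2)) auto
      also have "\<dots> \<le> ext_defect Hyperbolic u $ i" using b(2)[OF u(1)] u(2) d(2) by simp
      finally have "exp (\<alpha> * u$i) * fl.field u $ i < 0" unfolding fl.exp_field by simp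
      then show ?thesis by (simp add: mult_less_0_iff less_imp_le)
    qed
    moreover have "max b (- e / 2) < 0" using b(1) e(1) by simp
    ultimately show ?thesis by blast
  qed
  have "converging_flow (coord_dom Hyperbolic) (ext_defect Hyperbolic) \<alpha> Rb defect_bound {i. eps i \<noteq> 0} p (conf_coord Hyperbolic eps f0) m"
  proof (unfold_locales)
    show "coord_dom Hyperbolic = {u. \<forall>i\<in>{i. eps i \<noteq> 0}. u $ i < 0}" by (simp add: coord_dom_def)
    show "p \<in> coord_dom Hyperbolic" by (rule p)
    show "conf_coord Hyperbolic eps f0 \<in> coord_dom Hyperbolic" by (rule conf_point_conf_coord)
    show "ext_defect Hyperbolic p $ i = Rb i * exp (\<alpha> * p$i)" for i by (rule kp)
    show "\<alpha> * Rb i \<le> 0" for i by (rule sgn)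
    show "0 < m" by (rule m(1))
    show "(u t - p) \<bullet> (ext_defect Hyperbolic (u t) - ext_defect Hyperbolic p) \<ge> m * min (norm (u t - p)) ((norm (u t - p))\<^sup>2)"
      if "fl.is_sol T u" "t \<in> time_dom T" for T u t
      by (rule m(2)[OF fl.sol_in[OF that]])
    show "\<exists>b<0. \<forall>u\<in>coord_dom Hyperbolic. b \<le> u$i \<longrightarrow> fl.field u $ i \<le> 0" if "i \<in> {i. eps i \<noteq> 0}" for i
      using bar that by simp
  qed
  then show ?thesis unfolding p_def by blast
qed

section \<open>Conclusions for (N) and for the hyperbolic flow (M)\<close>

lemma solutions_extend_N:
  "solutions_extend (dcs Euclidean F eps eta) (sol_N F eps eta \<alpha>) (ext_sol_N F eps eta \<alpha>)"
  unfolding solutions_extend_def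
proof (intro allI impI)
  fix T f assume s: "sol_N F eps eta \<alpha> T f"
  interpret fl: surface_flow F eps eta Euclidean \<alpha> "\<lambda>_. curv_av F \<alpha> (f 0)" ..
  have sM: "sol_M Euclidean F eps eta \<alpha> (\<lambda>_. curv_av F \<alpha> (f 0)) T f" using s unfolding sol_N_iff_M .
  obtain T' h where h: "T \<le> T'" "ext_sol_M Euclidean F eps eta \<alpha> (\<lambda>_. curv_av F \<alpha> (f 0)) T' h"
    "\<forall>t\<in>time_dom T. h t = f t" "T < \<infinity> \<and> removable_sing (dcs Euclidean F eps eta) T f \<longrightarrow> T < T'"
    using fl.solutions_extend_M[unfolded solutions_extend_def, rule_format, OF sM] by blast
  have "0 < T" using s by (simp add: sol_N_def flow_solution_def)
  then have "0 \<in> time_dom T" by (simp add: time_dom_def zero_ereal_def[symmetric])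
  \<comment> \<open>The constant of the associated flow (M) depends on the initial value only, so
    the continuation solves (N) as well.\<close>
  then have h0: "h 0 = f 0" using h(3) by blast
  have "ext_sol_N F eps eta \<alpha> T' h" unfolding ext_sol_N_iff_M h0 by (rule h(2))
  then show "\<exists>T' h. T \<le> T' \<and> ext_sol_N F eps eta \<alpha> T' h \<and> (\<forall>t\<in>time_dom T. h t = f t) \<and>
      (T < \<infinity> \<and> removable_sing (dcs Euclidean F eps eta) T f \<longrightarrow> T < T')"
    using h by blast
qed

lemma unique_solution_N: "unique_solution (ext_sol_N F eps eta \<alpha>) f0"
  unfolding unique_solution_def
proof (intro conjI allI impI ballI)
  interpret fl: surface_flow F eps eta Euclidean \<alpha> "\<lambda>_. curv_av F \<alpha> f0" ..
  note uniq = fl.unique_solution_M[of f0, unfolded unique_solution_def]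
  obtain T f where f: "ext_sol_M Euclidean F eps eta \<alpha> (\<lambda>_. curv_av F \<alpha> f0) T f" "f 0 = f0"
    using uniq by blast
  have "ext_sol_N F eps eta \<alpha> T f" unfolding ext_sol_N_iff_M f(2) by (rule f(1))
  then show "\<exists>T f. ext_sol_N F eps eta \<alpha> T f \<and> f 0 = f0" using f(2) by blast
  fix T1 T2 f1 f2 t
  assume a: "ext_sol_N F eps eta \<alpha> T1 f1 \<and> ext_sol_N F eps eta \<alpha> T2 f2 \<and> f1 0 = f0 \<and> f2 0 = f0"
    and t: "t \<in> time_dom T1 \<inter> time_dom T2"
  have n: "ext_sol_N F eps eta \<alpha> T1 f1" "ext_sol_N F eps eta \<alpha> T2 f2" "f1 0 = f0" "f2 0 = f0" using a by simp_all
  have "ext_sol_M Euclidean F eps eta \<alpha> (\<lambda>_. curv_av F \<alpha> f0) T1 f1" using n(1) unfolding ext_sol_N_iff_M n(3) .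
  moreover have "ext_sol_M Euclidean F eps eta \<alpha> (\<lambda>_. curv_av F \<alpha> f0) T2 f2" using n(2) unfolding ext_sol_N_iff_M n(4) .
  ultimately show "f1 t = f2 t" using uniq a t by blast
qed

lemma exists_and_converges_cong:
  assumes "\<And>f. f 0 = f0 \<Longrightarrow> sol \<infinity> f \<longleftrightarrow> sol' \<infinity> f"
  shows "exists_and_converges g eps sol f0 \<longleftrightarrow> exists_and_converges g eps sol' f0"
  unfolding exists_and_converges_def using assms by blast

lemma convergence_N:
  assumes fs: "fs \<in> dcs Euclidean F eps eta" and c: "\<And>i. curv Euclidean F eps eta \<alpha> fs i = c"
    and chi: "\<alpha> * euler_char F \<le> 0"
  shows "sol_N F eps eta \<alpha> T f \<Longrightarrow> \<not> essential_sing T f"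
    and "exists_and_converges Euclidean eps (ext_sol_N F eps eta \<alpha>) f0"
    and "f0 \<in> dcs Euclidean F eps eta \<Longrightarrow>
      (\<forall>T f. sol_N F eps eta \<alpha> T f \<and> f 0 = f0 \<and> T < \<infinity> \<longrightarrow> \<not> removable_sing (dcs Euclidean F eps eta) T f) \<Longrightarrow>
      exists_and_converges Euclidean eps (sol_N F eps eta \<alpha>) f0"
    and "sol_N F eps eta \<alpha> \<infinity> f \<Longrightarrow> \<not> removable_sing (dcs Euclidean F eps eta) \<infinity> f"
proof -
  have key: "\<exists>p m. conf_point Euclidean p \<in> dcs Euclidean F eps eta \<and>
      converging_flow (coord_dom Euclidean) (ext_defect Euclidean) \<alpha> (\<lambda>_. curv_av F \<alpha> f0) defect_bound {} p
        (conf_coord Euclidean eps f0) m" for f0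
  proof -
    obtain p m where pm: "p \<in> dcs Euclidean F eps eta"
      "converging_flow (coord_dom Euclidean) (ext_defect Euclidean) \<alpha> (\<lambda>_. curv_av F \<alpha> f0) defect_bound {} p f0 m"
      using eucl_converging[OF fs c chi, of f0] by blast
    have "conf_point Euclidean p = p" using conf_point_conf_coord(2)[of Euclidean p] by simp
    then show ?thesis using pm by (intro exI[of _ p] exI[of _ m]) simp
  qed
  show "\<not> essential_sing T f" if s: "sol_N F eps eta \<alpha> T f" for T f
  proof -
    interpret fl: surface_flow F eps eta Euclidean \<alpha> "\<lambda>_. curv_av F \<alpha> (f 0)" ..
    obtain p m where pm: "conf_point Euclidean p \<in> dcs Euclidean F eps eta"
      "converging_flow (coord_dom Euclidean) (ext_defect Euclidean) \<alpha> (\<lambda>_. curv_av F \<alpha> (f 0)) defect_bound {} p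
        (conf_coord Euclidean eps (f 0)) m" using key[of "f 0"] by blast
    have "ext_sol_M Euclidean F eps eta \<alpha> (\<lambda>_. curv_av F \<alpha> (f 0)) T f"
      using s unfolding sol_N_iff_M sol_M_iff by (rule conjunct1)
    from fl.convergence(1)[OF pm(2,1) this] show ?thesis by simp
  qed
  show "\<not> removable_sing (dcs Euclidean F eps eta) \<infinity> f" if s: "sol_N F eps eta \<alpha> \<infinity> f" for f
  proof -
    interpret fl: surface_flow F eps eta Euclidean \<alpha> "\<lambda>_. curv_av F \<alpha> (f 0)" ..
    obtain p m where pm: "conf_point Euclidean p \<in> dcs Euclidean F eps eta"
      "converging_flow (coord_dom Euclidean) (ext_defect Euclidean) \<alpha> (\<lambda>_. curv_av F \<alpha> (f 0)) defect_bound {} p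
        (conf_coord Euclidean eps (f 0)) m" using key[of "f 0"] by blast
    have "ext_sol_M Euclidean F eps eta \<alpha> (\<lambda>_. curv_av F \<alpha> (f 0)) \<infinity> f"
      using s unfolding sol_N_iff_M sol_M_iff by (rule conjunct1)
    from fl.convergence(4)[OF pm(2,1) this] show ?thesis by simp
  qed
  interpret fl: surface_flow F eps eta Euclidean \<alpha> "\<lambda>_. curv_av F \<alpha> f0" ..
  obtain p m where pm: "conf_point Euclidean p \<in> dcs Euclidean F eps eta"
    "converging_flow (coord_dom Euclidean) (ext_defect Euclidean) \<alpha> (\<lambda>_. curv_av F \<alpha> f0) defect_bound {} p
      (conf_coord Euclidean eps f0) m" using key[of f0] by blast
  have eqE: "ext_sol_N F eps eta \<alpha> T f \<longleftrightarrow> ext_sol_M Euclidean F eps eta \<alpha> (\<lambda>_. curv_av F \<alpha> f0) T f"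
    and eqN: "sol_N F eps eta \<alpha> T f \<longleftrightarrow> sol_M Euclidean F eps eta \<alpha> (\<lambda>_. curv_av F \<alpha> f0) T f" if "f 0 = f0" for T f
    unfolding ext_sol_N_iff_M sol_N_iff_M that by (rule refl)+
  show "exists_and_converges Euclidean eps (ext_sol_N F eps eta \<alpha>) f0"
    by (rule iffD2[OF exists_and_converges_cong fl.convergence(2)[OF pm(2,1)]]) (rule eqE)
  show "exists_and_converges Euclidean eps (sol_N F eps eta \<alpha>) f0"
    if f0: "f0 \<in> dcs Euclidean F eps eta"
      and nr: "\<forall>T f. sol_N F eps eta \<alpha> T f \<and> f 0 = f0 \<and> T < \<infinity> \<longrightarrow> \<not> removable_sing (dcs Euclidean F eps eta) T f"
  proof (rule iffD2[OF exists_and_converges_cong fl.convergence(3)[OF pm(2,1) f0]])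
    show "sol_N F eps eta \<alpha> \<infinity> f \<longleftrightarrow> sol_M Euclidean F eps eta \<alpha> (\<lambda>_. curv_av F \<alpha> f0) \<infinity> f" if "f 0 = f0" for f
      using that by (rule eqN)
    show "\<forall>T f. sol_M Euclidean F eps eta \<alpha> (\<lambda>_. curv_av F \<alpha> f0) T f \<and> f 0 = f0 \<and> T < \<infinity> \<longrightarrow>
        \<not> removable_sing (dcs Euclidean F eps eta) T f"
      using nr eqN by blast
  qed
qed

lemma convergence_hyp:
  assumes fs: "fs \<in> dcs Hyperbolic F eps eta" and c: "\<And>i. curv Hyperbolic F eps eta \<alpha> fs i = Rb i"
    and sgn: "\<And>i. \<alpha> * Rb i \<le> 0" and lt: "\<And>i. Rb i < 2 * pi"
  shows "sol_M Hyperbolic F eps eta \<alpha> Rb T f \<Longrightarrow> \<not> essential_sing T f"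
    and "exists_and_converges Hyperbolic eps (ext_sol_M Hyperbolic F eps eta \<alpha> Rb) f0"
    and "f0 \<in> dcs Hyperbolic F eps eta \<Longrightarrow>
      (\<forall>T f. sol_M Hyperbolic F eps eta \<alpha> Rb T f \<and> f 0 = f0 \<and> T < \<infinity> \<longrightarrow> \<not> removable_sing (dcs Hyperbolic F eps eta) T f) \<Longrightarrow>
      exists_and_converges Hyperbolic eps (sol_M Hyperbolic F eps eta \<alpha> Rb) f0"
    and "sol_M Hyperbolic F eps eta \<alpha> Rb \<infinity> f \<Longrightarrow> \<not> removable_sing (dcs Hyperbolic F eps eta) \<infinity> f"
proof -
  interpret fl: surface_flow F eps eta Hyperbolic \<alpha> Rb ..
  have pd: "conf_point Hyperbolic (conf_coord Hyperbolic eps fs) \<in> dcs Hyperbolic F eps eta"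
    unfolding conf_point_conf_coord(2) by (rule fs)
  have cf: "\<exists>m. converging_flow (coord_dom Hyperbolic) (ext_defect Hyperbolic) \<alpha> Rb defect_bound {i. eps i \<noteq> 0}
     (conf_coord Hyperbolic eps fs) (conf_coord Hyperbolic eps f0) m" for f0
    by (rule hyp_converging[OF fs c sgn lt])
  show "\<not> essential_sing T f" if s: "sol_M Hyperbolic F eps eta \<alpha> Rb T f" for T f
    using cf[of "f 0"] fl.convergence(1)[OF _ pd conjunct1[OF s[unfolded sol_M_iff]]] by blast
  show "\<not> removable_sing (dcs Hyperbolic F eps eta) \<infinity> f" if s: "sol_M Hyperbolic F eps eta \<alpha> Rb \<infinity> f" for f
    using cf[of "f 0"] fl.convergence(4)[OF _ pd conjunct1[OF s[unfolded sol_M_iff]]] by blast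
  obtain m where m: "converging_flow (coord_dom Hyperbolic) (ext_defect Hyperbolic) \<alpha> Rb defect_bound {i. eps i \<noteq> 0}
     (conf_coord Hyperbolic eps fs) (conf_coord Hyperbolic eps f0) m" using cf by blast
  show "exists_and_converges Hyperbolic eps (ext_sol_M Hyperbolic F eps eta \<alpha> Rb) f0"
    by (rule fl.convergence(2)[OF m pd])
  show "exists_and_converges Hyperbolic eps (sol_M Hyperbolic F eps eta \<alpha> Rb) f0"
    if "f0 \<in> dcs Hyperbolic F eps eta"
      "\<forall>T f. sol_M Hyperbolic F eps eta \<alpha> Rb T f \<and> f 0 = f0 \<and> T < \<infinity> \<longrightarrow> \<not> removable_sing (dcs Hyperbolic F eps eta) T f"
    by (rule fl.convergence(3)[OF m pd that])
qed

end

theorem theorem1p5: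
  fixes F :: "'v::finite set set"
    and eps :: "'v \<Rightarrow> real"
    and eta :: "'v set \<Rightarrow> real"
    and \<alpha> :: real
    and Rbar :: "'v \<Rightarrow> real"
  assumes surface: "connected_closed_surface F"
    and weights: "admissible_weights F eps eta"
  shows
    "\<comment> \<open>(a)\<close>
     (solutions_extend (dcs Euclidean F eps eta) (sol_N F eps eta \<alpha>) (ext_sol_N F eps eta \<alpha>) \<and>
      (\<forall>g. solutions_extend (dcs g F eps eta) (sol_M g F eps eta \<alpha> Rbar) (ext_sol_M g F eps eta \<alpha> Rbar)) \<and>
      (\<alpha> * euler_char F \<le> 0 \<longrightarrow>
         (\<forall>f0\<in>dcs Euclidean F eps eta. unique_solution (ext_sol_N F eps eta \<alpha>) f0)) \<and>
      ((\<forall>i. \<alpha> * Rbar i \<le> 0) \<longrightarrow>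
         (\<forall>g. \<forall>f0\<in>dcs g F eps eta. unique_solution (ext_sol_M g F eps eta \<alpha> Rbar) f0)))
     \<and>
     \<comment> \<open>(b)\<close>
     ((\<exists>f\<in>dcs Euclidean F eps eta. \<exists>c. \<forall>i. curv Euclidean F eps eta \<alpha> f i = c) \<and>
      \<alpha> * euler_char F \<le> 0 \<longrightarrow>
        (\<forall>T f. sol_N F eps eta \<alpha> T f \<longrightarrow> \<not> essential_sing T f) \<and>
        (\<forall>f0\<in>dcs Euclidean F eps eta.
           (\<forall>T f. sol_N F eps eta \<alpha> T f \<and> f 0 = f0 \<and> T < \<infinity> \<longrightarrow>
                  \<not> removable_sing (dcs Euclidean F eps eta) T f) \<longrightarrow>
           exists_and_converges Euclidean eps (sol_N F eps eta \<alpha>) f0 \<and>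
           (\<forall>f. sol_N F eps eta \<alpha> \<infinity> f \<and> f 0 = f0 \<longrightarrow>
                  \<not> removable_sing (dcs Euclidean F eps eta) \<infinity> f)) \<and>
        (\<forall>f0\<in>dcs Euclidean F eps eta.
           exists_and_converges Euclidean eps (ext_sol_N F eps eta \<alpha>) f0))
     \<and>
     \<comment> \<open>(c)\<close>
     ((\<exists>f\<in>dcs Hyperbolic F eps eta. \<forall>i. curv Hyperbolic F eps eta \<alpha> f i = Rbar i) \<and>
      (\<alpha> > 0 \<and> (\<forall>i. Rbar i \<le> 0) \<or>
       \<alpha> < 0 \<and> (\<forall>i. Rbar i \<in> {0..<2 * pi}) \<or>
       \<alpha> = 0 \<and> (\<forall>i. Rbar i < 2 * pi) \<and> (\<Sum>i\<in>UNIV. Rbar i) > 2 * pi * euler_char F) \<longrightarrow>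
        (\<forall>T f. sol_M Hyperbolic F eps eta \<alpha> Rbar T f \<longrightarrow> \<not> essential_sing T f) \<and>
        (\<forall>f0\<in>dcs Hyperbolic F eps eta.
           (\<forall>T f. sol_M Hyperbolic F eps eta \<alpha> Rbar T f \<and> f 0 = f0 \<and> T < \<infinity> \<longrightarrow>
                  \<not> removable_sing (dcs Hyperbolic F eps eta) T f) \<longrightarrow>
           exists_and_converges Hyperbolic eps (sol_M Hyperbolic F eps eta \<alpha> Rbar) f0 \<and>
           (\<forall>f. sol_M Hyperbolic F eps eta \<alpha> Rbar \<infinity> f \<and> f 0 = f0 \<longrightarrow>
                  \<not> removable_sing (dcs Hyperbolic F eps eta) \<infinity> f)) \<and>
        (\<forall>f0\<in>dcs Hyperbolic F eps eta.
           exists_and_converges Hyperbolic eps (ext_sol_M Hyperbolic F eps eta \<alpha> Rbar) f0))"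
proof -
  interpret weighted_surface F eps eta by unfold_locales (fact surface, fact weights)
  have fl: "surface_flow F eps eta" by unfold_locales
  have extend: "\<forall>g. solutions_extend (dcs g F eps eta) (sol_M g F eps eta \<alpha> Rbar) (ext_sol_M g F eps eta \<alpha> Rbar)"
    by (intro allI surface_flow.solutions_extend_M fl)
  have unique: "\<forall>g. \<forall>f0\<in>dcs g F eps eta. unique_solution (ext_sol_M g F eps eta \<alpha> Rbar) f0"
    by (intro allI ballI surface_flow.unique_solution_M fl)
  have unique_M: "(\<forall>i. \<alpha> * Rbar i \<le> 0) \<longrightarrow>
      (\<forall>g. \<forall>f0\<in>dcs g F eps eta. unique_solution (ext_sol_M g F eps eta \<alpha> Rbar) f0)"
    using unique by (rule impI)
  have unique_N: "\<alpha> * euler_char F \<le> 0 \<longrightarrow>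
      (\<forall>f0\<in>dcs Euclidean F eps eta. unique_solution (ext_sol_N F eps eta \<alpha>) f0)"
    by (intro impI ballI unique_solution_N)
  \<comment> \<open>Each of the three cases of (c) supplies the sign for the Lyapunov function and
    the upper bound for the barrier.\<close>
  have bounds: "\<alpha> * Rbar i \<le> 0" "Rbar i < 2 * pi" if "\<alpha> > 0 \<and> (\<forall>i. Rbar i \<le> 0) \<or> \<alpha> < 0 \<and> (\<forall>i. Rbar i \<in> {0..<2 * pi}) \<or>
       \<alpha> = 0 \<and> (\<forall>i. Rbar i < 2 * pi) \<and> (\<Sum>i\<in>UNIV. Rbar i) > 2 * pi * euler_char F" for i
  proof -
    have "\<alpha> > 0 \<and> Rbar i \<le> 0 \<or> \<alpha> < 0 \<and> 0 \<le> Rbar i \<and> Rbar i < 2 * pi \<or> \<alpha> = 0 \<and> Rbar i < 2 * pi"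
      using that by (elim disjE conjE) simp_all
    then show "\<alpha> * Rbar i \<le> 0" "Rbar i < 2 * pi"
      using pi_gt_zero by (auto simp: mult_le_0_iff intro: le_less_trans[of _ 0])
  qed
  have B: "(\<exists>f\<in>dcs Euclidean F eps eta. \<exists>c. \<forall>i. curv Euclidean F eps eta \<alpha> f i = c) \<and>
      \<alpha> * euler_char F \<le> 0 \<longrightarrow>
        (\<forall>T f. sol_N F eps eta \<alpha> T f \<longrightarrow> \<not> essential_sing T f) \<and>
        (\<forall>f0\<in>dcs Euclidean F eps eta.
           (\<forall>T f. sol_N F eps eta \<alpha> T f \<and> f 0 = f0 \<and> T < \<infinity> \<longrightarrow>
                  \<not> removable_sing (dcs Euclidean F eps eta) T f) \<longrightarrow>
           exists_and_converges Euclidean eps (sol_N F eps eta \<alpha>) f0 \<and>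
           (\<forall>f. sol_N F eps eta \<alpha> \<infinity> f \<and> f 0 = f0 \<longrightarrow>
                  \<not> removable_sing (dcs Euclidean F eps eta) \<infinity> f)) \<and>
        (\<forall>f0\<in>dcs Euclidean F eps eta.
           exists_and_converges Euclidean eps (ext_sol_N F eps eta \<alpha>) f0)"
    (is "_ \<longrightarrow> ?concl")
  proof
    assume "(\<exists>f\<in>dcs Euclidean F eps eta. \<exists>c. \<forall>i. curv Euclidean F eps eta \<alpha> f i = c) \<and> \<alpha> * euler_char F \<le> 0"
    then obtain fs c where fs: "fs \<in> dcs Euclidean F eps eta" "\<And>i. curv Euclidean F eps eta \<alpha> fs i = c"
      and chi: "\<alpha> * euler_char F \<le> 0" by blast
    have 1: "\<forall>T f. sol_N F eps eta \<alpha> T f \<longrightarrow> \<not> essential_sing T f"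
      by (intro allI impI) (rule convergence_N(1)[OF fs chi])
    have 2: "exists_and_converges Euclidean eps (sol_N F eps eta \<alpha>) f0 \<and>
        (\<forall>f. sol_N F eps eta \<alpha> \<infinity> f \<and> f 0 = f0 \<longrightarrow> \<not> removable_sing (dcs Euclidean F eps eta) \<infinity> f)"
      if f0: "f0 \<in> dcs Euclidean F eps eta" and nr: "\<forall>T f. sol_N F eps eta \<alpha> T f \<and> f 0 = f0 \<and> T < \<infinity> \<longrightarrow> \<not> removable_sing (dcs Euclidean F eps eta) T f" for f0
      using convergence_N(3)[OF fs chi f0 nr] convergence_N(4)[OF fs chi] by blast
    show ?concl
      by (intro conjI 1) (intro ballI impI, rule 2, assumption+, intro ballI, rule convergence_N(2)[OF fs chi])
  qed
  have C: "(\<exists>f\<in>dcs Hyperbolic F eps eta. \<forall>i. curv Hyperbolic F eps eta \<alpha> f i = Rbar i) \<and>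
      (\<alpha> > 0 \<and> (\<forall>i. Rbar i \<le> 0) \<or>
       \<alpha> < 0 \<and> (\<forall>i. Rbar i \<in> {0..<2 * pi}) \<or>
       \<alpha> = 0 \<and> (\<forall>i. Rbar i < 2 * pi) \<and> (\<Sum>i\<in>UNIV. Rbar i) > 2 * pi * euler_char F) \<longrightarrow>
        (\<forall>T f. sol_M Hyperbolic F eps eta \<alpha> Rbar T f \<longrightarrow> \<not> essential_sing T f) \<and>
        (\<forall>f0\<in>dcs Hyperbolic F eps eta.
           (\<forall>T f. sol_M Hyperbolic F eps eta \<alpha> Rbar T f \<and> f 0 = f0 \<and> T < \<infinity> \<longrightarrow>
                  \<not> removable_sing (dcs Hyperbolic F eps eta) T f) \<longrightarrow>
           exists_and_converges Hyperbolic eps (sol_M Hyperbolic F eps eta \<alpha> Rbar) f0 \<and>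
           (\<forall>f. sol_M Hyperbolic F eps eta \<alpha> Rbar \<infinity> f \<and> f 0 = f0 \<longrightarrow>
                  \<not> removable_sing (dcs Hyperbolic F eps eta) \<infinity> f)) \<and>
        (\<forall>f0\<in>dcs Hyperbolic F eps eta.
           exists_and_converges Hyperbolic eps (ext_sol_M Hyperbolic F eps eta \<alpha> Rbar) f0)"
    (is "_ \<and> ?cond \<longrightarrow> ?concl")
  proof
    assume a: "(\<exists>f\<in>dcs Hyperbolic F eps eta. \<forall>i. curv Hyperbolic F eps eta \<alpha> f i = Rbar i) \<and> ?cond"
    then obtain fs where fs: "fs \<in> dcs Hyperbolic F eps eta" "\<And>i. curv Hyperbolic F eps eta \<alpha> fs i = Rbar i" by blast
    note bd = bounds[OF conjunct2[OF a]]
    have 1: "\<forall>T f. sol_M Hyperbolic F eps eta \<alpha> Rbar T f \<longrightarrow> \<not> essential_sing T f"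
      by (intro allI impI) (rule convergence_hyp(1)[OF fs bd])
    have 2: "exists_and_converges Hyperbolic eps (sol_M Hyperbolic F eps eta \<alpha> Rbar) f0 \<and>
        (\<forall>f. sol_M Hyperbolic F eps eta \<alpha> Rbar \<infinity> f \<and> f 0 = f0 \<longrightarrow> \<not> removable_sing (dcs Hyperbolic F eps eta) \<infinity> f)"
      if f0: "f0 \<in> dcs Hyperbolic F eps eta" and nr: "\<forall>T f. sol_M Hyperbolic F eps eta \<alpha> Rbar T f \<and> f 0 = f0 \<and> T < \<infinity> \<longrightarrow> \<not> removable_sing (dcs Hyperbolic F eps eta) T f" for f0
      using convergence_hyp(3)[OF fs bd f0 nr] convergence_hyp(4)[OF fs bd] by blast
    show ?concl
      by (intro conjI 1) (intro ballI impI, rule 2, assumption+, intro ballI, rule convergence_hyp(2)[OF fs bd])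
  qed
  show ?thesis
    by (intro conjI) (rule solutions_extend_N extend unique_N unique_M B C)+
qed

end
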